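(* If $\alpha<1$ and $d<3\alpha$ then \[\tau_{\beta_c}(x,y,z) \asymp \sqrt{\|x-y\|^{-d+\alpha}\|y-z\|^{-d+\alpha}\|z-x\|^{-d+\alpha}}\] for all distinct $x,y,z\in \mathbb{Z}^d$.
   Context: Setting: fix an integer $d\geq 1$, a real $\alpha>0$, a norm $\|\cdot\|$ on $\mathbb{R}^d$, and a kernel of the form $J(x,y)=\mathbf{1}(x\neq y)J(\|x-y\|)$ for $x,y\in\mathbb{Z}^d$, where $J:(0,\infty)\to(0,\infty)$ is decreasing and differentiable, tends to $0$ at infinity (so that $J(x,y)\sim \mathrm{const.}\,\|x-y\|^{-d-\alpha}$), and satisfies $|J'(r)|=C(1+\delta_r)r^{-d-\alpha-1}$ for some constant $C>0$ and some measurable error function $r\mapsto\delta_r$ with $\delta_r\to0$ as $r\to\infty$ and $\int_{r_0}^\infty \frac{|\delta_r|}{r}\,dr<\infty$ for some $r_0<\infty$. Long-range percolation with parameter $\beta\ge 0$ is the random graph on $\mathbb{Z}^d$ in which each pair of distinct vertices $x,y$ is joined by an (open) edge independently with probability $1-e^{-\beta J(x,y)}$; $\mathbb{P}_\beta$ denotes its law. The critical point is $\beta_c=\inf\{\beta\ge0:\mathbb{P}_\beta(\text{there is an infinite cluster})>0\}$, where clusters are connected components. The $k$-point function is $\tau_{\beta}(x_1,\ldots,x_k)=\mathbb{P}_\beta(x_1,\ldots,x_k\text{ all belong to the same cluster})$. The notation $\asymp$ means equality up to positive multiplicative constants depending only on $d$, $\alpha$, and the kernel $J$ (including the norm). *)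

theory Defs
  imports "HOL-Probability.Probability"
begin

text \<open>
  The lattice \<open>\<int>\<^sup>d\<close> is the type \<open>int ^ 'd\<close> with \<open>d = CARD('d)\<close>, which is automatically at
  least 1. Norms live on \<open>real ^ 'd\<close> and are arbitrary, so they are passed as functions \<open>N\<close>
  rather than taken from the type class.
\<close>

definition is_norm :: "(real ^ 'd \<Rightarrow> real) \<Rightarrow> bool" where
  "is_norm N \<longleftrightarrow>
     (\<forall>x. N x = 0 \<longleftrightarrow> x = 0) \<and>
     (\<forall>a x. N (a *\<^sub>R x) = \<bar>a\<bar> * N x) \<and>
     (\<forall>x y. N (x + y) \<le> N x + N y)"

definition lattice_dist :: "(real ^ 'd \<Rightarrow> real) \<Rightarrow> int ^ 'd \<Rightarrow> int ^ 'd \<Rightarrow> real" where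
  "lattice_dist N x y = N (\<chi> i. real_of_int (x $ i - y $ i))"

text \<open>Only the values of \<open>J\<close> and \<open>\<delta>\<close> on the positive half-line are relevant.\<close>

definition admissible_kernel :: "nat \<Rightarrow> real \<Rightarrow> (real \<Rightarrow> real) \<Rightarrow> bool" where
  "admissible_kernel d \<alpha> J \<longleftrightarrow>
     (\<forall>r>0. J r > 0) \<and>
     antimono_on {0<..} J \<and>
     (\<forall>r>0. J differentiable (at r)) \<and>
     (J \<longlongrightarrow> 0) at_top \<and>
     (\<exists>C>0. \<exists>\<delta> :: real \<Rightarrow> real.
        set_borel_measurable lborel {0<..} \<delta> \<and>
        (\<forall>r>0. \<bar>deriv J r\<bar> = C * (1 + \<delta> r) * r powr (- real d - \<alpha> - 1)) \<and>
        (\<delta> \<longlongrightarrow> 0) at_top \<and>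
        (\<exists>r\<^sub>0>0. set_integrable lborel {r\<^sub>0<..} (\<lambda>r. \<bar>\<delta> r\<bar> / r)))"

definition kernel ::
  "(real ^ 'd \<Rightarrow> real) \<Rightarrow> (real \<Rightarrow> real) \<Rightarrow> int ^ 'd \<Rightarrow> int ^ 'd \<Rightarrow> real" where
  "kernel N J x y = (if x = y then 0 else J (lattice_dist N x y))"

text \<open>Edges are unordered pairs of distinct vertices, encoded as two-element sets.\<close>

definition edges :: "(int ^ 'd) set set" where
  "edges = {{x, y} | x y. x \<noteq> y}"

definition edge_prob ::
  "(real ^ 'd \<Rightarrow> real) \<Rightarrow> (real \<Rightarrow> real) \<Rightarrow> real \<Rightarrow> (int ^ 'd) set \<Rightarrow> real" where
  "edge_prob N J \<beta> e = (THE p. \<forall>x y. e = {x, y} \<longrightarrow> p = 1 - exp (- \<beta> * kernel N J x y))"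

lemma lattice_dist_commute:
  assumes "is_norm N"
  shows "lattice_dist N x y = lattice_dist N y x"
proof -
  have "(\<chi> i. real_of_int (y $ i - x $ i)) = (-1) *\<^sub>R (\<chi> i. real_of_int (x $ i - y $ i))"
    by (simp add: vec_eq_iff)
  moreover have "N ((-1) *\<^sub>R v) = N v" for v
    using assms by (simp add: is_norm_def del: scaleR_minus1_left scaleR_minus_left)
  ultimately show ?thesis
    by (simp add: lattice_dist_def del: scaleR_minus1_left scaleR_minus_left)
qed

lemma edge_prob_eq:
  assumes "is_norm N"
  shows "edge_prob N J \<beta> {x, y} = 1 - exp (- \<beta> * kernel N J x y)"
proof -
  have "kernel N J u v = kernel N J x y" if "{x, y} = {u, v}" for u v
    using that lattice_dist_commute[OF assms] by (auto simp: kernel_def doubleton_eq_iff)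
  then have "\<forall>u v. {x, y} = {u, v} \<longrightarrow>
      1 - exp (- \<beta> * kernel N J x y) = 1 - exp (- \<beta> * kernel N J u v)"
    by metis
  then show ?thesis
    unfolding edge_prob_def by (intro the_equality) blast+
qed

definition percolation ::
  "(real ^ 'd \<Rightarrow> real) \<Rightarrow> (real \<Rightarrow> real) \<Rightarrow> real \<Rightarrow> ((int ^ 'd) set \<Rightarrow> bool) measure" where
  "percolation N J \<beta> =
     (\<Pi>\<^sub>M e\<in>edges. measure_pmf (bernoulli_pmf (edge_prob N J \<beta> e)))"

definition open_adj :: "((int ^ 'd) set \<Rightarrow> bool) \<Rightarrow> ((int ^ 'd) \<times> (int ^ 'd)) set" where
  "open_adj \<omega> = {(x, y). x \<noteq> y \<and> \<omega> {x, y}}"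

definition cluster :: "((int ^ 'd) set \<Rightarrow> bool) \<Rightarrow> int ^ 'd \<Rightarrow> (int ^ 'd) set" where
  "cluster \<omega> x = {y. (x, y) \<in> (open_adj \<omega>)\<^sup>*}"

definition clusters :: "((int ^ 'd) set \<Rightarrow> bool) \<Rightarrow> (int ^ 'd) set set" where
  "clusters \<omega> = range (cluster \<omega>)"

text \<open>
  This is an infimum in the reals, hence meaningful only if percolation occurs at some \<open>\<beta>\<close>.
  For admissible kernels that is the case if \<open>d \<ge> 2\<close> or \<open>\<alpha> \<le> 1\<close>.
\<close>

definition beta_c :: "(real ^ 'd \<Rightarrow> real) \<Rightarrow> (real \<Rightarrow> real) \<Rightarrow> real" where
  "beta_c N J = Inf {\<beta>. \<beta> \<ge> 0 \<and>
     measure (percolation N J \<beta>)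
       {\<omega> \<in> space (percolation N J \<beta>). \<exists>K\<in>clusters \<omega>. infinite K} > 0}"

definition tau ::
  "(real ^ 'd \<Rightarrow> real) \<Rightarrow> (real \<Rightarrow> real) \<Rightarrow> real \<Rightarrow> (int ^ 'd) list \<Rightarrow> real" where
  "tau N J \<beta> xs = measure (percolation N J \<beta>)
     {\<omega> \<in> space (percolation N J \<beta>). \<exists>K\<in>clusters \<omega>. set xs \<subseteq> K}"

end

(*
  All estimates are proved for percolation in finite boxes, uniformly in the box, and passed to
  the limit at the end. Write d for the dimension and a for the decay exponent of the kernel.

  Criticality enters twice. If clusters of size much larger than L^((d+a)/2) were likely in some
  box of side L, a renormalization argument would give percolation already below the critical
  point; so at criticality the largest cluster of a box of side L has at most this order with
  probability bounded below, and universal tightness controls all higher moments. Conversely the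
  expected number of open edges leaving the cluster of the origin inside a finite set is at least
  1, since otherwise the susceptibility would be bounded slightly above the critical point. As
  a < 1, the two facts give the two-point function up to constants, |x-y|^(a-d), and the
  inequality of Gladkov then gives the upper bound on the three-point function.

  For the lower bound let m(R) and chi(R) be the second and first moment of a cluster when only
  edges of length at most R are used. Then chi(R) is of order R^a and m(R) is at most of order
  R^((d+3a)/2). When R increases, m grows faster than chi^q for some q > (d+3a)/(2a) as long as
  m(R) / R^((d+3a)/2) is small, because the fourth moment is then negligible; such a q < 3
  exists exactly if d < 3a. Hence m(R) has the maximal order, which means that with probability
  of order n^((a-d)/2) the cluster of a vertex reaches size n^((d+a)/2) within distance n. Two
  such clusters, at x and at a neighbouring y, are joined by single edges to each other and to
  the cluster of z in the complement of the two boxes.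
*)

theory Submission
  imports Defs "HOL-Probability.Probability"
begin

text \<open>Probabilities are finite sums over sets of open edges, so measure theory enters only
  when the boxes exhaust the lattice. Why q can approach 3: let new edges of lengths in (R, R'] have
  total rate S per vertex. Exploring clusters gives chi' <= chi + S chi chi', so chi grows at most
  by 1/(1 - S chi). A merger of two clusters K and K' raises the second moment seen from K by
  2|K||K'| + |K'|^2, and by the Harris inequality this raises m by about 3 S chi m. The obstacle is
  the error of this expansion. It is of order R^(-d-a) times the fourth moment, and plain universal
  tightness bounds the fourth moment only by R^(d+a) m, the order of the gain itself. The way out: a
  cluster with M points in a cell of side R contributes at least M^3 to the sum of |K_u|^2 over the
  cell, so M is at most of order (R^d m)^(1/3). This matches R^((d+a)/2) exactly when m has maximal
  order and is smaller by a small factor otherwise. Hence the error is negligible precisely while m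
  is still too small.\<close>

abbreviation rpow :: "nat => real => real" (infixr "^r" 80) where
 "n ^r e \<equiv> real n powr e"

section \<open>Finite product measures\<close>

text \<open>Expectation of \<open>f\<close> for the random subset of \<open>E\<close> containing
  each \<open>e\<close> independently with probability \<open>p e\<close>. Being a finite sum, it
  needs no measurability.\<close>

definition avg :: "'e set => ('e => real) => ('e set => real) => real" where
 "avg E p f = (SUM A:Pow E. (PROD e:A. p e) * (PROD e:E - A. 1 - p e) * f A)"

abbreviation prb :: "'e set => ('e => real) => ('e set => bool) => real" where
 "prb E p Q \<equiv> avg E p (%A. of_bool (Q A))"

definition probs :: "'e set => ('e => real) => bool" where
 "probs E p \<longleftrightarrow> finite E & (ALL e:E. 0 <= p e & p e <= 1)"

lemma probs_finite: "probs E p ==> finite E"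
 by (simp add: probs_def)

lemma probs_subset: "probs E p ==> E' \<subseteq> E ==> probs E' p"
 by (auto simp: probs_def intro: finite_subset)

lemma avg_empty [simp]: "avg {} p f = f {}"
 by (simp add: avg_def)

text \<open>Conditioning on the state of a single edge; the inductions over edge sets rest on
  this.\<close>

lemma avg_insert:
 assumes "finite E" "e \<notin> E"
 shows "avg (insert e E) p f = p e * avg E p (%A. f (insert e A)) + (1 - p e) * avg E p f"
proof -
 have fin: "finite A" if "A \<subseteq> E" for A
  using that assms finite_subset by blast
 have inj: "inj_on (insert e) (Pow E)"
  using assms by (auto simp: inj_on_def)
 have "avg (insert e E) p f =
   (SUM A:Pow E. (PROD e:A. p e) * (PROD e:insert e E - A. 1 - p e) * f A)
  + (SUM A:insert e ` Pow E. (PROD e:A. p e) * (PROD e:insert e E - A. 1 - p e) * f A)"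
  unfolding avg_def Pow_insert using assms by (subst sum.union_disjoint) auto
 also have "(SUM A:Pow E. (PROD e:A. p e) * (PROD e:insert e E - A. 1 - p e) * f A)
  = (1 - p e) * avg E p f"
  unfolding avg_def sum_distrib_left
 proof (rule sum.cong)
  fix A assume A: "A : Pow E"
  have "insert e E - A = insert e (E - A)" using assms A by auto
  then show "(PROD e:A. p e) * (PROD e:insert e E - A. 1 - p e) * f A
    = (1 - p e) * ((PROD e:A. p e) * (PROD e:E - A. 1 - p e) * f A)"
   using assms by simp
 qed simp
 also have "(SUM A:insert e ` Pow E. (PROD e:A. p e) * (PROD e:insert e E - A. 1 - p e) * f A)
  = p e * avg E p (%A. f (insert e A))"
  unfolding avg_def sum_distrib_left sum.reindex[OF inj] comp_def
 proof (rule sum.cong)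
  fix A assume A: "A : Pow E"
  have "insert e E - insert e A = E - A" using assms A by auto
  moreover have "e \<notin> A" using A assms by auto
  ultimately show "(PROD e:insert e A. p e) * (PROD e:insert e E - insert e A. 1 - p e) * f (insert e A)
    = p e * ((PROD e:A. p e) * (PROD e:E - A. 1 - p e) * f (insert e A))"
   using fin[of A] A by simp
 qed simp
 finally show ?thesis by simp
qed

lemma avg_add: "avg E p (%A. f A + g A) = avg E p f + avg E p g"
 by (simp add: avg_def distrib_left sum.distrib)

lemma avg_cmult: "avg E p (%A. c * f A) = c * avg E p f"
 unfolding avg_def sum_distrib_left by (intro sum.cong) auto

lemma avg_cmult_right: "avg E p (%A. f A * c) = avg E p f * c"
 unfolding avg_def sum_distrib_right by (intro sum.cong) auto

lemma avg_diff: "avg E p (%A. f A - g A) = avg E p f - avg E p g"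
 by (simp add: avg_def right_diff_distrib sum_subtractf)

lemma avg_zero [simp]: "avg E p (%A. 0) = 0"
 by (simp add: avg_def)

lemma avg_sum: "avg E p (%A. SUM i:I. f i A) = (SUM i:I. avg E p (f i))"
 by (induction I rule: infinite_finite_induct) (auto simp: avg_add)

lemma avg_cong: "(\<And>A. A \<subseteq> E ==> f A = g A) ==> avg E p f = avg E p g"
 by (simp add: avg_def)

lemma avg_const [simp]: "finite E ==> avg E p (%A. c) = c"
 by (induction E rule: finite_induct) (simp_all add: avg_insert algebra_simps)

lemma avg_mono:
 assumes "probs E p" "\<And>A. A \<subseteq> E ==> f A <= g A"
 shows "avg E p f <= avg E p g"
 unfolding avg_def
proof (rule sum_mono)
 fix A assume "A : Pow E"
 then have "(PROD e:A. p e) * (PROD e:E - A. 1 - p e) >= 0"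
  using assms(1) by (intro mult_nonneg_nonneg prod_nonneg) (auto simp: probs_def)
 with \<open>A : Pow E\<close> show "(PROD e:A. p e) * (PROD e:E - A. 1 - p e) * f A
   <= (PROD e:A. p e) * (PROD e:E - A. 1 - p e) * g A"
  using assms(2) by (intro mult_left_mono) auto
qed

lemma avg_nonneg:
 assumes "probs E p" "\<And>A. A \<subseteq> E ==> 0 <= f A"
 shows "0 <= avg E p f"
 unfolding avg_def using assms
 by (intro sum_nonneg mult_nonneg_nonneg prod_nonneg) (auto simp: probs_def)

lemma prb_le_1: "probs E p ==> prb E p Q <= 1"
 using avg_mono[of E p "%A. of_bool (Q A)" "%_. 1"] by (simp add: probs_finite)

lemma prb_nonneg: "probs E p ==> 0 <= prb E p Q"
 by (rule avg_nonneg) auto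

lemma prb_mono: "probs E p ==> (\<And>A. A \<subseteq> E ==> Q A ==> Q' A) ==> prb E p Q <= prb E p Q'"
 by (rule avg_mono) auto

lemma prb_compl: "probs E p ==> prb E p (%A. ~ Q A) = 1 - prb E p Q"
proof -
 assume "probs E p"
 then have "avg E p (%A. 1 - of_bool (Q A)) = 1 - prb E p Q"
  by (subst avg_diff) (simp add: probs_finite)
 then show ?thesis by (simp add: of_bool_not_iff)
qed

lemma avg_union:
 assumes "finite E1" "finite E2" "E1 Int E2 = {}"
 shows "avg (E1 Un E2) p f = avg E1 p (%A. avg E2 p (%B. f (A Un B)))"
 using assms
proof (induction E1 arbitrary: f rule: finite_induct)
 case (insert e E)
 then have "avg (insert e (E Un E2)) p f
   = p e * avg (E Un E2) p (%A. f (insert e A)) + (1 - p e) * avg (E Un E2) p f"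
  by (intro avg_insert) auto
 then show ?case using insert by (simp add: avg_insert)
qed simp

lemma avg_restrict:
 assumes "finite E" "E' \<subseteq> E" "\<And>A. A \<subseteq> E ==> f A = f (A Int E')"
 shows "avg E p f = avg E' p f"
proof -
 have fin: "finite E'" using assms finite_subset by blast
 have "avg E p f = avg (E' Un (E - E')) p f"
  using assms by (simp add: Un_absorb1)
 also have "... = avg E' p (%A. avg (E - E') p (%B. f (A Un B)))"
  using assms fin by (intro avg_union) auto
 also have "... = avg E' p (%A. avg (E - E') p (%B. f A))"
 proof (intro avg_cong)
  fix A B assume *: "A \<subseteq> E'" "B \<subseteq> E - E'"
  then have "(A Un B) Int E' = A" by auto
  then show "f (A Un B) = f A" using assms(3)[of "A Un B"] * assms(2) by auto
 qed
 finally show ?thesis using assms by simp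
qed

lemma avg_restrict_Int:
 assumes "finite E" "E' \<subseteq> E"
 shows "avg E p (%A. f (A Int E')) = avg E' p f"
proof -
 have "avg E p (%A. f (A Int E')) = avg E' p (%A. f (A Int E'))"
  using assms by (intro avg_restrict) auto
 also have "... = avg E' p f"
  by (intro avg_cong) (simp add: Int_absorb2)
 finally show ?thesis .
qed

lemma avg_mono_set:
 assumes "probs E p" "E' \<subseteq> E" "\<And>A B. A \<subseteq> B ==> B \<subseteq> E ==> f A <= f B"
 shows "avg E' p f <= avg E p f"
proof -
 have "avg E' p f = avg E p (%A. f (A Int E'))"
  using assms by (simp add: avg_restrict_Int probs_finite)
 also have "... <= avg E p f"
  using assms by (intro avg_mono) auto
 finally show ?thesis .
qed

lemma avg_indep:
 assumes "finite E" "E1 \<subseteq> E" "E2 \<subseteq> E" "E1 Int E2 = {}"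
 shows "avg E p (%A. f (A Int E1) * g (A Int E2)) = avg E1 p f * avg E2 p g"
proof -
 have fin: "finite E1" "finite E2" using assms finite_subset by blast+
 have "avg E p (%A. f (A Int E1) * g (A Int E2)) = avg (E1 Un E2) p (%A. f (A Int E1) * g (A Int E2))"
  using assms by (intro avg_restrict) (auto simp: Int_assoc Int_absorb1)
 also have "... = avg E1 p (%A. avg E2 p (%B. f A * g B))"
 proof (subst avg_union[OF fin assms(4)], intro avg_cong)
  fix A B assume "A \<subseteq> E1" "B \<subseteq> E2"
  then have "(A Un B) Int E1 = A" "(A Un B) Int E2 = B" using assms(4) by auto
  then show "f ((A Un B) Int E1) * g ((A Un B) Int E2) = f A * g B" by simp
 qed
 finally show ?thesis by (simp add: avg_cmult avg_cmult_right)
qed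

lemma avg_image:
 assumes "inj_on h E"
 shows "avg (h ` E) p f = avg E (%e. p (h e)) (%A. f (h ` A))"
proof -
 have inj: "inj_on ((`) h) (Pow E)"
  using assms by (meson Pow_iff inj_on_def inj_on_image_eq_iff)
 have "Pow (h ` E) = (`) h ` Pow E" by (simp add: image_Pow_surj)
 then have "avg (h ` E) p f
   = (SUM A:Pow E. (PROD e:h ` A. p e) * (PROD e:h ` E - h ` A. 1 - p e) * f (h ` A))"
  unfolding avg_def by (simp add: sum.reindex[OF inj])
 also have "... = avg E (%e. p (h e)) (%A. f (h ` A))"
  unfolding avg_def
 proof (rule sum.cong)
  fix A assume "A : Pow E"
  then have A: "A \<subseteq> E" by auto
  have "h ` E - h ` A = h ` (E - A)" using assms A by (simp add: inj_on_image_set_diff)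
  moreover have "inj_on h A" "inj_on h (E - A)" using A by (auto intro: inj_on_subset[OF assms])
  ultimately show "(PROD e:h ` A. p e) * (PROD e:h ` E - h ` A. 1 - p e) * f (h ` A)
    = (PROD e:A. p (h e)) * (PROD e:E - A. 1 - p (h e)) * f (h ` A)"
   by (simp add: prod.reindex)
 qed simp
 finally show ?thesis .
qed

lemma avg_CS:
 assumes "probs E p"
 shows "(avg E p (%A. f A * g A))^2 <= avg E p (%A. (f A)^2) * avg E p (%A. (g A)^2)"
proof -
 define w where "w = (%A. (PROD e:A. p e) * (PROD e:E - A. 1 - p e))"
 have w: "w A >= 0" if "A : Pow E" for A
  unfolding w_def using assms that by (intro mult_nonneg_nonneg prod_nonneg) (auto simp: probs_def)
 have avg_w: "avg E p h = (SUM A:Pow E. w A * h A)" for h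
  by (simp add: avg_def w_def)
 have 1: "(SUM A:Pow E. (sqrt (w A) * f A) * (sqrt (w A) * g A)) = avg E p (%A. f A * g A)"
  unfolding avg_w
 proof (rule sum.cong)
  fix A assume "A : Pow E"
  have "sqrt (w A) * f A * (sqrt (w A) * g A) = (sqrt (w A) * sqrt (w A)) * (f A * g A)"
   by (simp only: mult_ac)
  then show "sqrt (w A) * f A * (sqrt (w A) * g A) = w A * (f A * g A)"
   using w[OF \<open>A : Pow E\<close>] by simp
 qed simp
 have 2: "(SUM A:Pow E. (sqrt (w A) * h A)^2) = avg E p (%A. (h A)^2)" for h
  unfolding avg_w using w by (intro sum.cong) (auto simp: power_mult_distrib)
 show ?thesis
  using Cauchy_Schwarz_ineq_sum[of "%A. sqrt (w A) * f A" "%A. sqrt (w A) * g A" "Pow E"]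
  unfolding 1 2 .
qed

lemma avg_markov:
 assumes "probs E p" "\<And>A. A \<subseteq> E ==> 0 <= f A" "c > 0"
 shows "prb E p (%A. f A >= c) <= avg E p f / c"
proof -
 have "prb E p (%A. f A >= c) <= avg E p (%A. f A * (1 / c))"
 proof (rule avg_mono[OF assms(1)])
  fix A assume "A \<subseteq> E"
  then show "of_bool (c <= f A) <= f A * (1 / c)"
   using assms(2)[of A] assms(3) by (cases "c <= f A") simp_all
 qed
 then show ?thesis unfolding avg_cmult_right by simp
qed

section \<open>Correlation inequalities of Harris and of van den Berg and Kesten\<close>

theorem harris:
 assumes "probs E p"
  "\<And>A B. A \<subseteq> B ==> B \<subseteq> E ==> f A <= f B" "\<And>A B. A \<subseteq> B ==> B \<subseteq> E ==> g A <= g B"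
 shows "avg E p f * avg E p g <= avg E p (%A. f A * g A)"
 using probs_finite[OF assms(1)] assms
proof (induction E arbitrary: f g rule: finite_induct)
 case (insert e E)
 define f1 g1 where "f1 = (%A. f (insert e A))" and "g1 = (%A. g (insert e A))"
 have pE: "probs E p" and p: "0 <= p e" "p e <= 1" using insert.prems(1) by (auto simp: probs_def)
 have mono: "f1 A <= f1 B & g1 A <= g1 B & f A <= f B & g A <= g B" if "A \<subseteq> B" "B \<subseteq> E" for A B
  unfolding f1_def g1_def using that by (intro conjI insert.prems(2,3)) auto
 have a1: "avg E p f <= avg E p f1" "avg E p g <= avg E p g1"
  unfolding f1_def g1_def by (intro avg_mono[OF pE] insert.prems(2,3); blast)+
 have IH1: "avg E p f1 * avg E p g1 <= avg E p (%A. f1 A * g1 A)"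
  using pE mono by (intro insert.IH) auto
 have IH0: "avg E p f * avg E p g <= avg E p (%A. f A * g A)"
  using pE mono by (intro insert.IH) auto
 have "avg (insert e E) p (%A. f A * g A)
   = p e * avg E p (%A. f1 A * g1 A) + (1 - p e) * avg E p (%A. f A * g A)"
  using insert by (simp add: avg_insert f1_def g1_def)
 also have "... >= p e * (avg E p f1 * avg E p g1) + (1 - p e) * (avg E p f * avg E p g)"
  using IH0 IH1 p by (intro add_mono mult_left_mono) auto
 \<comment> \<open>What remains is the covariance of the two conditional averages as functions of
   the single edge \<open>e\<close>. Both increase, so it is a product of increments of the same
   sign.\<close>
 moreover have "p e * (avg E p f1 * avg E p g1) + (1 - p e) * (avg E p f * avg E p g)
  - (p e * avg E p f1 + (1 - p e) * avg E p f) * (p e * avg E p g1 + (1 - p e) * avg E p g)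
  = p e * (1 - p e) * ((avg E p f1 - avg E p f) * (avg E p g1 - avg E p g))"
  by (simp add: algebra_simps)
 moreover have "... >= 0"
  using p a1 by (intro mult_nonneg_nonneg) auto
 ultimately show ?case using insert by (simp add: avg_insert f1_def g1_def)
qed simp

text \<open>
 Splitting the two uses of one edge into independent copies can only help, because
 \<open>max + min\<close> of the two mixed sections equals their sum. This is the induction step both of
 the BK inequality and of its decision-tree version.
\<close>

lemma duplicate_edge:
 fixes W :: "'e set => 'e set => real"
 assumes pE: "probs (insert e E) p" and eE: "e \<notin> E"
  and m: "\<And>A B A' B'. A \<subseteq> A' ==> B \<subseteq> B' ==> A' \<subseteq> insert e E ==> B' \<subseteq> insert e E ==> W A B <= W A' B'"
 shows "p e * avg E p (%A. avg E p (%B. max (W (insert e A) B) (W A (insert e B))))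
  + (1 - p e) * avg E p (%A. avg E p (W A))
  <= avg (insert e E) p (%A. avg (insert e E) p (W A))"
proof -
 define W00 W01 W10 W11 where "W00 = W" and "W01 = (%A B. W A (insert e B))"
  and "W10 = (%A B. W (insert e A) B)" and "W11 = (%A B. W (insert e A) (insert e B))"
 note defs = W00_def W01_def W10_def W11_def
 have fin: "finite E" and p: "0 <= p e" "p e <= 1" and pE': "probs E p"
  using pE by (auto simp: probs_def)
 let ?D = "%V. avg E p (%A. avg E p (%B. V A B))"
 have ms: "?D (%A B. max (W10 A B) (W01 A B)) + ?D (%A B. min (W10 A B) (W01 A B)) = ?D W10 + ?D W01"
 proof -
  have "?D (%A B. max (W10 A B) (W01 A B)) + ?D (%A B. min (W10 A B) (W01 A B))
   = ?D (%A B. max (W10 A B) (W01 A B) + min (W10 A B) (W01 A B))"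
   by (simp add: avg_add)
  also have "... = ?D (%A B. W10 A B + W01 A B)"
   by (intro avg_cong) (auto simp: max_def min_def)
  finally show ?thesis by (simp add: avg_add)
 qed
 have mn: "?D W00 <= ?D (%A B. min (W10 A B) (W01 A B))"
  unfolding defs by (intro avg_mono[OF pE'] min.boundedI m) auto
 have mx: "?D (%A B. max (W10 A B) (W01 A B)) <= ?D W11"
  unfolding defs by (intro avg_mono[OF pE'] max.boundedI m) auto
 \<comment> \<open>The weights \<open>p e\<close> and \<open>1 - p e\<close> are expanded into the
   four weights of two independent copies of \<open>e\<close>. The maximum is then compared with
   \<open>W11\<close>, \<open>W00\<close> with itself, and their sum with
   \<open>W10 + W01\<close>.\<close>
 have "p e * ?D (%A B. max (W10 A B) (W01 A B)) + (1 - p e) * ?D W00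
   = p e * p e * ?D (%A B. max (W10 A B) (W01 A B))
   + p e * (1 - p e) * (?D (%A B. max (W10 A B) (W01 A B)) + ?D W00) + (1 - p e) * (1 - p e) * ?D W00"
  by (simp add: algebra_simps)
 also have "... <= p e * p e * ?D W11
   + p e * (1 - p e) * (?D W10 + ?D W01) + (1 - p e) * (1 - p e) * ?D W00"
 proof -
  have "?D (%A B. max (W10 A B) (W01 A B)) + ?D W00 <= ?D W10 + ?D W01"
   using mn ms by linarith
  then show ?thesis
   using p by (intro add_right_mono add_mono[OF mult_left_mono[OF mx] mult_left_mono]) auto
 qed
 also have "... = avg (insert e E) p (%A. avg (insert e E) p (%B. W A B))"
  using fin eE by (simp add: avg_insert defs avg_add avg_cmult) (simp add: algebra_simps)
 finally show ?thesis unfolding defs by simp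
qed

text \<open>BK inequality in functional form: \<open>F\<close> is dominated by an increasing
  \<open>W\<close> evaluated at some splitting of the configuration into disjoint parts, and
  averaging makes the parts independent. A real-valued \<open>W\<close> also covers products of
  cluster sizes. In the induction an open edge \<open>e\<close> is claimed by one of the two parts,
  which gives the maximum handled by \<open>duplicate_edge\<close>.\<close>

theorem bk:
 fixes W :: "'e set => 'e set => real"
 assumes "probs E p"
  "\<And>A B A' B'. A \<subseteq> A' ==> B \<subseteq> B' ==> A' \<subseteq> E ==> B' \<subseteq> E ==> W A B <= W A' B'"
  "\<And>S. S \<subseteq> E ==> \<exists>C\<subseteq>S. F S <= W C (S - C)"
 shows "avg E p F <= avg E p (%A. avg E p (W A))"
 using probs_finite[OF assms(1)] assms
proof (induction E arbitrary: F W rule: finite_induct)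
 case empty
 then show ?case by force
next
 case (insert e E)
 have pE: "probs E p" and p: "0 <= p e" "p e <= 1" using insert.prems(1) by (auto simp: probs_def)
 note m = insert.prems(2)
 have 0: "avg E p F <= avg E p (%A. avg E p (W A))"
 proof (rule insert.IH[OF pE])
  fix S assume "S \<subseteq> E"
  then show "\<exists>C\<subseteq>S. F S <= W C (S - C)" using insert.prems(3)[of S] by auto
 next
  fix A B A' B' assume "A \<subseteq> A'" "B \<subseteq> B'" "A' \<subseteq> E" "B' \<subseteq> E"
  then show "W A B <= W A' B'" by (intro m) auto
 qed
 have 1: "avg E p (%A. F (insert e A))
   <= avg E p (%A. avg E p (%B. max (W (insert e A) B) (W A (insert e B))))"
 proof (rule insert.IH[OF pE])
  fix S assume S: "S \<subseteq> E"
  then obtain C where C: "C \<subseteq> insert e S" "F (insert e S) <= W C (insert e S - C)"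
   using insert.prems(3)[of "insert e S"] by auto
  have eS: "e \<notin> S" using S insert by auto
  show "\<exists>C\<subseteq>S. F (insert e S) <= max (W (insert e C) (S - C)) (W C (insert e (S - C)))"
  proof (cases "e : C")
   case True
   then have "insert e (C - {e}) = C" "S - (C - {e}) = insert e S - C" using eS by auto
   then show ?thesis using C by (intro exI[of _ "C - {e}"]) auto
  next
   case False
   then have "insert e (S - C) = insert e S - C" "C \<subseteq> S" using eS C by auto
   then show ?thesis using C by (intro exI[of _ C]) auto
  qed
 next
  fix A B A' B' assume "A \<subseteq> A'" "B \<subseteq> B'" "A' \<subseteq> E" "B' \<subseteq> E"
  then show "max (W (insert e A) B) (W A (insert e B)) <= max (W (insert e A') B') (W A' (insert e B'))"
   by (intro max.mono m) auto
 qed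
 have "avg (insert e E) p F = p e * avg E p (%A. F (insert e A)) + (1 - p e) * avg E p F"
  using insert by (simp add: avg_insert)
 also have "... <= p e * avg E p (%A. avg E p (%B. max (W (insert e A) B) (W A (insert e B))))
  + (1 - p e) * avg E p (%A. avg E p (W A))"
  using 0 1 p by (intro add_mono mult_left_mono) auto
 also have "... <= avg (insert e E) p (%A. avg (insert e E) p (W A))"
  using insert.prems(1) insert.hyps m by (intro duplicate_edge) auto
 finally show ?case .
qed

section \<open>Open clusters\<close>

definition conn :: "'v set set => 'v => 'v => bool" where
 "conn A = (%x y. {x, y} : A)\<^sup>*\<^sup>*"

definition clu :: "'v set set => 'v => 'v set" where
 "clu A x = {y. conn A x y}"

abbreviation csz :: "'v set set => 'v => real" where
 "csz A x \<equiv> real (card (clu A x))"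

lemma conn_refl [simp]: "conn A x x"
 by (simp add: conn_def)

lemma conn_edge: "{x, y} : A ==> conn A x y"
 by (simp add: conn_def r_into_rtranclp)

lemma conn_trans: "conn A x y ==> conn A y z ==> conn A x z"
 by (simp add: conn_def)

lemma conn_sym: "conn A x y ==> conn A y x"
 unfolding conn_def
proof (induction rule: rtranclp_induct)
 case (step y z)
 then have "{z, y} : A" by (simp add: insert_commute)
 then show ?case using step.IH by (meson converse_rtranclp_into_rtranclp)
qed simp

lemma conn_commute: "conn A x y \<longleftrightarrow> conn A y x"
 using conn_sym by metis

lemma conn_mono: "conn A x y ==> A \<subseteq> B ==> conn B x y"
 unfolding conn_def by (erule rtranclp_mono[THEN predicate2D, rotated]) auto

lemma conn_induct [consumes 1, case_names refl step]:
 assumes "conn A x y" "P x" "\<And>y z. conn A x y ==> {y, z} : A ==> P y ==> P z"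
 shows "P y"
 using assms unfolding conn_def by (induction rule: rtranclp_induct) auto

lemma mem_clu [simp]: "y : clu A x \<longleftrightarrow> conn A x y"
 by (simp add: clu_def)

lemma clu_mono: "A \<subseteq> B ==> clu A x \<subseteq> clu B x"
 using conn_mono by (auto simp: clu_def)

lemma clu_eq: "conn A x y ==> clu A x = clu A y"
 unfolding clu_def using conn_trans conn_sym by (metis Collect_cong)

lemma conn_in: "conn A x y ==> A \<subseteq> Pow V ==> x : V ==> y : V"
 by (induction rule: conn_induct) auto

lemma clu_subset: "A \<subseteq> Pow V ==> x : V ==> clu A x \<subseteq> V"
 using conn_in by (auto simp: clu_def)

lemma clu_subset_insert: "A \<subseteq> Pow V ==> clu A x \<subseteq> insert x V"
 by (rule clu_subset) auto

lemma finite_clu: "A \<subseteq> Pow V ==> finite V ==> finite (clu A x)"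
 using clu_subset_insert finite_subset by (metis finite.insertI)

text \<open>After its last visit to \<open>C\<close> a path uses only edges disjoint from
  \<open>C\<close>. These are disjoint from any edges used to explore inside \<open>C\<close>, as BK
  requires.\<close>

lemma conn_last_exit:
 assumes "conn A x y" "x : C" "y \<notin> C"
 shows "EX u v. u : C & v \<notin> C & {u, v} : A & conn {e : A. e Int C = {}} v y"
proof -
 have "y \<notin> C --> (EX u v. u : C & v \<notin> C & {u, v} : A & conn {e : A. e Int C = {}} v y)"
  using assms(1)
 proof (induction rule: conn_induct)
  case (step y z)
  show ?case
  proof
   assume z: "z \<notin> C"
   show "EX u v. u : C & v \<notin> C & {u, v} : A & conn {e : A. e Int C = {}} v z"
   proof (cases "y : C")
    case True
    then show ?thesis using z step by (intro exI[of _ y] exI[of _ z]) auto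
   next
    case False
    then obtain u v where uv: "u : C" "v \<notin> C" "{u, v} : A" "conn {e : A. e Int C = {}} v y"
     using step by auto
    moreover have "conn {e : A. e Int C = {}} y z"
     using False z step by (intro conn_edge) auto
    ultimately show ?thesis by (meson conn_trans)
   qed
  qed
 qed (use assms in auto)
 then show ?thesis using assms by auto
qed

text \<open>A path never leaves the cluster of its start. The clause \<open>e ~= {}\<close> makes
  the edges inside a cluster and the edges avoiding it disjoint families even if the empty set is a
  member of \<open>A\<close>.\<close>

lemma conn_within:
 assumes "conn A x y" "clu A x \<subseteq> D"
 shows "conn {e : A. e \<subseteq> D & e ~= {}} x y"
 using assms(1)
proof (induction rule: conn_induct)
 case (step y z)
 have "conn A x z" using step by (meson conn_edge conn_trans)
 then have "conn {e : A. e \<subseteq> D & e ~= {}} y z"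
  using step assms(2) by (intro conn_edge) auto
 then show ?case using step by (meson conn_trans)
qed simp

text \<open>For connections to a wired set containing \<open>v\<close>, opening
  \<open>{v, w}\<close> has the same effect as wiring \<open>w\<close> as well. This is how the
  search below absorbs an open edge into its stack.\<close>

lemma conn_insert_wired:
 assumes "conn (insert {v, w} A) s c" "s : S" "v : S"
 shows "EX s:insert w S. conn A s c"
 using assms(1)
proof (induction rule: conn_induct)
 case (step y z)
 then consider "{y, z} : A" | "{y, z} = {v, w}" by auto
 then show ?case
 proof cases
  case 1
  then show ?thesis using step by (meson conn_edge conn_trans)
 next
  case 2
  then show ?thesis using assms by (auto simp: doubleton_eq_iff intro: conn_refl)
 qed
next
 case refl
 show ?case using assms(2) by (intro bexI[of _ s]) simp_all
qed

lemma prb_conn_mono: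
 assumes "probs E p" "E' \<subseteq> E"
 shows "prb E' p (%A. conn A x y) <= prb E p (%A. conn A x y)"
 using assms by (intro avg_mono_set) (auto intro: conn_mono)

lemma prb_conn_commute: "prb E p (%A. conn A x y) = prb E p (%A. conn A y x)"
 by (simp only: conn_commute[of _ x y])

text \<open>Explore the cluster \<open>C\<close> of \<open>x\<close> in \<open>A Int E1\<close> and look at the last vertex in \<open>C\<close> of a path to \<open>y\<close>.\<close>

lemma conn_prb_decompose:
 fixes E :: "'v set set"
 assumes pE: "probs E p" and E1: "E1 \<subseteq> E" and EV: "E \<subseteq> Pow V" and V: "finite V"
 shows "prb E p (%A. conn A x y) <= prb E1 p (%A. conn A x y)
  + (SUM u:V. SUM v:V. of_bool ({u, v} : E - E1) *
    (prb E1 p (%A. conn A x u) * p {u, v} * prb E p (%A. conn A v y)))"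
proof -
 have fE: "finite E" using pE by (rule probs_finite)
 define Q where "Q = (%u v A. conn (A Int E1) x u & {u, v} : A &
   conn {e : A. e Int clu (A Int E1) x = {}} v y)"
 have pt: "of_bool (conn A x y) <= of_bool (conn (A Int E1) x y)
   + (SUM u:V. SUM v:V. of_bool ({u, v} : E - E1) * (of_bool (Q u v A) :: real))" if A: "A \<subseteq> E" for A
 proof (cases "conn A x y & ~ conn (A Int E1) x y")
  case True
  then obtain u v where uv: "conn (A Int E1) x u" "~ conn (A Int E1) x v" "{u, v} : A"
    "conn {e : A. e Int clu (A Int E1) x = {}} v y"
   using conn_last_exit[of A x y "clu (A Int E1) x"] by auto
  have "{u, v} \<notin> E1"
  proof
   assume "{u, v} : E1"
   then have "conn (A Int E1) u v" using uv by (intro conn_edge) auto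
   then show False using uv conn_trans by metis
  qed
  then have 1: "{u, v} : E - E1" "u : V" "v : V" using uv A EV by auto
  have "(1::real) = of_bool ({u, v} : E - E1) * of_bool (Q u v A)"
   using 1 uv by (simp add: Q_def)
  also have "... <= (SUM v:V. of_bool ({u, v} : E - E1) * of_bool (Q u v A))"
   using 1 V by (intro member_le_sum) auto
  also have "... <= (SUM u:V. SUM v:V. of_bool ({u, v} : E - E1) * of_bool (Q u v A))"
   using 1 V by (intro member_le_sum) (auto intro!: sum_nonneg)
  finally show ?thesis using True by simp
 next
  case False
  then show ?thesis by (auto intro!: add_nonneg_nonneg sum_nonneg)
 qed
 have Q: "prb E p (Q u v) <= prb E1 p (%A. conn A x u) * p {u, v} * prb E p (%A. conn A v y)"
  if uv: "{u, v} : E - E1" for u v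
 proof -
  let ?e = "{u, v}"
  define W where "W = (%I J. of_bool (conn (I Int E1) x u) * (of_bool (?e : J & conn (J - {?e}) v y) :: real))"
  have "prb E p (Q u v) <= avg E p (%A. avg E p (W A))"
  proof (rule bk[OF pE])
   fix A B A' B' :: "'v set set" assume "A \<subseteq> A'" "B \<subseteq> B'"
   then have "A Int E1 \<subseteq> A' Int E1" "B - {?e} \<subseteq> B' - {?e}" "B \<subseteq> B'" by auto
   then show "W A B <= W A' B'"
    unfolding W_def by (intro mult_mono) (auto intro: conn_mono)
  next
   fix S assume S: "S \<subseteq> E"
   show "\<exists>C\<subseteq>S. of_bool (Q u v S) <= W C (S - C)"
   proof (cases "Q u v S")
    case True
    \<comment> \<open>Disjoint witnesses: the edges inside the explored cluster carry the path to
      \<open>u\<close>, while \<open>{u, v}\<close> is not in \<open>E1\<close> and the rest of the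
      path avoids the cluster.\<close>
    let ?C = "{e : S Int E1. e \<subseteq> clu (S Int E1) x & e ~= {}}"
    have "conn ?C x u" using True by (intro conn_within) (auto simp: Q_def)
    then have 1: "conn (?C Int E1) x u" by (rule conn_mono) auto
    have 2: "?e : S - ?C" using True uv by (auto simp: Q_def)
    have "conn {e : S. e Int clu (S Int E1) x = {} & e ~= {}} v y"
     using True unfolding Q_def
     by (auto elim!: conn_mono[OF conn_within[OF _ subset_UNIV]])
    then have "conn (S - ?C - {?e}) v y"
     by (rule conn_mono) (use True in \<open>auto simp: Q_def\<close>)
    with 1 2 show ?thesis by (intro exI[of _ ?C]) (auto simp: W_def)
   qed (auto simp: W_def)
  qed
  also have "... = prb E p (%A. conn (A Int E1) x u) * prb E p (%A. ?e : A & conn (A - {?e}) v y)"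
   by (simp only: W_def avg_cmult avg_cmult_right)
  also have "prb E p (%A. conn (A Int E1) x u) = prb E1 p (%A. conn A x u)"
   using avg_restrict_Int[OF fE E1, of p "%A. of_bool (conn A x u)"] .
  also have "prb E p (%A. ?e : A & conn (A - {?e}) v y)
    = prb (insert ?e (E - {?e})) p (%A. ?e : A & conn (A - {?e}) v y)"
   using uv by (simp add: insert_absorb)
  also have "... = p ?e * avg (E - {?e}) p (%A. of_bool (conn (insert ?e A - {?e}) v y))
    + (1 - p ?e) * avg (E - {?e}) p (%A. of_bool (?e : A & conn (A - {?e}) v y))"
   using fE by (subst avg_insert) auto
  also have "avg (E - {?e}) p (%A. of_bool (?e : A & conn (A - {?e}) v y)) = avg (E - {?e}) p (%A. 0)"
   by (intro avg_cong) auto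
  also have "avg (E - {?e}) p (%A. of_bool (conn (insert ?e A - {?e}) v y)) = prb (E - {?e}) p (%A. conn A v y)"
  proof (rule avg_cong)
   fix A assume "A \<subseteq> E - {?e}"
   then have "insert ?e A - {?e} = A" by auto
   then show "of_bool (conn (insert ?e A - {?e}) v y) = (of_bool (conn A v y) :: real)" by simp
  qed
  also have "prb E1 p (%A. conn A x u) * (p ?e * prb (E - {?e}) p (%A. conn A v y) + (1 - p ?e) * avg (E - {?e}) p (%A. 0))
    <= prb E1 p (%A. conn A x u) * (p ?e * prb E p (%A. conn A v y))"
   using pE uv E1 probs_subset[OF pE E1]
   by (auto intro!: mult_left_mono prb_conn_mono prb_nonneg simp: probs_def)
  finally show ?thesis by (simp add: mult.assoc)
 qed
 have "prb E p (%A. conn A x y) <= avg E p (%A. of_bool (conn (A Int E1) x y)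
   + (SUM u:V. SUM v:V. of_bool ({u, v} : E - E1) * of_bool (Q u v A)))"
  by (intro avg_mono[OF pE] pt)
 also have "... = prb E1 p (%A. conn A x y) + (SUM u:V. SUM v:V. of_bool ({u, v} : E - E1) * prb E p (Q u v))"
  using avg_restrict_Int[OF fE E1, of p "%A. of_bool (conn A x y)"]
  by (simp only: avg_add avg_sum avg_cmult)
 also have "... <= prb E1 p (%A. conn A x y)
  + (SUM u:V. SUM v:V. of_bool ({u, v} : E - E1) *
    (prb E1 p (%A. conn A x u) * p {u, v} * prb E p (%A. conn A v y)))"
 proof (intro add_left_mono sum_mono)
  fix u v
  show "of_bool ({u, v} : E - E1) * prb E p (Q u v)
   <= of_bool ({u, v} : E - E1) *
      (prb E1 p (%A. conn A x u) * p {u, v} * prb E p (%A. conn A v y))"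
   using Q[of u v] by (cases "{u, v} : E - E1") simp_all
 qed
 finally show ?thesis .
qed

section \<open>Universal tightness of the largest cluster\<close>

text \<open>
 Splitting a rooted cluster of weight \<open>3m\<close> into two edge-disjoint connected pieces of weight \<open>m\<close>.
 The parameter \<open>\<rho>\<close> is the weight of the part of the cluster already attached to the root.
\<close>

lemma clu_split:
 assumes "A \<subseteq> Pow V" "finite V" "\<And>e. e : A ==> card e = 2" "\<rho> < m"
  "3 * m <= \<rho> + card (clu A u Int L)"
 shows "\<exists>B\<subseteq>A. m <= \<rho> + card (clu B u Int L) & (EX v. m <= card (clu (A - B) v Int L))"
proof -
 have "finite A" using assms(1,2) finite_subset by blast
 then show ?thesis using assms
 proof (induction "card A" arbitrary: A \<rho> u rule: less_induct)
  case less
  note AV = less.prems(2) and fV = less.prems(3) and c2 = less.prems(4) and rho = less.prems(5)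
   and big = less.prems(6)
  have ne: "e ~= {}" if "e : A" for e using c2[OF that] by auto
  define Au where "Au = {e : A. u \<notin> e}"
  define R where "R = clu A u"
  have AuA: "Au \<subseteq> A" by (auto simp: Au_def)
  have fclu: "finite (clu B x)" if "B \<subseteq> A" for B x
   using that AV fV finite_clu[of B V] by auto
  have fR: "finite R" using fclu by (auto simp: R_def)
  have DR: "clu Au x \<subseteq> R - {u}" if "x : R - {u}" for x
  proof
   fix y assume y: "y : clu Au x"
   then have "conn A x y" using AuA conn_mono by auto
   then have "y : R" using that conn_trans by (auto simp: R_def)
   moreover have "y ~= u"
   proof
    assume "y = u"
    then have "conn Au u x" using y conn_sym by auto
    then have "x = u" by (induction rule: conn_induct) (auto simp: Au_def)
    then show False using that by auto
   qed
   ultimately show "y : R - {u}" by auto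
  qed
  have nbr: "EX v. {u, v} : A & conn Au v y" if "y : R - {u}" for y
  proof -
   have "conn A u y" "y \<notin> {u}" using that by (auto simp: R_def)
   then obtain v where "{u, v} : A" "conn {e : A. e Int {u} = {}} v y"
    using conn_last_exit[of A u y "{u}"] by auto
   moreover have "{e : A. e Int {u} = {}} = Au" by (auto simp: Au_def)
   ultimately show ?thesis by auto
  qed
  have G: "conn {e : A. e \<subseteq> insert u T} u y"
   if T: "T \<subseteq> R - {u}" "\<And>y. y : T ==> clu Au y \<subseteq> T" and y: "y : T" for T y
  proof -
   obtain v where v: "{u, v} : A" "conn Au v y" using nbr[of y] T y by auto
   have "v : T" using T(2)[OF y] v conn_sym[of Au v y] by auto
   then have "conn {e : A. e \<subseteq> insert u T} u v" using v by (intro conn_edge) auto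
   moreover have "conn {e : Au. e \<subseteq> T & e ~= {}} v y"
    using v T(2)[OF \<open>v : T\<close>] by (intro conn_within)
   then have "conn {e : A. e \<subseteq> insert u T} v y" by (rule conn_mono) (use AuA in auto)
   ultimately show ?thesis by (rule conn_trans)
  qed
  have cardR: "card (R Int L) = card (X Int L) + card ((R - X) Int L)" if "X \<subseteq> R" for X
  proof -
   have "R Int L = (X Int L) Un ((R - X) Int L)" using that by auto
   moreover have "finite (X Int L)" "finite ((R - X) Int L)" using that fR finite_subset by auto
   ultimately show ?thesis by (simp add: card_Un_disjoint Int_commute disjoint_iff)
  qed
  have uR: "u : R" by (simp add: R_def)
  have mono_card: "card (X Int L) <= card (clu B x Int L)" if "X \<subseteq> clu B x" "B \<subseteq> A" for X B x
   using that fclu[of B x] by (intro card_mono) auto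
  show ?case
  \<comment> \<open>The branches at \<open>u\<close> are the \<open>Au\<close>-components of
    \<open>R - {u}\<close>. A branch of weight \<open>m\<close> is cut off, or else the root moves
    into it. If all branches are light they are grouped greedily.\<close>
  proof (cases "EX x:R - {u}. m <= card (clu Au x Int L)")
   case True
   then obtain x where x: "x : R - {u}" "m <= card (clu Au x Int L)" by auto
   define D where "D = clu Au x"
   have D: "D \<subseteq> R - {u}" using DR x by (simp add: D_def)
   have closed: "clu Au y \<subseteq> R - D - {u}" if "y : R - D - {u}" for y
   proof -
    have "clu Au y Int D = {}"
    proof (rule ccontr)
     assume "clu Au y Int D ~= {}"
     then obtain z where "conn Au y z" "conn Au x z" by (auto simp: D_def)
     then have "conn Au x y" using conn_sym conn_trans by metis
     then show False using that by (auto simp: D_def)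
    qed
    then show ?thesis using DR[of y] that by auto
   qed
   define B0 where "B0 = {e : A. e \<subseteq> R - D}"
   have "insert u (R - D - {u}) = R - D" using uR D by auto
   then have rest: "R - D \<subseteq> clu B0 u"
   proof -
    have "conn B0 u y" if "y : R - D" for y
    proof (cases "y = u")
     case False
     then have "conn {e : A. e \<subseteq> insert u (R - D - {u})} u y"
      using that closed by (intro G) auto
     then show ?thesis by (simp only: \<open>insert u (R - D - {u}) = R - D\<close> B0_def)
    qed simp
    then show ?thesis by auto
   qed
   have inD: "e : Au ==> e \<subseteq> D ==> e \<notin> B0" for e
    using ne AuA by (fastforce simp: B0_def)
   show ?thesis
   proof (cases "m <= \<rho> + card ((R - D) Int L)")
    case True
    have "D \<subseteq> clu (A - B0) x"
    proof
     fix y assume "y : D"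
     then have "conn {e : Au. e \<subseteq> D & e ~= {}} x y"
      by (intro conn_within) (auto simp: D_def)
     then have "conn (A - B0) x y" by (rule conn_mono) (use AuA inD in auto)
     then show "y : clu (A - B0) x" by simp
    qed
    then have "m <= card (clu (A - B0) x Int L)"
     using mono_card[of D "A - B0" x] x by (auto simp: D_def)
    moreover have "m <= \<rho> + card (clu B0 u Int L)"
     using True mono_card[OF rest] by (auto simp: B0_def)
    ultimately show ?thesis by (intro exI[of _ B0]) (auto simp: B0_def)
   next
    \<comment> \<open>What lies outside the branch is too light to be a piece. Its weight, still
      below \<open>m\<close>, is credited to \<open>\<rho>\<close>, and the splitting continues
      inside the branch from a neighbour \<open>v\<close> of \<open>u\<close>.\<close>
    case False
    obtain v where v: "{u, v} : A" "conn Au v x" using nbr x by auto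
    have Dv: "clu Au v = D" using clu_eq[OF v(2)] by (simp add: D_def)
    define A' where "A' = {e : Au. e \<subseteq> D}"
    have A'A: "A' \<subseteq> A" using AuA by (auto simp: A'_def)
    have "{u, v} : A - A'" using v by (auto simp: A'_def Au_def)
    then have "A' \<subset> A" using A'A by auto
    then have cA: "card A' < card A" using less.prems(1) by (rule psubset_card_mono[rotated])
    have "D \<subseteq> clu A' v"
    proof
     fix y assume "y : D"
     then have "conn {e : Au. e \<subseteq> D & e ~= {}} v y"
      using Dv by (intro conn_within) auto
     then have "conn A' v y" by (rule conn_mono) (auto simp: A'_def)
     then show "y : clu A' v" by simp
    qed
    then have "card (D Int L) <= card (clu A' v Int L)" by (rule mono_card[OF _ A'A])
    moreover have "card (R Int L) = card ((R - D) Int L) + card (D Int L)"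
    proof -
     have "D \<subseteq> R" using D by blast
     from cardR[OF this] show ?thesis by linarith
    qed
    ultimately have "3 * m <= (\<rho> + card ((R - D) Int L)) + card (clu A' v Int L)"
     using big by (simp add: R_def)
    then have "\<exists>B\<subseteq>A'. m <= (\<rho> + card ((R - D) Int L)) + card (clu B v Int L) &
      (EX v. m <= card (clu (A' - B) v Int L))"
     using less.prems A'A False finite_subset[OF A'A] by (intro less.hyps[OF cA]) auto
    then obtain B' v' where B': "B' \<subseteq> A'" "m <= \<rho> + card ((R - D) Int L) + card (clu B' v Int L)"
     "m <= card (clu (A' - B') v' Int L)"
     by auto
    define B where "B = B' Un B0 Un {{u, v}}"
    have BA: "B \<subseteq> A" using B' A'A v by (auto simp: B_def B0_def)
    have vD: "v : D" using Dv by auto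
    have "B' \<subseteq> Pow D" using B' by (auto simp: A'_def)
    then have clB': "clu B' v \<subseteq> D" using vD by (rule clu_subset)
    have sub: "(R - D) Un clu B' v \<subseteq> clu B u"
    proof
     fix y assume "y : (R - D) Un clu B' v"
     then show "y : clu B u"
     proof
      assume "y : R - D"
      moreover have "clu B0 u \<subseteq> clu B u" by (rule clu_mono) (auto simp: B_def)
      ultimately show ?thesis using rest by blast
     next
      assume "y : clu B' v"
      then have "conn B v y" using conn_mono[of B' v y B] by (auto simp: B_def)
      moreover have "conn B u v" by (intro conn_edge) (simp add: B_def)
      ultimately show ?thesis using conn_trans by auto
     qed
    qed
    have "card ((R - D) Int L) + card (clu B' v Int L) = card (((R - D) Un clu B' v) Int L)"
     using fR fclu[of B' v] B' A'A clB'
     by (subst card_Un_disjoint[symmetric]) (auto intro!: arg_cong[of _ _ card])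
    also have "... <= card (clu B u Int L)" by (rule mono_card[OF sub BA])
    finally have 1: "m <= \<rho> + card (clu B u Int L)" using B' by linarith
    have "A' - B' \<subseteq> A - B"
     using A'A inD by (auto simp: B_def A'_def Au_def)
    then have "clu (A' - B') v' \<subseteq> clu (A - B) v'" by (rule clu_mono)
    then have "m <= card (clu (A - B) v' Int L)"
     using mono_card[of _ "A - B"] B' by (meson Diff_subset order_trans)
    with 1 BA show ?thesis by auto
   qed
  next
   case False
   then have small: "card (clu Au x Int L) < m" if "x : R - {u}" for x using that by (meson not_le)
   define good where "good = (%T. T \<subseteq> R - {u} & (ALL y:T. clu Au y \<subseteq> T) & m <= \<rho> + card (insert u T Int L))"
   have "good (R - {u})"
    using DR big uR by (auto simp: good_def R_def insert_absorb)
   then obtain T where T: "good T" and Tmin: "\<And>T'. good T' ==> card T <= card T'"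
    using ex_has_least_nat[of good "R - {u}" card] by auto
   have fT: "finite T" using T fR finite_subset by (auto simp: good_def)
   \<comment> \<open>By minimality of \<open>T\<close>, dropping one branch of weight below
     \<open>m\<close> leaves less than \<open>m\<close>. Hence the group weighs at most
     \<open>2 * m\<close> and the other branches keep weight \<open>m\<close>. The two pieces share
     the vertex \<open>u\<close> but no edge.\<close>
   have T2: "\<rho> + card (insert u T Int L) <= 2 * m"
   proof (cases "T = {}")
    case True
    then have "card (insert u T Int L) <= card {u}" by (intro card_mono) auto
    then show ?thesis using rho by simp
   next
    case False
    then obtain y where y: "y : T" by auto
    then have yR: "y : R - {u}" using T by (auto simp: good_def)
    have "clu Au z \<subseteq> T - clu Au y" if "z : T - clu Au y" for z
    proof -
     have "clu Au z Int clu Au y = {}"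
     proof (rule ccontr)
      assume "clu Au z Int clu Au y ~= {}"
      then obtain a where "conn Au z a" "conn Au y a" by auto
      then have "conn Au y z" using conn_sym conn_trans by metis
      then show False using that by auto
     qed
     then show ?thesis using that T by (auto simp: good_def)
    qed
    then have "~ good (T - clu Au y) ==> ~ m <= \<rho> + card (insert u (T - clu Au y) Int L)"
     using T by (auto simp: good_def)
    moreover have "card (T - clu Au y) < card T"
    proof (rule psubset_card_mono[OF fT])
     have "y : clu Au y" by simp
     then show "T - clu Au y \<subset> T" using y by blast
    qed
    then have "~ good (T - clu Au y)" using Tmin by (meson not_le)
    ultimately have "\<rho> + card (insert u (T - clu Au y) Int L) < m" by simp
    moreover have "insert u T Int L \<subseteq> (insert u (T - clu Au y) Int L) Un (clu Au y Int L)" by auto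
    then have "card (insert u T Int L) <= card (insert u (T - clu Au y) Int L) + card (clu Au y Int L)"
     using fT fclu[OF AuA, of y] by (intro order_trans[OF card_mono card_Un_le]) auto
    ultimately show ?thesis using small[OF yR] by simp
   qed
   define T' where "T' = R - {u} - T"
   define B where "B = {e : A. e \<subseteq> insert u T}"
   have T'closed: "clu Au y \<subseteq> T'" if "y : T'" for y
   proof -
    have "clu Au y Int T = {}"
    proof (rule ccontr)
     assume "clu Au y Int T ~= {}"
     then obtain a where "conn Au y a" "a : T" by auto
     then have "y : T" using T conn_sym by (fastforce simp: good_def)
     then show False using that by (auto simp: T'_def)
    qed
    then show ?thesis using DR[of y] that by (auto simp: T'_def)
   qed
   have "insert u T \<subseteq> clu B u"
    using G[of T] T by (auto simp: good_def B_def)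
   then have 1: "m <= \<rho> + card (clu B u Int L)"
    using mono_card[of "insert u T" B u] T by (auto simp: good_def B_def)
   have notB: "e \<notin> B" if "e : A" "e \<subseteq> insert u T'" for e
   proof
    assume "e : B"
    then have "e \<subseteq> {u}" using that by (auto simp: B_def T'_def)
    then have "card e <= 1" using card_mono[of "{u}" e] by auto
    then show False using c2[OF that(1)] by auto
   qed
   have "T' \<subseteq> clu (A - B) u"
   proof
    fix y assume "y : T'"
    then have "conn {e : A. e \<subseteq> insert u T'} u y"
     using T'closed by (intro G) (auto simp: T'_def)
    then have "conn (A - B) u y" by (rule conn_mono) (use notB in auto)
    then show "y : clu (A - B) u" by simp
   qed
   then have "card (T' Int L) <= card (clu (A - B) u Int L)" by (rule mono_card) auto
   moreover have "card (R Int L) = card (insert u T Int L) + card (T' Int L)"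
   proof -
    have "insert u T \<subseteq> R" using T uR by (auto simp: good_def)
    moreover have "R - insert u T = T'" by (auto simp: T'_def)
    ultimately show ?thesis using cardR[of "insert u T"] by simp
   qed
   ultimately have "m <= card (clu (A - B) u Int L)" using T2 big by (simp add: R_def)
   with 1 show ?thesis by (intro exI[of _ B]) (auto simp: B_def)
  qed
 qed
qed

locale finite_perc =
 fixes V :: "'v set" and E :: "'v set set" and p :: "'v set => real"
 assumes fV: "finite V" and EV: "E \<subseteq> Pow V" and c2: "\<And>e. e : E ==> card e = 2"
  and p01: "\<And>e. 0 <= p e & p e <= 1"
begin

lemma pE: "probs E p"
 using fV EV p01 finite_subset[of E "Pow V"] by (auto simp: probs_def)

lemma finite_clu': "A \<subseteq> E ==> finite (clu A x)"
 using finite_clu[of A V] fV EV by auto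

lemma clu_card_mono: "A \<subseteq> B ==> B \<subseteq> E ==> card (clu A x Int L) <= card (clu B x Int L)"
 using finite_clu'[of B x] clu_mono[of A B x] by (intro card_mono) auto

lemma ex_clu_mono: "A \<subseteq> B ==> B \<subseteq> E ==> EX v. m <= card (clu A v Int L) ==> EX v. m <= card (clu B v Int L)"
 using clu_card_mono order_trans by metis

text \<open>\<open>clu_split\<close> gives edge-disjoint pieces of weight \<open>m\<close>, one
  still attached to \<open>x\<close> and one anywhere; BK multiplies their probabilities.\<close>

lemma tail_step:
 assumes "m >= 1"
 shows "prb E p (%A. 3 * m <= card (clu A x Int L))
  <= prb E p (%A. m <= card (clu A x Int L)) * prb E p (%A. EX v. m <= card (clu A v Int L))"
proof -
 define W where "W = (%I J. of_bool (m <= card (clu I x Int L)) * (of_bool (EX v. m <= card (clu J v Int L)) :: real))"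
 have "prb E p (%A. 3 * m <= card (clu A x Int L)) <= avg E p (%A. avg E p (W A))"
 proof (rule bk[OF pE])
  fix A B A' B' assume "A \<subseteq> A'" "B \<subseteq> B'" "A' \<subseteq> E" "B' \<subseteq> E"
  then show "W A B <= W A' B'" unfolding W_def
   using clu_card_mono[of A A' x L] ex_clu_mono[of B B' m L] by (intro mult_mono) auto
 next
  fix S assume S: "S \<subseteq> E"
  show "\<exists>C\<subseteq>S. of_bool (3 * m <= card (clu S x Int L)) <= W C (S - C)"
  proof (cases "3 * m <= card (clu S x Int L)")
   case True
   have "\<exists>B\<subseteq>S. m <= 0 + card (clu B x Int L) & (EX v. m <= card (clu (S - B) v Int L))"
    by (rule clu_split[OF _ fV]) (use S EV c2 True assms in auto)
   then show ?thesis by (auto simp: W_def)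
  qed (auto simp: W_def)
 qed
 then show ?thesis by (simp add: W_def avg_cmult avg_cmult_right)
qed

lemma max_step:
 assumes "m >= 1"
 shows "prb E p (%A. EX v. 3 * m <= card (clu A v Int L)) <= (prb E p (%A. EX v. m <= card (clu A v Int L)))^2"
proof -
 define W where "W = (%I J. of_bool (EX v. m <= card (clu I v Int L)) * (of_bool (EX v. m <= card (clu J v Int L)) :: real))"
 have "prb E p (%A. EX v. 3 * m <= card (clu A v Int L)) <= avg E p (%A. avg E p (W A))"
 proof (rule bk[OF pE])
  fix A B A' B' assume "A \<subseteq> A'" "B \<subseteq> B'" "A' \<subseteq> E" "B' \<subseteq> E"
  then show "W A B <= W A' B'" unfolding W_def
   using ex_clu_mono[of A A' m L] ex_clu_mono[of B B' m L] by (intro mult_mono) auto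
 next
  fix S assume S: "S \<subseteq> E"
  show "\<exists>C\<subseteq>S. of_bool (EX v. 3 * m <= card (clu S v Int L)) <= W C (S - C)"
  proof (cases "EX v. 3 * m <= card (clu S v Int L)")
   case True
   then obtain x where x: "3 * m <= card (clu S x Int L)" by auto
   have "\<exists>B\<subseteq>S. m <= 0 + card (clu B x Int L) & (EX v. m <= card (clu (S - B) v Int L))"
    by (rule clu_split[OF _ fV]) (use S EV c2 x assms in auto)
   then show ?thesis by (auto simp: W_def)
  qed (auto simp: W_def)
 qed
 then show ?thesis by (simp add: W_def avg_cmult avg_cmult_right power2_eq_square)
qed

lemma max_tail:
 assumes "m >= 1"
 shows "prb E p (%A. EX v. 3 ^ k * m <= card (clu A v Int L)) <= prb E p (%A. EX v. m <= card (clu A v Int L)) ^ (2 ^ k)"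
proof (induction k)
 case (Suc k)
 have "prb E p (%A. EX v. 3 * (3 ^ k * m) <= card (clu A v Int L))
   <= (prb E p (%A. EX v. 3 ^ k * m <= card (clu A v Int L)))^2"
  using assms by (intro max_step) auto
 also have "... <= (prb E p (%A. EX v. m <= card (clu A v Int L)) ^ (2 ^ k))^2"
  using Suc by (intro power_mono prb_nonneg pE)
 finally show ?case by (simp add: mult_ac flip: power_mult)
qed simp

text \<open>Each tripling of the threshold costs the current bound on the maximum, and the exponents
  1, 2, 4, ... from \<open>max_tail\<close> add up to \<open>2 ^ k - 1\<close>.\<close>

lemma clu_tail:
 assumes "m >= 1"
 shows "prb E p (%A. 3 ^ k * m <= card (clu A x Int L))
  <= prb E p (%A. m <= card (clu A x Int L)) * prb E p (%A. EX v. m <= card (clu A v Int L)) ^ (2 ^ k - 1)"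
proof (induction k)
 case (Suc k)
 let ?q = "prb E p (%A. EX v. m <= card (clu A v Int L))"
 have "prb E p (%A. 3 * (3 ^ k * m) <= card (clu A x Int L))
   <= prb E p (%A. 3 ^ k * m <= card (clu A x Int L)) * prb E p (%A. EX v. 3 ^ k * m <= card (clu A v Int L))"
  using assms by (intro tail_step) auto
 also have "... <= (prb E p (%A. m <= card (clu A x Int L)) * ?q ^ (2 ^ k - 1)) * ?q ^ (2 ^ k)"
  using Suc max_tail[OF assms] by (intro mult_mono mult_nonneg_nonneg prb_nonneg pE zero_le_power)
 also have "... = prb E p (%A. m <= card (clu A x Int L)) * ?q ^ (2 ^ k - 1 + 2 ^ k)"
  by (simp only: power_add mult.assoc)
 also have "(2::nat) ^ k - 1 + 2 ^ k = 2 ^ Suc k - 1" by simp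
 finally show ?case by (simp only: power_Suc mult.assoc)
qed simp

end

lemma summable_double_exp:
 fixes a q :: real
 assumes "0 <= a" "0 <= q" "q < 1"
 shows "summable (%k. a ^ k * q ^ (2 ^ k - 1))"
proof -
 have "(%k. q ^ k) \<longlonglongrightarrow> 0" using assms by (intro LIMSEQ_realpow_zero) auto
 then have "(%k. a * q ^ k) \<longlonglongrightarrow> a * 0" by (rule tendsto_mult_left)
 then have "eventually (%k. a * q ^ k < 1 / 2) sequentially" by (rule order_tendstoD) simp
 then obtain N where N: "\<And>k. k >= N ==> a * q ^ k < 1 / 2" by (auto simp: eventually_sequentially)
 show ?thesis
 proof (rule summable_ratio_test[of "1 / 2" N])
  fix k assume k: "k >= N"
  have "k <= 2 ^ k" by (rule less_imp_le[OF less_exp])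
  then have "q ^ (2 ^ k) <= q ^ k" using assms by (intro power_decreasing) auto
  then have 1: "a * q ^ (2 ^ k) <= 1 / 2" using N[OF k] assms by (smt (verit) mult_left_mono)
  have "(2::nat) ^ Suc k - 1 = (2 ^ k - 1) + 2 ^ k" by simp
  then have "a ^ Suc k * q ^ (2 ^ Suc k - 1) = (a * q ^ (2 ^ k)) * (a ^ k * q ^ (2 ^ k - 1))"
   by (simp only: power_add power_Suc mult_ac)
  also have "... <= 1 / 2 * (a ^ k * q ^ (2 ^ k - 1))"
   using assms 1 by (intro mult_right_mono) auto
  finally show "norm (a ^ Suc k * q ^ (2 ^ Suc k - 1)) <= 1 / 2 * norm (a ^ k * q ^ (2 ^ k - 1))"
   using assms by (simp add: abs_mult)
 qed simp
qed

text \<open>Universal tightness: above the typical size of the largest cluster, tails are stretched exponential.\<close>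

lemma moment_bound:
 fixes \<delta> :: real
 assumes \<delta>: "0 < \<delta>" "\<delta> < 1"
 shows "EX C>=1. ALL (V::'v set) E p L m x i. finite_perc V E p --> m >= 1 --> i <= j -->
  prb E p (%A. EX v. m <= card (clu A v Int L)) <= 1 - \<delta> -->
  avg E p (%A. real (card (clu A x Int L)) ^ j) <= C * real m ^ (j - i) * avg E p (%A. real (card (clu A x Int L)) ^ i)"
proof -
 \<comment> \<open>Contribution of sizes between \<open>3 ^ k * m\<close> and
   \<open>3 ^ (k + 1) * m\<close>: the upper end to the power \<open>j\<close>, times the decay of
   \<open>clu_tail\<close>.\<close>
 define f where "f = (%k. (3 ^ j) * ((3 ^ j) ^ k * (1 - \<delta>) ^ (2 ^ k - 1)))"
 have sf: "summable f"
  unfolding f_def using \<delta> by (intro summable_mult summable_double_exp) auto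
 have f0: "f k >= 0" for k using \<delta> by (simp add: f_def)
 define C where "C = 1 + suminf f"
 have C1: "C >= 1" using suminf_nonneg[OF sf f0] by (simp add: C_def)
 show ?thesis
 proof (intro exI[of _ C] conjI C1 allI impI)
  fix V E p L m x i
  assume "finite_perc (V :: 'v set) E p" and m: "m >= (1::nat)" and ij: "i <= j"
   and q: "prb E p (%A. EX v. m <= card (clu A v Int L)) <= 1 - \<delta>"
  then interpret finite_perc V E p by simp
  let ?X = "%A. card (clu A x Int L)"
  let ?q = "prb E p (%A. EX v. m <= card (clu A v Int L))"
  define n where "n = card (insert x V)"
  have Xn: "?X A < 3 ^ n * m" if "A \<subseteq> E" for A
  proof -
   have "?X A <= n" unfolding n_def
    using that EV clu_subset_insert[of A V x] fV by (intro card_mono) auto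
   also have "n < 3 ^ n" by (rule less_exp[THEN less_le_trans]) (simp add: power_mono)
   also have "3 ^ n * 1 <= 3 ^ n * m" using m by (intro mult_left_mono) auto
   then have "3 ^ n <= 3 ^ n * m" by simp
   finally show ?thesis .
  qed
  have pt: "real (?X A) ^ j <= real m ^ (j - i) * real (?X A) ^ i
    + (SUM k<n. 3 ^ j * (3 ^ j) ^ k * real m ^ j * of_bool (3 ^ k * m <= ?X A))" if A: "A \<subseteq> E" for A
  proof (cases "?X A < m")
   case True
   then have "real (?X A) ^ j = real (?X A) ^ (j - i) * real (?X A) ^ i"
    using ij by (simp flip: power_add)
   also have "... <= real m ^ (j - i) * real (?X A) ^ i"
    using True by (intro mult_right_mono power_mono) auto
   finally show ?thesis
    by (rule order_trans) (intro add_increasing2 sum_nonneg mult_nonneg_nonneg order.refl; simp)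
  next
   case False
   define k where "k = (LEAST k. ?X A < 3 ^ k * m)"
   have k: "?X A < 3 ^ k * m" unfolding k_def by (rule LeastI[of _ n]) (rule Xn[OF A])
   have kn: "k <= n" unfolding k_def by (rule Least_le) (rule Xn[OF A])
   have "k ~= 0" using False k by (intro notI) simp
   then obtain l where l: "k = Suc l" using not0_implies_Suc by auto
   have "~ ?X A < 3 ^ l * m"
    using not_less_Least[of l "%k. ?X A < 3 ^ k * m"] l by (simp add: k_def)
   then have "of_bool (3 ^ l * m <= ?X A) = (1::real)" by simp
   have "real (?X A) <= 3 ^ k * real m"
    using of_nat_mono[OF less_imp_le[OF k], where 'a = real] by simp
   then have "real (?X A) ^ j <= (3 ^ k * real m) ^ j" by (intro power_mono) auto
   also have "... = 3 ^ j * (3 ^ j) ^ l * real m ^ j * of_bool (3 ^ l * m <= ?X A)"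
    using \<open>of_bool (3 ^ l * m <= ?X A) = (1::real)\<close>
    by (simp add: l power_mult_distrib power_add mult.commute flip: power_mult)
   also have "... <= (SUM k<n. 3 ^ j * (3 ^ j) ^ k * real m ^ j * of_bool (3 ^ k * m <= ?X A))"
    using kn l by (intro member_le_sum) auto
   finally show ?thesis by (simp add: add_increasing)
  qed
  \<comment> \<open>Markov turns the remaining probability of reaching \<open>m\<close> into the
    \<open>i\<close>-th moment, so no absolute tail bound is left in the estimate.\<close>
  have mk: "real m ^ i * prb E p (%A. m <= ?X A) <= avg E p (%A. real (?X A) ^ i)"
  proof -
   have "avg E p (%A. real m ^ i * of_bool (m <= ?X A)) <= avg E p (%A. real (?X A) ^ i)"
    by (intro avg_mono[OF pE]) (auto intro: power_mono)
   then show ?thesis by (simp add: avg_cmult)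
  qed
  have tail: "prb E p (%A. 3 ^ k * m <= ?X A) <= prb E p (%A. m <= ?X A) * (1 - \<delta>) ^ (2 ^ k - 1)" for k
   using clu_tail[OF m, of k x L] q
   by (rule order_trans[OF _ mult_left_mono[OF power_mono]]) (auto intro!: prb_nonneg pE)
  have "avg E p (%A. real (?X A) ^ j) <= avg E p (%A. real m ^ (j - i) * real (?X A) ^ i
    + (SUM k<n. 3 ^ j * (3 ^ j) ^ k * real m ^ j * of_bool (3 ^ k * m <= ?X A)))"
   by (intro avg_mono[OF pE] pt)
  also have "... = real m ^ (j - i) * avg E p (%A. real (?X A) ^ i)
    + (SUM k<n. 3 ^ j * (3 ^ j) ^ k * real m ^ j * prb E p (%A. 3 ^ k * m <= ?X A))"
   by (simp only: avg_add avg_sum avg_cmult)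
  also have "... <= real m ^ (j - i) * avg E p (%A. real (?X A) ^ i)
    + (SUM k<n. 3 ^ j * (3 ^ j) ^ k * real m ^ j * (prb E p (%A. m <= ?X A) * (1 - \<delta>) ^ (2 ^ k - 1)))"
   by (intro add_left_mono sum_mono mult_left_mono tail) auto
  also have "... = real m ^ (j - i) * avg E p (%A. real (?X A) ^ i)
    + (SUM k<n. f k) * (real m ^ j * prb E p (%A. m <= ?X A))"
   unfolding sum_distrib_right by (simp only: f_def mult_ac)
  also have "... <= real m ^ (j - i) * avg E p (%A. real (?X A) ^ i)
    + suminf f * (real m ^ j * prb E p (%A. m <= ?X A))"
   by (intro add_left_mono mult_right_mono sum_le_suminf sf) (auto intro!: f0 mult_nonneg_nonneg prb_nonneg pE)
  also have "real m ^ j * prb E p (%A. m <= ?X A) = real m ^ (j - i) * (real m ^ i * prb E p (%A. m <= ?X A))"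
   using ij by (simp flip: power_add mult.assoc)
  also have "suminf f * (real m ^ (j - i) * (real m ^ i * prb E p (%A. m <= ?X A)))
   <= suminf f * (real m ^ (j - i) * avg E p (%A. real (?X A) ^ i))"
   by (intro mult_left_mono mk suminf_nonneg sf f0) auto
  finally show "avg E p (%A. real (?X A) ^ j) <= C * real m ^ (j - i) * avg E p (%A. real (?X A) ^ i)"
   by (simp add: C_def algebra_simps)
 qed
qed

section \<open>The three-point inequality of Gladkov\<close>

definition conn_set :: "'v set set => 'v set => 'v => bool" where
 "conn_set A S c \<longleftrightarrow> (EX s:S. conn A s c)"

text \<open>Connection in the graph where the vertices of \<open>S\<close> are identified.\<close>

definition wired_conn :: "'v set set => 'v set => 'v => 'v => bool" where
 "wired_conn A S b c \<longleftrightarrow> conn A b c \<or> conn_set A S b & conn_set A S c"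

text \<open>
 \<open>\<gamma>\<close> is the stack of a depth-first search started at its last element. The stack is cut at some
 vertex \<open>i\<close>; the part towards the start is wired in the first copy and the part towards the
 top in the second.
\<close>

definition split_conn :: "'v => 'v => 'v list => 'v set set => 'v set set => bool" where
 "split_conn b c \<gamma> A B \<longleftrightarrow> (EX ys i zs. \<gamma> = ys @ i # zs &
   conn_set A (set (i # zs)) c & wired_conn B (set (ys @ [i])) b c)"

lemma conn_set_mono: "conn_set A S c ==> A \<subseteq> B ==> S \<subseteq> T ==> conn_set B T c"
proof -
 assume "conn_set A S c" "A \<subseteq> B" "S \<subseteq> T"
 then obtain s where "s : T" "conn A s c" by (auto simp: conn_set_def)
 then show ?thesis using conn_mono[of A s c B] \<open>A \<subseteq> B\<close> by (auto simp: conn_set_def)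
qed

lemma wired_conn_mono: "wired_conn A S b c ==> A \<subseteq> B ==> S \<subseteq> T ==> wired_conn B T b c"
 unfolding wired_conn_def using conn_mono[of A b c B] conn_set_mono[of A S _ B T] by auto

lemma split_conn_mono:
 assumes "split_conn b c \<gamma> A B" "A \<subseteq> A'" "B \<subseteq> B'"
 shows "split_conn b c \<gamma> A' B'"
proof -
 obtain ys i zs where "\<gamma> = ys @ i # zs" "conn_set A (set (i # zs)) c" "wired_conn B (set (ys @ [i])) b c"
  using assms(1) unfolding split_conn_def by blast
 then show ?thesis unfolding split_conn_def
  using conn_set_mono[OF _ assms(2) order.refl] wired_conn_mono[OF _ assms(3) order.refl] by blast
qed

lemma conn_set_insert_edge:
 assumes "v : S"
 shows "conn_set (insert {v, w} A) S c \<longleftrightarrow> conn_set A (insert w S) c"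
proof
 assume "conn_set (insert {v, w} A) S c"
 then show "conn_set A (insert w S) c"
  unfolding conn_set_def using conn_insert_wired[of v w A _ c S] assms by blast
next
 assume "conn_set A (insert w S) c"
 then obtain s where s: "s = w \<or> s : S" "conn A s c" by (auto simp: conn_set_def)
 then have "conn (insert {v, w} A) s c" by (auto elim: conn_mono)
 moreover have "conn (insert {v, w} A) v w" by (intro conn_edge) simp
 ultimately show "conn_set (insert {v, w} A) S c"
  using s assms unfolding conn_set_def by (metis conn_trans)
qed

text \<open>The open edge along which \<open>w\<close> was pushed is needed in one copy only: in the
  first if the stack is cut at \<open>w\<close>, in the second if it is cut further down. This is
  the form required by \<open>duplicate_edge\<close>.\<close>

lemma split_conn_push:
 assumes "split_conn b c (w # v # \<gamma>) A B"
 shows "split_conn b c (v # \<gamma>) (insert {v, w} A) B \<or> split_conn b c (v # \<gamma>) A (insert {v, w} B)"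
proof -
 obtain ys i zs where s: "w # v # \<gamma> = ys @ i # zs" "conn_set A (set (i # zs)) c"
  "wired_conn B (set (ys @ [i])) b c"
  using assms by (auto simp: split_conn_def)
 show ?thesis
 proof (cases ys)
  case Nil
  then have iz: "i = w" "zs = v # \<gamma>" using s by auto
  have "conn_set A (insert w (set (v # \<gamma>))) c" using s iz by simp
  then have 1: "conn_set (insert {v, w} A) (set (v # \<gamma>)) c"
   by (subst conn_set_insert_edge) simp_all
  have "conn B b c" using s(3) Nil iz conn_trans[OF conn_sym, of B w b c]
   by (auto simp: wired_conn_def conn_set_def)
  then have 2: "wired_conn B (set ([] @ [v])) b c" by (simp add: wired_conn_def)
  show ?thesis unfolding split_conn_def using 1 2
   by (intro disjI1 exI[of _ "[]"] exI[of _ v] exI[of _ \<gamma>]) simp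
 next
  case (Cons w' ys')
  then have 1: "w' = w" "v # \<gamma> = ys' @ i # zs" using s by auto
  have v: "v : set (ys' @ [i])" using 1 by (cases ys') auto
  have "wired_conn (insert {v, w} B) (set (ys' @ [i])) b c"
   using s(3) conn_mono[of B b c "insert {v, w} B"]
   unfolding wired_conn_def conn_set_insert_edge[OF v] Cons 1 by auto
  then show ?thesis unfolding split_conn_def using 1 s
   by (intro disjI2 exI[of _ ys'] exI[of _ i] exI[of _ zs]) simp
 qed
qed

text \<open>The cone of triples with \<open>x^2 <= s * u\<close> and nonnegative \<open>s\<close>,
  \<open>u\<close> is convex, so the bound survives averaging over the state of an edge.\<close>

lemma convex_CS:
 fixes x0 :: real
 assumes "x0^2 <= s0 * u0" "x1^2 <= s1 * u1" "0 <= s0" "0 <= u0" "0 <= s1" "0 <= u1" "0 <= q" "0 <= r"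
 shows "(q * x0 + r * x1)^2 <= (q * s0 + r * s1) * (q * u0 + r * u1)"
proof -
 have "\<bar>x0 * x1\<bar>^2 <= (s0 * u0) * (s1 * u1)"
  unfolding power2_abs power_mult_distrib using assms by (intro mult_mono) auto
 also have "(s0 * u0) * (s1 * u1) = (s0 * u1) * (s1 * u0)" by simp
 also have "... <= ((s0 * u1 + s1 * u0) / 2)^2"
  using zero_le_power2[of "s0 * u1 - s1 * u0"] by (simp add: power2_eq_square field_simps)
 finally have "\<bar>x0 * x1\<bar> <= (s0 * u1 + s1 * u0) / 2"
  by (rule power2_le_imp_le) (use assms in auto)
 then have 1: "2 * (x0 * x1) <= s0 * u1 + s1 * u0" using abs_ge_self[of "x0 * x1"] by simp
 have "(q * x0 + r * x1)^2 = q * q * x0^2 + r * r * x1^2 + q * r * (2 * (x0 * x1))"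
  by (simp add: power2_eq_square algebra_simps)
 also have "... <= q * q * (s0 * u0) + r * r * (s1 * u1) + q * r * (s0 * u1 + s1 * u0)"
  using assms 1 by (intro add_mono mult_left_mono mult_nonneg_nonneg)
 finally show ?thesis by (simp add: algebra_simps)
qed

text \<open>The search from the stack \<open>\<gamma>\<close> with unexplored edges \<open>F\<close>
  stops once its top is \<open>b\<close> or \<open>c\<close>. The leaves that find \<open>b\<close>
  first contribute \<open>x\<close> to the probability of meeting both targets. There
  \<open>s\<close> is the probability of such a leaf and \<open>u\<close> averages the squared
  conditional probability of still reaching \<open>c\<close>, so \<open>x^2 <= s * u\<close> is
  Cauchy-Schwarz over the leaves. Primed quantities exchange \<open>b\<close> and
  \<open>c\<close>.\<close>

lemma (in finite_perc) dfs_bound: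
 assumes "F \<subseteq> E" "\<gamma> ~= []"
 shows "EX x s u x' s' u'. prb F p (%A. conn_set A (set \<gamma>) b & conn_set A (set \<gamma>) c) <= x + x' &
  x^2 <= s * u & x'^2 <= s' * u' & 0 <= s & 0 <= u & 0 <= s' & 0 <= u' &
  s <= prb F p (%A. conn_set A (set \<gamma>) b) & s' <= prb F p (%A. conn_set A (set \<gamma>) c) &
  u <= 2 * avg F p (%A. prb F p (split_conn b c \<gamma> A)) &
  u' <= 2 * avg F p (%A. prb F p (split_conn c b \<gamma> A))"
 using assms
\<comment> \<open>An edge counts twice and a stack entry once, so deleting a closed edge, pushing
  along an open one and popping the top all decrease the measure.\<close>
proof (induction "card F + card F + length \<gamma>" arbitrary: F \<gamma> rule: less_induct)
 case less
 note FE = less.prems(1)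
 have pF: "probs F p" using pE FE by (rule probs_subset)
 have fF: "finite F" using pF by (rule probs_finite)
 obtain v \<gamma>' where g: "\<gamma> = v # \<gamma>'" using less.prems by (cases \<gamma>) auto
 have U0: "0 <= avg F p (%A. prb F p (split_conn b c \<gamma> A))" for b c
  by (intro avg_nonneg pF) auto
 \<comment> \<open>The square is the probability that two independent copies both reach
   \<open>c\<close>, from stack positions \<open>i\<close> and \<open>j\<close>. Cutting at the one
   further from the top serves both, as \<open>b\<close> is the top; the order of the copies gives
   the factor 2.\<close>
 have leaf: "(prb F p (%A. conn_set A (set \<gamma>) c))^2 <= 2 * avg F p (%A. prb F p (split_conn b c \<gamma> A))"
  if "v = b" for b c
 proof -
  let ?h = "prb F p (%A. conn_set A (set \<gamma>) c)"
  have "?h^2 = avg F p (%A. avg F p (%B. of_bool (conn_set A (set \<gamma>) c) * of_bool (conn_set B (set \<gamma>) c)))"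
   by (simp add: avg_cmult avg_cmult_right power2_eq_square)
  also have "... <= avg F p (%A. avg F p (%B. of_bool (split_conn b c \<gamma> A B) + of_bool (split_conn b c \<gamma> B A)))"
  proof (intro avg_mono pF)
   fix A B assume "A \<subseteq> F" "B \<subseteq> F"
   have *: "split_conn b c \<gamma> A B" if "conn A (\<gamma> ! i) c" "conn B (\<gamma> ! j) c" "j <= i" "i < length \<gamma>" for i j A B
   proof -
    have "conn_set A (set (\<gamma> ! i # drop (Suc i) \<gamma>)) c" using that by (auto simp: conn_set_def)
    moreover have "wired_conn B (set (take i \<gamma> @ [\<gamma> ! i])) b c"
    proof -
     have tk: "take i \<gamma> @ [\<gamma> ! i] = take (Suc i) \<gamma>" using that by (simp add: take_Suc_conv_app_nth)
     have "\<gamma> ! j : set (take (Suc i) \<gamma>)" using that by (auto simp: set_conv_nth intro!: exI[of _ j])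
     moreover have "b : set (take (Suc i) \<gamma>)" using g \<open>v = b\<close> by simp
     ultimately have "conn_set B (set (take (Suc i) \<gamma>)) c" "conn_set B (set (take (Suc i) \<gamma>)) b"
      unfolding conn_set_def using that by (blast, intro bexI[of _ b]) simp_all
     then show ?thesis unfolding wired_conn_def tk by simp
    qed
    ultimately show ?thesis unfolding split_conn_def
     using that id_take_nth_drop[of i \<gamma>] by blast
   qed
   show "of_bool (conn_set A (set \<gamma>) c) * of_bool (conn_set B (set \<gamma>) c)
    <= (of_bool (split_conn b c \<gamma> A B) + of_bool (split_conn b c \<gamma> B A) :: real)"
   proof (cases "conn_set A (set \<gamma>) c & conn_set B (set \<gamma>) c")
    case True
    then obtain i j where ij: "conn A (\<gamma> ! i) c" "i < length \<gamma>" "conn B (\<gamma> ! j) c" "j < length \<gamma>"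
     unfolding conn_set_def by (metis in_set_conv_nth)
    show ?thesis
    proof (cases "j <= i")
     case True
     then show ?thesis using *[of A i B j] ij by simp
    next
     case False
     then show ?thesis using *[of B j A i] ij by simp
    qed
   qed auto
  qed
  also have "... = avg F p (%A. prb F p (split_conn b c \<gamma> A)) + avg F p (%A. prb F p (%B. split_conn b c \<gamma> B A))"
   by (simp add: avg_add)
  also have "avg F p (%A. prb F p (%B. split_conn b c \<gamma> B A)) = avg F p (%A. prb F p (split_conn b c \<gamma> A))"
   unfolding avg_def sum_distrib_left by (subst sum.swap) (intro sum.cong refl, simp)
  finally show ?thesis by simp
 qed
 consider "v = b" | "v = c" | e where "v ~= b" "v ~= c" "e : F" "v : e"
  | "v ~= b" "v ~= c" "ALL e:F. v \<notin> e" by blast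
 then show ?case
 proof cases
  case 1
  let ?h = "prb F p (%A. conn_set A (set \<gamma>) c)"
  have b: "conn_set A (set \<gamma>) b" for A using 1 g by (auto simp: conn_set_def)
  show ?thesis
   by (rule exI[of _ ?h], rule exI[of _ 1], rule exI[of _ "?h^2"], rule exI[of _ 0], rule exI[of _ 0], rule exI[of _ 0])
    (use leaf[OF 1, of c] U0 b fF in \<open>simp add: prb_nonneg pF\<close>)
 next
  case 2
  let ?h = "prb F p (%A. conn_set A (set \<gamma>) b)"
  have c: "conn_set A (set \<gamma>) c" for A using 2 g by (auto simp: conn_set_def)
  show ?thesis
   by (rule exI[of _ 0], rule exI[of _ 0], rule exI[of _ 0], rule exI[of _ ?h], rule exI[of _ 1], rule exI[of _ "?h^2"])
    (use leaf[OF 2, of b] U0 c fF in \<open>simp add: prb_nonneg pF\<close>)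
 next
  case 3
  obtain w where e: "e = {v, w}" "v ~= w"
   using c2[of e] 3 FE by (auto simp: card_2_iff)
  \<comment> \<open>Reveal an edge at the top of the stack: if closed it is discarded, if open its
    other end is pushed. The bounds of the two cases are averaged.\<close>
  define F' where "F' = F - {e}"
  have F: "F = insert e F'" "e \<notin> F'" "finite F'" using 3 fF by (auto simp: F'_def)
  have F'E: "F' \<subseteq> E" using FE by (auto simp: F'_def)
  have pF': "probs F' p" using pE F'E by (rule probs_subset)
  have card: "card F = Suc (card F')" using F by simp
  have q: "0 <= p e" "0 <= 1 - p e" using p01[of e] by auto
  obtain x0 s0 u0 x0' s0' u0' where I0:
   "prb F' p (%A. conn_set A (set \<gamma>) b & conn_set A (set \<gamma>) c) <= x0 + x0'"
   "x0^2 <= s0 * u0" "x0'^2 <= s0' * u0'" "0 <= s0" "0 <= u0" "0 <= s0'" "0 <= u0'"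
   "s0 <= prb F' p (%A. conn_set A (set \<gamma>) b)" "s0' <= prb F' p (%A. conn_set A (set \<gamma>) c)"
   "u0 <= 2 * avg F' p (%A. prb F' p (split_conn b c \<gamma> A))"
   "u0' <= 2 * avg F' p (%A. prb F' p (split_conn c b \<gamma> A))"
   using less.hyps[OF _ F'E, of \<gamma>] card g by auto
  let ?\<gamma> = "w # \<gamma>"
  obtain x1 s1 u1 x1' s1' u1' where I1:
   "prb F' p (%A. conn_set A (set ?\<gamma>) b & conn_set A (set ?\<gamma>) c) <= x1 + x1'"
   "x1^2 <= s1 * u1" "x1'^2 <= s1' * u1'" "0 <= s1" "0 <= u1" "0 <= s1'" "0 <= u1'"
   "s1 <= prb F' p (%A. conn_set A (set ?\<gamma>) b)" "s1' <= prb F' p (%A. conn_set A (set ?\<gamma>) c)"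
   "u1 <= 2 * avg F' p (%A. prb F' p (split_conn b c ?\<gamma> A))"
   "u1' <= 2 * avg F' p (%A. prb F' p (split_conn c b ?\<gamma> A))"
   using less.hyps[OF _ F'E, of ?\<gamma>] card by auto
  have ce: "conn_set (insert e A) (set \<gamma>) c \<longleftrightarrow> conn_set A (set ?\<gamma>) c" for A c
   using conn_set_insert_edge[of v "set \<gamma>" w A c] g e by simp
  have rec: "prb F p (%A. Q (conn_set A (set \<gamma>) b) (conn_set A (set \<gamma>) c))
    = p e * prb F' p (%A. Q (conn_set A (set ?\<gamma>) b) (conn_set A (set ?\<gamma>) c))
    + (1 - p e) * prb F' p (%A. Q (conn_set A (set \<gamma>) b) (conn_set A (set \<gamma>) c))" for Q
   using F by (simp only: F(1) avg_insert[OF F(3,2)] ce)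
  have urec: "p e * avg F' p (%A. prb F' p (split_conn b c ?\<gamma> A))
    + (1 - p e) * avg F' p (%A. prb F' p (split_conn b c \<gamma> A))
    <= avg F p (%A. prb F p (split_conn b c \<gamma> A))" for b c
  proof -
   have "avg F' p (%A. prb F' p (split_conn b c ?\<gamma> A))
    <= avg F' p (%A. avg F' p (%B. max (of_bool (split_conn b c \<gamma> (insert e A) B)) (of_bool (split_conn b c \<gamma> A (insert e B)))))"
    using split_conn_push[of b c w v \<gamma>'] unfolding g e by (intro avg_mono pF') auto
   then have "p e * avg F' p (%A. prb F' p (split_conn b c ?\<gamma> A))
    + (1 - p e) * avg F' p (%A. prb F' p (split_conn b c \<gamma> A))
    <= p e * avg F' p (%A. avg F' p (%B. max (of_bool (split_conn b c \<gamma> (insert e A) B)) (of_bool (split_conn b c \<gamma> A (insert e B)))))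
    + (1 - p e) * avg F' p (%A. prb F' p (split_conn b c \<gamma> A))"
    using q by (intro add_right_mono mult_left_mono)
   also have "... <= avg (insert e F') p (%A. prb (insert e F') p (split_conn b c \<gamma> A))"
    using pF F split_conn_mono[of b c \<gamma>] by (intro duplicate_edge) auto
   finally show ?thesis using F by simp
  qed
  show ?thesis
  proof (intro exI conjI)
   show "prb F p (%A. conn_set A (set \<gamma>) b & conn_set A (set \<gamma>) c)
    <= (p e * x1 + (1 - p e) * x0) + (p e * x1' + (1 - p e) * x0')"
    using mult_left_mono[OF I0(1) q(2)] mult_left_mono[OF I1(1) q(1)]
    unfolding rec[of "(&)"] by (simp add: algebra_simps)
   show "(p e * x1 + (1 - p e) * x0)^2 <= (p e * s1 + (1 - p e) * s0) * (p e * u1 + (1 - p e) * u0)"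
    using I0 I1 q by (intro convex_CS)
   show "(p e * x1' + (1 - p e) * x0')^2 <= (p e * s1' + (1 - p e) * s0') * (p e * u1' + (1 - p e) * u0')"
    using I0 I1 q by (intro convex_CS)
   show "p e * s1 + (1 - p e) * s0 <= prb F p (%A. conn_set A (set \<gamma>) b)"
    unfolding rec[of "%x y. x"] using I0 I1 q by (intro add_mono mult_left_mono)
   show "p e * s1' + (1 - p e) * s0' <= prb F p (%A. conn_set A (set \<gamma>) c)"
    unfolding rec[of "%x y. y"] using I0 I1 q by (intro add_mono mult_left_mono)
   show "p e * u1 + (1 - p e) * u0 <= 2 * avg F p (%A. prb F p (split_conn b c \<gamma> A))"
    using urec[of b c] mult_left_mono[OF I0(10) q(2)] mult_left_mono[OF I1(10) q(1)] by simp
   show "p e * u1' + (1 - p e) * u0' <= 2 * avg F p (%A. prb F p (split_conn c b \<gamma> A))"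
    using urec[of c b] mult_left_mono[OF I0(11) q(2)] mult_left_mono[OF I1(11) q(1)] by simp
  qed (use I0 I1 q in auto)
 next
  case 4
  \<comment> \<open>No unexplored edge touches the top, so it can be popped.\<close>
  have iso: "~ conn A v y" if "A \<subseteq> F" "v ~= y" for A y
  proof
   assume "conn A v y"
   then have "v = y" by (induction rule: conn_induct) (use 4 that in auto)
   then show False using that by simp
  qed
  have ceq: "conn_set A (set \<gamma>) y \<longleftrightarrow> conn_set A (set \<gamma>') y" if "A \<subseteq> F" "v ~= y" for A y
   using iso[OF that] by (auto simp: conn_set_def g)
  show ?thesis
  proof (cases "\<gamma>' = []")
   case True
   then have "prb F p (%A. conn_set A (set \<gamma>) b & conn_set A (set \<gamma>) c) = avg F p (%A. 0)"
    using ceq 4 by (intro avg_cong) (auto simp: conn_set_def)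
   then show ?thesis
    by (intro exI[of _ 0]) (use U0 in \<open>simp add: prb_nonneg pF\<close>)
  next
   case False
   have "length \<gamma>' < length \<gamma>" using g by simp
   then obtain x s u x' s' u' where I:
    "prb F p (%A. conn_set A (set \<gamma>') b & conn_set A (set \<gamma>') c) <= x + x'"
    "x^2 <= s * u" "x'^2 <= s' * u'" "0 <= s" "0 <= u" "0 <= s'" "0 <= u'"
    "s <= prb F p (%A. conn_set A (set \<gamma>') b)" "s' <= prb F p (%A. conn_set A (set \<gamma>') c)"
    "u <= 2 * avg F p (%A. prb F p (split_conn b c \<gamma>' A))"
    "u' <= 2 * avg F p (%A. prb F p (split_conn c b \<gamma>' A))"
    using less.hyps[OF _ FE False] by auto
   have "split_conn b c \<gamma> A B" if sp: "split_conn b c \<gamma>' A B" for A B b c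
   proof -
    obtain ys i zs where "\<gamma>' = ys @ i # zs" "conn_set A (set (i # zs)) c" "wired_conn B (set (ys @ [i])) b c"
     using sp unfolding split_conn_def by blast
    then show ?thesis unfolding split_conn_def g
     using wired_conn_mono[of B "set (ys @ [i])" b c B "set ((v # ys) @ [i])"]
     by (intro exI[of _ "v # ys"] exI[of _ i] exI[of _ zs]) auto
   qed
   then have U: "avg F p (%A. prb F p (split_conn b c \<gamma>' A)) <= avg F p (%A. prb F p (split_conn b c \<gamma> A))" for b c
    by (intro avg_mono pF) auto
   have e1: "prb F p (%A. conn_set A (set \<gamma>) y) = prb F p (%A. conn_set A (set \<gamma>') y)" if "v ~= y" for y
    using ceq that by (intro avg_cong) auto
   have e2: "prb F p (%A. conn_set A (set \<gamma>) b & conn_set A (set \<gamma>) c)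
     = prb F p (%A. conn_set A (set \<gamma>') b & conn_set A (set \<gamma>') c)"
    using ceq 4 by (intro avg_cong) auto
   have u: "u <= 2 * avg F p (%A. prb F p (split_conn b c \<gamma> A))"
    using I(10) U[of b c] by linarith
   have u': "u' <= 2 * avg F p (%A. prb F p (split_conn c b \<gamma> A))"
    using I(11) U[of c b] by linarith
   show ?thesis unfolding e1[OF 4(1)] e1[OF 4(2)] e2
    by (intro exI[of _ x] exI[of _ s] exI[of _ u] exI[of _ x'] exI[of _ s'] exI[of _ u'] conjI I(1-9) u u')
  qed
 qed
qed

text \<open>With the stack \<open>[a]\<close> the only cut is at \<open>a\<close>, where wiring has
  no effect, and the split event becomes a product of two connection events. The constant 8 comes
  from \<open>(x + x')^2 <= 2 * x^2 + 2 * x'^2\<close> and the two factors 2 of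
  \<open>dfs_bound\<close>.\<close>

theorem (in finite_perc) gladkov:
 "(prb E p (%A. conn A a b & conn A a c))^2
  <= 8 * (prb E p (%A. conn A a b) * prb E p (%A. conn A b c) * prb E p (%A. conn A a c))"
proof -
 let ?P = "%x y. prb E p (%A. conn A x y)"
 have sp: "split_conn b c [a] A B \<longleftrightarrow> conn A a c & conn B b c" for A B b c
 proof -
  have "conn B b c \<or> conn B a b & conn B a c \<longleftrightarrow> conn B b c"
   using conn_sym conn_trans by metis
  then show ?thesis
   by (auto simp: split_conn_def wired_conn_def conn_set_def append_eq_Cons_conv Cons_eq_append_conv)
 qed
 have U: "avg E p (%A. prb E p (split_conn b c [a] A)) = ?P a c * ?P b c" for b c
 proof -
  have "avg E p (%A. prb E p (split_conn b c [a] A)) = avg E p (%A. avg E p (%B. of_bool (conn A a c) * of_bool (conn B b c)))"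
   by (intro avg_cong) (auto simp: sp)
  then show ?thesis by (simp add: avg_cmult avg_cmult_right)
 qed
 have cs: "conn_set A (set [a]) y \<longleftrightarrow> conn A a y" for A y by (simp add: conn_set_def)
 let ?X = "prb E p (%A. conn A a b & conn A a c)"
 let ?Z = "?P a b * ?P b c * ?P a c"
 obtain x s u x' s' u' where I: "?X <= x + x'"
  "x^2 <= s * u" "x'^2 <= s' * u'" "0 <= s" "0 <= u" "0 <= s'" "0 <= u'" "s <= ?P a b" "s' <= ?P a c"
  "u <= 2 * (?P a c * ?P b c)" "u' <= 2 * (?P a b * ?P c b)"
  using dfs_bound[of E "[a]" b c] unfolding U cs by auto
 have "x^2 <= ?P a b * (2 * (?P a c * ?P b c))"
  using I by (intro order_trans[OF I(2)] mult_mono) auto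
 then have x: "x^2 <= 2 * ?Z" by (simp add: mult_ac)
 have "x'^2 <= ?P a c * (2 * (?P a b * ?P c b))"
  using I by (intro order_trans[OF I(3)] mult_mono) auto
 then have x': "x'^2 <= 2 * ?Z" using prb_conn_commute[of E p b c] by (simp add: mult_ac)
 have "?X^2 <= (x + x')^2"
  using I(1) prb_nonneg[OF pE] by (intro power_mono) auto
 also have "... <= 2 * x^2 + 2 * x'^2"
  using zero_le_power2[of "x - x'"] by (simp add: power2_eq_square algebra_simps)
 also have "... <= 8 * ?Z" using x x' by linarith
 finally show ?thesis .
qed

section \<open>Long-range kernels on boxes\<close>

text \<open>The sup-distance, with natural values. Its balls are cubes of explicit cardinality, and
  every norm is comparable to it (\<open>norm_sd_bounds\<close>).\<close>

definition sd :: "int ^ 'd => int ^ 'd => nat" where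
 "sd x y = nat (Max (range (%i. \<bar>x $ i - y $ i\<bar>)))"

lemma sd_le_iff: "sd x y <= n \<longleftrightarrow> (ALL i. \<bar>x $ i - y $ i\<bar> <= int n)"
proof -
 have "sd x y <= n \<longleftrightarrow> Max (range (%i. \<bar>x $ i - y $ i\<bar>)) <= int n"
  unfolding sd_def by (simp add: nat_le_iff)
 also have "... \<longleftrightarrow> (ALL i. \<bar>x $ i - y $ i\<bar> <= int n)"
  by (subst Max_le_iff) auto
 finally show ?thesis .
qed

lemma abs_le_sd: "\<bar>x $ i - y $ i\<bar> <= int (sd x y)"
 using sd_le_iff[of x y "sd x y"] by simp

lemma sd_commute: "sd x y = sd y x"
 unfolding sd_def by (simp add: abs_minus_commute)

lemma sd_self [simp]: "sd x x = 0"
 using sd_le_iff[of x x 0] by simp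

lemma sd_eq_0_iff [simp]: "sd x y = 0 \<longleftrightarrow> x = y"
 using sd_le_iff[of x y 0] by (auto simp: vec_eq_iff)

lemma sd_pos: "x ~= y ==> 1 <= sd x y"
 using sd_eq_0_iff[of x y] by linarith

lemma sd_triangle: "sd x z <= sd x y + sd y z"
 unfolding sd_le_iff
proof
 fix i show "\<bar>x $ i - z $ i\<bar> <= int (sd x y + sd y z)"
  using abs_le_sd[of x i y] abs_le_sd[of y i z] by linarith
qed

lemma sd_shift [simp]: "sd (x + z) (y + z) = sd x y"
 by (simp add: sd_def)

lemma sd_shift_left [simp]: "sd (z + x) (z + y) = sd x y"
 by (simp add: sd_def)

definition lbox :: "int ^ 'd => nat => (int ^ 'd) set" where
 "lbox x n = {y. sd x y <= n}"

lemma mem_lbox [simp]: "y : lbox x n \<longleftrightarrow> sd x y <= n"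
 by (simp add: lbox_def)

lemma vec_box:
 assumes "\<And>i. finite (S i)"
 shows "finite {y :: int ^ 'd. ALL i. y $ i : S i} & card {y :: int ^ 'd. ALL i. y $ i : S i} = (PROD i:UNIV. card (S i))"
proof -
 have b: "bij_betw vec_nth {y :: int ^ 'd. ALL i. y $ i : S i} (Pi\<^sub>E UNIV S)"
  by (rule bij_betw_byWitness[where f' = vec_lambda]) (auto simp: PiE_def)
 have "finite (Pi\<^sub>E UNIV S)" using assms by (intro finite_PiE) auto
 with b show ?thesis
  using bij_betw_finite[OF b] bij_betw_same_card[OF b] by (simp add: card_PiE)
qed

lemma lbox_eq: "lbox x n = {y. ALL i. y $ i : {x $ i - int n..x $ i + int n}}"
 unfolding lbox_def sd_le_iff by (auto simp: abs_le_iff) (metis add.commute diff_le_eq, smt (verit))+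

lemma finite_lbox [simp]: "finite (lbox x n)"
 unfolding lbox_eq by (rule vec_box[THEN conjunct1]) simp

lemma card_lbox: "card (lbox (x :: int ^ 'd) n) = (2 * n + 1) ^ CARD('d)"
proof -
 have "nat (2 * int n + 1) = 2 * n + 1" by simp
 then show ?thesis
  unfolding lbox_eq by (subst vec_box[THEN conjunct2]) (simp_all add: prod_constant)
qed

lemma lbox_mono: "m <= n ==> lbox x m \<subseteq> lbox x n"
 by auto

lemma self_in_lbox: "x : lbox x n"
 by simp

lemma lbox_shift: "(%y. y + z) ` lbox x n = lbox (x + z) n"
proof safe
 fix y assume "y : lbox (x + z) n"
 then have "y - z : lbox x n" using sd_shift[of x z "y - z"] by simp
 then show "y : (%y. y + z) ` lbox x n" by (force simp: image_iff intro!: bexI[of _ "y - z"])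
qed simp

lemma power_diff_le:
 fixes x y :: real
 assumes "0 <= y" "y <= x"
 shows "x ^ n - y ^ n <= real n * (x - y) * x ^ (n - 1)"
proof (induction n)
 case (Suc n)
 have "x ^ Suc n - y ^ Suc n = x * (x ^ n - y ^ n) + (x - y) * y ^ n" by (simp add: algebra_simps)
 also have "... <= x * (real n * (x - y) * x ^ (n - 1)) + (x - y) * x ^ n"
  using assms Suc by (intro add_mono mult_left_mono power_mono) auto
 also have "... = real (Suc n) * (x - y) * x ^ n"
  by (cases n) (simp_all add: algebra_simps)
 finally show ?case by simp
qed simp

lemma power_diff_ge:
 fixes x y :: real
 assumes "0 <= y" "y <= x" "n > 0"
 shows "(x - y) * y ^ (n - 1) <= x ^ n - y ^ n"
proof -
 obtain k where k: "n = Suc k" using assms not0_implies_Suc by blast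
 have "x ^ Suc k - y ^ Suc k - (x - y) * y ^ k = x * (x ^ k - y ^ k)" by (simp add: algebra_simps)
 also have "... >= 0" using assms by (intro mult_nonneg_nonneg) (auto intro: power_mono)
 finally show ?thesis using k by simp
qed

lemma card_annulus:
 assumes "m <= n"
 shows "real (card (lbox (x :: int ^ 'd) n - lbox x m)) = real (2 * n + 1) ^ CARD('d) - real (2 * m + 1) ^ CARD('d)"
 using card_mono[OF _ lbox_mono[OF assms, of x]] card_Diff_subset[OF _ lbox_mono[OF assms, of x]]
 by (simp add: card_lbox of_nat_diff)

lemma card_sphere:
 assumes "k >= 1"
 shows "real (card {y :: int ^ 'd. sd x y = k}) <= real CARD('d) * 2 * 3 ^ (CARD('d) - 1) * real k ^ (CARD('d) - 1)"
proof -
 let ?d = "CARD('d)"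
 have "{y. sd x y = k} = lbox x k - lbox x (k - 1)" using assms by auto
 then have "real (card {y. sd x y = k}) = real (2 * k + 1) ^ ?d - real (2 * (k - 1) + 1) ^ ?d"
  using card_annulus[of "k - 1" k x] by simp
 also have "... <= real ?d * (real (2 * k + 1) - real (2 * (k - 1) + 1)) * real (2 * k + 1) ^ (?d - 1)"
  by (intro power_diff_le) auto
 also have "real (2 * k + 1) - real (2 * (k - 1) + 1) = 2" using assms by (simp add: of_nat_diff)
 also have "real ?d * 2 * real (2 * k + 1) ^ (?d - 1) <= real ?d * 2 * (3 * real k) ^ (?d - 1)"
  using assms by (intro mult_left_mono power_mono) auto
 finally show ?thesis by (simp add: power_mult_distrib mult_ac)
qed

lemma finite_sphere: "finite {y. sd x y = k}"
 by (rule finite_subset[OF _ finite_lbox[of x k]]) auto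

lemma sum_radial_le:
 fixes f :: "nat => real"
 assumes "finite T" "\<And>y. y : T ==> m < sd x y & sd x y <= n" "\<And>k. f k >= 0"
 shows "(SUM y:T. f (sd x (y :: int ^ 'd))) <=
  real CARD('d) * 2 * 3 ^ (CARD('d) - 1) * (SUM k:{m<..n}. real k ^ (CARD('d) - 1) * f k)"
proof -
 have "(SUM y:T. f (sd x y)) = (SUM k:{m<..n}. SUM y:{y : T. sd x y = k}. f (sd x y))"
  using assms by (subst sum.group) auto
 also have "... <= (SUM k:{m<..n}. (real CARD('d) * 2 * 3 ^ (CARD('d) - 1) * real k ^ (CARD('d) - 1)) * f k)"
 proof (rule sum_mono)
  fix k assume k: "k : {m<..n}"
  have "(SUM y:{y : T. sd x y = k}. f (sd x y)) = real (card {y : T. sd x y = k}) * f k"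
   by simp
  also have "... <= real (card {y. sd x y = k}) * f k"
   using assms finite_sphere by (intro mult_right_mono of_nat_mono card_mono) auto
  also have "... <= (real CARD('d) * 2 * 3 ^ (CARD('d) - 1) * real k ^ (CARD('d) - 1)) * f k"
   using k assms by (intro mult_right_mono card_sphere) auto
  finally show "(SUM y:{y : T. sd x y = k}. f (sd x y)) <=
   (real CARD('d) * 2 * 3 ^ (CARD('d) - 1) * real k ^ (CARD('d) - 1)) * f k" .
 qed
 finally show ?thesis by (simp add: sum_distrib_left mult.assoc)
qed

lemma powr_diff_step:
 fixes b :: real
 assumes "k >= (1::nat)"
 shows "EX z. real k < z & z < real k + 1 & (real k + 1) powr b - k ^r b = b * z powr (b - 1)"
proof -
 have "EX z>real k. z < real k + 1 & (real k + 1) powr b - k ^r b = (real k + 1 - real k) * (b * z powr (b - 1))"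
 proof (rule MVT2)
  fix x assume "real k <= x" "x <= real k + 1"
  then show "((%x. x powr b) has_real_derivative b * x powr (b - 1)) (at x)"
   using assms by (intro has_real_derivative_powr) auto
 qed simp
 then show ?thesis by auto
qed

lemma sum_powr_upper:
 fixes a :: real
 assumes "0 < a" "a < 1"
 shows "(SUM k:{0<..n}. k ^r (-a)) <= n ^r (1 - a) / (1 - a)"
proof (induction n)
 case (Suc n)
 have "real (Suc n) powr (-a) <= (real (Suc n) powr (1 - a) - n ^r (1 - a)) / (1 - a)"
 proof (cases "n = 0")
  case True
  then show ?thesis using assms by (simp add: field_simps)
 next
  case False
  then obtain z where z: "real n < z" "z < real n + 1"
   "(real n + 1) powr (1 - a) - n ^r (1 - a) = (1 - a) * z powr (1 - a - 1)"
   using powr_diff_step[of n "1 - a"] by auto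
  have "(real n + 1) powr (-a) <= z powr (-a)"
   using z False assms by (intro powr_mono2') auto
  then have "(1 - a) * (real n + 1) powr (-a) <= (1 - a) * z powr (-a)"
   using assms by (intro mult_left_mono) auto
  also have "... = (real n + 1) powr (1 - a) - n ^r (1 - a)" using z by simp
  finally show ?thesis using assms by (simp add: pos_le_divide_eq mult.commute add.commute)
 qed
 moreover have "{0<..Suc n} = insert (Suc n) {0<..n}" by auto
 ultimately show ?case using Suc assms by (simp add: diff_divide_distrib)
qed simp

text \<open>Comparison with an integral; writing \<open>m + 1\<close> on the right keeps the bound
  finite at \<open>m = 0\<close>.\<close>

lemma sum_powr_tail:
 fixes a :: real
 assumes "0 < a"
 shows "(SUM k:{m<..n}. k ^r (-1 - a)) <= (1 + 1 / a) * 2 powr a * real (m + 1) powr (-a)"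
proof -
 have A: "(SUM k:{m<..n}. k ^r (-1 - a)) <= (m ^r (-a) - real (max m n) powr (-a)) / a" if m: "m >= 1" for m
 proof (induction n)
  case (Suc n)
  show ?case
  proof (cases "m <= n")
   case True
   then obtain z where z: "real n < z" "z < real n + 1"
    "(real n + 1) powr (-a) - n ^r (-a) = -a * z powr (-a - 1)"
    using powr_diff_step[of n "-a"] m by auto
   have "(real n + 1) powr (-a - 1) <= z powr (-a - 1)"
    using z True m assms by (intro powr_mono2') auto
   then have "a * (real n + 1) powr (-a - 1) <= a * z powr (-a - 1)"
    using assms by (intro mult_left_mono) auto
   moreover have e: "-1 - a = -a - 1" by simp
   ultimately have "a * real (Suc n) powr (-1 - a) <= n ^r (-a) - real (Suc n) powr (-a)"
    unfolding e using z by (simp add: add.commute)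
   then have "real (Suc n) powr (-1 - a) <= (n ^r (-a) - real (Suc n) powr (-a)) / a"
    using assms by (simp add: field_simps)
   moreover have "{m<..Suc n} = insert (Suc n) {m<..n}" using True by auto
   ultimately show ?thesis using Suc True assms by (simp add: max_def diff_divide_distrib)
  next
   case False
   then have "{m<..Suc n} = {}" by auto
   then show ?thesis using False by (cases "m = Suc n") (simp_all add: max_def)
  qed
 qed simp
 have B: "(SUM k:{m<..n}. k ^r (-1 - a)) <= m ^r (-a) / a" if m: "m >= 1" for m
  by (rule order_trans[OF A[OF m]]) (use assms in \<open>auto intro!: divide_right_mono\<close>)
 show ?thesis
 proof (cases "m = 0")
  case True
  have "(SUM k:{0<..n}. k ^r (-1 - a)) <= (SUM k:insert 1 {1<..n}. k ^r (-1 - a))"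
   by (intro sum_mono2) auto
  also have "... <= 1 + 1 / a" using B[of 1] by simp
  also have "(1 + 1 / a) * 1 <= (1 + 1 / a) * 2 powr a"
   using assms by (intro mult_left_mono ge_one_powr_ge_zero) auto
  then have "1 + 1 / a <= (1 + 1 / a) * 2 powr a" by simp
  finally show ?thesis using True by simp
 next
  case False
  have "m ^r (-a) = 2 powr a * (2 * real m) powr (-a)"
   using False by (simp add: powr_mult powr_minus field_simps)
  also have "... <= 2 powr a * real (m + 1) powr (-a)"
   using False assms by (intro mult_left_mono powr_mono2') auto
  finally have "m ^r (-a) / a <= 1 / a * (2 powr a * real (m + 1) powr (-a))"
   using assms by (simp add: divide_right_mono)
  also have "... <= (1 + 1 / a) * (2 powr a * real (m + 1) powr (-a))"
   by (intro mult_right_mono) auto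
  finally show ?thesis using B[of m] False by simp
 qed
qed

section \<open>Edge sets and edge probabilities\<close>

definition Ed :: "'v set => 'v set set" where
 "Ed V = {{x, y} | x y. x : V & y : V & x ~= y}"

definition EdR :: "(int ^ 'd) set => nat => (int ^ 'd) set set" where
 "EdR V R = {{x, y} | x y. x : V & y : V & x ~= y & sd x y <= R}"

text \<open>Summing over both orientations and halving makes the probability a function of the set
  \<open>e\<close> without choosing endpoints; see \<open>pk_edge\<close> for its value on an
  edge.\<close>

definition pk :: "('v => 'v => real) => 'v set => real" where
 "pk w e = 1 - exp (- (SUM x:e. SUM y:e - {x}. w x y) / 2)"

lemma pk_01: "(\<And>x y. 0 <= w x y) ==> 0 <= pk w e & pk w e <= 1"
 by (simp add: pk_def sum_nonneg)

lemma pk_edge: "x ~= y ==> w x y = w y x ==> pk w {x, y} = 1 - exp (- w x y)"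
proof -
 assume *: "x ~= y" "w x y = w y x"
 have "{x, y} - {x} = {y}" "{x, y} - {y} = {x}" using * by auto
 then show ?thesis using * by (simp add: pk_def)
qed

lemma in_Ed [simp]: "{x, y} : Ed V \<longleftrightarrow> x : V & y : V & x ~= y"
 by (auto simp: Ed_def doubleton_eq_iff)

lemma in_EdR [simp]: "{x, y} : EdR V R \<longleftrightarrow> x : V & y : V & x ~= y & sd x y <= R"
 by (auto simp: EdR_def doubleton_eq_iff sd_commute)

lemma Ed_mono: "V \<subseteq> W ==> Ed V \<subseteq> Ed W"
 by (auto simp: Ed_def)

lemma EdR_mono: "V \<subseteq> W ==> R <= R' ==> EdR V R \<subseteq> EdR W R'"
 unfolding EdR_def by (blast intro: order_trans)

lemma EdR_subset_Ed: "EdR V R \<subseteq> Ed V"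
 by (auto simp: EdR_def Ed_def)

lemma Ed_EdR: "(\<And>x y. x : V ==> y : V ==> sd x y <= R) ==> Ed V = EdR V R"
 unfolding EdR_def Ed_def by blast

lemma Ed_Pow: "Ed V \<subseteq> Pow V"
 by (auto simp: Ed_def)

lemma EdR_Pow: "EdR V R \<subseteq> Pow V"
 by (auto simp: EdR_def)

lemma finite_Ed: "finite V ==> finite (Ed V)"
 by (rule finite_subset[OF Ed_Pow]) simp

lemma finite_EdR: "finite V ==> finite (EdR V R)"
 by (rule finite_subset[OF EdR_Pow]) simp

lemma Ed_card: "e : Ed V ==> card e = 2"
 by (auto simp: Ed_def)

lemma Ed_cases: "e : Ed V ==> (\<And>x y. e = {x, y} ==> x : V ==> y : V ==> x ~= y ==> P) ==> P"
 by (auto simp: Ed_def)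

lemma conn_image:
 assumes "inj h"
 shows "conn ((`) h ` A) (h x) (h y) \<longleftrightarrow> conn A x y"
proof
 assume "conn A x y"
 then show "conn ((`) h ` A) (h x) (h y)"
 proof (induction rule: conn_induct)
  case (step y z)
  then have "conn ((`) h ` A) (h y) (h z)" by (intro conn_edge) (auto simp: image_iff intro!: bexI[of _ "{y, z}"])
  then show ?case using step conn_trans by metis
 qed simp
next
 assume "conn ((`) h ` A) (h x) (h y)"
 then have "EX z. h y = h z & conn A x z"
 proof (induction "h y" arbitrary: y rule: conn_induct)
  case refl
  then show ?case by (intro exI[of _ x]) simp
 next
  case (step u v)
  then obtain e where e: "e : A" "{u, h v} = h ` e" by auto
  obtain y' where "u = h y'" using e by blast
  then obtain z where z: "h y' = h z" "conn A x z" using step by blast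
  have "h ` {y', v} = h ` e" using e \<open>u = h y'\<close> by simp
  then have "e = {y', v}" using assms by (metis inj_image_eq_iff)
  then have "conn A z v" using e z injD[OF assms z(1)] by (auto intro: conn_edge)
  then show ?case using z conn_trans by metis
 qed
 then show "conn A x y" using injD[OF assms] by metis
qed

lemma clu_image:
 assumes "inj h" "\<And>e. e : A ==> e ~= {}"
 shows "clu ((`) h ` A) (h x) = h ` clu A x"
proof safe
 fix y assume "y : clu ((`) h ` A) (h x)"
 then have y: "conn ((`) h ` A) (h x) y" by simp
 have "y : range h"
  using y by (induction rule: conn_induct) (auto dest: equalityD2)
 then show "y : h ` clu A x" using y conn_image[OF assms(1)] by auto
next
 fix y assume "y : clu A x"
 then show "h y : clu ((`) h ` A) (h x)" using conn_image[OF assms(1)] by auto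
qed

lemma prb_exists_open:
 assumes "finite E" "G \<subseteq> E"
 shows "prb E p (%A. EX e:G. e : A) = 1 - (PROD e:G. 1 - p e)"
proof -
 have "prb E p (%A. EX e:G. e : A) = prb E p (%A. EX e:G. e : A Int G)"
  by (intro avg_cong) auto
 also have "... = prb G p (%A. EX e:G. e : A)"
  using avg_restrict_Int[OF assms, of p "%A. of_bool (EX e:G. e : A)"] by simp
 also have "... = 1 - (PROD e:G. 1 - p e)"
  using finite_subset[OF assms(2,1)]
 proof (induction G rule: finite_induct)
  case (insert e G)
  have "prb (insert e G) p (%A. EX e:insert e G. e : A)
    = p e * prb G p (%A. EX e':insert e G. e' : insert e A) + (1 - p e) * prb G p (%A. EX e':insert e G. e' : A)"
   using insert by (simp add: avg_insert)
  also have "prb G p (%A. EX e':insert e G. e' : insert e A) = prb G p (%A. True)"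
   by (intro avg_cong) auto
  also have "prb G p (%A. EX e':insert e G. e' : A) = prb G p (%A. EX e':G. e' : A)"
   using insert by (intro avg_cong) auto
  finally show ?case using insert by (simp add: algebra_simps)
 qed simp
 finally show ?thesis .
qed

definition crs :: "'v set => 'v set => 'v set set" where
 "crs S T = {{u, v} | u v. u : S & v : T}"

lemma crs_mono: "S \<subseteq> S' ==> T \<subseteq> T' ==> crs S T \<subseteq> crs S' T'"
 by (auto simp: crs_def)

lemma crs_image: "crs S T = (%(u, v). {u, v}) ` (S \<times> T)"
 by (auto simp: crs_def)

lemma finite_crs: "finite S ==> finite T ==> finite (crs S T)"
 by (simp add: crs_image)

lemma prb_crs_open:
 assumes "finite E" "crs S T \<subseteq> E" "finite S" "finite T" "S Int T = {}"
  and sym: "\<And>x y. w x y = w y x"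
 shows "prb E (pk w) (%A. EX u:S. EX v:T. {u, v} : A) = 1 - exp (- (SUM u:S. SUM v:T. w u v))"
proof -
 have inj: "inj_on (%(u, v). {u, v}) (S \<times> T)"
  using assms(5) by (auto simp: inj_on_def doubleton_eq_iff)
 have "prb E (pk w) (%A. EX u:S. EX v:T. {u, v} : A) = prb E (pk w) (%A. EX e:crs S T. e : A)"
  by (intro avg_cong) (auto simp: crs_def)
 also have "... = 1 - (PROD e:crs S T. 1 - pk w e)"
  using assms by (intro prb_exists_open)
 also have "(PROD e:crs S T. 1 - pk w e) = (PROD (u, v):S \<times> T. 1 - pk w {u, v})"
  unfolding crs_image by (subst prod.reindex[OF inj]) (simp add: case_prod_unfold)
 also have "... = (PROD (u, v):S \<times> T. exp (- w u v))"
 proof (intro prod.cong refl)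
  fix uv assume "uv : S \<times> T"
  then obtain u v where uv: "uv = (u, v)" "u ~= v" using assms(5) by (cases uv) blast
  show "(case uv of (u, v) => 1 - pk w {u, v}) = (case uv of (u, v) => exp (- w u v))"
   using uv pk_edge[of u v w] sym[of u v] by simp
 qed
 also have "... = exp (- (SUM u:S. SUM v:T. w u v))"
  using assms(3,4) by (simp add: exp_sum sum.cartesian_product sum_negf[symmetric] case_prod_unfold)
 finally show ?thesis .
qed

lemma of_bool_le_if: "(P ==> Q) ==> (of_bool P :: real) <= of_bool Q"
 by simp

lemma exp_lower: 
 fixes t :: real
 assumes "0 <= t"
 shows "t - t^2 / 2 <= 1 - exp (- t)"
proof -
 have "(%t. 1 - exp (- t) - t + t^2 / 2) 0 <= (%t. 1 - exp (- t) - t + t^2 / 2) t"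
 proof (rule DERIV_nonneg_imp_nondecreasing[OF assms])
  fix x :: real assume "0 <= x" "x <= t"
  have "((%t. 1 - exp (- t) - t + t^2 / 2) has_real_derivative (exp (- x) - 1 + x)) (at x)"
   by (auto intro!: derivative_eq_intros)
  moreover have "exp (- x) - 1 + x >= 0" using exp_ge_add_one_self[of "- x"] by linarith
  ultimately show "EX y. ((%t. 1 - exp (- t) - t + t^2 / 2) has_real_derivative y) (at x) & 0 <= y" by blast
 qed
 then show ?thesis by simp
qed

lemma card_Int_sum: "finite L ==> real (card (S Int L)) = (SUM y:L. of_bool (y : S))"
proof -
 assume "finite L"
 then have "(SUM y:L. of_bool (y : S)) = (SUM y:S Int L. 1 :: real)"
  by (intro sum.mono_neutral_cong_right) auto
 then show ?thesis by simp
qed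

section \<open>Percolation with a symmetric kernel and the gluing of clusters\<close>

locale sym_kernel =
 fixes w :: "'v => 'v => real"
 assumes w_sym: "w x y = w y x" and w_nonneg: "0 <= w x y"
begin

abbreviation "avw E \<equiv> avg E (pk w)"

abbreviation "prw E Q \<equiv> prb E (pk w) Q"

abbreviation "pr E x y \<equiv> prw E (%A. conn A x y)"

lemma p01: "0 <= pk w e & pk w e <= 1"
 by (rule pk_01) (rule w_nonneg)

lemma fp: "finite V ==> finite_perc V (Ed V) (pk w)"
 by unfold_locales (simp_all add: p01 Ed_card Ed_Pow)

lemma fp_sub: "finite V ==> E \<subseteq> Ed V ==> finite_perc V E (pk w)"
 using Ed_Pow[of V] by unfold_locales (auto simp: p01 Ed_card subset_iff)

lemma pE: "finite E ==> probs E (pk w)"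
 by (simp add: probs_def p01)

lemma pEd: "finite V ==> probs (Ed V) (pk w)"
 by (simp add: pE finite_Ed)

lemma pk_le: "x ~= y ==> pk w {x, y} <= w x y"
 using exp_ge_add_one_self[of "- w x y"] by (simp add: pk_edge w_sym)

lemma avg_card: "finite L ==> avw E (%A. real (card (clu A x Int L))) = (SUM y:L. pr E x y)"
 by (simp only: card_Int_sum avg_sum mem_clu)

lemma decompose:
 assumes V: "finite V" and E: "E \<subseteq> Ed V" and E1: "E1 \<subseteq> E"
 shows "pr E x y <= pr E1 x y + (SUM u:V. SUM v:V. of_bool ({u, v} : E - E1) * (pr E1 x u * w u v * pr E v y))"
proof -
 have fE: "finite E" using finite_subset[OF E finite_Ed[OF V]] .
 have fE1: "finite E1" using finite_subset[OF E1 fE] .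
 have "pr E x y <= pr E1 x y + (SUM u:V. SUM v:V. of_bool ({u, v} : E - E1) * (pr E1 x u * pk w {u, v} * pr E v y))"
  using pE[OF fE] E1 V order_trans[OF E Ed_Pow] by (intro conn_prb_decompose)
 also have "... <= pr E1 x y + (SUM u:V. SUM v:V. of_bool ({u, v} : E - E1) * (pr E1 x u * w u v * pr E v y))"
 proof (intro add_left_mono sum_mono)
  fix u v
  show "of_bool ({u, v} : E - E1) * (pr E1 x u * pk w {u, v} * pr E v y)
   <= of_bool ({u, v} : E - E1) * (pr E1 x u * w u v * pr E v y)"
  proof (cases "{u, v} : E - E1")
   case True
   then have "{u, v} : Ed V" using E by blast
   then have "u ~= v" by simp
   then show ?thesis
    by (intro mult_left_mono mult_right_mono pk_le prb_nonneg pE fE fE1) auto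
  next
   case False
   then have "of_bool ({u, v} : E - E1) = (0 :: real)" by simp
   then show ?thesis by (simp only: mult_zero_left order.refl)
  qed
 qed
 finally show ?thesis .
qed

text \<open>Edges inside \<open>S\<close>, inside \<open>T\<close> and between them are independent,
  and one open edge between the two clusters suffices. The set \<open>L\<close> localizes the part
  of \<open>T\<close> where the kernel is bounded below.\<close>

lemma glue:
 assumes S: "finite S" "finite T" "S Int T = {}" and L: "L \<subseteq> T"
  and k: "\<And>u v. u : S ==> v : L ==> k <= w u v" and x: "x : S"
 shows "avw (Ed S) (%A. avw (Ed T) (%B.
   1 - exp (- k * csz A x * real (card (clu B y Int L))))) <= pr (Ed (S Un T)) x y"
proof -
 have fin: "finite (Ed S)" "finite (Ed T)" "finite (crs S T)"
  using S by (simp_all add: finite_Ed finite_crs)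
 have sub: "Ed S Un (Ed T Un crs S T) \<subseteq> Ed (S Un T)"
 proof -
  have "crs S T \<subseteq> Ed (S Un T)" using S(3) by (auto simp: crs_def)
  then show ?thesis using Ed_mono[of S "S Un T"] Ed_mono[of T "S Un T"] by blast
 qed
 have disj: "Ed S Int (Ed T Un crs S T) = {}" "Ed T Int crs S T = {}"
  using S(3) by (auto simp: Ed_def crs_def doubleton_eq_iff)
 have "avw (Ed S) (%A. avw (Ed T) (%B.
   1 - exp (- k * csz A x * real (card (clu B y Int L)))))
  <= avw (Ed S) (%A. avw (Ed T) (%B.
   prw (crs S T) (%C. EX u:clu A x. EX v:clu B y Int L. {u, v} : C)))"
 proof (intro avg_mono pE fin)
  fix A B assume AB: "A \<subseteq> Ed S" "B \<subseteq> Ed T"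
  have A: "clu A x \<subseteq> S" using AB x Ed_Pow by (intro clu_subset) blast+
  have fA: "finite (clu A x)" "finite (clu B y Int L)" using A L S finite_subset[of L T] finite_subset by auto
  have "prw (crs S T) (%C. EX u:clu A x. EX v:clu B y Int L. {u, v} : C)
    = 1 - exp (- (SUM u:clu A x. SUM v:clu B y Int L. w u v))"
   using A L S(3) fA by (intro prb_crs_open fin crs_mono w_sym) auto
  moreover have "(SUM u:clu A x. SUM v:clu B y Int L. k) <= (SUM u:clu A x. SUM v:clu B y Int L. w u v)"
   using A by (intro sum_mono k) auto
  ultimately show "1 - exp (- k * csz A x * real (card (clu B y Int L)))
    <= prw (crs S T) (%C. EX u:clu A x. EX v:clu B y Int L. {u, v} : C)"
   by (simp add: mult_ac)
 qed
 also have "... <= avw (Ed S) (%A. avw (Ed T) (%B. prw (crs S T) (%C. conn (A Un (B Un C)) x y)))"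
 proof (intro avg_mono pE fin of_bool_le_if)
  fix A B C assume "EX u:clu A x. EX v:clu B y Int L. {u, v} : C"
  then obtain u v where "conn A x u" "conn B v y" "{u, v} : C" using conn_commute[of B y] by auto
  then have "conn (A Un (B Un C)) x u" "conn (A Un (B Un C)) u v" "conn (A Un (B Un C)) v y"
   by (auto intro: conn_edge elim: conn_mono)
  then show "conn (A Un (B Un C)) x y" by (meson conn_trans)
 qed
 also have "... = pr (Ed S Un (Ed T Un crs S T)) x y"
  using fin disj by (simp add: avg_union)
 also have "... <= pr (Ed (S Un T)) x y"
  using S by (intro prb_conn_mono sub pEd) auto
 finally show ?thesis .
qed

text \<open>Second-order expansion of \<open>1 - exp (- t)\<close>: the condition
  \<open>k * (M1 * M2) <= 1\<close> makes the quadratic term at most half of the linear one.\<close>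

lemma glue_moments:
 assumes S: "finite S" "finite T" "S Int T = {}" and x: "x : S" and y: "y : T"
  and k: "\<And>u v. u : S ==> v : T ==> k <= w u v" and k0: "0 <= k"
  and m1: "avw (Ed S) (%A. csz A x ^ 2) <= M1 * avw (Ed S) (%A. csz A x)"
  and m2: "avw (Ed T) (%A. csz A y ^ 2) <= M2 * avw (Ed T) (%A. csz A y)"
  and kM: "k * (M1 * M2) <= 1"
 shows "k / 2 * avw (Ed S) (%A. csz A x) * avw (Ed T) (%A. csz A y)
   <= pr (Ed (S Un T)) x y"
proof -
 let ?X = "%A. csz A x" and ?Y = "%B. csz B y"
 let ?a = "avw (Ed S)" and ?b = "avw (Ed T)"
 have pos: "0 <= ?a ?X" "0 <= ?b ?Y" "0 <= ?a (%A. (?X A)^2)" "0 <= ?b (%A. (?Y A)^2)"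
  using S by (auto intro!: avg_nonneg pEd)
 have "k * ?a (%A. (?X A)^2) * ?b (%A. (?Y A)^2) <= k * ((M1 * ?a ?X) * (M2 * ?b ?Y))"
  unfolding mult.assoc[of k]
  by (intro mult_left_mono[OF mult_mono[OF m1 m2 order_trans[OF pos(3) m1] pos(4)] k0])
 also have "... = (k * (M1 * M2)) * (?a ?X * ?b ?Y)" by simp
 also have "... <= 1 * (?a ?X * ?b ?Y)"
  using kM pos by (intro mult_right_mono) auto
 finally have q: "k * ?a (%A. (?X A)^2) * ?b (%A. (?Y A)^2) <= ?a ?X * ?b ?Y" by simp
 have "k * (?a ?X * ?b ?Y) - k / 2 * (k * ?a (%A. (?X A)^2) * ?b (%A. (?Y A)^2))
   = ?a (%A. ?b (%B. k * (?X A * ?Y B) - k / 2 * (k * ((?X A)^2 * (?Y B)^2))))"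
  by (simp only: avg_diff avg_cmult avg_cmult_right mult.assoc)
 also have "... <= ?a (%A. ?b (%B. 1 - exp (- k * csz A x * real (card (clu B y Int T)))))"
 proof (intro avg_mono pEd S)
  fix A B assume "A \<subseteq> Ed S" "B \<subseteq> Ed T"
  then have "clu B y Int T = clu B y"
   using y Ed_Pow[of T] clu_subset[of B T y] by blast
  moreover have "0 <= k * (?X A * ?Y B)" using k0 by simp
  from exp_lower[OF this] have "k * (?X A * ?Y B) - (k * (?X A * ?Y B))^2 / 2 <= 1 - exp (- (k * (?X A * ?Y B)))" .
  ultimately show "k * (?X A * ?Y B) - k / 2 * (k * ((?X A)^2 * (?Y B)^2))
    <= 1 - exp (- k * csz A x * real (card (clu B y Int T)))"
   by (simp add: power2_eq_square mult_ac)
 qed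
 also have "... <= pr (Ed (S Un T)) x y"
  using S x k by (intro glue) auto
 finally have "k * (?a ?X * ?b ?Y) - k / 2 * (k * ?a (%A. (?X A)^2) * ?b (%A. (?Y A)^2)) <= pr (Ed (S Un T)) x y" .
 moreover have "k / 2 * (k * ?a (%A. (?X A)^2) * ?b (%A. (?Y A)^2)) <= k / 2 * (?a ?X * ?b ?Y)"
  using q k0 by (intro mult_left_mono) auto
 ultimately show ?thesis by (simp add: mult.assoc)
qed

end

section \<open>Translation-invariant kernels with polynomial decay\<close>

locale kern = sym_kernel w for w :: "int ^ 'd => int ^ 'd => real" +
 fixes a c0 C0 :: real
 assumes a0: "0 < a" and a1: "a < 1" and c0: "0 < c0" and C0: "0 < C0"
  and w_shift: "w (x + z) (y + z) = w x y"
  and w_lower: "x ~= y ==> c0 * real (sd x y) powr (- (real CARD('d) + a)) <= w x y"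
  and w_upper: "x ~= y ==> w x y <= C0 * real (sd x y) powr (- (real CARD('d) + a))"
begin

definition D :: real where "D = real CARD('d)"

lemma D1: "1 <= D"
 by (simp add: D_def Suc_le_eq)

lemma aD: "a < D"
 using a1 D1 by linarith

lemmas wl = w_lower[folded D_def] and wu = w_upper[folded D_def]

definition Kd :: real where "Kd = D * 2 * 3 ^ (CARD('d) - 1)"

lemma Kd_pos: "0 < Kd"
 using D1 by (simp add: Kd_def)

lemma powr_D: "k > 0 ==> real k ^ (CARD('d) - 1) = k ^r (D - 1)"
 by (simp add: D_def of_nat_diff Suc_le_eq flip: powr_realpow)

lemma powr_Dn: "x > 0 ==> x ^ CARD('d) = x powr D"
 by (simp add: D_def powr_realpow)

text \<open>The edges of length \<open>k\<close> at a vertex have total weight of order k^(-1-a), so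
  the first moment of the length truncated at \<open>R\<close> grows like R^(1-a). The smallness of
  boundary effects rests on this use of a < 1.\<close>

lemma sum_w_sd:
 assumes T: "finite T" "\<And>v. v : T ==> v ~= u & sd u v <= R"
 shows "(SUM v:T. w u v * real (sd u v)) <= C0 * Kd / (1 - a) * R ^r (1 - a)"
proof -
 have "(SUM v:T. w u v * real (sd u v)) <= (SUM v:T. C0 * real (sd u v) powr (- (D + a)) * real (sd u v))"
  using T by (intro sum_mono mult_right_mono wu) auto
 also have "... <= Kd * (SUM k:{0<..R}. real k ^ (CARD('d) - 1) * (C0 * k ^r (- (D + a)) * real k))"
  unfolding Kd_def D_def
  by (rule sum_radial_le[of T 0 u R "%k. C0 * k ^r (- (real CARD('d) + a)) * real k"])
   (use T sd_pos[of u] C0 in force)+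
 also have "(SUM k:{0<..R}. real k ^ (CARD('d) - 1) * (C0 * k ^r (- (D + a)) * real k))
   = (SUM k:{0<..R}. C0 * k ^r (- a))"
 proof (rule sum.cong)
  fix k assume "k : {0<..R}"
  then have "real k ^ (CARD('d) - 1) * (C0 * k ^r (- (D + a)) * real k)
    = C0 * (k ^r (D - 1) * k ^r (- (D + a)) * k ^r 1)"
   using powr_D[of k] by simp
  also have "... = C0 * k ^r (- a)"
   by (simp only: flip: powr_add) simp
  finally show "real k ^ (CARD('d) - 1) * (C0 * k ^r (- (D + a)) * real k) = C0 * k ^r (- a)" .
 qed simp
 also have "... = C0 * (SUM k:{0<..R}. k ^r (- a))" by (simp add: sum_distrib_left)
 also have "Kd * ... <= Kd * (C0 * (R ^r (1 - a) / (1 - a)))"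
  using Kd_pos C0 a0 a1 by (intro mult_left_mono sum_powr_upper) auto
 finally show ?thesis by (simp add: field_simps)
qed

definition K2 :: real where "K2 = C0 * Kd * ((1 + 1 / a) * 2 powr a)"

lemma K2_pos: "0 < K2"
 unfolding K2_def using C0 Kd_pos a0 by (intro mult_pos_pos add_pos_pos) auto

lemma sum_w_far:
 assumes T: "finite T" "\<And>v. v : T ==> R < sd u v"
 shows "(SUM v:T. w u v) <= K2 * real (R + 1) powr (- a)"
proof -
 define n where "n = Max (insert 0 (sd u ` T))"
 have n: "sd u v <= n" if "v : T" for v unfolding n_def using T that by (intro Max_ge) auto
 have "(SUM v:T. w u v) <= (SUM v:T. C0 * real (sd u v) powr (- (D + a)))"
  using T by (intro sum_mono wu) force
 also have "... <= Kd * (SUM k:{R<..n}. real k ^ (CARD('d) - 1) * (C0 * k ^r (- (D + a))))"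
  unfolding Kd_def D_def
  by (rule sum_radial_le[of T R u n "%k. C0 * k ^r (- (real CARD('d) + a))"])
   (use T C0 n in auto)
 also have "(SUM k:{R<..n}. real k ^ (CARD('d) - 1) * (C0 * k ^r (- (D + a))))
   = (SUM k:{R<..n}. C0 * k ^r (- 1 - a))"
 proof (rule sum.cong)
  fix k assume "k : {R<..n}"
  then have "real k ^ (CARD('d) - 1) * (C0 * k ^r (- (D + a)))
    = C0 * (k ^r (D - 1) * k ^r (- (D + a)))"
   using powr_D[of k] by simp
  also have "... = C0 * k ^r (- 1 - a)"
   by (simp only: flip: powr_add) simp
  finally show "real k ^ (CARD('d) - 1) * (C0 * k ^r (- (D + a))) = C0 * k ^r (- 1 - a)" .
 qed simp
 also have "... = C0 * (SUM k:{R<..n}. k ^r (- 1 - a))" by (simp add: sum_distrib_left)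
 also have "Kd * ... <= Kd * (C0 * ((1 + 1 / a) * 2 powr a * real (R + 1) powr (- a)))"
  using Kd_pos C0 a0 by (intro mult_left_mono sum_powr_tail) auto
 finally show ?thesis by (simp add: K2_def mult_ac)
qed

lemma inj_shift: "inj (%x :: int ^ 'd. x + z)"
 by (simp add: inj_def)

lemma pk_shift:
 shows "pk w ((%x. x + z) ` e) = pk w e"
proof -
 have "(%x. x + z) ` e - {x + z} = (%x. x + z) ` (e - {x})" for x by auto
 then have "(SUM x:(%x. x + z) ` e. SUM y:(%x. x + z) ` e - {x}. w x y)
  = (SUM x:e. SUM y:e - {x}. w (x + z) (y + z))"
  by (simp add: sum.reindex inj_on_def)
 then show ?thesis by (simp add: pk_def w_shift)
qed

lemma avg_shift:
 assumes "\<And>A. A \<subseteq> E ==> g ((`) ((`) (%x. x + z)) A) = f A"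
 shows "avw ((`) ((`) (%x. x + z)) E) g = avw E f"
proof -
 have inj: "inj_on ((`) (%x. x + z)) E" by (auto simp: inj_on_def inj_image_eq_iff)
 have "avw ((`) ((`) (%x. x + z)) E) g = avw E (%A. g ((`) ((`) (%x. x + z)) A))"
  by (subst avg_image[OF inj]) (simp add: pk_shift)
 also have "... = avw E f" by (intro avg_cong assms)
 finally show ?thesis .
qed

lemma Ed_shift: "Ed ((%x. x + z) ` V) = (`) ((`) (%x. x + z)) (Ed V)" for z :: "int ^ 'd"
proof (intro set_eqI iffI)
 fix e assume "e : Ed ((%x. x + z) ` V)"
 then obtain x y where xy: "x : V" "y : V" "x ~= y" "e = {x + z, y + z}"
  by (elim Ed_cases) blast
 then have "{x, y} : Ed V" "e = (%x. x + z) ` {x, y}" by simp_all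
 then show "e : (`) ((`) (%x. x + z)) (Ed V)" by (rule rev_image_eqI)
next
 fix e assume "e : (`) ((`) (%x. x + z)) (Ed V)"
 then obtain e' where e': "e' : Ed V" "e = (%x. x + z) ` e'" by (rule imageE) simp
 from e'(1) show "e : Ed ((%x. x + z) ` V)"
  by (elim Ed_cases) (simp add: e'(2))
qed

lemma EdR_shift: "EdR ((%x. x + z) ` V) R = (`) ((`) (%x. x + z)) (EdR V R)" for z :: "int ^ 'd"
proof (intro set_eqI iffI)
 fix e assume "e : EdR ((%x. x + z) ` V) R"
 then obtain x y where xy: "x : V" "y : V" "x ~= y" "sd (x + z) (y + z) <= R" "e = {x + z, y + z}"
  unfolding EdR_def by blast
 then have "{x, y} : EdR V R" "e = (%x. x + z) ` {x, y}" by simp_all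
 then show "e : (`) ((`) (%x. x + z)) (EdR V R)" by (rule rev_image_eqI)
next
 fix e assume "e : (`) ((`) (%x. x + z)) (EdR V R)"
 then obtain x y where xy: "x : V" "y : V" "x ~= y" "sd x y <= R" "e = (%x. x + z) ` {x, y}"
  unfolding EdR_def by blast
 then show "e : EdR ((%x. x + z) ` V) R" by simp
qed

lemma conn_shift: "conn ((`) ((`) (%x. x + z)) A) (x + z) (y + z) \<longleftrightarrow> conn A x y" for z :: "int ^ 'd"
 using conn_image[OF inj_shift[of z], of A x y] .

lemma card_clu_shift:
 fixes z :: "int ^ 'd"
 assumes "\<And>e. e : A ==> e ~= {}"
 shows "card (clu ((`) ((`) (%x. x + z)) A) (x + z) Int (%x. x + z) ` L) = card (clu A x Int L)"
proof -
 have "clu ((`) ((`) (%x. x + z)) A) (x + z) Int (%x. x + z) ` L = (%x. x + z) ` (clu A x Int L)"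
  using clu_image[OF inj_shift[of z], of A x] assms image_Int[OF inj_shift[of z]] by metis
 then show ?thesis by (simp add: card_image)
qed

lemma pr_shift: "pr (Ed ((%x. x + z) ` V)) (x + z) (y + z) = pr (Ed V) x y"
 unfolding Ed_shift by (rule avg_shift) (simp add: conn_shift)

end

section \<open>Renormalization\<close>

text \<open>Half-open cubes of side \<open>L\<close> tile the lattice, and a cube of side
  \<open>K * L\<close> is tiled by those of side \<open>L\<close>, which centred boxes do not
  offer.\<close>

definition cube :: "nat => int ^ 'd => (int ^ 'd) set" where
 "cube L z = {y. ALL i. y $ i div int L = z $ i}"

lemma cube_eq:
 assumes "L >= 1"
 shows "cube L z = {y. ALL i. y $ i : {int L * z $ i..<int L * z $ i + int L}}"
proof -
 have "k div int L = j \<longleftrightarrow> k : {int L * j..<int L * j + int L}" for k j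
 proof
  assume j: "k div int L = j"
  have "int L * (k div int L) + k mod int L = k" "0 <= k mod int L" "k mod int L < int L"
   using assms by simp_all
  then show "k : {int L * j..<int L * j + int L}"
   unfolding j atLeastLessThan_iff by linarith
 next
  assume "k : {int L * j..<int L * j + int L}"
  then show "k div int L = j"
   using assms by (intro div_pos_geq[THEN trans] int_div_pos_eq[of _ _ _ "k - int L * j"]) auto
 qed
 then show ?thesis by (simp add: cube_def)
qed

lemma finite_cube: "L >= 1 ==> finite (cube L z)"
 unfolding cube_eq by (rule vec_box[THEN conjunct1]) simp

lemma card_cube: "L >= 1 ==> card (cube L (z :: int ^ 'd)) = L ^ CARD('d)"
 unfolding cube_eq by (subst vec_box[THEN conjunct2]) (simp_all add: prod_constant)

lemma cube_sd:
 assumes "L >= 1" "x : cube L z" "y : cube L z"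
 shows "sd x y <= L"
 unfolding sd_le_iff
proof
 fix i
 show "\<bar>x $ i - y $ i\<bar> <= int L"
  using assms(2,3) unfolding cube_eq[OF assms(1)] by (auto dest!: spec[of _ i])
qed

lemma cube_disjoint: "z ~= z' ==> cube L z Int cube L z' = {}"
 by (auto simp: cube_def vec_eq_iff)

lemma cube_mult:
 assumes "K >= 1" "L >= 1"
 shows "y : cube (K * L) z \<longleftrightarrow> (\<chi> i. y $ i div int L) : cube K z"
proof -
 have "k div int (K * L) = k div int L div int K" for k
  using zdiv_zmult2_eq[of "int K" k "int L"] by (simp add: mult.commute)
 then show ?thesis by (simp add: cube_def)
qed

lemma subcube:
 assumes "K >= 1" "L >= 1" "z' : cube K z"
 shows "cube L z' \<subseteq> cube (K * L) z"
proof
 fix y assume "y : cube L z'"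
 then have "(\<chi> i. y $ i div int L) = z'" by (simp add: cube_def vec_eq_iff)
 then show "y : cube (K * L) z" using assms by (simp add: cube_mult)
qed

lemma cube_shift:
 assumes "L >= 1"
 shows "cube L z = (%x. x + (\<chi> i. int L * z $ i)) ` cube L 0"
proof (intro set_eqI iffI)
 fix y assume "y : cube L z"
 then have "y - (\<chi> i. int L * z $ i) : cube L 0"
  using assms by (auto simp: cube_eq algebra_simps)
 then show "y : (%x. x + (\<chi> i. int L * z $ i)) ` cube L 0" by (rule rev_image_eqI) simp
next
 fix y assume "y : (%x. x + (\<chi> i. int L * z $ i)) ` cube L 0"
 then show "y : cube L z" using assms by (auto simp: cube_eq)
qed

text \<open>The ratio of successive sides grows geometrically, so that the losses of density over
  all levels form a convergent product.\<close>

primrec blk :: "nat => nat => nat => nat" where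
 "blk K0 L 0 = L"
| "blk K0 L (Suc n) = K0 * 2 ^ n * blk K0 L n"

text \<open>One subcube per level may fail, hence the \<open>- 1\<close>.\<close>

primrec sz :: "nat => nat => nat => nat => nat" where
 "sz d K0 m 0 = m"
| "sz d K0 m (Suc n) = ((K0 * 2 ^ n) ^ d - 1) * sz d K0 m n"

context kern
begin

definition big :: "nat => int ^ 'd => nat => (int ^ 'd) set set => bool" where
 "big L z m A \<longleftrightarrow> (EX v. m <= card (clu A v Int cube L z))"

definition fail :: "nat => nat => real" where
 "fail L m = prw (Ed (cube L 0)) (%A. ~ big L 0 m A)"

lemma fail_shift:
 assumes "L >= 1"
 shows "prw (Ed (cube L z)) (%A. ~ big L z m A) = fail L m"
 unfolding fail_def cube_shift[OF assms, of z] Ed_shift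
proof (rule avg_shift)
 let ?z = "\<chi> i. int L * z $ i"
 have ex_shift: "(EX v. P v) \<longleftrightarrow> (EX v. P (v + ?z))" for P by (metis diff_add_cancel)
 fix A assume A: "A \<subseteq> Ed (cube L (0 :: int ^ 'd))"
 have ne: "e ~= {}" if "e : A" for e using A that Ed_card[of e] by fastforce
 have "(EX v. m <= card (clu ((`) ((`) (%x. x + ?z)) A) v Int cube L z)) \<longleftrightarrow>
   (EX v. m <= card (clu ((`) ((`) (%x. x + ?z)) A) (v + ?z) Int cube L z))"
  by (rule ex_shift)
 also have "... \<longleftrightarrow> (EX v. m <= card (clu A v Int cube L 0))"
  using card_clu_shift[OF ne, where z = ?z and L = "cube L 0"] by (simp add: cube_shift[OF assms, of z])
 finally show "of_bool (~ big L z m ((`) ((`) (%x. x + ?z)) A)) = (of_bool (~ big L 0 m A) :: real)"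
  by (simp add: big_def)
qed

text \<open>If at most one subcube lacks a large cluster and the chosen clusters of any two other
  subcubes are joined by an edge, their union is large enough. Otherwise two subcubes fail, or some
  pair of chosen clusters is not joined; there are at most \<open>K ^ (2 * CARD('d))\<close>
  pairs.\<close>

lemma renorm_step:
 assumes K: "K >= 2" and L: "L >= 1" and m: "m >= 1"
 shows "fail (K * L) ((K ^ CARD('d) - 1) * m) <= real K ^ (2 * CARD('d)) * (fail L m)^2
  + real K ^ (2 * CARD('d)) * exp (- (c0 * (real m)^2 * real (K * L) powr (- (D + a))))"
proof -
 have K1: "K >= 1" and KL: "K * L >= 1" using K L by auto
 define Z where "Z = cube K (0 :: int ^ 'd)"
 have fZ: "finite Z" and cZ: "card Z = K ^ CARD('d)"
  using K1 by (simp_all add: Z_def finite_cube card_cube)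
 let ?Q = "%z. cube L z :: (int ^ 'd) set"
 let ?V = "cube (K * L) (0 :: int ^ 'd)"
 have QV: "?Q z \<subseteq> ?V" if "z : Z" for z using subcube[OF K1 L] that by (simp add: Z_def)
 have fQ: "finite (?Q z)" for z by (rule finite_cube[OF L])
 have fV: "finite ?V" by (rule finite_cube[OF KL])
 define E where "E = Ed ?V"
 define E1 where "E1 = (UN z:Z. Ed (?Q z))"
 define E2 where "E2 = E - E1"
 have E1E: "E1 \<subseteq> E" using Ed_mono[OF QV] by (auto simp: E1_def E_def)
 have fE: "finite E" "finite E1" "finite E2"
  using finite_Ed[OF fV] E1E finite_subset by (auto simp: E_def E2_def)
 have un: "E1 Un E2 = E" "E1 Int E2 = {}" using E1E by (auto simp: E2_def)
 have edq: "Ed (?Q z) \<subseteq> E1" if "z : Z" for z using that by (auto simp: E1_def)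
 have A12: "(A Un B) Int Ed (?Q z) = A Int Ed (?Q z)" if "B \<subseteq> E2" "z : Z" for A B z
  using that edq[of z] by (auto simp: E2_def)
 have crsE2: "crs (?Q z) (?Q z') \<subseteq> E2" if z: "z : Z" "z' : Z" "z ~= z'" for z z'
 proof
  fix e assume "e : crs (?Q z) (?Q z')"
  then obtain u v where uv: "e = {u, v}" "u : ?Q z" "v : ?Q z'" by (auto simp: crs_def)
  have "u ~= v" using uv z cube_disjoint[of z z' L] by auto
  then have "e : E" using uv z QV by (auto simp: E_def)
  moreover have "e \<notin> Ed (?Q y)" for y
  proof
   assume "e : Ed (?Q y)"
   then have "u : ?Q y" "v : ?Q y" using uv by auto
   then have "z = y" "z' = y" using uv cube_disjoint[of z y L] cube_disjoint[of z' y L] by blast+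
   then show False using z by simp
  qed
  ultimately show "e : E2" by (auto simp: E2_def E1_def)
 qed
 define good where "good = (%A z. big L z m (A Int Ed (?Q z)))"
 \<comment> \<open>The choice looks only at edges inside the subcube, so the linking edges in
   \<open>E2\<close> remain independent of it.\<close>
 define ch where "ch = (%A z. SOME v. m <= card (clu (A Int Ed (?Q z)) v Int ?Q z))"
 define CL where "CL = (%A z. clu (A Int Ed (?Q z)) (ch A z) Int ?Q z)"
 have CLm: "m <= card (CL A z)" if "good A z" for A z
  using someI_ex[of "%v. m <= card (clu (A Int Ed (?Q z)) v Int ?Q z)"] that
  by (simp add: CL_def ch_def good_def big_def)
 have fCL: "finite (CL A z)" for A z using fQ by (simp add: CL_def)
 have CL12: "CL (A Un B) z = CL A z" "good (A Un B) z = good A z" if "B \<subseteq> E2" "z : Z" for A B z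
  using A12[OF that] by (simp_all add: CL_def ch_def good_def)
 define P where "P = {(z, z'). z : Z & z' : Z & z ~= z'}"
 have fP: "finite P" "card P <= K ^ (2 * CARD('d))"
 proof -
  have "P \<subseteq> Z \<times> Z" by (auto simp: P_def)
  then show "finite P" "card P <= K ^ (2 * CARD('d))"
   using fZ card_mono[of "Z \<times> Z" P] finite_subset[of P "Z \<times> Z"]
   by (auto simp: card_cartesian_product cZ power_add mult_2)
 qed
 define noedge where "noedge = (%A B (z, z'). good A z & good A z' & ~ (EX u:CL A z. EX v:CL A z'. {u, v} : B))"
 define bad2 where "bad2 = (%A (z, z'). ~ good A z & ~ good A z')"
 have key: "~ big (K * L) 0 ((K ^ CARD('d) - 1) * m) (A Un B) ==>
   (EX i:P. bad2 A i) \<or> (EX i:P. noedge A B i)" if AB: "A \<subseteq> E1" "B \<subseteq> E2" for A B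
 proof (rule ccontr)
  assume nb: "~ big (K * L) 0 ((K ^ CARD('d) - 1) * m) (A Un B)"
   and "~ ((EX i:P. bad2 A i) \<or> (EX i:P. noedge A B i))"
  then have n1: "\<And>z z'. z : Z ==> z' : Z ==> z ~= z' ==> good A z \<or> good A z'"
   and n2: "\<And>z z'. z : Z ==> z' : Z ==> z ~= z' ==> good A z ==> good A z' ==>
     EX u:CL A z. EX v:CL A z'. {u, v} : B"
   by (auto simp: P_def bad2_def noedge_def)
  define G where "G = {z : Z. good A z}"
  have "card (Z - G) <= 1"
   unfolding card_le_Suc0_iff_eq[OF finite_Diff[OF fZ], unfolded One_nat_def[symmetric]]
   using n1 by (auto simp: G_def)
  moreover have "card (Z - G) = card Z - card G" using fZ by (intro card_Diff_subset) (auto simp: G_def intro: finite_subset)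
  ultimately have cG: "K ^ CARD('d) - 1 <= card G" using cZ by linarith
  have "(2::nat) ^ 1 <= 2 ^ CARD('d)" by (intro power_increasing) (auto simp: Suc_le_eq)
  also have "... <= K ^ CARD('d)" using K by (intro power_mono) auto
  finally have "1 <= card G" using cG by simp
  then obtain z0 where z0: "z0 : G" by (metis card.empty ex_in_conv not_one_le_zero)
  let ?v = "ch A z0"
  have sub: "CL A z \<subseteq> clu (A Un B) ?v Int ?V" if z: "z : G" for z
  proof
   fix y assume y: "y : CL A z"
   have in_clu: "conn (A Un B) (ch A z) y" if "y : CL A z" for y z
    using that by (auto simp: CL_def elim!: conn_mono)
   have "conn (A Un B) ?v (ch A z)"
   proof (cases "z = z0")
    case False
    then obtain u v where "u : CL A z0" "v : CL A z" "{u, v} : B"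
     using n2[of z0 z] z z0 by (auto simp: G_def)
    then have "conn (A Un B) ?v u" "conn (A Un B) u v" "conn (A Un B) v (ch A z)"
     using in_clu[of u z0] conn_sym[OF in_clu[of v z]] by (auto intro: conn_edge)
    then show ?thesis by (meson conn_trans)
   qed simp
   then have "conn (A Un B) ?v y" using in_clu[OF y] conn_trans by metis
   then show "y : clu (A Un B) ?v Int ?V" using y QV z by (auto simp: CL_def G_def)
  qed
  have disj: "CL A z Int CL A z' = {}" if "z ~= z'" for z z'
   using cube_disjoint[OF that, of L] by (auto simp: CL_def)
  have fG: "finite G" using fZ by (auto simp: G_def)
  have "(K ^ CARD('d) - 1) * m <= card G * m" using cG by simp
  also have "... = (SUM z:G. m)" by simp
  also have "... <= (SUM z:G. card (CL A z))" by (intro sum_mono CLm) (auto simp: G_def)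
  also have "... = card (UN z:G. CL A z)"
   using fG fCL disj by (subst card_UN_disjoint) auto
  also have "... <= card (clu (A Un B) ?v Int ?V)"
   using fV sub by (intro card_mono) auto
  finally show False using nb by (auto simp: big_def)
 qed
 have bad: "prw E1 (%A. bad2 A i) = (fail L m)^2" if i: "i : P" for i
 proof -
  obtain z z' where z: "i = (z, z')" "z : Z" "z' : Z" "z ~= z'" using i by (auto simp: P_def)
  have d: "Ed (?Q z) Int Ed (?Q z') = {}"
   using cube_disjoint[OF z(4), of L] by (auto simp: Ed_def doubleton_eq_iff)
  have "prw E1 (%A. bad2 A i) = avw E1 (%A.
    of_bool (~ big L z m (A Int Ed (?Q z))) * of_bool (~ big L z' m (A Int Ed (?Q z'))))"
   by (intro avg_cong) (auto simp: bad2_def z good_def)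
  also have "... = fail L m * fail L m"
   using avg_indep[OF fE(2) edq[OF z(2)] edq[OF z(3)] d, of "pk w"
     "%A. of_bool (~ big L z m A)" "%A. of_bool (~ big L z' m A)"]
   by (simp only: fail_shift[OF L])
  finally show ?thesis by (simp add: power2_eq_square)
 qed
 let ?x = "exp (- (c0 * (real m)^2 * real (K * L) powr (- (D + a))))"
 have ne: "prw E2 (%B. noedge A B i) <= ?x" if A: "A \<subseteq> E1" and i: "i : P" for A i
 proof -
  obtain z z' where z: "i = (z, z')" "z : Z" "z' : Z" "z ~= z'" using i by (auto simp: P_def)
  show ?thesis
  proof (cases "good A z & good A z'")
   case True
   have CQ: "CL A z \<subseteq> ?Q z" "CL A z' \<subseteq> ?Q z'" by (auto simp: CL_def)
   have "prw E2 (%B. noedge A B i) = prw E2 (%B. ~ (EX u:CL A z. EX v:CL A z'. {u, v} : B))"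
    using True by (intro avg_cong) (auto simp: noedge_def z)
   also have "... = 1 - prw E2 (%B. EX u:CL A z. EX v:CL A z'. {u, v} : B)"
    by (intro prb_compl pE fE)
   also have "prw E2 (%B. EX u:CL A z. EX v:CL A z'. {u, v} : B)
     = 1 - exp (- (SUM u:CL A z. SUM v:CL A z'. w u v))"
    using crs_mono[OF CQ] crsE2[OF z(2-4)] CQ cube_disjoint[OF z(4), of L]
    by (intro prb_crs_open fE fCL w_sym) blast+
   also have "1 - (1 - exp (- (SUM u:CL A z. SUM v:CL A z'. w u v))) <= ?x"
   proof -
    have "(SUM u:CL A z. SUM v:CL A z'. c0 * real (K * L) powr (- (D + a))) <= (SUM u:CL A z. SUM v:CL A z'. w u v)"
    proof (intro sum_mono)
     fix u v assume "u : CL A z" "v : CL A z'"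
     then have uv: "u : ?Q z" "v : ?Q z'" using CQ by auto
     then have "u ~= v" using cube_disjoint[OF z(4), of L] by auto
     have "sd u v <= K * L" using uv QV z by (intro cube_sd[OF KL, of _ 0]) auto
     then have "real (K * L) powr (- (D + a)) <= real (sd u v) powr (- (D + a))"
      using \<open>u ~= v\<close> sd_pos[of u v] D1 a0 by (intro powr_mono2' of_nat_mono) auto
     then have "c0 * real (K * L) powr (- (D + a)) <= c0 * real (sd u v) powr (- (D + a))"
      using c0 by (intro mult_left_mono) auto
     also have "... <= w u v" by (rule wl[OF \<open>u ~= v\<close>])
     finally show "c0 * real (K * L) powr (- (D + a)) <= w u v" .
    qed
    moreover have "(real m)^2 * (c0 * real (K * L) powr (- (D + a)))
      <= (real (card (CL A z)) * real (card (CL A z'))) * (c0 * real (K * L) powr (- (D + a)))"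
     unfolding power2_eq_square using CLm True c0 by (intro mult_right_mono mult_mono) auto
    ultimately show ?thesis by (simp add: mult_ac)
   qed
   finally show ?thesis .
  next
   case False
   then have "prw E2 (%B. noedge A B i) = avw E2 (%B. 0)"
    by (intro avg_cong) (auto simp: noedge_def z)
   then show ?thesis by simp
  qed
 qed
 have "fail (K * L) ((K ^ CARD('d) - 1) * m)
   = avw E1 (%A. prw E2 (%B. ~ big (K * L) 0 ((K ^ CARD('d) - 1) * m) (A Un B)))"
  unfolding fail_def E_def[symmetric] using avg_union[OF fE(2,3) un(2), of "pk w"] un(1) by simp
 also have "... <= avw E1 (%A. avw E2 (%B. (SUM i:P. of_bool (bad2 A i)) + (SUM i:P. of_bool (noedge A B i))))"
 proof (intro avg_mono pE fE)
  fix A B assume AB: "A \<subseteq> E1" "B \<subseteq> E2"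
  have 1: "(1::real) <= (SUM i:P. of_bool (R i))" if ex: "EX i:P. R i" for R
  proof -
   obtain i where "i : P" "R i" using ex by blast
   then show ?thesis using member_le_sum[of i P "%i. of_bool (R i) :: real"] fP by simp
  qed
  have 0: "(0::real) <= (SUM i:P. of_bool (R i))" for R by (intro sum_nonneg) auto
  show "of_bool (~ big (K * L) 0 ((K ^ CARD('d) - 1) * m) (A Un B))
   <= (SUM i:P. of_bool (bad2 A i)) + (SUM i:P. of_bool (noedge A B i) :: real)"
  proof (cases "big (K * L) 0 ((K ^ CARD('d) - 1) * m) (A Un B)")
   case False
   then show ?thesis using key[OF AB] 1[of "bad2 A"] 1[of "noedge A B"] 0[of "bad2 A"] 0[of "noedge A B"] by fastforce
  qed (simp add: 0)
 qed
 also have "... = (SUM i:P. prw E1 (%A. bad2 A i)) + (SUM i:P. avw E1 (%A. prw E2 (%B. noedge A B i)))"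
  using fE by (simp add: avg_add avg_sum)
 also have "... <= (SUM i:P. (fail L m)^2) + (SUM i:P. avw E1 (%A. ?x))"
  by (intro add_mono sum_mono avg_mono ne pE fE) (simp_all add: bad)
 also have "... = real (card P) * (fail L m)^2 + real (card P) * ?x" using fE by simp
 also have "... <= real (K ^ (2 * CARD('d))) * (fail L m)^2 + real (K ^ (2 * CARD('d))) * ?x"
  by (intro add_mono mult_right_mono of_nat_mono fP) auto
 finally show ?thesis by simp
qed

lemma fail_bounds: "L >= 1 ==> 0 <= fail L m & fail L m <= 1"
 unfolding fail_def by (intro conjI prb_nonneg prb_le_1 pEd finite_cube)

text \<open>With x = 2^(-n), lowering the density factor from 1/2 + x/2 to 1/2 + x/4 leaves room for
  the relative loss x/4 of one level.\<close>

lemma half_pow_step: "(x :: real) * x <= x ==> 1 / 2 + x / 2 / 2 <= (1 / 2 + x / 2) * (1 - x / 4)"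
 by (simp add: field_simps)

text \<open>The linking exponent at least doubles per level. The failure bound beats the number of
  pairs at its own level and reproduces itself. The density never falls below half of its initial
  value.\<close>

lemma renorm_iterate:
 assumes K0: "K0 >= 4" "8 * 2 powr (D + a) <= K0 ^r (D - a)" and L: "L >= 1" and m: "m >= 1"
  and t: "4 * 16 ^ CARD('d) * real K0 ^ (4 * CARD('d)) <= exp (c0 * (real m)^2 * real (K0 * L) powr (- (D + a)))"
  and f: "fail L m <= 1 / (2 * (2 * real K0) ^ (2 * CARD('d)))"
 shows "blk K0 L n >= 1 & sz CARD('d) K0 m n >= 1 &
  2 ^ n * (c0 * (real m)^2 * real (K0 * L) powr (- (D + a)))
   <= c0 * (real (sz CARD('d) K0 m n))^2 * real (K0 * 2 ^ n * blk K0 L n) powr (- (D + a)) &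
  fail (blk K0 L n) (sz CARD('d) K0 m n) <= 1 / (2 * (2 * real (K0 * 2 ^ n)) ^ (2 * CARD('d))) &
  real m / real L ^ CARD('d) * (1 / 2 + (1 / 2) ^ n / 2) <= real (sz CARD('d) K0 m n) / real (blk K0 L n) ^ CARD('d)"
proof (induction n)
 case 0
 then show ?case using assms by simp
next
 case (Suc n)
 define K where "K = K0 * 2 ^ n"
 define B where "B = blk K0 L n"
 define s where "s = sz CARD('d) K0 m n"
 let ?d = "CARD('d)"
 let ?t0 = "c0 * (real m)^2 * real (K0 * L) powr (- (D + a))"
 define tn where "tn = c0 * (real s)^2 * real (K * B) powr (- (D + a))"
 have IH: "B >= 1" "s >= 1" "2 ^ n * ?t0 <= tn" "fail B s <= 1 / (2 * (2 * real K) ^ (2 * ?d))"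
   "real m / real L ^ ?d * (1 / 2 + (1 / 2) ^ n / 2) <= real s / real B ^ ?d"
  using Suc unfolding K_def B_def s_def tn_def by blast+
 have K0K: "K0 <= K" by (simp add: K_def)
 then have K4: "K >= 4" using K0 by simp
 have Kd: "real K <= real K ^ ?d" using K4 by (intro self_le_power) (auto simp: Suc_le_eq)
 have Kd1: "1 <= K ^ ?d" using K4 by simp
 have Bs: "blk K0 L (Suc n) = K * B" "sz CARD('d) K0 m (Suc n) = (K ^ ?d - 1) * s"
  by (simp_all add: K_def B_def s_def)
 have "4 <= K ^ ?d" using Kd K4 by (metis of_nat_le_iff of_nat_power order_trans)
 then have s1: "(K ^ ?d - 1) * s >= 1" using IH by (simp add: Suc_le_eq)
 have rK: "real (K ^ ?d - 1) = real K ^ ?d - 1" using Kd1 by (simp add: of_nat_diff)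
 have t0: "0 <= ?t0" using c0 by simp
 \<comment> \<open>Squared sizes gain at least \<open>K ^r (2 * D) / 4\<close> and the kernel loses
   \<open>(2 * real K) powr (- (D + a))\<close>; the second assumption on \<open>K0\<close> makes
   the product at least 2.\<close>
 have tn_ge: "2 * tn <= c0 * (real ((K ^ ?d - 1) * s))^2 * real (K0 * 2 ^ Suc n * (K * B)) powr (- (D + a))"
 proof -
  have "real K ^ ?d / 2 <= real K ^ ?d - 1" using Kd K4 by linarith
  then have "(real K ^ ?d / 2)^2 <= (real (K ^ ?d - 1))^2" unfolding rK by (intro power_mono) auto
  moreover have "(real K ^ ?d / 2)^2 = K ^r (2 * D) / 4"
   using K4 by (simp add: power_divide D_def powr_realpow[symmetric] powr_add[symmetric] power2_eq_square)
  ultimately have 1: "K ^r (2 * D) / 4 <= (real (K ^ ?d - 1))^2" by simp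
  have "8 * 2 powr (D + a) <= K ^r (D - a)"
   using K0(2) powr_mono2[of "D - a" "real K0" "real K"] K0K aD by simp
  then have "8 * 2 powr (D + a) * 2 powr (- (D + a)) <= K ^r (D - a) * 2 powr (- (D + a))"
   by (intro mult_right_mono) auto
  moreover have "2 powr (D + a) * 2 powr (- (D + a)) = (1 :: real)"
   by (simp flip: powr_add)
  ultimately have "8 <= K ^r (D - a) * 2 powr (- (D + a))"
   by (simp only: mult.assoc)
  also have "... = (K ^r (2 * D) * K ^r (- (D + a))) * 2 powr (- (D + a))"
   by (simp flip: powr_add)
  also have "... = K ^r (2 * D) * (2 * real K) powr (- (D + a))"
   using K4 by (simp add: powr_mult)
  finally have "2 <= K ^r (2 * D) / 4 * (2 * real K) powr (- (D + a))" by simp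
  also have "... <= (real (K ^ ?d - 1))^2 * (2 * real K) powr (- (D + a))"
   using 1 by (intro mult_right_mono) auto
  finally have "2 * tn <= ((real (K ^ ?d - 1))^2 * (2 * real K) powr (- (D + a))) * tn"
   using c0 by (intro mult_right_mono) (auto simp: tn_def)
  also have "... = c0 * (real ((K ^ ?d - 1) * s))^2 * ((2 * real K) powr (- (D + a)) * real (K * B) powr (- (D + a)))"
   by (simp add: tn_def power_mult_distrib mult_ac del: of_nat_diff)
  also have "(2 * real K) powr (- (D + a)) * real (K * B) powr (- (D + a)) = real (K0 * 2 ^ Suc n * (K * B)) powr (- (D + a))"
   by (simp add: K_def mult_ac flip: powr_mult)
  finally show ?thesis .
 qed
 \<comment> \<open>The two failure terms of \<open>renorm_step\<close> get equal shares. Squaring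
   the old bound and multiplying by the number of pairs gives 1 / (4 (4K)^(2d)), and
   \<open>4 * K\<close> is twice the next ratio.\<close>
 have f': "fail (K * B) ((K ^ ?d - 1) * s) <= 1 / (2 * (2 * real (K0 * 2 ^ Suc n)) ^ (2 * ?d))"
 proof -
  have "fail (K * B) ((K ^ ?d - 1) * s) <= real K ^ (2 * ?d) * (fail B s)^2 + real K ^ (2 * ?d) * exp (- tn)"
   unfolding tn_def using K4 IH by (intro renorm_step) auto
  moreover have "real K ^ (2 * ?d) * (fail B s)^2 <= 1 / (4 * (4 * real K) ^ (2 * ?d))"
  proof -
   have "real K ^ (2 * ?d) * (fail B s)^2 <= real K ^ (2 * ?d) * (1 / (2 * (2 * real K) ^ (2 * ?d)))^2"
    using IH fail_bounds by (intro mult_left_mono power_mono) auto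
   also have "(2 * (2 * real K) ^ (2 * ?d))^2 = real K ^ (2 * ?d) * (4 * (4 * real K) ^ (2 * ?d))"
   proof -
    have "(4::real) ^ (2 * ?d) = 2 ^ (2 * ?d) * 2 ^ (2 * ?d)" by (simp flip: power_mult_distrib)
    then show ?thesis by (simp add: power2_eq_square power_mult_distrib)
   qed
   then have "real K ^ (2 * ?d) * (1 / (2 * (2 * real K) ^ (2 * ?d)))^2 = 1 / (4 * (4 * real K) ^ (2 * ?d))"
    using K4 by (simp add: power_divide)
   finally show ?thesis .
  qed
  moreover have "real K ^ (2 * ?d) * exp (- tn) <= 1 / (4 * (4 * real K) ^ (2 * ?d))"
  proof -
   let ?X = "4 * 16 ^ ?d * real K0 ^ (4 * ?d)"
   have "(2::real) ^ (4 * ?d) = 16 ^ ?d" by (simp add: power_mult)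
   also have "... <= ?X"
   proof -
    have "1 <= 4 * real K0 ^ (4 * ?d)" using K0 one_le_power[of "real K0" "4 * ?d"] by linarith
    then have "16 ^ ?d * 1 <= 16 ^ ?d * (4 * real K0 ^ (4 * ?d))" by (intro mult_left_mono) auto
    then show ?thesis by (simp add: mult_ac)
   qed
   finally have "(2::real) ^ (4 * ?d) <= exp ?t0" using t by linarith
   then have "(2 ^ (4 * ?d)) ^ n <= exp ?t0 ^ n" by (intro power_mono) auto
   then have "?X * (2 ^ (4 * ?d)) ^ n <= exp ?t0 * exp ?t0 ^ n" using t by (intro mult_mono) auto
   also have "... = exp (real (Suc n) * ?t0)" by (simp only: exp_of_nat_mult power_Suc)
   also have "... <= exp (2 ^ n * ?t0)"
   proof -
    have "Suc n <= 2 ^ n" by (simp add: Suc_le_eq)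
    then have "real (Suc n) <= 2 ^ n" by (metis of_nat_le_iff of_nat_numeral of_nat_power)
    then show ?thesis using t0 by (intro exp_mono mult_right_mono) auto
   qed
   also have "... <= exp tn" using IH by simp
   also have "?X * (2 ^ (4 * ?d)) ^ n = real K ^ (2 * ?d) * (4 * (4 * real K) ^ (2 * ?d))"
   proof -
    have "(4::real) ^ (2 * ?d) = 16 ^ ?d" by (simp add: power_mult)
    moreover have "real K ^ (2 * ?d) * real K ^ (2 * ?d) = real K0 ^ (4 * ?d) * (2 ^ (4 * ?d)) ^ n"
     by (simp add: K_def power_mult_distrib mult_ac flip: power_mult power_add)
    ultimately show ?thesis by (simp add: power_mult_distrib)
   qed
   finally have "real K ^ (2 * ?d) * (4 * (4 * real K) ^ (2 * ?d)) <= exp tn" .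
   then show ?thesis using K4 by (simp add: exp_minus field_simps)
  qed
  ultimately have "fail (K * B) ((K ^ ?d - 1) * s) <= 1 / (2 * (4 * real K) ^ (2 * ?d))" by simp
  also have "4 * real K = 2 * real (K0 * 2 ^ Suc n)" by (simp add: K_def)
  finally show ?thesis .
 qed
 have dens: "real m / real L ^ ?d * (1 / 2 + (1 / 2) ^ Suc n / 2) <= real ((K ^ ?d - 1) * s) / real (K * B) ^ ?d"
 proof -
  have "(1 / 2) ^ n = 1 / (2::real) ^ n" by (simp add: power_divide)
  have "1 / real K ^ ?d <= 1 / real K" using Kd K4 by (intro divide_left_mono) auto
  also have "... <= (1 / 2) ^ n / 4"
   using K0 by (simp add: K_def power_divide divide_simps)
  finally have 1: "1 / real K ^ ?d <= (1 / 2) ^ n / 4" .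
  have h: "(1 / 2 :: real) ^ n <= 1" by (intro power_le_one) auto
  have "(1 / 2 :: real) ^ n * (1 / 2) ^ n <= 1 * (1 / 2) ^ n" using h by (intro mult_right_mono) auto
  then have hh: "(1 / 2 :: real) ^ n * (1 / 2) ^ n <= (1 / 2) ^ n" unfolding mult_1 .
  have e: "(1 / 2 :: real) ^ Suc n / 2 = (1 / 2) ^ n / 2 / 2" by simp
  have "(1 / 2 :: real) + (1 / 2) ^ Suc n / 2 <= (1 / 2 + (1 / 2) ^ n / 2) * (1 - (1 / 2) ^ n / 4)"
   unfolding e by (rule half_pow_step[OF hh])
  also have "... <= (1 / 2 + (1 / 2) ^ n / 2) * (1 - 1 / real K ^ ?d)"
   using 1 by (intro mult_left_mono) auto
  finally have 2: "1 / 2 + (1 / 2) ^ Suc n / 2 <= (1 / 2 + (1 / 2) ^ n / 2) * (1 - 1 / real K ^ ?d)" .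
  have "real m / real L ^ ?d * (1 / 2 + (1 / 2) ^ Suc n / 2)
    <= (real m / real L ^ ?d * (1 / 2 + (1 / 2) ^ n / 2)) * (1 - 1 / real K ^ ?d)"
   unfolding mult.assoc by (intro mult_left_mono[OF 2]) auto
  also have "... <= (real s / real B ^ ?d) * (1 - 1 / real K ^ ?d)"
   using K4 Kd by (intro mult_right_mono IH) auto
  also have "... = real ((K ^ ?d - 1) * s) / real (K * B) ^ ?d"
   using K4 IH(1) unfolding of_nat_mult rK by (simp add: field_simps power_mult_distrib)
  finally show ?thesis .
 qed
 have "2 ^ Suc n * ?t0 <= 2 * tn" using IH(3) by simp
 then have "2 ^ Suc n * ?t0 <= c0 * (real ((K ^ ?d - 1) * s))^2 * real (K0 * 2 ^ Suc n * (K * B)) powr (- (D + a))"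
  using tn_ge by linarith
 then show ?case unfolding Bs using f' dens s1 K4 IH(1) by (simp add: Suc_le_eq)
qed

text \<open>At a high level a giant cluster occupies at least half the initial density with
  probability at least 1/2. Averaging over the vertices of the cube yields a vertex that belongs to
  it with probability a quarter of the initial density.\<close>

lemma renorm_percolates:
 assumes K0: "K0 >= 4" "8 * 2 powr (D + a) <= K0 ^r (D - a)" and L: "L >= 1" and m: "m >= 1"
  and t: "4 * 16 ^ CARD('d) * real K0 ^ (4 * CARD('d)) <= exp (c0 * (real m)^2 * real (K0 * L) powr (- (D + a)))"
  and f: "fail L m <= 1 / (2 * (2 * real K0) ^ (2 * CARD('d)))"
 shows "EX \<theta>>0. ALL n. EX V x. finite V & \<theta> <= prw (Ed V) (%A. n <= card (clu A x))"
proof (intro exI[of _ "real m / real L ^ CARD('d) / 4"] conjI allI)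
 let ?d = "CARD('d)"
 show "0 < real m / real L ^ ?d / 4" using m L by simp
 fix N :: nat
 define n where "n = nat \<lceil>real N / (real m / real L ^ ?d / 2)\<rceil>"
 note I = renorm_iterate[OF assms, of n]
 define B where "B = blk K0 L n"
 define s where "s = sz CARD('d) K0 m n"
 have B1: "B >= 1" and s1: "s >= 1" and fl: "fail B s <= 1 / (2 * (2 * real (K0 * 2 ^ n)) ^ (2 * ?d))"
  and dn: "real m / real L ^ ?d * (1 / 2 + (1 / 2) ^ n / 2) <= real s / real B ^ ?d"
  using I by (simp_all add: B_def s_def)
 have "1 <= (2 * real (K0 * 2 ^ n)) ^ (2 * ?d)" using K0 by (intro one_le_power) (simp add: mult_ge1_I)
 then have "1 / (2 * (2 * real (K0 * 2 ^ n)) ^ (2 * ?d)) <= 1 / 2" by (intro divide_left_mono) auto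
 then have fl2: "fail B s <= 1 / 2" using fl by simp
 have "real m / real L ^ ?d * (1 / 2) <= real m / real L ^ ?d * (1 / 2 + (1 / 2) ^ n / 2)"
  by (intro mult_left_mono) auto
 then have "real m / real L ^ ?d * (1 / 2) <= real s / real B ^ ?d" using dn by linarith
 then have dn2: "real m / real L ^ ?d / 2 * real B ^ ?d <= real s"
  using B1 by (simp add: pos_le_divide_eq)
 have nB: "real n <= real B ^ ?d"
 proof -
  have "n <= blk K0 L n"
  proof (induction n)
   case (Suc k)
   have "Suc k <= 2 ^ k" by (simp add: Suc_le_eq)
   also have "... <= K0 * 2 ^ k * 1" using K0 by simp
   also have "... <= K0 * 2 ^ k * blk K0 L k"
    using renorm_iterate[OF assms, of k] by (intro mult_left_mono) auto
   finally show ?case by simp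
  qed simp
  then have "real n <= real B" by (simp add: B_def)
  also have "... <= real B ^ ?d" using B1 by (intro self_le_power) (auto simp: Suc_le_eq)
  finally show ?thesis .
 qed
 have "real N <= real m / real L ^ ?d / 2 * real n"
 proof -
  have "real N / (real m / real L ^ ?d / 2) <= real n" unfolding n_def by linarith
  then show ?thesis using m L by (simp add: field_simps)
 qed
 also have "... <= real m / real L ^ ?d / 2 * real B ^ ?d" using nB by (intro mult_left_mono) auto
 also have "... <= real s" by (rule dn2)
 finally have Ns: "N <= s" by simp
 let ?Q = "cube B (0 :: int ^ 'd)"
 have fQ: "finite ?Q" using B1 by (rule finite_cube)
 have "real s * (1 / 2) <= real s * (1 - fail B s)" using fl2 by (intro mult_left_mono) auto
 also have "1 - fail B s = prw (Ed ?Q) (%A. big B 0 s A)"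
  unfolding fail_def by (subst prb_compl[OF pEd[OF fQ]]) simp
 also have "real s * ... = avw (Ed ?Q) (%A. real s * of_bool (big B 0 s A))"
  by (simp only: avg_cmult)
 also have "... <= avw (Ed ?Q) (%A. SUM x:?Q. of_bool (s <= card (clu A x)))"
 proof (intro avg_mono pEd fQ)
  fix A assume A: "A \<subseteq> Ed ?Q"
  show "real s * of_bool (big B 0 s A) <= (SUM x:?Q. of_bool (s <= card (clu A x)))"
  proof (cases "big B 0 s A")
   case True
   then obtain v where v: "s <= card (clu A v Int ?Q)" by (auto simp: big_def)
   have AP: "A \<subseteq> Pow ?Q" using A Ed_Pow by blast
   have "s <= card (clu A x)" if "x : clu A v" for x
    using v clu_eq[of A v x] that card_mono[OF finite_clu[OF AP fQ, of v], of "clu A v Int ?Q"] by auto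
   then have "(SUM x:clu A v Int ?Q. 1) <= (SUM x:clu A v Int ?Q. of_bool (s <= card (clu A x)) :: real)"
    by (intro sum_mono) auto
   also have "... <= (SUM x:?Q. of_bool (s <= card (clu A x)))"
    using fQ by (intro sum_mono2) auto
   finally show ?thesis using v True by simp
  qed (simp add: sum_nonneg)
 qed
 also have "... = (SUM x:?Q. prw (Ed ?Q) (%A. s <= card (clu A x)))" by (simp add: avg_sum)
 finally have tot: "real s / 2 <= (SUM x:?Q. prw (Ed ?Q) (%A. s <= card (clu A x)))" by simp
 have "EX x:?Q. real m / real L ^ ?d / 4 <= prw (Ed ?Q) (%A. s <= card (clu A x))"
 proof (rule ccontr)
  assume "~ ?thesis"
  then have "(SUM x:?Q. prw (Ed ?Q) (%A. s <= card (clu A x))) < (SUM x:?Q. real m / real L ^ ?d / 4)"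
   using fQ card_cube[OF B1, of "0 :: int ^ 'd"] B1 by (intro sum_strict_mono) (auto simp: not_le)
  also have "... = real m / real L ^ ?d / 2 * real B ^ ?d / 2" using card_cube[OF B1, of "0 :: int ^ 'd"] by (simp add: mult_ac)
  also have "... <= real s / 2" using dn2 by simp
  finally show False using tot by simp
 qed
 then obtain x where "real m / real L ^ ?d / 4 <= prw (Ed ?Q) (%A. s <= card (clu A x))" by auto
 also have "... <= prw (Ed ?Q) (%A. N <= card (clu A x))"
  using Ns by (intro prb_mono pEd fQ) auto
 finally show "EX V x. finite V & real m / real L ^ ?d / 4 <= prw (Ed V) (%A. N <= card (clu A x))"
  using fQ by blast
qed

end

section \<open>Two-point estimates at criticality\<close>

text \<open>All that is retained of criticality. In \<open>phi_ge\<close> the total weight leaving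
  \<open>S\<close> at \<open>u\<close> is an infinite sum; it is represented by an arbitrary bound
  \<open>g u\<close> on its finite partial sums.\<close>

locale crit = kern w a c0 C0 for w :: "int ^ 'd => int ^ 'd => real" and a c0 C0 +
 fixes \<delta>0 B :: real
 assumes \<delta>0: "0 < \<delta>0" "\<delta>0 < 1" and B: "1 <= B"
  and max_bound: "L >= 1 ==> m >= 1 ==> B * L ^r ((real CARD('d) + a) / 2) <= real m ==>
   prw (Ed (cube L 0)) (%A. EX v. m <= card (clu A v Int cube L 0)) <= 1 - \<delta>0"
  and phi_ge: "finite S ==> 0 : S ==>
   (\<And>u T. u : S ==> finite T ==> T Int S = {} ==> (SUM v:T. w u v) <= g u) ==>
   1 <= (SUM u:S. pr (Ed S) 0 u * g u)"

context kern
begin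

lemma ne_Ed: "A \<subseteq> Ed V ==> e : A ==> e ~= {}"
 using Ed_card[of e V] by fastforce

lemma big_shift:
 fixes z :: "int ^ 'd"
 shows "prw (Ed ((%x. x + z) ` V)) (%A. EX v. m <= card (clu A v Int (%x. x + z) ` V))
  = prw (Ed V) (%A. EX v. m <= card (clu A v Int V))"
 unfolding Ed_shift
proof (rule avg_shift)
 have ex_shift: "(EX v. P v) \<longleftrightarrow> (EX v. P (v + z))" for P by (metis diff_add_cancel)
 fix A assume "A \<subseteq> Ed V"
 then have ne: "e ~= {}" if "e : A" for e using that by (rule ne_Ed)
 show "of_bool (EX v. m <= card (clu ((`) ((`) (%x. x + z)) A) v Int (%x. x + z) ` V))
  = (of_bool (EX v. m <= card (clu A v Int V)) :: real)"
  using card_clu_shift[OF ne, where z = z and L = V]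
  by (subst ex_shift) simp
qed

lemma avg_card_V:
 assumes "finite V" "x : V" "E \<subseteq> Ed V"
 shows "avw E (%A. csz A x) = (SUM y:V. pr E x y)"
proof -
 have "clu A x Int V = clu A x" if "A \<subseteq> E" for A
  using clu_subset[of A V x] assms that Ed_Pow[of V] by blast
 then have "avw E (%A. csz A x) = avw E (%A. real (card (clu A x Int V)))"
  by (intro avg_cong) simp
 then show ?thesis using assms by (simp add: avg_card)
qed

lemma pr_outside:
 assumes "E \<subseteq> Ed V" "x : V" "y \<notin> V"
 shows "pr E x y = 0"
proof -
 have "~ conn A x y" if "A \<subseteq> E" for A
  using conn_in[of A x y V] assms that Ed_Pow[of V] by blast
 then have "pr E x y = avw E (%A. 0)" by (intro avg_cong) simp
 then show ?thesis by simp
qed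

lemma pr_outside':
 assumes "E \<subseteq> Ed V" "x \<notin> V" "x ~= y"
 shows "pr E x y = 0"
proof -
 have "~ conn A x y" if "A \<subseteq> E" for A
 proof
  assume "conn A x y"
  then have "x = y"
  proof (induction rule: conn_induct)
   case (step y z)
   then show ?case using assms that by auto
  qed simp
  then show False using assms by simp
 qed
 then have "pr E x y = avw E (%A. 0)" by (intro avg_cong) simp
 then show ?thesis by simp
qed

lemma pr_self: "finite E ==> pr E x x = 1"
 by simp

lemma pr_bounds: "finite E ==> 0 <= pr E x y & pr E x y <= 1"
 using prb_nonneg[OF pE] prb_le_1[OF pE] by metis

lemma pr_mono: "finite E ==> E' \<subseteq> E ==> pr E' x y <= pr E x y"
 by (intro prb_conn_mono pE)

section \<open>Clusters inside a box and the edges leaving it\<close>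

definition pb :: "nat => int ^ 'd => real" where
 "pb s u = pr (Ed (lbox 0 s)) 0 u"

definition en :: "nat => real" where
 "en n = (SUM u:lbox 0 n. pb n u)"

text \<open>Expected weight of the edges of length at most \<open>R\<close> by which the cluster of
  0 in the box of radius \<open>s\<close> can leave the box.\<close>

definition phi :: "nat => nat => real" where
 "phi R s = (SUM u:lbox 0 s. SUM v:lbox u R - lbox 0 s. pb s u * w u v)"

lemma pb_nonneg: "0 <= pb s u"
 unfolding pb_def using pr_bounds finite_Ed finite_lbox by blast

lemma pb_0: "pb s 0 = 1"
 by (simp add: pb_def finite_Ed)

lemma pb_mono: "s <= t ==> pb s u <= pb t u"
 unfolding pb_def by (intro pr_mono Ed_mono lbox_mono finite_Ed finite_lbox)

lemma en_ge_1: "1 <= en n"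
 unfolding en_def using member_le_sum[of 0 "lbox 0 n" "pb n"] pb_0 pb_nonneg by auto

lemma pr_box: "pr (Ed (lbox x s)) x y = pb s (y - x)"
 using pr_shift[where V = "lbox 0 s" and x = 0 and y = "y - x" and z = x]
 by (simp add: pb_def lbox_shift)

lemma en_mono: "n <= m ==> en n <= en m"
 unfolding en_def
 by (intro order_trans[OF sum_mono[OF pb_mono] sum_mono2]) (auto intro: pb_nonneg order_trans)

text \<open>A cluster reaching beyond a box around \<open>x\<close> leaves that box through some edge.\<close>

lemma exit_bound':
 assumes V: "finite V"
 shows "pr (EdR (V Int lbox x s) R) x y <= of_bool (sd x y <= s) * pb s (y - x)"
  and "pr (EdR V R) x y <= pr (EdR (V Int lbox x s) R) x y
  + (SUM u:lbox 0 s. SUM v:lbox u R - lbox 0 s. pb s u * w u v * pr (EdR V R) (x + v) y)"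
proof -
 let ?E = "EdR V R" and ?E1 = "EdR (V Int lbox x s) R"
 have EV: "?E \<subseteq> Ed V" by (rule EdR_subset_Ed)
 have E1: "?E1 \<subseteq> ?E" by (intro EdR_mono) auto
 have E1b: "?E1 \<subseteq> Ed (lbox x s)" using EdR_subset_Ed Ed_mono[of "V Int lbox x s" "lbox x s"] by blast
 have fE: "finite ?E" "finite ?E1" using V by (auto intro: finite_EdR)
 have p1: "pr ?E1 x u <= of_bool (sd x u <= s) * pb s (u - x)" for u
 proof (cases "sd x u <= s")
  case True
  then show ?thesis using pr_mono[OF finite_Ed[OF finite_lbox] E1b, of x u] by (simp add: pr_box)
 next
  case False
  then show ?thesis using pr_outside[OF E1b, of x u] by simp
 qed
 show "pr ?E1 x y <= of_bool (sd x y <= s) * pb s (y - x)" by (rule p1)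
 have "pr ?E x y <= pr ?E1 x y + (SUM u:V. SUM v:V. of_bool ({u, v} : ?E - ?E1) * (pr ?E1 x u * w u v * pr ?E v y))"
  by (rule decompose[OF V EV E1])
 also have "(SUM u:V. SUM v:V. of_bool ({u, v} : ?E - ?E1) * (pr ?E1 x u * w u v * pr ?E v y))
  <= (SUM u:V. SUM v:V. of_bool (u : lbox x s & v : lbox u R - lbox x s) * (pb s (u - x) * w u v * pr ?E v y))"
 proof (intro sum_mono)
  fix u v
  have nn: "0 <= w u v" "0 <= pr ?E v y" "0 <= pb s (u - x)"
   using w_nonneg pr_bounds[OF fE(1)] pb_nonneg by auto
  show "of_bool ({u, v} : ?E - ?E1) * (pr ?E1 x u * w u v * pr ?E v y)
   <= of_bool (u : lbox x s & v : lbox u R - lbox x s) * (pb s (u - x) * w u v * pr ?E v y)"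
  proof (cases "{u, v} : ?E - ?E1 & sd x u <= s")
   case True
   then have "u : lbox x s & v : lbox u R - lbox x s" by auto
   moreover have "pr ?E1 x u * w u v * pr ?E v y <= pb s (u - x) * w u v * pr ?E v y"
    using p1[of u] True nn by (intro mult_right_mono) auto
   ultimately show ?thesis using True by simp
  next
   case False
   then have "of_bool ({u, v} : ?E - ?E1) * (pr ?E1 x u * w u v * pr ?E v y) <= 0"
    using p1[of u] nn pr_bounds[OF fE(2), of x u] by (cases "{u, v} : ?E - ?E1") auto
   also have "0 <= of_bool (u : lbox x s & v : lbox u R - lbox x s) * (pb s (u - x) * w u v * pr ?E v y)"
    using nn by simp
   finally show ?thesis .
  qed
 qed
 also have "... = (SUM u:V. of_bool (u : lbox x s) * (SUM v:V. of_bool (v : lbox u R - lbox x s) * (pb s (u - x) * w u v * pr ?E v y)))"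
  by (simp add: sum_distrib_left of_bool_conj mult.assoc)
 also have "... <= (SUM u:lbox x s. SUM v:lbox u R - lbox x s. pb s (u - x) * w u v * pr ?E v y)"
 proof -
  have nn: "0 <= pb s (u - x) * w u v * pr ?E v y" for u v
   using w_nonneg pr_bounds[OF fE(1)] pb_nonneg by (intro mult_nonneg_nonneg) auto
  have restr: "(SUM u:V. of_bool (u : T) * h u) <= (SUM u:T. h u)" if "finite T" "\<And>u. 0 <= (h u :: real)" for T h
  proof -
   have "(SUM u:V. of_bool (u : T) * h u) = (SUM u:V Int T. h u)"
    using V by (intro sum.mono_neutral_cong_right) auto
   also have "... <= (SUM u:T. h u)" using that by (intro sum_mono2) auto
   finally show ?thesis .
  qed
  have "(SUM u:V. of_bool (u : lbox x s) * (SUM v:V. of_bool (v : lbox u R - lbox x s) * (pb s (u - x) * w u v * pr ?E v y)))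
   <= (SUM u:lbox x s. (SUM v:V. of_bool (v : lbox u R - lbox x s) * (pb s (u - x) * w u v * pr ?E v y)))"
   by (intro restr sum_nonneg mult_nonneg_nonneg[OF _ nn]) auto
  also have "... <= (SUM u:lbox x s. SUM v:lbox u R - lbox x s. pb s (u - x) * w u v * pr ?E v y)"
   using nn by (intro sum_mono restr) auto
  finally show ?thesis .
 qed
 also have "... = (SUM u:lbox 0 s. SUM v:lbox (u + x) R - lbox x s. pb s u * w (u + x) v * pr ?E v y)"
  by (rule sum.reindex_bij_witness[of _ "%u. u + x" "%u. u - x"])
   (use sd_shift[of 0 x] sd_shift[of x "- x"] in auto)
 also have "... = (SUM u:lbox 0 s. SUM v:lbox u R - lbox 0 s. pb s u * w u v * pr ?E (x + v) y)"
 proof (rule sum.cong[OF refl])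
  fix u
  show "(SUM v:lbox (u + x) R - lbox x s. pb s u * w (u + x) v * pr ?E v y)
   = (SUM v:lbox u R - lbox 0 s. pb s u * w u v * pr ?E (x + v) y)"
  proof (rule sum.reindex_bij_witness[of _ "%v. v + x" "%v. v - x"])
   fix v assume v: "v : lbox (u + x) R - lbox x s"
   show "v - x : lbox u R - lbox 0 s"
    using v sd_shift[of u x "v - x"] sd_shift[of 0 x "v - x"] by simp
   show "pb s u * w u (v - x) * pr ?E (x + (v - x)) y = pb s u * w (u + x) v * pr ?E v y"
    using w_shift[of u x "v - x"] by simp
  next
   fix v assume "v : lbox u R - lbox 0 s"
   then show "v + x : lbox (u + x) R - lbox x s"
    using sd_shift[of 0 x v] by simp
  qed simp_all
 qed
 finally show "pr ?E x y <= pr ?E1 x y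
  + (SUM u:lbox 0 s. SUM v:lbox u R - lbox 0 s. pb s u * w u v * pr ?E (x + v) y)"
  by simp
qed

lemma exit_bound:
 assumes V: "finite V"
 shows "pr (EdR V R) x y <= of_bool (sd x y <= s) * pb s (y - x)
  + (SUM u:lbox 0 s. SUM v:lbox u R - lbox 0 s. pb s u * w u v * pr (EdR V R) (x + v) y)"
 using exit_bound'(1)[OF V, where x = x and y = y and s = s and R = R]
  exit_bound'(2)[OF V, where x = x and y = y and s = s and R = R] by linarith

text \<open>An edge from \<open>u\<close> to \<open>v\<close> leaves the box of radius
  \<open>s\<close> only if \<open>s\<close> lies between the norms of its ends, hence for at most
  \<open>sd u v\<close> values of \<open>s\<close>. Summing over \<open>s\<close> thus produces the
  truncated first moment of \<open>sum_w_sd\<close>.\<close>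

lemma phi_sum: "(SUM s:{1..n}. phi R s) <= C0 * Kd / (1 - a) * R ^r (1 - a) * en n"
proof -
 have "(SUM s:{1..n}. phi R s) <= (SUM s:{1..n}. SUM u:lbox 0 n. pb n u * (SUM v:lbox u R. of_bool (sd 0 u <= s & s < sd 0 v) * w u v))"
 proof (rule sum_mono)
  fix s assume s: "s : {1..n}"
  have "phi R s = (SUM u:lbox 0 s. pb s u * (SUM v:lbox u R - lbox 0 s. w u v))"
   by (simp add: phi_def sum_distrib_left)
  also have "... <= (SUM u:lbox 0 s. pb n u * (SUM v:lbox u R. of_bool (sd 0 u <= s & s < sd 0 v) * w u v))"
  proof (intro sum_mono mult_mono)
   fix u :: "int ^ 'd" assume u: "u : lbox 0 s"
   show "pb s u <= pb n u" using s by (intro pb_mono) auto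
   have "(SUM v:lbox u R - lbox 0 s. w u v) = (SUM v:lbox u R. of_bool (sd 0 u <= s & s < sd 0 v) * w u v)"
    using u by (intro sum.mono_neutral_cong_left) auto
   then show "(SUM v:lbox u R - lbox 0 s. w u v) <= (SUM v:lbox u R. of_bool (sd 0 u <= s & s < sd 0 v) * w u v)"
    by simp
  qed (auto intro: pb_nonneg sum_nonneg w_nonneg)
  also have "... <= (SUM u:lbox 0 n. pb n u * (SUM v:lbox u R. of_bool (sd 0 u <= s & s < sd 0 v) * w u v))"
   using s by (intro sum_mono2) (auto intro!: mult_nonneg_nonneg pb_nonneg sum_nonneg w_nonneg)
  finally show "phi R s <= (SUM u:lbox 0 n. pb n u * (SUM v:lbox u R. of_bool (sd 0 u <= s & s < sd 0 v) * w u v))" .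
 qed
 also have "... = (SUM u:lbox 0 n. pb n u * (SUM v:lbox u R. (SUM s:{1..n}. of_bool (sd 0 u <= s & s < sd 0 v)) * w u v))"
  by (subst sum.swap, intro sum.cong refl, simp only: sum_distrib_left[symmetric] sum_distrib_right)
   (intro arg_cong[of _ _ "(*) _"] sum.swap)
 also have "... <= (SUM u:lbox 0 n. pb n u * (C0 * Kd / (1 - a) * R ^r (1 - a)))"
 proof (intro sum_mono mult_left_mono pb_nonneg)
  fix u :: "int ^ 'd"
  have "(SUM v:lbox u R. (SUM s:{1..n}. of_bool (sd 0 u <= s & s < sd 0 v)) * w u v)
   <= (SUM v:lbox u R. real (sd u v) * w u v)"
  proof (intro sum_mono mult_right_mono w_nonneg)
   fix v :: "int ^ 'd"
   have "(SUM s:{1..n}. of_bool (sd 0 u <= s & s < sd 0 v)) = real (card {s : {1..n}. sd 0 u <= s & s < sd 0 v})"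
   proof -
    have "{s. sd 0 u <= s & s < sd 0 v} Int {1..n} = {s : {1..n}. sd 0 u <= s & s < sd 0 v}" by auto
    then show ?thesis using card_Int_sum[of "{1..n}" "{s. sd 0 u <= s & s < sd 0 v}"] by simp
   qed
   also have "... <= real (card {sd 0 u..<sd 0 v})" by (intro of_nat_mono card_mono) auto
   also have "... <= real (sd u v)" using sd_triangle[of 0 v u] by simp
   finally show "(SUM s:{1..n}. of_bool (sd 0 u <= s & s < sd 0 v)) <= real (sd u v)" .
  qed
  also have "... = (SUM v:lbox u R - {u}. w u v * real (sd u v))"
   by (intro sum.mono_neutral_cong_right) auto
  also have "... <= C0 * Kd / (1 - a) * R ^r (1 - a)"
   by (intro sum_w_sd) auto
  finally show "(SUM v:lbox u R. (SUM s:{1..n}. of_bool (sd 0 u <= s & s < sd 0 v)) * w u v)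
   <= C0 * Kd / (1 - a) * R ^r (1 - a)" .
 qed
 also have "... = C0 * Kd / (1 - a) * R ^r (1 - a) * en n"
  unfolding en_def by (subst sum_distrib_right[symmetric]) (rule mult.commute)
 finally show ?thesis .
qed

end

section \<open>The order of the expected cluster size in a box\<close>

context crit
begin

definition M0 :: "nat => nat" where
 "M0 L = nat \<lceil>B * L ^r ((D + a) / 2)\<rceil>"

lemma M0:
 assumes "L >= 1"
 shows "1 <= M0 L" "B * L ^r ((D + a) / 2) <= real (M0 L)" "real (M0 L) <= 2 * B * L ^r ((D + a) / 2)"
proof -
 have "1 <= L ^r ((D + a) / 2)" using assms D1 a0 by (intro ge_one_powr_ge_zero) auto
 then have 1: "1 <= B * L ^r ((D + a) / 2)" using B mult_mono[of 1 B 1 "L ^r ((D + a) / 2)"] by simp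
 then show "B * L ^r ((D + a) / 2) <= real (M0 L)" unfolding M0_def by linarith
 with 1 show "1 <= M0 L" by linarith
 have "real (M0 L) <= B * L ^r ((D + a) / 2) + 1" unfolding M0_def using 1 by linarith
 then show "real (M0 L) <= 2 * B * L ^r ((D + a) / 2)" using 1 by linarith
qed

abbreviation "moment_bound_with \<delta> j C \<equiv>
 ALL (V :: (int ^ 'd) set) E p L m x i. finite_perc V E p --> m >= 1 --> i <= j -->
   prb E p (%A. EX v. m <= card (clu A v Int L)) <= 1 - \<delta> -->
   avg E p (%A. real (card (clu A x Int L)) ^ j) <= C * real m ^ (j - i) * avg E p (%A. real (card (clu A x Int L)) ^ i)"

abbreviation "cube_moments_with j C \<equiv>
 ALL L z x i. L >= 1 --> i <= j --> (let V = (%x. x + z) ` cube L 0 in x : V -->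
  avw (Ed V) (%A. csz A x ^ j)
   <= C * (L ^r ((D + a) / 2)) ^ (j - i) * avw (Ed V) (%A. csz A x ^ i))"

lemma cube_moments: "EX C>=1. cube_moments_with j C"
proof -
 obtain C where C: "C >= 1 & moment_bound_with TYPE('d) \<delta>0 j C"
  using moment_bound[OF \<delta>0, of j] by (rule exE)
 note C = C[THEN conjunct1] C[THEN conjunct2, rule_format]
 have B1: "1 <= (2 * B) ^ j" using B by (intro one_le_power) auto
 show ?thesis
 proof (intro exI[of _ "C * (2 * B) ^ j"] conjI allI impI)
  show "1 <= C * (2 * B) ^ j" using C(1) B1 mult_mono[of 1 C 1 "(2 * B) ^ j"] by simp
  fix L :: nat and z x :: "int ^ 'd" and i assume L: "L >= 1" and ij: "i <= j"
  define V where "V = (%x. x + z) ` cube L 0"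
  have fV: "finite V" using L by (simp add: V_def finite_cube)
  show "let V = (%x. x + z) ` cube L 0 in x : V -->
   avw (Ed V) (%A. csz A x ^ j)
   <= C * (2 * B) ^ j * (L ^r ((D + a) / 2)) ^ (j - i) * avw (Ed V) (%A. csz A x ^ i)"
   unfolding V_def[symmetric] Let_def
  proof
   assume x: "x : V"
   have "prw (Ed V) (%A. EX v. M0 L <= card (clu A v Int V)) <= 1 - \<delta>0"
    unfolding V_def big_shift using M0[OF L] L by (intro max_bound) (auto simp: D_def)
   then have "avw (Ed V) (%A. real (card (clu A x Int V)) ^ j)
    <= C * real (M0 L) ^ (j - i) * avw (Ed V) (%A. real (card (clu A x Int V)) ^ i)"
    using M0[OF L] ij by (intro C(2)[OF fp[OF fV]])
   also have "... <= C * ((2 * B) ^ j * (L ^r ((D + a) / 2)) ^ (j - i)) * avw (Ed V) (%A. real (card (clu A x Int V)) ^ i)"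
   proof (intro mult_right_mono mult_left_mono avg_nonneg pEd fV)
    have "real (M0 L) ^ (j - i) <= (2 * B * L ^r ((D + a) / 2)) ^ (j - i)"
     using M0[OF L] by (intro power_mono) auto
    also have "... = (2 * B) ^ (j - i) * (L ^r ((D + a) / 2)) ^ (j - i)" by (simp add: power_mult_distrib)
    also have "... <= (2 * B) ^ j * (L ^r ((D + a) / 2)) ^ (j - i)"
     using B by (intro mult_right_mono power_increasing) auto
    finally show "real (M0 L) ^ (j - i) <= (2 * B) ^ j * (L ^r ((D + a) / 2)) ^ (j - i)" .
   qed (use C in auto)
   finally have *: "avw (Ed V) (%A. real (card (clu A x Int V)) ^ j)
    <= C * (2 * B) ^ j * (L ^r ((D + a) / 2)) ^ (j - i) * avw (Ed V) (%A. real (card (clu A x Int V)) ^ i)"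
    by (simp add: mult.assoc)
   have "avw (Ed V) (%A. real (card (clu A x Int V)) ^ k) = avw (Ed V) (%A. csz A x ^ k)" for k
   proof (rule avg_cong)
    fix A assume "A \<subseteq> Ed V"
    then have "clu A x Int V = clu A x" using clu_subset[of A V x] x Ed_Pow[of V] by blast
    then show "real (card (clu A x Int V)) ^ k = csz A x ^ k" by simp
   qed
   then show "avw (Ed V) (%A. csz A x ^ j)
   <= C * (2 * B) ^ j * (L ^r ((D + a) / 2)) ^ (j - i) * avw (Ed V) (%A. csz A x ^ i)"
    using * by simp
  qed
 qed
qed

definition SS :: "nat => real" where
 "SS L = (SUM x:cube L 0. SUM y:cube L 0. pr (Ed (cube L 0)) x y)"

text \<open>Two adjacent cubes of side \<open>L\<close> lie in one of side \<open>2 * L\<close>.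
  Gluing their clusters costs \<open>L ^r (- (D + a))\<close>, and universal tightness keeps the
  second-order term under control.\<close>

lemma SS_double: "EX k>0. ALL L>=1. k * L ^r (- (D + a)) * (SS L)^2 <= SS (2 * L)"
proof -
 obtain C where C: "C >= 1" "\<And>L z x. L >= 1 ==> x : (%x. x + z) ` cube L 0 ==>
   avw (Ed ((%x. x + z) ` cube L 0)) (%A. csz A x ^ 2)
   <= C * L ^r ((D + a) / 2) * avw (Ed ((%x. x + z) ` cube L 0)) (%A. csz A x)"
 proof -
  obtain C where "C >= 1" and H: "cube_moments_with 2 C"
   using cube_moments[of 2] by blast
  show ?thesis
  proof (rule that[OF \<open>C >= 1\<close>])
   fix L :: nat and z x :: "int ^ 'd" assume "L >= 1" "x : (%x. x + z) ` cube L 0"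
   with H[THEN spec[of _ L], THEN spec[of _ z], THEN spec[of _ x], THEN spec[of _ 1]]
   show "avw (Ed ((%x. x + z) ` cube L 0)) (%A. csz A x ^ 2)
    <= C * L ^r ((D + a) / 2) * avw (Ed ((%x. x + z) ` cube L 0)) (%A. csz A x)"
    by (simp add: Let_def)
  qed
 qed
 \<comment> \<open>The first bound keeps \<open>k\<close> below the kernel at distance
   \<open>2 * L\<close>; the second cancels the square of the moment constant in
   \<open>glue_moments\<close>.\<close>
 define k where "k = min (c0 * 2 powr (- (D + a))) (1 / C^2)"
 have k: "0 < k" using c0 C(1) by (simp add: k_def)
 show ?thesis
 proof (intro exI[of _ "k / 2"] conjI allI impI)
  fix L :: nat assume L: "L >= 1"
  let ?z = "(\<chi> i. int L) :: int ^ 'd"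
  define Q0 where "Q0 = cube L (0 :: int ^ 'd)"
  define Q1 where "Q1 = (%x. x + ?z) ` Q0"
  let ?Q = "cube (2 * L) (0 :: int ^ 'd)"
  have "(\<chi> i. int L * (\<chi> i. 1) $ i) = ?z" by (simp add: vec_eq_iff)
  then have Q1: "Q1 = cube L (\<chi> i. 1)" unfolding Q1_def Q0_def using cube_shift[OF L, of "(\<chi> i. 1) :: int ^ 'd"] by simp
  have disj: "Q0 Int Q1 = {}"
   unfolding Q1 Q0_def by (intro cube_disjoint) (simp add: vec_eq_iff)
  have sub: "Q0 Un Q1 \<subseteq> ?Q"
  proof -
   have "0 : cube 2 (0 :: int ^ 'd)" "(\<chi> i. 1) : cube 2 (0 :: int ^ 'd)" by (simp_all add: cube_def)
   then show ?thesis unfolding Q1 Q0_def using subcube[of 2 L "0 :: int ^ 'd" 0] subcube[of 2 L "(\<chi> i. 1) :: int ^ 'd" 0] L by simp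
  qed
  have fin: "finite Q0" "finite Q1" "finite ?Q" using L by (auto simp: Q0_def Q1 intro!: finite_cube)
  have Q0': "Q0 = (%x. x + 0) ` cube L 0" by (simp add: Q0_def)
  let ?e = "%V x. avw (Ed V) (%A. csz A x)"
  let ?k = "k * L ^r (- (D + a))"
  have main: "?k / 2 * ?e Q0 x * ?e Q1 y <= pr (Ed ?Q) x y" if x: "x : Q0" and y: "y : Q1" for x y
  proof -
   have "?k / 2 * ?e Q0 x * ?e Q1 y <= pr (Ed (Q0 Un Q1)) x y"
   proof (rule glue_moments[OF fin(1,2) disj x y])
    fix u v assume uv: "u : Q0" "v : Q1"
    then have "u ~= v" using disj by auto
    have "sd u v <= 2 * L" using uv sub L by (intro cube_sd[of "2 * L" u 0 v]) auto
    then have "real (sd u v) <= 2 * real L" by (metis of_nat_le_iff of_nat_mult of_nat_numeral)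
    then have "(2 * real L) powr (- (D + a)) <= real (sd u v) powr (- (D + a))"
     using sd_pos[OF \<open>u ~= v\<close>] D1 a0 by (intro powr_mono2') auto
    then have "c0 * (2 powr (- (D + a)) * L ^r (- (D + a))) <= c0 * real (sd u v) powr (- (D + a))"
     using c0 by (simp add: powr_mult)
    also have "... <= w u v" by (rule wl[OF \<open>u ~= v\<close>])
    finally have "c0 * 2 powr (- (D + a)) * L ^r (- (D + a)) <= w u v" by (simp add: mult.assoc)
    moreover have "?k <= c0 * 2 powr (- (D + a)) * L ^r (- (D + a))"
     by (intro mult_right_mono) (auto simp: k_def)
    ultimately show "?k <= w u v" by linarith
   next
    show "avw (Ed Q0) (%A. (csz A x)^2) <= (C * L ^r ((D + a) / 2)) * ?e Q0 x"
     using C(2)[OF L, of x 0] x by (simp add: Q0_def)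
    show "avw (Ed Q1) (%A. (csz A y)^2) <= (C * L ^r ((D + a) / 2)) * ?e Q1 y"
     using C(2)[OF L, of y ?z] y by (simp add: Q1_def Q0_def)
    have "L ^r ((D + a) / 2) * L ^r ((D + a) / 2) = L ^r (D + a)"
     by (simp flip: powr_add)
    then have "?k * (C * L ^r ((D + a) / 2) * (C * L ^r ((D + a) / 2)))
      = k * C^2 * (L ^r (- (D + a)) * L ^r (D + a))"
     by (simp add: power2_eq_square mult_ac)
    also have "L ^r (- (D + a)) * L ^r (D + a) = 1"
     using L by (simp flip: powr_add)
    also have "k * C^2 * 1 <= 1 / C^2 * C^2"
     unfolding mult_1_right by (intro mult_right_mono) (auto simp: k_def)
    also have "... = 1" using C(1) by simp
    finally show "?k * (C * L ^r ((D + a) / 2) * (C * L ^r ((D + a) / 2))) <= 1" .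
   qed (use k in auto)
   also have "... <= pr (Ed ?Q) x y" by (intro pr_mono finite_Ed fin Ed_mono sub)
   finally show ?thesis .
  qed
  have e0: "(SUM x:Q0. ?e Q0 x) = SS L"
   unfolding SS_def Q0_def[symmetric] using fin by (intro sum.cong refl avg_card_V) auto
  have e1: "(SUM x:Q1. ?e Q1 x) = SS L"
  proof -
   have "(SUM x:Q1. ?e Q1 x) = (SUM x:Q1. SUM y:Q1. pr (Ed Q1) x y)"
    using fin by (intro sum.cong refl avg_card_V) auto
   also have "... = (SUM x:Q0. SUM y:Q0. pr (Ed Q1) (x + ?z) (y + ?z))"
    unfolding Q1_def by (simp add: sum.reindex inj_on_def)
   finally show ?thesis unfolding Q1_def pr_shift SS_def Q0_def .
  qed
  have "k / 2 * L ^r (- (D + a)) * (SS L)^2 = (SUM x:Q0. SUM y:Q1. ?k / 2 * ?e Q0 x * ?e Q1 y)"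
   unfolding power2_eq_square by (subst (1) e0[symmetric], subst e1[symmetric])
    (simp add: sum_product sum_distrib_left mult_ac, rule sum.swap)
  also have "... <= (SUM x:Q0. SUM y:Q1. pr (Ed ?Q) x y)" by (intro sum_mono main)
  also have "... <= (SUM x:Q0. SUM y:?Q. pr (Ed ?Q) x y)"
   using sub fin pr_bounds[OF finite_Ed[OF fin(3)]] by (intro sum_mono sum_mono2) auto
  also have "... <= SS (2 * L)"
   unfolding SS_def using sub fin pr_bounds[OF finite_Ed[OF fin(3)]] by (intro sum_mono2 sum_nonneg) auto
  finally show "k / 2 * L ^r (- (D + a)) * (SS L)^2 <= SS (2 * L)" .
 qed (use k in simp)
qed

text \<open>After normalization \<open>SS_double\<close> reads v(L)^2 <= v(2L). A value above 2
  would force doubly exponential growth along powers of 2, against the trivial polynomial bound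
  \<open>SS_triv\<close>.\<close>

lemma SS_upper: "EX C>0. ALL L>=1. SS L <= C * L ^r (D + a)"
proof -
 obtain k where k: "k > 0" "\<And>L. L >= 1 ==> k * L ^r (- (D + a)) * (SS L)^2 <= SS (2 * L)"
  using SS_double by auto
 define k1 where "k1 = k * 2 powr (- (D + a))"
 have k1: "k1 > 0" using k by (simp add: k1_def)
 define v where "v = (%L. k1 * SS L * L ^r (- (D + a)))"
 have step: "(v L)^2 <= v (2 * L)" if L: "L >= 1" for L
 proof -
  have "(v L)^2 = k1 * (k * L ^r (- (D + a)) * (SS L)^2) * (2 powr (- (D + a)) * L ^r (- (D + a)))"
   by (simp add: v_def k1_def power2_eq_square mult_ac)
  also have "... <= k1 * SS (2 * L) * (2 powr (- (D + a)) * L ^r (- (D + a)))"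
   using k1 by (intro mult_right_mono mult_left_mono k(2) L) auto
  also have "2 powr (- (D + a)) * L ^r (- (D + a)) = real (2 * L) powr (- (D + a))"
   by (simp add: powr_mult)
  finally show ?thesis by (simp add: v_def)
 qed
 have SS_triv: "SS L <= L ^r (2 * D)" if "L >= 1" for L
 proof -
  have "SS L <= (SUM x:cube L (0 :: int ^ 'd). SUM y:cube L (0 :: int ^ 'd). 1)"
   unfolding SS_def using pr_bounds finite_Ed finite_cube[OF that] by (intro sum_mono) blast
  also have "... = (real L ^ CARD('d)) * (real L ^ CARD('d))" by (simp add: card_cube[OF that])
  also have "... = L ^r (2 * D)" using that by (simp add: powr_Dn flip: powr_add)
  finally show ?thesis .
 qed
 have v2: "v L <= 2" if L: "L >= 1" for L
 proof (rule ccontr)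
  assume "~ v L <= 2"
  then have vL: "2 < v L" by simp
  have it: "2 ^ (2 ^ n) <= v (2 ^ n * L)" for n
  proof (induction n)
   case (Suc n)
   have "(2::real) ^ (2 ^ Suc n) = (2 ^ (2 ^ n))^2" by (simp flip: power_mult)
   also have "... <= (v (2 ^ n * L))^2" using Suc by (intro power_mono) auto
   also have "... <= v (2 * (2 ^ n * L))" using L by (intro step) simp
   finally show ?case by (simp add: mult_ac)
  qed (use vL in simp)
  have up: "v (2 ^ n * L) <= k1 * L ^r (D - a) * (2 powr (D - a)) ^ n" for n
  proof -
   have "2 ^ n * L >= 1" using L by simp
   then have "v (2 ^ n * L) <= k1 * real (2 ^ n * L) powr (2 * D) * real (2 ^ n * L) powr (- (D + a))"
    unfolding v_def using k1 by (intro mult_right_mono mult_left_mono SS_triv) auto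
   also have "... = k1 * real (2 ^ n * L) powr (D - a)"
    by (simp only: mult.assoc flip: powr_add) simp
   also have "real (2 ^ n * L) powr (D - a) = L ^r (D - a) * (2 powr (D - a)) ^ n"
    by (simp add: powr_mult powr_power mult.commute flip: powr_realpow powr_powr)
     (simp add: powr_powr mult.commute)
   finally show ?thesis by (simp add: mult.assoc)
  qed
  have "summable (%n. (2 powr (D - a)) ^ n * (1 / 2) ^ (2 ^ n - 1))"
   by (intro summable_double_exp) auto
  then have "(%n. (2 powr (D - a)) ^ n * (1 / 2) ^ (2 ^ n - 1)) \<longlonglongrightarrow> 0" by (rule summable_LIMSEQ_zero)
  then have "(%n. k1 * L ^r (D - a) * ((2 powr (D - a)) ^ n * (1 / 2) ^ (2 ^ n - 1))) \<longlonglongrightarrow> k1 * L ^r (D - a) * 0"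
   by (rule tendsto_mult_left)
  then have "eventually (%n. k1 * L ^r (D - a) * ((2 powr (D - a)) ^ n * (1 / 2) ^ (2 ^ n - 1)) < 1) sequentially"
   by (rule order_tendstoD) simp
  then obtain n where n: "k1 * L ^r (D - a) * ((2 powr (D - a)) ^ n * (1 / 2) ^ (2 ^ n - 1)) < 1"
   by (auto simp: eventually_sequentially)
  have "(2::real) ^ (2 ^ n - 1) <= 2 ^ (2 ^ n)" by (intro power_increasing) auto
  also have "... <= k1 * L ^r (D - a) * (2 powr (D - a)) ^ n" using it up order_trans by blast
  finally have "2 ^ (2 ^ n - 1) * (1 / 2) ^ (2 ^ n - 1) <= k1 * L ^r (D - a) * (2 powr (D - a)) ^ n * (1 / 2 :: real) ^ (2 ^ n - 1)"
   by (intro mult_right_mono) auto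
  then show False using n by (simp add: mult.assoc power_one_over)
 qed
 show ?thesis
 proof (intro exI[of _ "2 / k1"] conjI allI impI)
  fix L :: nat assume L: "L >= 1"
  have "SS L * L ^r (- (D + a)) <= 2 / k1"
   using v2[OF L] k1 by (simp add: v_def pos_le_divide_eq mult_ac)
  then have "SS L * L ^r (- (D + a)) * L ^r (D + a) <= 2 / k1 * L ^r (D + a)"
   by (intro mult_right_mono) auto
  moreover have "L ^r (- (D + a)) * L ^r (D + a) = 1" using L by (simp flip: powr_add)
  ultimately show "SS L <= 2 / k1 * L ^r (D + a)" by (simp add: mult.assoc)
 qed (use k1 in simp)
qed

text \<open>At least \<open>n ^r D\<close> points of a cube of side \<open>4 * n + 1\<close> have
  their whole box of radius \<open>n\<close> inside it, so \<open>SS\<close> controls that many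
  copies of \<open>en n\<close>.\<close>

lemma en_upper: "EX C>0. ALL n>=1. en n <= C * n ^r a"
proof -
 obtain C where C: "C > 0" "\<And>L. L >= 1 ==> SS L <= C * L ^r (D + a)" using SS_upper by auto
 show ?thesis
 proof (intro exI[of _ "C * 5 powr (D + a)"] conjI allI impI)
  fix n :: nat assume n: "n >= 1"
  define L where "L = 4 * n + 1"
  have L: "L >= 1" by (simp add: L_def)
  let ?Q = "cube L (0 :: int ^ 'd)"
  let ?c = "(\<chi> i. 2 * int n) :: int ^ 'd"
  have sub: "lbox x n \<subseteq> ?Q" if x: "x : lbox ?c n" for x
  proof
   fix y assume "y : lbox x n"
   then show "y : ?Q" using x L
    unfolding cube_eq[OF L] by (auto simp: L_def sd_le_iff abs_le_iff) (smt (verit))+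
  qed
  have fQ: "finite ?Q" using L by (rule finite_cube)
  have "n ^r D * en n <= real (card (lbox ?c n)) * en n"
  proof (intro mult_right_mono)
   have "n ^r D = real n ^ CARD('d)" using n by (simp add: powr_Dn)
   also have "... <= real (2 * n + 1) ^ CARD('d)" by (intro power_mono) auto
   finally show "n ^r D <= real (card (lbox ?c n))" by (simp add: card_lbox)
  qed (use en_ge_1[of n] in simp)
  also have "... = (SUM x:lbox ?c n. en n)" by simp
  also have "... <= (SUM x:lbox ?c n. SUM y:?Q. pr (Ed ?Q) x y)"
  proof (rule sum_mono)
   fix x assume x: "x : lbox ?c n"
   have "en n = (SUM y:lbox x n. pb n (y - x))"
    unfolding en_def
    by (rule sum.reindex_bij_witness[of _ "%u. u - x" "%u. u + x"])
     (use sd_shift[of 0 x] sd_shift[of x "- x"] in auto)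
   also have "... = (SUM y:lbox x n. pr (Ed (lbox x n)) x y)" by (simp add: pr_box)
   also have "... <= (SUM y:lbox x n. pr (Ed ?Q) x y)"
    using sub[OF x] fQ by (intro sum_mono pr_mono finite_Ed Ed_mono)
   also have "... <= (SUM y:?Q. pr (Ed ?Q) x y)"
    using sub[OF x] fQ pr_bounds[OF finite_Ed[OF fQ]] by (intro sum_mono2) auto
   finally show "en n <= (SUM y:?Q. pr (Ed ?Q) x y)" .
  qed
  also have "... <= SS L"
   unfolding SS_def using fQ pr_bounds[OF finite_Ed[OF fQ]] sub self_in_lbox
   by (intro sum_mono2 sum_nonneg) blast+
  also have "... <= C * L ^r (D + a)" by (rule C(2)[OF L])
  also have "... <= C * (5 * real n) powr (D + a)"
   using C n D1 a0 by (intro mult_left_mono powr_mono2) (auto simp: L_def)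
  also have "... = n ^r D * (C * 5 powr (D + a) * n ^r a)"
   using n by (simp add: powr_mult powr_add)
  finally show "en n <= C * 5 powr (D + a) * n ^r a"
   using n by simp
 qed (use C in simp)
qed

text \<open>Apply \<open>phi_ge\<close> to the box of each radius \<open>s <= n\<close>, split the
  outgoing edges at length \<open>n\<close>, and sum over \<open>s\<close>. The short ones are
  bounded by \<open>phi_sum\<close>, the long ones by \<open>K2 * n ^r (- a)\<close> per
  vertex.\<close>

lemma en_lower: "EX c>0. ALL n>=1. c * n ^r a <= en n"
proof -
 define K1 where "K1 = C0 * Kd / (1 - a)"
 have K1: "K1 > 0" using C0 Kd_pos a1 by (simp add: K1_def)
 show ?thesis
 proof (intro exI[of _ "1 / (K1 + K2)"] conjI allI impI)
  fix n :: nat assume n: "n >= 1"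
  have one: "(1::real) <= phi n s + K2 * n ^r (- a) * en n" if s: "s : {1..n}" for s
  proof -
   define g where "g = (%u :: int ^ 'd. (SUM v:lbox u n - lbox 0 s. w u v) + K2 * n ^r (- a))"
   have "1 <= (SUM u:lbox (0 :: int ^ 'd) s. pr (Ed (lbox 0 s)) 0 u * g u)"
   proof (rule phi_ge)
    fix u :: "int ^ 'd" and T :: "(int ^ 'd) set" assume u: "u : lbox 0 s" and T: "finite T" "T Int lbox 0 s = {}"
    have "(SUM v:T. w u v) = (SUM v:T Int lbox u n. w u v) + (SUM v:T - lbox u n. w u v)"
     using T by (metis sum.Int_Diff)
    also have "(SUM v:T Int lbox u n. w u v) <= (SUM v:lbox u n - lbox 0 s. w u v)"
     using T w_nonneg by (intro sum_mono2) auto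
    also have "(SUM v:T - lbox u n. w u v) <= K2 * real (n + 1) powr (- a)"
     using T by (intro sum_w_far) auto
    also have "... <= K2 * n ^r (- a)"
     using K2_pos n a0 by (intro mult_left_mono powr_mono2') auto
    finally show "(SUM v:T. w u v) <= g u" by (simp add: g_def)
   qed auto
   also have "... = phi n s + K2 * n ^r (- a) * (SUM u:lbox 0 s. pb s u)"
    by (simp add: g_def phi_def pb_def distrib_left sum.distrib sum_distrib_left sum_distrib_right mult_ac)
   also have "... <= phi n s + K2 * n ^r (- a) * en n"
    using s K2_pos by (intro add_left_mono mult_left_mono) (auto simp: en_def[symmetric] intro: en_mono)
   finally show ?thesis .
  qed
  have "real n = (SUM s:{1..n}. 1)" by simp
  also have "... <= (SUM s:{1..n}. phi n s + K2 * n ^r (- a) * en n)" by (intro sum_mono one)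
  also have "... = (SUM s:{1..n}. phi n s) + real n * (K2 * n ^r (- a) * en n)" by (simp add: sum.distrib)
  also have "... <= K1 * n ^r (1 - a) * en n + real n * (K2 * n ^r (- a) * en n)"
   unfolding K1_def by (intro add_right_mono phi_sum)
  also have "real n * (K2 * n ^r (- a) * en n) = K2 * n ^r (1 - a) * en n"
   using n by (simp add: powr_diff powr_minus field_simps)
  finally have "real n <= (K1 + K2) * n ^r (1 - a) * en n" by (simp add: algebra_simps)
  then have "real n * n ^r (a - 1) <= (K1 + K2) * en n * (n ^r (1 - a) * n ^r (a - 1))"
   by (metis mult.assoc mult.commute mult_right_mono powr_ge_zero)
  moreover have "n ^r (1 - a) * n ^r (a - 1) = 1" using n by (simp flip: powr_add)
  moreover have "real n * n ^r (a - 1) = n ^r a" using n by (simp add: powr_diff)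
  ultimately show "1 / (K1 + K2) * n ^r a <= en n"
   using K1 K2_pos by (simp add: field_simps)
 qed (use K1 K2_pos in simp)
qed

text \<open>By \<open>phi_sum\<close> and \<open>en_upper\<close> the average of
  \<open>phi R s\<close> over \<open>s <= K * R\<close> is of order K^(a-1). For box sizes that are
  a large multiple of the range, leaving the box is therefore rare for some
  \<open>s\<close>.\<close>

lemma phi_small:
 assumes "\<delta> > 0"
 shows "EX K>=1. ALL R>=1. EX s. 1 <= s & s <= K * R & phi R s <= \<delta>"
proof -
 obtain C where C: "C > 0" "\<And>n. n >= 1 ==> en n <= C * n ^r a" using en_upper by auto
 define K1 where "K1 = C0 * Kd / (1 - a)"
 have K1: "K1 > 0" using C0 Kd_pos a1 by (simp add: K1_def)
 have "((%K. K1 * C * K ^r (a - 1)) \<longlongrightarrow> K1 * C * 0) sequentially"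
  using a1 by (intro tendsto_mult_left tendsto_neg_powr filterlim_real_sequentially) auto
 then have "eventually (%K. K1 * C * K ^r (a - 1) < \<delta>) sequentially"
  by (rule order_tendstoD) (use assms in simp)
 then obtain K where K: "K >= 1" "K1 * C * K ^r (a - 1) < \<delta>"
  unfolding eventually_sequentially by (meson le_cases le_trans order.refl)
 show ?thesis
 proof (rule exI[of _ K], intro conjI K(1) allI impI)
  fix R :: nat assume R: "R >= 1"
  have KR: "K * R >= 1" using K R by simp
  have "(SUM s:{1..K * R}. phi R s) <= K1 * R ^r (1 - a) * en (K * R)"
   unfolding K1_def by (rule phi_sum)
  also have "... <= K1 * R ^r (1 - a) * (C * real (K * R) powr a)"
   using K1 by (intro mult_left_mono C KR) auto
  also have "... = K1 * C * K ^r (a - 1) * real (K * R)"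
   using K R by (simp add: powr_mult powr_diff field_simps)
  also have "... < \<delta> * real (K * R)"
   using K KR by (intro mult_strict_right_mono) auto
  also have "... = (SUM s:{1..K * R}. \<delta>)" by simp
  finally have "EX s:{1..K * R}. phi R s < \<delta>" by (meson not_le sum_mono)
  then show "EX s. 1 <= s & s <= K * R & phi R s <= \<delta>" by (force simp: less_imp_le)
 qed
qed

end

text \<open>Finite volume provides the crude bound \<open>b\<close>, which makes the supremum
  finite; the supremum then satisfies \<open>S <= A + S / 2\<close>.\<close>

lemma self_improve:
 fixes f :: "'i => real"
 assumes step: "\<And>X i. 0 <= X ==> (\<And>i. f i <= X) ==> f i <= A + X / 2"
  and bdd: "\<And>i. f i <= b" and f0: "\<And>i. 0 <= f i"
 shows "f i <= 2 * A"
proof -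
 define S where "S = (SUP i. f i)"
 have bd: "bdd_above (range f)" using bdd by (auto simp: bdd_above_def)
 have S: "f i <= S" for i unfolding S_def by (rule cSUP_upper[OF UNIV_I bd])
 have "0 <= S" using S f0 order_trans by blast
 then have "f i <= A + S / 2" for i using step S by blast
 then have "S <= A + S / 2" unfolding S_def by (intro cSUP_least) auto
 then have "S <= 2 * A" by simp
 then show ?thesis using S[of i] by linarith
qed

section \<open>Truncated susceptibility and two-point bounds\<close>

context kern
begin

definition Cf :: real where "Cf = C0 * 2 powr a * 2"

lemma Cf_pos: "0 < Cf"
 using C0 by (simp add: Cf_def)

text \<open>On the dyadic shell at scale r the kernel is of order r^(-d-a) and \<open>f\<close> has
  mass of order G r^a. The product r^(-d) sums geometrically over the shells.\<close>

lemma far_sum: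
 assumes G: "0 <= G" "\<And>v. 0 <= f v" "\<And>y r. r >= 1 ==> (SUM z:lbox y r. f z) <= G * r ^r a"
  and T: "finite T" "\<And>v. v : T ==> \<rho> < sd u v" and \<rho>: "\<rho> >= 1"
 shows "(SUM v:T. w u v * f v) <= Cf * G * real \<rho> powr (- D)"
proof -
 have A: "(SUM v:T. w u v * f v) <= C0 * 2 powr a * G * real \<rho> powr (- D) * (SUM k<n. (1 / 2) ^ k)"
  if "finite T" "\<And>v. v : T ==> \<rho> < sd u v & sd u v <= 2 ^ n * \<rho>" for n T
  using that
 proof (induction n arbitrary: T)
  case 0
  then have "T = {}" by force
  then show ?case by simp
 next
  case (Suc n)
  let ?m = "2 ^ n * \<rho>"
  have m1: "?m >= 1" using \<rho> by simp
  have "(SUM v:T. w u v * f v) = (SUM v:T Int lbox u ?m. w u v * f v) + (SUM v:T - lbox u ?m. w u v * f v)"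
   using Suc by (intro sum.Int_Diff) auto
  also have "(SUM v:T Int lbox u ?m. w u v * f v) <= C0 * 2 powr a * G * real \<rho> powr (- D) * (SUM k<n. (1 / 2) ^ k)"
   using Suc.prems by (intro Suc.IH) auto
  also have "(SUM v:T - lbox u ?m. w u v * f v) <= (SUM v:T - lbox u ?m. C0 * ?m ^r (- (D + a)) * f v)"
  proof (intro sum_mono mult_right_mono G)
   fix v assume v: "v : T - lbox u ?m"
   then have "u ~= v" using m1 by auto
   have "real ?m <= real (sd u v)" using v by (intro of_nat_mono) auto
   then have "real (sd u v) powr (- (D + a)) <= ?m ^r (- (D + a))"
    using m1 D1 a0 by (intro powr_mono2') auto
   then have "C0 * real (sd u v) powr (- (D + a)) <= C0 * ?m ^r (- (D + a))"
    using C0 by (intro mult_left_mono) auto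
   then show "w u v <= C0 * ?m ^r (- (D + a))" using wu[OF \<open>u ~= v\<close>] by linarith
  qed
  also have "... = C0 * ?m ^r (- (D + a)) * (SUM v:T - lbox u ?m. f v)" by (simp add: sum_distrib_left)
  also have "... <= C0 * ?m ^r (- (D + a)) * (SUM v:lbox u (2 * ?m). f v)"
   using C0 G Suc.prems by (intro mult_left_mono sum_mono2) (auto simp: mult.assoc)
  also have "... <= C0 * ?m ^r (- (D + a)) * (G * real (2 * ?m) powr a)"
   using C0 m1 by (intro mult_left_mono G) auto
  also have "... = C0 * 2 powr a * G * (?m ^r (- (D + a)) * ?m ^r a)"
   by (simp add: powr_mult mult_ac)
  also have "?m ^r (- (D + a)) * ?m ^r a = ?m ^r (- D)"
   by (simp only: flip: powr_add) simp
  also have "?m ^r (- D) = real \<rho> powr (- D) * (2 ^ n) powr (- D)"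
   by (simp add: powr_mult mult.commute)
  also have "C0 * 2 powr a * G * (real \<rho> powr (- D) * (2 ^ n) powr (- D))
    <= C0 * 2 powr a * G * (real \<rho> powr (- D) * (1 / 2) ^ n)"
  proof (intro mult_left_mono)
   have "(2 ^ n :: real) powr (- D) <= (2 ^ n) powr (- 1)" using D1 by (intro powr_mono) auto
   then show "(2 ^ n :: real) powr (- D) <= (1 / 2) ^ n" by (simp add: powr_minus power_one_over inverse_eq_divide)
  qed (use C0 G in auto)
  finally show ?case by (simp add: algebra_simps)
 qed
 define n where "n = Max (insert 0 (sd u ` T))"
 have "sd u v <= 2 ^ n * \<rho>" if "v : T" for v
 proof -
  have "sd u v <= n" unfolding n_def using T that by (intro Max_ge) auto
  also have "n <= 2 ^ n * 1" using less_exp[of n] by simp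
  also have "... <= 2 ^ n * \<rho>" using \<rho> by (intro mult_left_mono) auto
  finally show ?thesis .
 qed
 then have "(SUM v:T. w u v * f v) <= C0 * 2 powr a * G * real \<rho> powr (- D) * (SUM k<n. (1 / 2) ^ k)"
  using T by (intro A) auto
 also have "(SUM k<n. (1 / 2 :: real) ^ k) <= 2"
  by (subst sum_gp_strict) auto
 then have "C0 * 2 powr a * G * real \<rho> powr (- D) * (SUM k<n. (1 / 2) ^ k)
  <= C0 * 2 powr a * G * real \<rho> powr (- D) * 2"
  using C0 G by (intro mult_left_mono) auto
 finally show ?thesis by (simp add: Cf_def mult_ac)
qed

lemma exit_sum:
 assumes V: "finite V" and Y: "finite Y"
  and X: "\<And>v. sd 0 v <= s + R ==> (SUM y:Y. pr (EdR V R) (x + v) y) <= X"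
 shows "(SUM y:Y. pr (EdR V R) x y) <= (SUM y:Y. of_bool (sd x y <= s) * pb s (y - x)) + phi R s * X"
proof -
 have "(SUM y:Y. pr (EdR V R) x y) <= (SUM y:Y. of_bool (sd x y <= s) * pb s (y - x)
  + (SUM u:lbox 0 s. SUM v:lbox u R - lbox 0 s. pb s u * w u v * pr (EdR V R) (x + v) y))"
  by (intro sum_mono exit_bound V)
 also have "... = (SUM y:Y. of_bool (sd x y <= s) * pb s (y - x))
  + (SUM u:lbox 0 s. SUM v:lbox u R - lbox 0 s. pb s u * w u v * (SUM y:Y. pr (EdR V R) (x + v) y))"
  unfolding sum.distrib sum_distrib_left
  by (subst sum.swap, rule arg_cong2[of _ _ _ _ "(+)"], rule refl, rule sum.cong, rule refl, rule sum.swap)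
 also have "... <= (SUM y:Y. of_bool (sd x y <= s) * pb s (y - x))
  + (SUM u:lbox 0 s. SUM v:lbox u R - lbox 0 s. pb s u * w u v * X)"
 proof (intro add_left_mono sum_mono mult_left_mono X mult_nonneg_nonneg pb_nonneg w_nonneg)
  fix u v :: "int ^ 'd" assume "u : lbox 0 s" "v : lbox u R - lbox 0 s"
  then show "sd 0 v <= s + R" using sd_triangle[of 0 v u] by simp
 qed
 finally show ?thesis by (simp add: phi_def sum_distrib_right)
qed

lemma exit_first_sum:
 assumes "finite Y"
 shows "(SUM y:Y. of_bool (sd x y <= s) * pb s (y - x)) <= en s"
proof -
 have "(SUM y:Y. of_bool (sd x y <= s) * pb s (y - x)) = (SUM y:Y Int lbox x s. pb s (y - x))"
  using assms by (intro sum.mono_neutral_cong_right) auto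
 also have "... <= (SUM y:lbox x s. pb s (y - x))"
  using pb_nonneg by (intro sum_mono2) auto
 also have "... = en s"
  unfolding en_def
  by (rule sum.reindex_bij_witness[of _ "%u. u + x" "%u. u - x"])
   (use sd_shift[of 0 x] sd_shift[of x "- x"] in auto)
 finally show ?thesis .
qed

end

context crit
begin

abbreviation "chi_decay_with C K \<equiv>
 ALL R>=1. ALL V Y x j. finite V --> finite Y --> (ALL y:Y. j * (K * R) <= sd x y) -->
  (SUM y:Y. pr (EdR V R) x y) <= C * R ^r a * (1 / 2) ^ j"

text \<open>Choose \<open>s\<close> of order \<open>R\<close> with \<open>phi R s <= 1 / 2\<close>:
  each exit from a box of radius \<open>s\<close> costs a factor 1/2 and advances by at most
  \<open>s + R\<close>. The case \<open>j = 0\<close> is self-improvement; the rest counts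
  exits.\<close>

lemma chi_decay: "EX C>0. EX K>=1. chi_decay_with C K"
proof -
 obtain C where C: "C > 0" "\<And>n. n >= 1 ==> en n <= C * n ^r a" using en_upper by auto
 obtain K where K: "K >= 1" "\<And>R. R >= 1 ==> EX s. 1 <= s & s <= K * R & phi R s <= 1 / 2"
  using phi_small[of "1 / 2"] by auto
 define A where "A = C * K ^r a"
 show ?thesis
 proof (rule exI[of _ "2 * A"], intro conjI, use C K in \<open>simp add: A_def\<close>,
   rule exI[of _ "K + 2"], intro conjI allI impI, simp)
  fix R :: nat and V Y :: "(int ^ 'd) set" and x :: "int ^ 'd" and j
  assume R: "R >= 1" and V: "finite V" and "finite Y" "ALL y:Y. j * ((K + 2) * R) <= sd x y"
  obtain s where s: "1 <= s" "s <= K * R" "phi R s <= 1 / 2" using K(2)[OF R] by auto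
  have es: "en s <= A * R ^r a"
  proof -
   have "en s <= C * s ^r a" by (rule C(2)[OF s(1)])
   also have "... <= C * real (K * R) powr a"
    using s C a0 by (intro mult_left_mono powr_mono2 of_nat_mono) auto
   finally show ?thesis by (simp add: A_def powr_mult mult.assoc)
  qed
  have base: "(SUM y:Y. pr (EdR V R) x y) <= 2 * (A * R ^r a)" if Y: "finite Y" for x Y
  proof (rule self_improve[of "%x. SUM y:Y. pr (EdR V R) x y" _ "real (card Y)"])
   fix X x assume X: "0 <= X" "\<And>i. (SUM y:Y. pr (EdR V R) i y) <= X"
   have "(SUM y:Y. pr (EdR V R) x y) <= (SUM y:Y. of_bool (sd x y <= s) * pb s (y - x)) + phi R s * X"
    by (intro exit_sum V Y X)
   also have "... <= A * R ^r a + 1 / 2 * X"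
    using exit_first_sum[OF Y, of x s] es s X by (intro add_mono mult_right_mono) auto
   finally show "(SUM y:Y. pr (EdR V R) x y) <= A * R ^r a + X / 2" by simp
  next
   fix x
   have "(SUM y:Y. pr (EdR V R) x y) <= (SUM y:Y. 1)"
    using pr_bounds[OF finite_EdR[OF V]] by (intro sum_mono) auto
   then show "(SUM y:Y. pr (EdR V R) x y) <= real (card Y)" by simp
  qed (use pr_bounds[OF finite_EdR[OF V]] in \<open>auto intro!: sum_nonneg\<close>)
  have "(SUM y:Y. pr (EdR V R) x y) <= 2 * (A * R ^r a) * (1 / 2) ^ j"
   if "finite Y" "ALL y:Y. j * ((K + 2) * R) <= sd x y" for j x Y
   using that
  proof (induction j arbitrary: x)
   case 0
   then show ?case using base by simp
  next
   case (Suc j)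
   \<comment> \<open>One exit covers at most \<open>(K + 1) * R\<close>. The additional
     \<open>R\<close> makes the target lie strictly outside the first box, so the term without an
     exit vanishes.\<close>
   have far: "Suc j * ((K + 2) * R) >= j * ((K + 2) * R) + (s + R) + 1"
    using s(2) R by (simp add: algebra_simps)
   have "(SUM y:Y. pr (EdR V R) x y) <= (SUM y:Y. of_bool (sd x y <= s) * pb s (y - x))
     + phi R s * (2 * (A * R ^r a) * (1 / 2) ^ j)"
   proof (rule exit_sum[OF V Suc.prems(1)], rule Suc.IH[OF Suc.prems(1)], rule ballI)
    fix v y :: "int ^ 'd" assume v: "sd 0 v <= s + R" and "y : Y"
    then have "Suc j * ((K + 2) * R) <= sd x y" using Suc.prems by blast
    moreover have "sd x y <= sd x (x + v) + sd (x + v) y" by (rule sd_triangle)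
    moreover have "sd x (x + v) = sd 0 v" using sd_shift_left[of x 0 v] by simp
    ultimately show "j * ((K + 2) * R) <= sd (x + v) y" using far v by linarith
   qed
   also have "(SUM y:Y. of_bool (sd x y <= s) * pb s (y - x)) = 0"
   proof (rule sum.neutral, rule ballI)
    fix y assume "y : Y"
    then have "Suc j * ((K + 2) * R) <= sd x y" using Suc.prems by blast
    then have "~ sd x y <= s" using far by linarith
    then show "of_bool (sd x y <= s) * pb s (y - x) = 0" by simp
   qed
   also have "0 + phi R s * (2 * (A * R ^r a) * (1 / 2) ^ j) <= 1 / 2 * (2 * (A * R ^r a) * (1 / 2) ^ j)"
    unfolding add_0 using s C by (intro mult_right_mono) (auto simp: A_def)
   finally show ?case by simp
  qed
  from this[OF \<open>finite Y\<close> \<open>ALL y:Y. j * ((K + 2) * R) <= sd x y\<close>]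
  show "(SUM y:Y. pr (EdR V R) x y) <= 2 * A * R ^r a * (1 / 2) ^ j" by (simp add: mult_ac)
 qed
qed

abbreviation "chi_upper_with C \<equiv>
 ALL R>=1. ALL V Y x. finite V --> finite Y --> (SUM y:Y. pr (EdR V R) x y) <= C * R ^r a"

lemma chi_upper: "EX C>0. chi_upper_with C"
proof -
 obtain C K where C: "C > 0" and H: "chi_decay_with C K"
  using chi_decay by blast
 show ?thesis
 proof (intro exI[of _ C] conjI C allI impI)
  fix R :: nat and V Y :: "(int ^ 'd) set" and x :: "int ^ 'd"
  assume "R >= 1" "finite V" "finite Y"
  then show "(SUM y:Y. pr (EdR V R) x y) <= C * R ^r a"
   using H[rule_format, of R V Y 0 x] by simp
 qed
qed

text \<open>Explore the cluster of \<open>x\<close> with edges of length at most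
  \<open>\<rho>\<close>. A connection that this misses uses a longer edge out of the explored
  cluster, and \<open>far_sum\<close> bounds the continuation.\<close>

lemma truncate:
 assumes V: "finite V" and G: "0 <= G" "\<And>x y r. r >= 1 ==> (SUM z:lbox y r. pr (Ed V) x z) <= G * r ^r a"
  and C: "\<And>Y. finite Y ==> (SUM y:Y. pr (EdR V \<rho>) x y) <= X" and \<rho>: "\<rho> >= 1"
 shows "pr (Ed V) x z <= pr (EdR V \<rho>) x z + X * (Cf * G * real \<rho> powr (- D))"
proof -
 have fE: "finite (Ed V)" "finite (EdR V \<rho>)" using V by (auto intro: finite_Ed finite_EdR)
 have K: "0 <= Cf * G * real \<rho> powr (- D)" using Cf_pos G by simp
 have "pr (Ed V) x z <= pr (EdR V \<rho>) x z + (SUM u:V. SUM v:V. of_bool ({u, v} : Ed V - EdR V \<rho>) * (pr (EdR V \<rho>) x u * w u v * pr (Ed V) v z))"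
  by (intro decompose V EdR_subset_Ed order.refl)
 also have "(SUM u:V. SUM v:V. of_bool ({u, v} : Ed V - EdR V \<rho>) * (pr (EdR V \<rho>) x u * w u v * pr (Ed V) v z))
  = (SUM u:V. pr (EdR V \<rho>) x u * (SUM v:V. of_bool ({u, v} : Ed V - EdR V \<rho>) * (w u v * pr (Ed V) v z)))"
  by (simp add: sum_distrib_left mult_ac)
 also have "... <= (SUM u:V. pr (EdR V \<rho>) x u * (Cf * G * real \<rho> powr (- D)))"
 proof (intro sum_mono mult_left_mono)
  fix u assume u: "u : V"
  have "(SUM v:V. of_bool ({u, v} : Ed V - EdR V \<rho>) * (w u v * pr (Ed V) v z))
   = (SUM v:{v\<in>V. \<rho> < sd u v}. w u v * pr (Ed V) v z)"
   using V u \<rho> by (intro sum.mono_neutral_cong_right) auto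
  also have "... = (SUM v:{v\<in>V. \<rho> < sd u v}. w u v * pr (Ed V) z v)"
   by (intro sum.cong refl) (simp add: prb_conn_commute)
  also have "... <= Cf * G * real \<rho> powr (- D)"
   using V \<rho> pr_bounds[OF fE(1)] by (intro far_sum G) auto
  finally show "(SUM v:V. of_bool ({u, v} : Ed V - EdR V \<rho>) * (w u v * pr (Ed V) v z)) <= Cf * G * real \<rho> powr (- D)" .
 qed (use pr_bounds[OF fE(2)] in auto)
 also have "... = (SUM u:V. pr (EdR V \<rho>) x u) * (Cf * G * real \<rho> powr (- D))" by (simp add: sum_distrib_right)
 also have "... <= X * (Cf * G * real \<rho> powr (- D))" by (intro mult_right_mono C V K)
 finally show ?thesis by simp
qed

abbreviation "box_upper_with C \<equiv>
 ALL V x y r. finite V --> r >= 1 --> (SUM z:lbox y r. pr (Ed V) x z) <= C * r ^r a"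

text \<open>The box is centred at an arbitrary \<open>y\<close>, so the estimate is not just the
  expected cluster size. Truncating at length \<open>l * r\<close> leaves a main term bounded by the
  truncated susceptibility. The error is \<open>l ^r (a - D)\<close> times the quantity being
  bounded, and a large \<open>l\<close> permits self-improvement.\<close>

lemma box_upper: "EX C>0. box_upper_with C"
proof -
 obtain C where C: "C > 0" and chi_all: "chi_upper_with C"
  using chi_upper by blast
 note chi = chi_all[rule_format]
 have "((%l. C * 3 ^ CARD('d) * Cf * l ^r (a - D)) \<longlongrightarrow> C * 3 ^ CARD('d) * Cf * 0) sequentially"
  using aD by (intro tendsto_mult_left tendsto_neg_powr filterlim_real_sequentially) auto
 then have "eventually (%l. C * 3 ^ CARD('d) * Cf * l ^r (a - D) < 1 / 2) sequentially"
  by (rule order_tendstoD) simp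
 then obtain l where l: "l >= 1" "C * 3 ^ CARD('d) * Cf * l ^r (a - D) < 1 / 2"
  unfolding eventually_sequentially by (meson le_cases le_trans order.refl)
 show ?thesis
 proof (intro exI[of _ "2 * (C * l ^r a)"] conjI allI impI)
  fix V :: "(int ^ 'd) set" and x y :: "int ^ 'd" and r :: nat
  assume V: "finite V" and r: "r >= 1"
  have pb: "0 <= pr (Ed V) x z & pr (Ed V) x z <= 1" for x z by (intro pr_bounds finite_Ed V)
  \<comment> \<open>The radius is \<open>Suc r\<close>, so that the index type carries no positivity
    condition.\<close>
  define F where "F = (%(x, y, r). (SUM z:lbox y (Suc r). pr (Ed V) x z) / real (Suc r) powr a)"
  have "F (x, y, r - 1) <= 2 * (C * l ^r a)"
  proof (rule self_improve[of F _ "real (card V + 1)"])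
   fix X and i :: "(int ^ 'd) \<times> (int ^ 'd) \<times> nat" assume X: "0 <= X" "\<And>i. F i <= X"
   obtain x y r' where i: "i = (x, y, r')" by (cases i)
   define r where "r = Suc r'"
   have r1: "r >= 1" by (simp add: r_def)
   have G: "(SUM z:lbox y r. pr (Ed V) x z) <= X * r ^r a" if "r >= 1" for x y r
    using X(2)[of "(x, y, r - 1)"] that by (simp add: F_def pos_divide_le_eq)
   define \<rho> where "\<rho> = l * r"
   have \<rho>: "\<rho> >= 1" using l r1 by (simp add: \<rho>_def)
   have "(SUM z:lbox y r. pr (Ed V) x z) <= (SUM z:lbox y r. pr (EdR V \<rho>) x z + C * real \<rho> powr a * (Cf * X * real \<rho> powr (- D)))"
    by (intro sum_mono truncate V X(1) G chi \<rho>)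
   also have "... = (SUM z:lbox y r. pr (EdR V \<rho>) x z) + real (card (lbox y r)) * (C * real \<rho> powr a * (Cf * X * real \<rho> powr (- D)))"
    by (simp add: sum.distrib)
   also have "... <= C * real \<rho> powr a + (3 ^ CARD('d) * r ^r D) * (C * real \<rho> powr a * (Cf * X * real \<rho> powr (- D)))"
   proof (intro add_mono chi \<rho> V mult_right_mono)
    have "real (card (lbox y r)) = real (2 * r + 1) ^ CARD('d)" by (simp add: card_lbox)
    also have "... <= (3 * real r) ^ CARD('d)" using r1 by (intro power_mono) auto
    also have "... = 3 ^ CARD('d) * r ^r D" using r1 by (simp add: power_mult_distrib powr_Dn)
    finally show "real (card (lbox y r)) <= 3 ^ CARD('d) * r ^r D" .
   qed (use C Cf_pos X in auto)
   also have "(3 ^ CARD('d) * r ^r D) * (C * real \<rho> powr a * (Cf * X * real \<rho> powr (- D)))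
    = (C * 3 ^ CARD('d) * Cf * l ^r (a - D)) * (X * r ^r a)"
   proof -
    have "r ^r D * (real \<rho> powr a * real \<rho> powr (- D)) = l ^r (a - D) * r ^r a"
     using r1 l by (simp add: \<rho>_def powr_mult powr_minus powr_diff field_simps)
    then show ?thesis by (simp add: mult_ac)
   qed
   also have "... <= 1 / 2 * (X * r ^r a)" using l X by (intro mult_right_mono) auto
   also have "C * real \<rho> powr a = C * l ^r a * r ^r a" by (simp add: \<rho>_def powr_mult)
   finally have "(SUM z:lbox y r. pr (Ed V) x z) <= (C * l ^r a + X / 2) * r ^r a" by (simp add: algebra_simps)
   then show "F i <= C * l ^r a + X / 2"
    using r1 unfolding i F_def r_def by (simp add: pos_divide_le_eq)
  next
   fix i :: "(int ^ 'd) \<times> (int ^ 'd) \<times> nat"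
   obtain x y r where i: "i = (x, y, r)" by (cases i)
   have "(SUM z:lbox y (Suc r). pr (Ed V) x z) <= (SUM z:lbox y (Suc r). of_bool (z : insert x V))"
   proof (rule sum_mono)
    fix z show "pr (Ed V) x z <= of_bool (z : insert x V)"
     using pb[of x z] pr_outside[of "Ed V" V x z] pr_outside'[of "Ed V" V x z] by (cases "z : insert x V"; cases "x : V") auto
   qed
   also have "... = real (card (insert x V Int lbox y (Suc r)))" by (simp add: card_Int_sum)
   also have "... <= real (card (insert x V))" using V by (intro of_nat_mono card_mono) auto
   also have "... <= real (card V + 1)" using card_insert_le_m1[of "card V + 1" V x] by (simp add: card_insert_if V)
   also have "... <= real (card V + 1) * real (Suc r) powr a"
    using a0 mult_left_mono[of 1 "real (Suc r) powr a" "real (card V + 1)"] ge_one_powr_ge_zero[of "real (Suc r)" a] by simp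
   finally show "F i <= real (card V + 1)" unfolding i F_def by (simp add: pos_divide_le_eq)
  qed (auto simp: F_def pb intro!: divide_nonneg_nonneg sum_nonneg)
  then show "(SUM z:lbox y r. pr (Ed V) x z) <= 2 * (C * l ^r a) * r ^r a"
   using r by (simp add: F_def pos_divide_le_eq)
 qed (use C l in simp)
qed

abbreviation "truncate_error_with C \<equiv>
 ALL V x y \<rho>. finite V --> \<rho> >= 1 --> pr (Ed V) x y <= pr (EdR V \<rho>) x y + C * real \<rho> powr (a - D)"

lemma truncate_error: "EX C>0. truncate_error_with C"
proof -
 obtain G where G0: "G > 0" and G_all: "box_upper_with G"
  using box_upper by blast
 note G = G0 G_all[rule_format]
 obtain C where C: "C > 0" and chi_all: "chi_upper_with C"
  using chi_upper by blast
 note chi = chi_all[rule_format]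
 show ?thesis
 proof (intro exI[of _ "C * Cf * G"] conjI allI impI)
  fix V :: "(int ^ 'd) set" and x y and \<rho> :: nat assume V: "finite V" and \<rho>: "\<rho> >= 1"
  have "pr (Ed V) x y <= pr (EdR V \<rho>) x y + C * real \<rho> powr a * (Cf * G * real \<rho> powr (- D))"
   using G V by (intro truncate V chi \<rho>) auto
  also have "C * real \<rho> powr a * (Cf * G * real \<rho> powr (- D)) = C * Cf * G * (real \<rho> powr a * real \<rho> powr (- D))" by simp
  also have "real \<rho> powr a * real \<rho> powr (- D) = real \<rho> powr (a - D)" by (simp only: flip: powr_add) simp
  finally show "pr (Ed V) x y <= pr (EdR V \<rho>) x y + C * Cf * G * real \<rho> powr (a - D)" .
 qed (use C G Cf_pos in simp)
qed

abbreviation "point_upper_with C \<equiv>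
 ALL V x y. finite V --> x ~= y --> pr (Ed V) x y <= C * real (sd x y) powr (a - D)"

text \<open>Truncate at a length \<open>\<rho>\<close> proportional to the distance. With only these
  edges, \<open>y\<close> is reached after leaving a box of radius \<open>s\<close> around
  \<open>x\<close>, which costs \<open>phi \<rho> s <= \<delta>\<close> and leaves at least half of
  the distance; then self-improvement applies.\<close>

lemma point_upper: "EX C>0. point_upper_with C"
proof -
 obtain C where C0: "C > 0" and C_all: "truncate_error_with C"
  using truncate_error by blast
 note C = C0 C_all[rule_format]
 \<comment> \<open>Half of the factor lost when the distance is halved, so that the recursive term
   is at most \<open>X / 2\<close>.\<close>
 define \<delta> where "\<delta> = 2 powr (a - D) / 2"
 obtain K where K: "K >= 1" "\<And>R. R >= 1 ==> EX s. 1 <= s & s <= K * R & phi R s <= \<delta>"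
  using phi_small[of \<delta>] by (auto simp: \<delta>_def)
 \<comment> \<open>From this distance on, \<open>\<rho> = r div (2 * (K + 1))\<close> is positive,
   and \<open>r0\<close> also bounds \<open>r / \<rho>\<close>; smaller distances are absorbed by
   the first summand of \<open>A\<close>.\<close>
 define r0 where "r0 = 4 * (K + 1)"
 define A where "A = r0 ^r (D - a) + C * r0 ^r (D - a)"
 have A: "A > 0" using C by (simp add: A_def r0_def add_pos_pos)
 show ?thesis
 proof (intro exI[of _ "2 * A"] conjI allI impI)
  fix V :: "(int ^ 'd) set" and x y :: "int ^ 'd" assume V: "finite V" and xy: "x ~= y"
  have fE: "finite (Ed V)" "finite (EdR V R)" for R using V by (auto intro: finite_Ed finite_EdR)
  note pbd = pr_bounds[OF fE(1)]
  define F where "F = (%(x, y). pr (Ed V) x y * real (sd x y) powr (D - a))"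
  define b where "b = (SUM x:V. SUM y:V. real (sd x y) powr (D - a))"
  have "F (x, y) <= 2 * A"
  proof (rule self_improve[of F A b])
   fix X and i :: "(int ^ 'd) \<times> (int ^ 'd)" assume X: "0 <= X" "\<And>i. F i <= X"
   obtain x y where i: "i = (x, y)" by (cases i)
   define r where "r = sd x y"
   show "F i <= A + X / 2"
   proof (cases "r < r0")
    case True
    have "F i = pr (Ed V) x y * r ^r (D - a)" by (simp add: i F_def r_def)
    also have "... <= 1 * r0 ^r (D - a)"
     using True pbd[of x y] aD by (intro mult_mono powr_mono2) auto
    also have "... <= A + X / 2" using X C by (simp add: A_def)
    finally show ?thesis .
   next
    case False
    then have r: "r0 <= r" by simp
    define \<rho> where "\<rho> = r div (2 * (K + 1))"
    have "2 * (K + 1) <= r" using r by (simp add: r0_def)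
    then have \<rho>1: "\<rho> >= 1" unfolding \<rho>_def by (simp add: div_greater_zero_iff Suc_le_eq)
    have "2 * (K + 1) * \<rho> <= r" unfolding \<rho>_def by (rule times_div_less_eq_dividend)
    then have \<rho>r: "2 * (K * \<rho> + \<rho>) <= r" by (simp add: algebra_simps)
    have "r < 2 * (K + 1) * (\<rho> + 1)"
     unfolding \<rho>_def using dividend_less_times_div[of "2 * (K + 1)" r] by (simp add: algebra_simps)
    also have "... <= 2 * (K + 1) * (2 * \<rho>)" using \<rho>1 by (intro mult_left_mono) auto
    finally have rr: "r <= r0 * \<rho>" by (simp add: r0_def algebra_simps)
    obtain s where s: "1 <= s" "s <= K * \<rho>" "phi \<rho> s <= \<delta>" using K(2)[OF \<rho>1] by auto
    have s\<rho>: "2 * s + 2 * \<rho> <= r"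
     using mult_le_mono2[OF s(2), of 2] \<rho>r by (simp add: algebra_simps)
    have rpos: "r > 0" using r by (simp add: r0_def)
    have "(SUM y:{y}. pr (EdR V \<rho>) x y) <= (SUM y:{y}. of_bool (sd x y <= s) * pb s (y - x))
      + phi \<rho> s * (X * (real r / 2) powr (a - D))"
    proof (rule exit_sum[OF V])
     fix v :: "int ^ 'd" assume v: "sd 0 v <= s + \<rho>"
     have "r <= sd x (x + v) + sd (x + v) y" unfolding r_def by (rule sd_triangle)
     moreover have "sd x (x + v) = sd 0 v" using sd_shift_left[of x 0 v] by simp
     ultimately have far: "r <= 2 * sd (x + v) y" using v s\<rho> by linarith
     then have pos: "sd (x + v) y > 0" using rpos by simp
     have "pr (EdR V \<rho>) (x + v) y <= pr (Ed V) (x + v) y"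
      by (intro pr_mono fE EdR_subset_Ed)
     also have "... = F (x + v, y) * real (sd (x + v) y) powr (a - D)"
     proof -
      have "x + v ~= y" using pos by auto
      then show ?thesis by (simp add: F_def mult.assoc flip: powr_add)
     qed
     also have "... <= X * (real r / 2) powr (a - D)"
      using X(1) far pos rpos aD pbd[of "x + v" y]
      by (intro mult_mono X(2) powr_mono2') auto
     finally show "(SUM y:{y}. pr (EdR V \<rho>) (x + v) y) <= X * (real r / 2) powr (a - D)" by simp
    qed simp
    moreover have "~ sd x y <= s" using s\<rho> rpos \<rho>1 unfolding r_def by linarith
    ultimately have "pr (EdR V \<rho>) x y <= phi \<rho> s * (X * (real r / 2) powr (a - D))" by simp
    also have "... <= \<delta> * (X * (real r / 2) powr (a - D))"
     using s X by (intro mult_right_mono) auto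
    also have "(real r / 2) powr (a - D) = r ^r (a - D) * 2 powr (D - a)"
     by (simp add: powr_divide powr_diff)
    also have "\<delta> * (X * (r ^r (a - D) * 2 powr (D - a))) = X / 2 * r ^r (a - D)"
     by (simp add: \<delta>_def powr_diff)
    finally have 1: "pr (EdR V \<rho>) x y <= X / 2 * r ^r (a - D)" .
    have "real \<rho> powr (a - D) <= (real r / real r0) powr (a - D)"
    proof (rule powr_mono2')
     have "real r <= real r0 * real \<rho>" using rr by (metis of_nat_le_iff of_nat_mult)
     then show "real r / real r0 <= real \<rho>" by (simp add: r0_def pos_divide_le_eq mult.commute)
    qed (use aD rpos in \<open>auto simp: r0_def\<close>)
    also have "... = r ^r (a - D) * r0 ^r (D - a)" by (simp add: powr_divide powr_diff)
    finally have "C * real \<rho> powr (a - D) <= C * (r ^r (a - D) * r0 ^r (D - a))"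
     using C by (intro mult_left_mono) auto
    then have "pr (Ed V) x y <= X / 2 * r ^r (a - D) + C * (r ^r (a - D) * r0 ^r (D - a))"
     using C(2)[OF V \<rho>1, of x y] 1 by linarith
    then have "pr (Ed V) x y * r ^r (D - a)
      <= (X / 2 * r ^r (a - D) + C * (r ^r (a - D) * r0 ^r (D - a))) * r ^r (D - a)"
     by (intro mult_right_mono) auto
    also have "... = (X / 2 + C * r0 ^r (D - a)) * (r ^r (a - D) * r ^r (D - a))"
     by (simp add: algebra_simps)
    also have "r ^r (a - D) * r ^r (D - a) = 1" using rpos by (simp flip: powr_add)
    finally have "F i <= X / 2 + C * r0 ^r (D - a)" by (simp add: F_def i r_def)
    also have "... <= A + X / 2" by (simp add: A_def)
    finally show ?thesis .
   qed
  next
   fix i :: "(int ^ 'd) \<times> (int ^ 'd)"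
   obtain x y where i: "i = (x, y)" by (cases i)
   have b0: "0 <= b" unfolding b_def by (intro sum_nonneg) auto
   show "F i <= b"
   proof (cases "x : V & y : V")
    case True
    have "F i <= real (sd x y) powr (D - a)"
     using pbd[of x y] by (simp add: i F_def mult_left_le_one_le)
    also have "... <= (SUM y:V. real (sd x y) powr (D - a))" using True V by (intro member_le_sum) auto
    also have "... <= b" unfolding b_def using True V by (intro member_le_sum) (auto intro: sum_nonneg)
    finally show ?thesis .
   next
    case False
    then have "pr (Ed V) x y = 0 \<or> x = y"
     using pr_outside[of "Ed V" V x y] pr_outside'[of "Ed V" V x y] by auto
    then show ?thesis using b0 aD by (auto simp: i F_def)
   qed
  qed (auto simp: F_def pbd)
  then have "pr (Ed V) x y * real (sd x y) powr (D - a) * real (sd x y) powr (a - D) <= 2 * A * real (sd x y) powr (a - D)"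
   unfolding F_def by (intro mult_right_mono) auto
  then show "pr (Ed V) x y <= 2 * A * real (sd x y) powr (a - D)"
   using xy by (simp add: mult.assoc flip: powr_add)
 qed (use A in simp)
qed

lemma lbox_cube: "lbox (x :: int ^ 'd) n = (%y. y + (x - (\<chi> i. int n))) ` cube (2 * n + 1) 0"
proof (intro set_eqI iffI)
 fix y assume y: "y : lbox x n"
 then have "y - (x - (\<chi> i. int n)) : cube (2 * n + 1) 0"
 proof -
  have L: "2 * n + 1 >= (1 :: nat)" by simp
  show ?thesis using y unfolding cube_eq[OF L] mem_lbox sd_le_iff
   by (auto simp: abs_le_iff) (smt (verit))+
 qed
 then show "y : (%y. y + (x - (\<chi> i. int n))) ` cube (2 * n + 1) 0" by (rule rev_image_eqI) simp
next
 fix y assume "y : (%y. y + (x - (\<chi> i. int n))) ` cube (2 * n + 1) 0"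
 then obtain c where c: "c : cube (2 * n + 1) 0" "y = c + (x - (\<chi> i. int n))" by auto
 have L: "2 * n + 1 >= (1 :: nat)" by simp
 have "\<bar>x $ i - y $ i\<bar> <= int n" for i
  using c(1) unfolding c(2) cube_eq[OF L] by (auto dest!: spec[of _ i])
 then show "y : lbox x n" by (simp add: sd_le_iff)
qed

abbreviation "box_moments_with j C \<equiv>
 ALL n x i. n >= 1 --> i <= j -->
  avw (Ed (lbox x n)) (%A. csz A x ^ j)
   <= C * (n ^r ((D + a) / 2)) ^ (j - i) * avw (Ed (lbox x n)) (%A. csz A x ^ i)"

lemma box_moments: "EX C>=1. box_moments_with j C"
proof -
 obtain C where C1: "C >= 1" and H: "cube_moments_with j C"
  using cube_moments[of j] by blast
 define c where "c = (3 powr ((D + a) / 2)) ^ j"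
 have c1: "1 <= c" unfolding c_def using D1 a0 by (intro one_le_power ge_one_powr_ge_zero) auto
 show ?thesis
 proof (intro exI[of _ "C * c"] conjI allI impI)
  show "1 <= C * c" using C1 c1 mult_mono[of 1 C 1 c] by simp
  fix n :: nat and x :: "int ^ 'd" and i assume n: "n >= 1" and ij: "i <= j"
  let ?e = "%k. avw (Ed (lbox x n)) (%A. csz A x ^ k)"
  have "?e j <= C * (real (2 * n + 1) powr ((D + a) / 2)) ^ (j - i) * ?e i"
   using H[THEN spec[of _ "2 * n + 1"], THEN spec[of _ "x - (\<chi> i. int n)"], THEN spec[of _ x], THEN spec[of _ i]] ij
   unfolding Let_def lbox_cube[symmetric] by simp
  also have "... <= C * (c * (n ^r ((D + a) / 2)) ^ (j - i)) * ?e i"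
  proof (intro mult_right_mono mult_left_mono avg_nonneg pEd finite_lbox)
   have "(real (2 * n + 1) powr ((D + a) / 2)) ^ (j - i) <= ((3 * real n) powr ((D + a) / 2)) ^ (j - i)"
    using n D1 a0 by (intro power_mono powr_mono2) auto
   also have "... = (3 powr ((D + a) / 2)) ^ (j - i) * (n ^r ((D + a) / 2)) ^ (j - i)"
    by (simp add: powr_mult power_mult_distrib)
   also have "... <= c * (n ^r ((D + a) / 2)) ^ (j - i)"
    unfolding c_def using D1 a0 by (intro mult_right_mono power_increasing ge_one_powr_ge_zero) auto
   finally show "(real (2 * n + 1) powr ((D + a) / 2)) ^ (j - i) <= c * (n ^r ((D + a) / 2)) ^ (j - i)" .
  qed (use C1 in auto)
  finally show "?e j <= C * c * (n ^r ((D + a) / 2)) ^ (j - i) * ?e i" by (simp add: mult.assoc)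
 qed
qed

lemma avg_lbox: "avw (Ed (lbox x n)) (%A. csz A x) = en n"
proof -
 have "avw (Ed (lbox x n)) (%A. csz A x) = (SUM y:lbox x n. pb n (y - x))"
  by (subst avg_card_V[of "lbox x n"]) (auto simp: pr_box)
 also have "... = en n"
  unfolding en_def
  by (rule sum.reindex_bij_witness[of _ "%u. u + x" "%u. u - x"])
   (use sd_shift[of 0 x] sd_shift[of x "- x"] in auto)
 finally show ?thesis .
qed

abbreviation "point_lower_with c \<equiv>
 ALL V x y. finite V --> x ~= y --> lbox x (2 * sd x y) \<subseteq> V --> c * real (sd x y) powr (a - D) <= pr (Ed V) x y"

text \<open>Glue the clusters of \<open>x\<close> and \<open>y\<close> in disjoint boxes of radius
  comparable to r: the order is r^(-d-a) times (r^a)^2. Distances at most 2 are handled by a direct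
  edge.\<close>

lemma point_lower: "EX c>0. point_lower_with c"
proof -
 obtain ce where ce: "ce > 0" "\<And>n. n >= 1 ==> ce * n ^r a <= en n" using en_lower by auto
 obtain C where C1: "C >= 1" and C: "\<And>n x. n >= 1 ==>
  avw (Ed (lbox x n)) (%A. csz A x ^ 2) <= C * n ^r ((D + a) / 2) * en n"
 proof -
  obtain C where "C >= 1" and H: "box_moments_with 2 C"
   using box_moments[of 2] by blast
  show ?thesis
  proof (rule that[OF \<open>C >= 1\<close>])
   fix n :: nat and x assume "n >= 1"
   then show "avw (Ed (lbox x n)) (%A. csz A x ^ 2) <= C * n ^r ((D + a) / 2) * en n"
    using H[THEN spec[of _ n], THEN spec[of _ x], THEN spec[of _ 1]] by (simp add: avg_lbox)
  qed
 qed
 define k where "k = min (c0 * 2 powr (- (D + a))) (1 / C^2)"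
 have k: "0 < k" using c0 C1 by (simp add: k_def)
 define q where "q = 1 - exp (- (c0 * 2 powr (- (D + a))))"
 have q: "q > 0" using c0 by (simp add: q_def)
 define c where "c = min q (k / 2 * (ce * 6 powr (- a))^2)"
 have c: "c > 0" using q k ce by (simp add: c_def)
 show ?thesis
 proof (intro exI[of _ c] conjI c allI impI)
  fix V :: "(int ^ 'd) set" and x y :: "int ^ 'd"
  assume V: "finite V" and xy: "x ~= y" and sub: "lbox x (2 * sd x y) \<subseteq> V"
  define r where "r = sd x y"
  have r1: "r >= 1" using sd_pos[OF xy] by (simp add: r_def)
  show "c * real (sd x y) powr (a - D) <= pr (Ed V) x y"
  proof (cases "r <= 2")
   case True
   have xyV: "x : V" "y : V" using sub by auto
   then have e: "{x, y} : Ed V" using xy by simp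
   have "c * r ^r (a - D) <= q * 1"
    using r1 aD q powr_mono2'[of "a - D" 1 "real r"] by (intro mult_mono) (auto simp: c_def)
   also have "q <= pk w {x, y}"
   proof -
    have "2 powr (- (D + a)) <= r ^r (- (D + a))"
     using True r1 D1 a0 by (intro powr_mono2') auto
    then have "c0 * 2 powr (- (D + a)) <= c0 * r ^r (- (D + a))" using c0 by (intro mult_left_mono) auto
    also have "... <= w x y" using wl[OF xy] by (simp add: r_def)
    finally show ?thesis using pk_edge[OF xy w_sym[of x y]] by (simp add: q_def)
   qed
   also have "... = prw (Ed V) (%A. EX e:{{x, y}}. e : A)"
    using e V by (subst prb_exists_open) (auto simp: finite_Ed)
   also have "... <= pr (Ed V) x y"
    by (intro prb_mono pEd V) (auto intro: conn_edge)
   finally show ?thesis by (simp add: r_def)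
  next
   case False
   \<comment> \<open>The largest radius for which the two boxes are disjoint; it still satisfies
     \<open>r <= 6 * n\<close>.\<close>
   define n where "n = (r - 1) div 2"
   have n: "n >= 1" "2 * n < r" "r <= 6 * n" using False by (auto simp: n_def)
   let ?S = "lbox x n" and ?T = "lbox y n"
   have disj: "?S Int ?T = {}"
   proof (rule ccontr)
    assume "?S Int ?T ~= {}"
    then obtain z where "sd x z <= n" "sd y z <= n" by auto
    then show False using sd_triangle[of x y z] n by (simp add: r_def sd_commute[of z y])
   qed
   let ?k = "k * r ^r (- (D + a))"
   have "?k / 2 * avw (Ed ?S) (%A. csz A x) * avw (Ed ?T) (%A. csz A y)
    <= pr (Ed (?S Un ?T)) x y"
   proof (rule glue_moments[OF finite_lbox finite_lbox disj self_in_lbox self_in_lbox])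
    fix u v assume uv: "u : ?S" "v : ?T"
    then have "u ~= v" using disj by auto
    have "sd u v <= sd u x + sd x y + sd y v" using sd_triangle[of u v x] sd_triangle[of x v y] by linarith
    then have "sd u v <= 2 * r" using uv n by (simp add: r_def sd_commute[of u x])
    then have "real (sd u v) <= 2 * real r" by (metis of_nat_le_iff of_nat_mult of_nat_numeral)
    then have "(2 * real r) powr (- (D + a)) <= real (sd u v) powr (- (D + a))"
     using sd_pos[OF \<open>u ~= v\<close>] D1 a0 by (intro powr_mono2') auto
    then have "c0 * (2 powr (- (D + a)) * r ^r (- (D + a))) <= c0 * real (sd u v) powr (- (D + a))"
     using c0 by (simp add: powr_mult)
    also have "... <= w u v" by (rule wl[OF \<open>u ~= v\<close>])
    finally have "c0 * 2 powr (- (D + a)) * r ^r (- (D + a)) <= w u v" by (simp add: mult.assoc)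
    moreover have "?k <= c0 * 2 powr (- (D + a)) * r ^r (- (D + a))"
     by (intro mult_right_mono) (auto simp: k_def)
    ultimately show "?k <= w u v" by linarith
   next
    show "avw (Ed ?S) (%A. (csz A x)^2) <= (C * n ^r ((D + a) / 2)) * avw (Ed ?S) (%A. csz A x)"
     using C[OF n(1), of x] by (simp add: avg_lbox)
    show "avw (Ed ?T) (%A. (csz A y)^2) <= (C * n ^r ((D + a) / 2)) * avw (Ed ?T) (%A. csz A y)"
     using C[OF n(1), of y] by (simp add: avg_lbox)
    have "n ^r ((D + a) / 2) * n ^r ((D + a) / 2) = n ^r (D + a)"
     by (simp flip: powr_add)
    also have "... <= r ^r (D + a)" using n D1 a0 by (intro powr_mono2) auto
    finally have "?k * (C * n ^r ((D + a) / 2) * (C * n ^r ((D + a) / 2)))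
      <= ?k * (C^2 * r ^r (D + a))"
     using k C1 by (intro mult_left_mono) (auto simp: power2_eq_square mult_ac)
    also have "... = k * C^2 * (r ^r (- (D + a)) * r ^r (D + a))" by simp
    also have "r ^r (- (D + a)) * r ^r (D + a) = 1"
     using r1 by (simp flip: powr_add)
    also have "k * C^2 * 1 <= 1 / C^2 * C^2"
     unfolding mult_1_right by (intro mult_right_mono) (auto simp: k_def)
    also have "... = 1" using C1 by simp
    finally show "?k * (C * n ^r ((D + a) / 2) * (C * n ^r ((D + a) / 2))) <= 1" .
   qed (use k in auto)
   also have "... <= pr (Ed V) x y"
   proof (intro pr_mono finite_Ed V Ed_mono)
    show "?S Un ?T \<subseteq> V"
    proof
     fix z assume "z : ?S Un ?T"
     then have "sd x z <= 2 * sd x y"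
      using sd_triangle[of x z y] n by (auto simp: r_def)
     then show "z : V" using sub by auto
    qed
   qed
   finally have "?k / 2 * en n * en n <= pr (Ed V) x y" by (simp add: avg_lbox)
   moreover have "c * r ^r (a - D) <= ?k / 2 * en n * en n"
   proof -
    have "ce * 6 powr (- a) * r ^r a = ce * (real r / 6) powr a"
     by (simp add: powr_divide powr_minus_divide)
    also have "... <= ce * n ^r a" using n ce a0 by (intro mult_left_mono powr_mono2) auto
    also have "... <= en n" by (rule ce(2)[OF n(1)])
    finally have e: "ce * 6 powr (- a) * r ^r a <= en n" .
    have "c * r ^r (a - D) <= (k / 2 * (ce * 6 powr (- a))^2) * r ^r (a - D)"
     by (intro mult_right_mono) (auto simp: c_def)
    also have "... = ?k / 2 * ((ce * 6 powr (- a) * r ^r a) * (ce * 6 powr (- a) * r ^r a))"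
    proof -
     have "r ^r (a - D) = r ^r (- (D + a)) * (r ^r a * r ^r a)"
      by (simp flip: powr_add)
     then show ?thesis by (simp add: power2_eq_square mult_ac)
    qed
    also have "... <= ?k / 2 * (en n * en n)"
     using e k ce en_ge_1[of n] by (intro mult_left_mono mult_mono) auto
    finally show ?thesis by (simp add: mult.assoc)
   qed
   ultimately show ?thesis by (simp add: r_def)
  qed
 qed
qed

end

section \<open>Hyperscaling\<close>

definition ci :: "nat => int ^ 'd => int ^ 'd" where
 "ci R x = (\<chi> i. x $ i div int R)"

lemma in_cube_ci: "y : cube R z \<longleftrightarrow> ci R y = z"
 by (simp add: cube_def ci_def vec_eq_iff)

lemma ci_sd:
 assumes "R >= 1"
 shows "R * sd (ci R x) (ci R y) <= sd x y + R"
proof -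
 have *: "int R * \<bar>x $ i div int R - y $ i div int R\<bar> <= int (sd x y) + int R" for i
 proof -
  have m: "int R * (k div int R) + k mod int R = k" "0 <= k mod int R" "k mod int R < int R" for k
   using assms by simp_all
  have "int R * (x $ i div int R - y $ i div int R) = (x $ i - y $ i) - (x $ i mod int R - y $ i mod int R)"
   unfolding right_diff_distrib using m(1)[of "x $ i"] m(1)[of "y $ i"] by linarith
  then have "\<bar>int R * (x $ i div int R - y $ i div int R)\<bar> <= int (sd x y) + int R"
   using m(2,3)[of "x $ i"] m(2,3)[of "y $ i"] abs_le_sd[of x i y] by linarith
  then show ?thesis by (simp add: abs_mult)
 qed
 obtain i where i: "int (sd (ci R x) (ci R y)) = \<bar>ci R x $ i - ci R y $ i\<bar>"
 proof -
  have "Max (range (%i. \<bar>ci R x $ i - ci R y $ i\<bar>)) : range (%i. \<bar>ci R x $ i - ci R y $ i\<bar>)"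
   by (intro Max_in) auto
  then obtain i where "Max (range (%i. \<bar>ci R x $ i - ci R y $ i\<bar>)) = \<bar>ci R x $ i - ci R y $ i\<bar>" by (rule rangeE)
  then show ?thesis by (intro that[of i]) (simp add: sd_def)
 qed
 have "int (R * sd (ci R x) (ci R y)) <= int (sd x y + R)"
  using *[of i] i by (simp add: ci_def)
 then show ?thesis by (simp only: of_nat_le_iff)
qed

lemma weighted_square:
 fixes X q :: "'z => real"
 assumes "finite Z" "\<And>z. z : Z ==> 0 < q z"
 shows "(SUM z:Z. X z)^2 <= (SUM z:Z. q z) * (SUM z:Z. (X z)^2 / q z)"
proof -
 have 1: "(SUM z:Z. sqrt (q z) * (X z / sqrt (q z))) = (SUM z:Z. X z)"
  using assms by (intro sum.cong) force+
 have 2: "(SUM z:Z. (sqrt (q z))^2) = (SUM z:Z. q z)"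
  using assms by (intro sum.cong) (auto intro: less_imp_le)
 have 3: "(SUM z:Z. (X z / sqrt (q z))^2) = (SUM z:Z. (X z)^2 / q z)"
  using assms by (intro sum.cong) (auto simp: power_divide intro: less_imp_le)
 show ?thesis
  using Cauchy_Schwarz_ineq_sum[of "%z. sqrt (q z)" "%z. X z / sqrt (q z)" Z] unfolding 1 2 3 .
qed

lemma weighted_fourth:
 fixes X q :: "'z => real"
 assumes "finite Z" "\<And>z. z : Z ==> 0 < q z"
 shows "(SUM z:Z. X z) ^ 4 <= (SUM z:Z. q z) ^ 3 * (SUM z:Z. (X z) ^ 4 / q z ^ 3)"
proof -
 let ?s = "SUM z:Z. q z"
 have s0: "0 <= ?s" using assms by (intro sum_nonneg) (auto intro: less_imp_le)
 have "(SUM z:Z. X z) ^ 4 = ((SUM z:Z. X z)^2)^2" by simp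
 also have "... <= (?s * (SUM z:Z. (X z)^2 / q z))^2"
  by (intro power_mono weighted_square assms) auto
 also have "... = ?s^2 * (SUM z:Z. (X z)^2 / q z)^2" by (simp add: power_mult_distrib)
 also have "... <= ?s^2 * (?s * (SUM z:Z. ((X z)^2 / q z)^2 / q z))"
  by (intro mult_left_mono weighted_square assms) auto
 also have "(SUM z:Z. ((X z)^2 / q z)^2 / q z) = (SUM z:Z. (X z) ^ 4 / q z ^ 3)"
  by (intro sum.cong refl) (simp add: power_divide power3_eq_cube power2_eq_square power4_eq_xxxx)
 finally show ?thesis by (simp add: power3_eq_cube power2_eq_square mult.assoc)
qed

locale crit_low = crit w a c0 C0 \<delta>0 B
 for w :: "int ^ 'd => int ^ 'd => real" and a c0 C0 \<delta>0 B +
 assumes low: "D < 3 * a"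
begin

lemma CARD2: "CARD('d) <= 2"
proof -
 have "real CARD('d) < 3" using low a1 by (simp add: D_def)
 then show ?thesis by linarith
qed

lemma sum_weights:
 fixes \<rho> :: real
 assumes "0 < \<rho>" "\<rho> < 1"
 shows "EX S>0. ALL Z (z0 :: int ^ 'd). finite Z --> (SUM z:Z. \<rho> ^ sd z0 z) <= S"
proof -
 have sm: "summable (%k. real (Suc k) * \<rho> ^ k)"
  using geometric_deriv_sums[of \<rho>] assms by (auto simp: sums_iff)
 define S where "S = 1 + Kd * (\<Sum>k. real (Suc k) * \<rho> ^ k)"
 have S: "S > 0" unfolding S_def using Kd_pos suminf_nonneg[OF sm] assms
  by (intro add_pos_nonneg mult_nonneg_nonneg) auto
 show ?thesis
 proof (intro exI[of _ S] conjI S allI impI)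
  fix Z :: "(int ^ 'd) set" and z0 :: "int ^ 'd" assume Z: "finite Z"
  define n where "n = Max (insert 0 (sd z0 ` Z))"
  have n: "sd z0 v <= n" if "v : Z" for v unfolding n_def using Z that by (intro Max_ge) auto
  have "(SUM z:Z. \<rho> ^ sd z0 z) <= (SUM z:insert z0 (Z - {z0}). \<rho> ^ sd z0 z)"
   using Z assms by (intro sum_mono2) auto
  also have "... = 1 + (SUM z:Z - {z0}. \<rho> ^ sd z0 z)" using Z by (subst sum.insert) auto
  also have "(SUM z:Z - {z0}. \<rho> ^ sd z0 z) <= Kd * (SUM k:{0<..n}. real k ^ (CARD('d) - 1) * \<rho> ^ k)"
   unfolding Kd_def D_def
   by (rule sum_radial_le[of "Z - {z0}" 0 z0 n "%k. \<rho> ^ k"]) (use Z n assms sd_pos[of z0] in force)+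
  also have "... <= Kd * (SUM k:{0<..n}. real (Suc k) * \<rho> ^ k)"
  proof (intro mult_left_mono sum_mono mult_right_mono)
   fix k assume k: "k : {0<..n}"
   have "real k ^ (CARD('d) - 1) <= real k ^ 1" using k CARD2 by (intro power_increasing) auto
   also have "real k ^ 1 <= real (Suc k)" by simp
   finally show "real k ^ (CARD('d) - 1) <= real (Suc k)" .
  qed (use Kd_pos assms in auto)
  also have "... <= Kd * (\<Sum>k. real (Suc k) * \<rho> ^ k)"
   using Kd_pos assms by (intro mult_left_mono sum_le_suminf sm) auto
  finally show "(SUM z:Z. \<rho> ^ sd z0 z) <= S" by (simp add: S_def)
 qed
qed

text \<open>The decay is written as the twelfth power of a weight that is itself summable over
  cells. The weighted inequalities below divide by powers of the weight and still have a summable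
  factor left.\<close>

lemma cell_decay:
 "EX C>0. EX \<rho>. 0 < \<rho> & \<rho> < 1 & (ALL R>=1. ALL V x z. finite V -->
  (SUM y:cube R z. pr (EdR V R) x y) <= C * R ^r a * (\<rho> ^ sd (ci R x) z) ^ 12)"
proof -
 obtain C K where C: "C > 0" and K: "K >= (1::nat)"
  and H: "chi_decay_with C K"
  using chi_decay by blast
 define \<rho> where "\<rho> = (1 / 2 :: real) powr (1 / real (12 * K))"
 have \<rho>K: "\<rho> ^ (12 * K) = 1 / 2"
  using K by (simp add: \<rho>_def powr_power)
 have \<rho>0: "0 < \<rho>" by (simp add: \<rho>_def)
 have \<rho>1: "\<rho> < 1"
 proof (rule ccontr)
  assume "~ \<rho> < 1"
  then have "1 <= \<rho> ^ (12 * K)" by (intro one_le_power) auto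
  then show False using \<rho>K by simp
 qed
 show ?thesis
 proof (rule exI[of _ "2 * C"], intro conjI, use C in simp, rule exI[of _ \<rho>], intro conjI \<rho>0 \<rho>1 allI impI)
  fix R :: nat and V :: "(int ^ 'd) set" and x z :: "int ^ 'd" assume R: "1 <= R" and V: "finite V"
  define n where "n = sd (ci R x) z"
  define j where "j = (n - 1) div K"
  have "(SUM y:cube R z. pr (EdR V R) x y) <= C * R ^r a * (1 / 2) ^ j"
  proof (rule H[rule_format, OF R V finite_cube[OF R]])
   fix y assume y: "y : cube R z"
   have "j * K <= n - 1" unfolding j_def by (rule div_times_less_eq_dividend)
   then have "j * K * R <= (n - 1) * R" by (intro mult_right_mono) auto
   also have "... = R * n - R" using diff_mult_distrib[of n 1 R] by (simp add: mult.commute)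
   also have "... <= sd x y" using ci_sd[OF R, of x y] y by (simp add: in_cube_ci n_def)
   finally show "j * (K * R) <= sd x y" by (simp add: mult.assoc)
  qed
  also have "(1 / 2 :: real) ^ j <= 2 * (\<rho> ^ n) ^ 12"
  proof -
   have "n - 1 < K * (j + 1)" unfolding j_def using K dividend_less_times_div[of K "n - 1"] by simp
   then have "n <= K * (j + 1)" by linarith
   then have "\<rho> ^ (12 * (K * (j + 1))) <= \<rho> ^ (12 * n)" using \<rho>0 \<rho>1 by (intro power_decreasing) auto
   also have "\<rho> ^ (12 * (K * (j + 1))) = (1 / 2) ^ (j + 1)"
    unfolding \<rho>K[symmetric] power_mult[symmetric] by (simp add: mult.assoc)
   finally show ?thesis by (simp add: power_mult[symmetric] mult.commute)
  qed
  finally show "(SUM y:cube R z. pr (EdR V R) x y) <= 2 * C * R ^r a * (\<rho> ^ sd (ci R x) z) ^ 12"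
   using C by (simp add: n_def mult_left_mono)
 qed
qed

lemma fpR: "finite V ==> finite_perc V (EdR V R) (pk w)"
 by (rule fp_sub[OF _ EdR_subset_Ed])

lemma pER: "finite V ==> probs (EdR V R) (pk w)"
 by (simp add: pE finite_EdR)

lemma avg_cell: "R >= 1 ==> avw E (%A. real (card (clu A x Int cube R z))) = (SUM y:cube R z. pr E x y)"
 by (simp add: avg_card finite_cube)

abbreviation "cell_moment2_with C \<equiv>
 ALL R>=1. ALL V E x z. finite V --> E \<subseteq> Ed V -->
  avw E (%A. real (card (clu A x Int cube R z)) ^ 2)
   <= C * R ^r ((D + a) / 2) * (SUM y:cube R z. pr E x y)"

text \<open>Clusters may wander outside the cell, so \<open>max_bound\<close> does not apply.
  Instead, a cluster with \<open>M\<close> points in the cell provides \<open>M^2\<close> connected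
  pairs there, whose expected number is at most of order R^(d+a) by \<open>box_upper\<close>. Markov
  and universal tightness do the rest.\<close>

lemma cell_moment2: "EX C>0. cell_moment2_with C"
proof -
 obtain G where G0: "G > 0" and G_all: "box_upper_with G"
  using box_upper by blast
 note G = G_all[rule_format]
 obtain C where C: "C >= 1 & moment_bound_with TYPE('d) (1 / 2) 2 C"
  using moment_bound[of "1 / 2" 2] by (elim exE[rotated]) auto
 note C1 = C[THEN conjunct1] and C2 = C[THEN conjunct2, rule_format]
 \<comment> \<open>Chosen with \<open>g^2 >= 2 * G\<close>, so that Markov gives probability at most
   1/2.\<close>
 define g where "g = sqrt (2 * G) + 1"
 have g1: "g >= 1" using G0 by (simp add: g_def)
 show ?thesis
 proof (intro exI[of _ "C * (g + 1)"] conjI allI impI)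
  fix R :: nat and V :: "(int ^ 'd) set" and E and x z :: "int ^ 'd" assume R: "1 <= R" and V: "finite V" and EV: "E \<subseteq> Ed V"
  note fE = finite_subset[OF EV finite_Ed[OF V]]
  let ?Q = "cube R z"
  have fQ: "finite ?Q" by (rule finite_cube[OF R])
  define h where "h = R ^r ((D + a) / 2)"
  have h1: "h >= 1" unfolding h_def using R D1 a0 by (intro ge_one_powr_ge_zero) auto
  have hh: "h^2 = R ^r D * R ^r a"
   by (simp add: h_def power2_eq_square flip: powr_add)
  define M where "M = nat \<lceil>g * h\<rceil>"
  have gh: "1 <= g * h" using g1 h1 mult_mono[of 1 g 1 h] by simp
  have M: "g * h <= real M" "real M <= (g + 1) * h" "1 <= M"
  proof -
   show "g * h <= real M" unfolding M_def by linarith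
   then show "1 <= M" using gh by linarith
   have "real M <= g * h + 1" unfolding M_def using gh by linarith
   then show "real M <= (g + 1) * h" using h1 by (simp add: algebra_simps)
  qed
  have "prw E (%A. EX v. M <= card (clu A v Int ?Q))
   <= prw E (%A. (real M)^2 <= (SUM u:?Q. SUM y:?Q. of_bool (conn A u y)))"
  proof (intro prb_mono pE fE)
   fix A assume "EX v. M <= card (clu A v Int ?Q)"
   then obtain v where v: "M <= card (clu A v Int ?Q)" by auto
   have "(real M)^2 <= real (card (clu A v Int ?Q)) * real (card (clu A v Int ?Q))"
    unfolding power2_eq_square using v by (intro mult_mono) auto
   also have "... = (SUM u:clu A v Int ?Q. SUM y:clu A v Int ?Q. 1)" by simp
   also have "... = (SUM u:clu A v Int ?Q. SUM y:clu A v Int ?Q. of_bool (conn A u y))"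
    by (intro sum.cong refl) (auto intro: conn_trans[OF conn_sym])
   also have "... <= (SUM u:?Q. SUM y:?Q. of_bool (conn A u y))"
    using fQ by (intro order_trans[OF sum_mono[OF sum_mono2] sum_mono2]) (auto intro: sum_nonneg)
   finally show "(real M)^2 <= (SUM u:?Q. SUM y:?Q. of_bool (conn A u y))" .
  qed
  also have "... <= avw E (%A. SUM u:?Q. SUM y:?Q. of_bool (conn A u y)) / (real M)^2"
   using M by (intro avg_markov pE fE sum_nonneg) auto
  also have "avw E (%A. SUM u:?Q. SUM y:?Q. of_bool (conn A u y)) = (SUM u:?Q. SUM y:?Q. pr E u y)"
   by (simp add: avg_sum)
  also have "... <= (SUM u:?Q. G * R ^r a)"
  proof (rule sum_mono)
   fix u assume u: "u : ?Q"
   have "(SUM y:?Q. pr E u y) <= (SUM y:?Q. pr (Ed V) u y)"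
    by (intro sum_mono pr_mono finite_Ed V EV)
   also have "... <= (SUM y:lbox u R. pr (Ed V) u y)"
    using cube_sd[OF R u] pr_bounds[OF finite_Ed[OF V]] by (intro sum_mono2) auto
   also have "... <= G * R ^r a" by (rule G[OF V R])
   finally show "(SUM y:?Q. pr E u y) <= G * R ^r a" .
  qed
  also have "... = G * h^2" using R by (simp add: card_cube hh powr_Dn mult_ac)
  also have "G * h^2 / (real M)^2 <= 1 - 1 / 2"
  proof -
   have "2 * G <= g^2" unfolding g_def using G0 by (simp add: power2_sum)
   then have "2 * G * h^2 <= g^2 * h^2" by (intro mult_right_mono) auto
   also have "... = (g * h)^2" by (simp add: power_mult_distrib)
   also have "... <= (real M)^2" using M gh by (intro power_mono) auto
   finally show ?thesis using M by (simp add: divide_le_eq)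
  qed
  finally have "prw E (%A. EX v. M <= card (clu A v Int ?Q)) <= 1 - 1 / 2" by (simp add: divide_right_mono)
  from C2[OF fp_sub[OF V EV] M(3) _ this, of 1 x]
  have "avw E (%A. real (card (clu A x Int ?Q)) ^ 2) <= C * real M * (SUM y:?Q. pr E x y)"
   by (simp add: avg_cell[OF R])
  also have "... <= C * ((g + 1) * h) * (SUM y:?Q. pr E x y)"
   using C1 M pr_bounds[OF fE] by (intro mult_right_mono mult_left_mono sum_nonneg) auto
  finally show "avw E (%A. real (card (clu A x Int ?Q)) ^ 2)
   <= C * (g + 1) * R ^r ((D + a) / 2) * (SUM y:?Q. pr E x y)"
   by (simp add: h_def mult.assoc)
 qed (use C1 g1 in \<open>auto intro!: mult_pos_pos\<close>)
qed

abbreviation "cell_moment4_with C \<equiv>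
 ALL R>=1. ALL V x z m. finite V --> m >= 1 -->
  (ALL v. avw (EdR V R) (%A. csz A v ^ 2) <= m) -->
  avw (EdR V R) (%A. real (card (clu A x Int cube R z)) ^ 4)
   <= C * (R ^r D * m) powr (2 / 3) * avw (EdR V R) (%A. real (card (clu A x Int cube R z)) ^ 2)"

text \<open>A cluster with \<open>M\<close> points in the cell contributes at least
  \<open>M ^ 3\<close> to the sum of squared cluster sizes over the cell, whose mean is at most
  \<open>R ^r D * m\<close>. The tightness scale is thus the cube root of this, which improves when
  \<open>m\<close> is small.\<close>

lemma cell_moment4: "EX C>0. cell_moment4_with C"
proof -
 obtain C where C: "C >= 1 & moment_bound_with TYPE('d) (1 / 2) 4 C"
  using moment_bound[of "1 / 2" 4] by (elim exE[rotated]) auto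
 note C1 = C[THEN conjunct1] and C2 = C[THEN conjunct2, rule_format]
 show ?thesis
 proof (intro exI[of _ "C * (4 * 2 powr (2 / 3))"] conjI allI impI)
  fix R :: nat and V :: "(int ^ 'd) set" and x z :: "int ^ 'd" and m :: real
  assume R: "1 <= R" and V: "finite V" and m: "m >= 1"
   and m2: "ALL v. avw (EdR V R) (%A. csz A v ^ 2) <= m"
  let ?E = "EdR V R" and ?Q = "cube R z"
  have fQ: "finite ?Q" by (rule finite_cube[OF R])
  define h where "h = (2 * (R ^r D * m)) powr (1 / 3)"
  have Rm: "1 <= R ^r D * m"
   using m R D1 mult_mono[of 1 "R ^r D" 1 m] ge_one_powr_ge_zero[of "real R" D] by simp
  then have h1: "h >= 1" unfolding h_def by (intro ge_one_powr_ge_zero) auto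
  have h3: "h ^ 3 = 2 * (R ^r D * m)"
  proof -
   have "h ^ 3 = h powr 3" using h1 by (simp add: powr_numeral)
   then show ?thesis using Rm by (simp add: h_def powr_powr)
  qed
  define M where "M = nat \<lceil>h\<rceil>"
  have M: "h <= real M" "real M <= 2 * h" "1 <= M" unfolding M_def using h1 by linarith+
  have "prw ?E (%A. EX v. M <= card (clu A v Int ?Q))
   <= prw ?E (%A. real M ^ 3 <= (SUM u:?Q. csz A u ^ 2))"
  proof (intro prb_mono pER V)
   fix A assume A: "A \<subseteq> ?E" and "EX v. M <= card (clu A v Int ?Q)"
   then obtain v where v: "M <= card (clu A v Int ?Q)" by auto
   have "A \<subseteq> Pow V" using A EdR_Pow by blast
   then have "finite (clu A v)" by (rule finite_clu[OF _ V])
   then have "card (clu A v Int ?Q) <= card (clu A v)" by (intro card_mono) auto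
   then have cv: "M <= card (clu A v)" using v by linarith
   have "real M ^ 3 = real M * real M ^ 2" by (simp add: power3_eq_cube power2_eq_square)
   also have "... <= real (card (clu A v Int ?Q)) * real M ^ 2" using v by (intro mult_right_mono) auto
   also have "... = (SUM u:clu A v Int ?Q. real M ^ 2)" by simp
   also have "... <= (SUM u:clu A v Int ?Q. csz A u ^ 2)"
   proof (intro sum_mono power_mono)
    fix u assume "u : clu A v Int ?Q"
    then have "clu A v = clu A u" by (intro clu_eq) simp
    then show "real M <= csz A u" using cv by simp
   qed simp
   also have "... <= (SUM u:?Q. csz A u ^ 2)" using fQ by (intro sum_mono2) auto
   finally show "real M ^ 3 <= (SUM u:?Q. csz A u ^ 2)" .
  qed
  also have "... <= avw ?E (%A. SUM u:?Q. csz A u ^ 2) / real M ^ 3"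
   using M by (intro avg_markov pER V sum_nonneg) auto
  also have "avw ?E (%A. SUM u:?Q. csz A u ^ 2) <= (SUM u:?Q. m)"
   unfolding avg_sum by (intro sum_mono) (use m2 in blast)
  also have "... = h ^ 3 / 2" using R h3 by (simp add: card_cube powr_Dn)
  also have "h ^ 3 / 2 / real M ^ 3 <= 1 - 1 / 2"
   using power_mono[OF M(1), of 3] h1 M by (simp add: divide_le_eq)
  finally have "prw ?E (%A. EX v. M <= card (clu A v Int ?Q)) <= 1 - 1 / 2" by (simp add: divide_right_mono)
  from C2[OF fpR[OF V] M(3) _ this, of 2 x]
  have "avw ?E (%A. real (card (clu A x Int ?Q)) ^ 4)
    <= C * real M ^ 2 * avw ?E (%A. real (card (clu A x Int ?Q)) ^ 2)" by simp
  also have "... <= C * (4 * 2 powr (2 / 3) * (R ^r D * m) powr (2 / 3)) * avw ?E (%A. real (card (clu A x Int ?Q)) ^ 2)"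
  proof (intro mult_right_mono mult_left_mono avg_nonneg pER V)
   have "real M ^ 2 <= (2 * h) ^ 2" using M by (intro power_mono) auto
   also have "... = 4 * h ^ 2" by (simp add: power_mult_distrib)
   also have "h ^ 2 = 2 powr (2 / 3) * (R ^r D * m) powr (2 / 3)"
   proof -
    have "h ^ 2 = h powr 2" using h1 by (simp add: powr_numeral)
    then show ?thesis using Rm by (simp add: h_def powr_powr powr_mult)
   qed
   finally show "real M ^ 2 <= 4 * 2 powr (2 / 3) * (R ^r D * m) powr (2 / 3)" by simp
  qed (use C1 in auto)
  finally show "avw ?E (%A. real (card (clu A x Int ?Q)) ^ 4)
   <= C * (4 * 2 powr (2 / 3)) * (R ^r D * m) powr (2 / 3) * avw ?E (%A. real (card (clu A x Int ?Q)) ^ 2)"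
   by (simp add: mult.assoc)
 qed (use C1 in auto)
qed

lemma card_cells:
 assumes "R >= 1" "finite V" "A \<subseteq> EdR V R"
 shows "csz A x = (SUM z:ci R ` insert x V. real (card (clu A x Int cube R z)))"
proof -
 have AV: "A \<subseteq> Pow V" using assms EdR_Pow by blast
 have fin: "finite (clu A x)" by (rule finite_clu[OF AV assms(2)])
 have "clu A x = (UN z:ci R ` insert x V. clu A x Int cube R z)"
  using clu_subset_insert[OF AV, of x] by (fastforce simp: in_cube_ci)
 then have "card (clu A x) = card (UN z:ci R ` insert x V. clu A x Int cube R z)" by simp
 also have "... = (SUM z:ci R ` insert x V. card (clu A x Int cube R z))"
  using assms(2) fin by (intro card_UN_disjoint) (auto simp: in_cube_ci)
 finally show ?thesis by simp
qed

abbreviation "moments_abs_with C \<equiv>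
 ALL R>=1. ALL V x. finite V -->
  avw (EdR V R) (%A. csz A x ^ 2) <= C * R ^r ((D + 3 * a) / 2) &
  (ALL m>=1. (ALL v. avw (EdR V R) (%A. csz A v ^ 2) <= m) -->
   avw (EdR V R) (%A. csz A x ^ 4)
    <= C * (R ^r D * m) powr (2 / 3) * sqrt (m * R ^r ((D + 3 * a) / 2)))"

text \<open>Cells are summed by Cauchy-Schwarz and its iterate, with weights decaying away from
  \<open>x\<close>. The second moment of one cell is of order R^((d+a)/2) times R^a times the
  decay.\<close>

lemma moments_abs: "EX C>0. moments_abs_with C"
proof -
 obtain C1 \<rho> where C1: "C1 > 0" and \<rho>: "0 < \<rho>" "\<rho> < 1"
  and H1: "ALL R>=1. ALL V x z. finite V --> (SUM y:cube R z. pr (EdR V R) x y) <= C1 * R ^r a * (\<rho> ^ sd (ci R x) z) ^ 12"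
  using cell_decay by blast
 obtain C2 where C2: "C2 > 0" and H2: "cell_moment2_with C2"
  using cell_moment2 by blast
 obtain C4 where C4: "C4 > 0" and H4: "cell_moment4_with C4"
  using cell_moment4 by blast
 obtain S where S: "S > 0" and HS: "ALL Z (z0 :: int ^ 'd). finite Z --> (SUM z:Z. \<rho> ^ sd z0 z) <= S"
  using sum_weights[OF \<rho>] by blast
 define Ca where "Ca = S * (C2 * C1 * S)"
 define Cb where "Cb = S ^ 3 * C4 * sqrt (C2 * C1 * S)"
 have pos: "Ca > 0" "Cb > 0" using S C1 C2 C4 by (simp_all add: Ca_def Cb_def)
 show ?thesis
 proof (intro exI[of _ "Ca + Cb"] conjI allI impI)
  fix R :: nat and V :: "(int ^ 'd) set" and x :: "int ^ 'd" assume R: "1 <= R" and V: "finite V"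
  let ?E = "EdR V R"
  define Z where "Z = ci R ` insert x V"
  have fZ: "finite Z" using V by (simp add: Z_def)
  define q where "q = (%z. \<rho> ^ sd (ci R x) z)"
  have q: "0 < q z" "q z <= 1" for z using \<rho> by (auto simp: q_def intro: power_le_one)
  have Sq: "(SUM z:Z. q z) <= S" "0 <= (SUM z:Z. q z)"
   using HS fZ \<rho> by (auto simp: q_def intro!: sum_nonneg)
  let ?X = "%z A. real (card (clu A x Int cube R z))"
  let ?h = "R ^r ((D + 3 * a) / 2)"
  have EX2: "avw ?E (%A. ?X z A ^ 2) <= C2 * C1 * ?h * q z ^ 12" for z
  proof -
   have "avw ?E (%A. ?X z A ^ 2) <= C2 * R ^r ((D + a) / 2) * (SUM y:cube R z. pr ?E x y)"
    using H2[rule_format, OF R V EdR_subset_Ed] .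
   also have "... <= C2 * R ^r ((D + a) / 2) * (C1 * R ^r a * q z ^ 12)"
    unfolding q_def using C2 by (intro mult_left_mono H1[rule_format] R V) auto
   also have "... = C2 * C1 * (R ^r ((D + a) / 2) * R ^r a) * q z ^ 12" by simp
   also have "R ^r ((D + a) / 2) * R ^r a = ?h"
   proof -
    have "(D + a) / 2 + a = (D + 3 * a) / 2" by simp
    then show ?thesis by (simp only: flip: powr_add)
   qed
   finally show ?thesis .
  qed
  have EXn: "0 <= avw ?E (%A. ?X z A ^ 2)" for z by (intro avg_nonneg pER V) auto
  have wsum: "(SUM z:Z. avw ?E (%A. ?X z A ^ 2) / q z ^ k) <= C2 * C1 * S * ?h" if "k <= 11" for k
  proof -
   have "(SUM z:Z. avw ?E (%A. ?X z A ^ 2) / q z ^ k) <= (SUM z:Z. C2 * C1 * ?h * q z)"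
   proof (rule sum_mono)
    fix z
    have "avw ?E (%A. ?X z A ^ 2) / q z ^ k <= C2 * C1 * ?h * q z ^ 12 / q z ^ k"
     using q[of z] by (intro divide_right_mono EX2) auto
    also have "... = C2 * C1 * ?h * q z ^ (12 - k)"
     using q[of z] that by (simp add: power_diff)
    also have "... <= C2 * C1 * ?h * q z ^ 1"
     using C1 C2 q[of z] that by (intro mult_left_mono power_decreasing) auto
    finally show "avw ?E (%A. ?X z A ^ 2) / q z ^ k <= C2 * C1 * ?h * q z" by simp
   qed
   also have "... = C2 * C1 * ?h * (SUM z:Z. q z)" by (simp add: sum_distrib_left)
   also have "... <= C2 * C1 * ?h * S" using C1 C2 Sq by (intro mult_left_mono) auto
   finally show ?thesis by (simp add: mult_ac)
  qed
  have "avw ?E (%A. csz A x ^ 2) <= avw ?E (%A. S * (SUM z:Z. ?X z A ^ 2 / q z))"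
  proof (intro avg_mono pER V)
   fix A assume "A \<subseteq> ?E"
   then have "csz A x ^ 2 = (SUM z:Z. ?X z A)^2" by (simp add: card_cells[OF R V] Z_def)
   also have "... <= (SUM z:Z. q z) * (SUM z:Z. ?X z A ^ 2 / q z)" by (intro weighted_square fZ q)
   also have "... <= S * (SUM z:Z. ?X z A ^ 2 / q z)"
    using Sq by (intro mult_right_mono sum_nonneg) (auto intro!: divide_nonneg_pos q)
   finally show "csz A x ^ 2 <= S * (SUM z:Z. ?X z A ^ 2 / q z)" .
  qed
  also have "... = S * (SUM z:Z. avw ?E (%A. ?X z A ^ 2) / q z ^ 1)"
   using avg_cmult_right[of ?E "pk w" _ "1 / q _"] by (simp add: avg_cmult avg_sum)
  also have "... <= S * (C2 * C1 * S * ?h)" using S by (intro mult_left_mono wsum) auto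
  finally have A2: "avw ?E (%A. csz A x ^ 2) <= Ca * ?h" by (simp add: Ca_def mult.assoc)
  also have "... <= (Ca + Cb) * ?h" using pos by (intro mult_right_mono) auto
  finally show "avw ?E (%A. csz A x ^ 2) <= (Ca + Cb) * ?h" .
  fix m :: real assume m: "m >= 1" and m2: "ALL v. avw ?E (%A. csz A v ^ 2) <= m"
  let ?M = "(R ^r D * m) powr (2 / 3)"
  have "avw ?E (%A. csz A x ^ 4) <= avw ?E (%A. S ^ 3 * (SUM z:Z. ?X z A ^ 4 / q z ^ 3))"
  proof (intro avg_mono pER V)
   fix A assume "A \<subseteq> ?E"
   then have "csz A x ^ 4 = (SUM z:Z. ?X z A) ^ 4" by (simp add: card_cells[OF R V] Z_def)
   also have "... <= (SUM z:Z. q z) ^ 3 * (SUM z:Z. ?X z A ^ 4 / q z ^ 3)" by (intro weighted_fourth fZ q)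
   also have "... <= S ^ 3 * (SUM z:Z. ?X z A ^ 4 / q z ^ 3)"
    using Sq by (intro mult_right_mono power_mono sum_nonneg) (auto intro!: divide_nonneg_pos q intro: less_imp_le[OF q(1)])
   finally show "csz A x ^ 4 <= S ^ 3 * (SUM z:Z. ?X z A ^ 4 / q z ^ 3)" .
  qed
  also have "... = S ^ 3 * (SUM z:Z. avw ?E (%A. ?X z A ^ 4) / q z ^ 3)"
   using avg_cmult_right[of ?E "pk w" _ "1 / q _ ^ 3"] by (simp add: avg_cmult avg_sum)
  also have "... <= S ^ 3 * (SUM z:Z. C4 * ?M * avw ?E (%A. ?X z A ^ 2) / q z ^ 3)"
   using S q m m2 by (intro mult_left_mono sum_mono divide_right_mono H4[rule_format] R V) (auto intro: less_imp_le)
  also have "... = S ^ 3 * (C4 * ?M) * (SUM z:Z. avw ?E (%A. ?X z A ^ 2) / q z ^ 3)"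
   by (simp add: sum_distrib_left mult.assoc)
  also have "... <= S ^ 3 * (C4 * ?M) * sqrt (m * (C2 * C1 * S * ?h))"
  proof (intro mult_left_mono)
   \<comment> \<open>Interpolation: the unweighted sum is at most \<open>m\<close> by the very
     definition of \<open>m\<close>, and the sum weighted by the sixth power still converges thanks
     to \<open>cell_decay\<close>; hence a geometric mean.\<close>
   let ?e = "%z. avw ?E (%A. ?X z A ^ 2)"
   have "(SUM z:Z. ?e z / q z ^ 3)^2 = (SUM z:Z. sqrt (?e z) * (sqrt (?e z) / q z ^ 3))^2"
    using EXn by simp
   also have "... <= (SUM z:Z. (sqrt (?e z))^2) * (SUM z:Z. (sqrt (?e z) / q z ^ 3)^2)"
    by (rule Cauchy_Schwarz_ineq_sum)
   also have "... = (SUM z:Z. ?e z) * (SUM z:Z. ?e z / q z ^ 6)"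
    using EXn by (simp add: power_divide flip: power_mult)
   also have "... <= m * (C2 * C1 * S * ?h)"
   proof (intro mult_mono wsum)
    have "(SUM z:Z. ?e z) = avw ?E (%A. SUM z:Z. ?X z A ^ 2)" by (simp add: avg_sum)
    also have "... <= avw ?E (%A. csz A x ^ 2)"
    proof (intro avg_mono pER V)
     fix A assume "A \<subseteq> ?E"
     then have e: "csz A x = (SUM z:Z. ?X z A)" by (simp add: card_cells[OF R V] Z_def)
     have "(SUM z:Z. ?X z A ^ 2) <= (SUM z:Z. ?X z A * csz A x)"
      unfolding power2_eq_square e by (intro sum_mono mult_left_mono member_le_sum fZ) auto
     also have "... = csz A x ^ 2" by (simp add: e power2_eq_square sum_distrib_right)
     finally show "(SUM z:Z. ?X z A ^ 2) <= csz A x ^ 2" .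
    qed
    also have "... <= m" using m2 by blast
    finally show "(SUM z:Z. ?e z) <= m" .
   qed (use m in \<open>auto intro!: sum_nonneg divide_nonneg_pos EXn zero_less_power q(1)\<close>)
   finally show "(SUM z:Z. ?e z / q z ^ 3) <= sqrt (m * (C2 * C1 * S * ?h))" by (rule real_le_rsqrt)
  qed (use S C4 in auto)
  also have "sqrt (m * (C2 * C1 * S * ?h)) = sqrt (C2 * C1 * S) * sqrt (m * ?h)"
   by (simp add: real_sqrt_mult mult_ac)
  also have "S ^ 3 * (C4 * ?M) * (sqrt (C2 * C1 * S) * sqrt (m * ?h)) = Cb * ?M * sqrt (m * ?h)"
   by (simp add: Cb_def)
  also have "... <= (Ca + Cb) * ?M * sqrt (m * ?h)"
   using pos m by (intro mult_right_mono) auto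
  finally show "avw ?E (%A. csz A x ^ 4) <= (Ca + Cb) * ?M * sqrt (m * ?h)" .
 qed (use pos in simp)
qed

end

section \<open>Sprinkling of longer edges\<close>

context sym_kernel
begin

lemma prb_pairs_open:
 assumes "finite E" "finite P" "P \<subseteq> S \<times> T" "S Int T = {}" "\<And>u v. (u, v) : P ==> {u, v} : E"
 shows "prw E (%A. EX (u, v):P. {u, v} : A) = 1 - exp (- (SUM (u, v):P. w u v))"
proof -
 let ?g = "%(u, v). {u, v}"
 have inj: "inj_on ?g P"
 proof (rule inj_onI)
  fix i j assume ij: "i : P" "j : P" "?g i = ?g j"
  obtain u v u' v' where uv: "i = (u, v)" "j = (u', v')" by (cases i, cases j)
  then have "u : S" "v : T" "u' : S" "v' : T" using ij assms(3) by auto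
  then show "i = j" using ij(3) assms(4) by (auto simp: uv doubleton_eq_iff)
 qed
 have "prw E (%A. EX (u, v):P. {u, v} : A) = prw E (%A. EX e:?g ` P. e : A)"
  by (intro avg_cong) (auto simp: case_prod_unfold)
 also have "... = 1 - (PROD e:?g ` P. 1 - pk w e)"
  using assms by (intro prb_exists_open) auto
 also have "(PROD e:?g ` P. 1 - pk w e) = (PROD (u, v):P. 1 - pk w {u, v})"
  by (subst prod.reindex[OF inj]) (simp add: case_prod_unfold)
 also have "... = (PROD (u, v):P. exp (- w u v))"
 proof (intro prod.cong refl)
  fix uv assume "uv : P"
  then obtain u v where uv: "uv = (u, v)" "u ~= v" using assms(3,4) by (cases uv) blast
  show "(case uv of (u, v) => 1 - pk w {u, v}) = (case uv of (u, v) => exp (- w u v))"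
   using uv pk_edge[of u v w] w_sym[of u v] by simp
 qed
 also have "... = exp (- (SUM (u, v):P. w u v))"
  using assms(2) by (simp add: exp_sum sum_negf[symmetric] case_prod_unfold)
 finally show ?thesis .
qed

text \<open>When \<open>x\<close> and \<open>v\<close> lie in different clusters, the edges inside
  these two clusters are disjoint witnesses, so BK bounds the joint moment by the product.\<close>

lemma bk_clusters:
 assumes V: "finite V" and E: "E \<subseteq> Ed V"
 shows "avw E (%A. of_bool (conn A x u & ~ conn A x v) * csz A x ^ i * csz A v ^ j)
  <= avw E (%A. of_bool (conn A x u) * csz A x ^ i) * avw E (%A. csz A v ^ j)"
proof -
 interpret finite_perc V E "pk w" by (rule fp_sub[OF V E])
 define W where "W = (%I J. (of_bool (conn I x u) * csz I x ^ i) * csz J v ^ j)"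
 have cm: "csz A y <= csz B y" if "A \<subseteq> B" "B \<subseteq> E" for A B y
  using card_mono[OF finite_clu'[OF that(2)] clu_mono[OF that(1)]] by simp
 have "avw E (%A. of_bool (conn A x u & ~ conn A x v) * csz A x ^ i * csz A v ^ j)
  <= avw E (%A. avw E (W A))"
 proof (rule bk[OF pE])
  fix A B A' B' assume s: "A \<subseteq> A'" "B \<subseteq> B'" "A' \<subseteq> E" "B' \<subseteq> E"
  then have "of_bool (conn A x u) <= (of_bool (conn A' x u) :: real)" using conn_mono[of A x u A'] by auto
  then show "W A B <= W A' B'"
   unfolding W_def by (intro mult_mono power_mono cm s mult_nonneg_nonneg) auto
 next
  fix S assume S: "S \<subseteq> E"
  show "\<exists>C\<subseteq>S. of_bool (conn S x u & ~ conn S x v) * csz S x ^ i * csz S v ^ j <= W C (S - C)"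
  proof (cases "conn S x u & ~ conn S x v")
   case True
   let ?C = "{e : S. e \<subseteq> clu S x & e ~= {}}"
   have C: "conn ?C x y" if "conn S x y" for y using that by (intro conn_within) auto
   have disj: "clu S v Int clu S x = {}"
   proof (rule ccontr)
    assume "clu S v Int clu S x ~= {}"
    then obtain z where "conn S v z" "conn S x z" by auto
    then show False using True conn_trans conn_sym by metis
   qed
   have D: "conn (S - ?C) v y" if "conn S v y" for y
   proof -
    have "conn {e : S. e \<subseteq> clu S v & e ~= {}} v y" using that by (intro conn_within) auto
    then show ?thesis by (rule conn_mono) (use disj in blast)
   qed
   have "card (clu S x) <= card (clu ?C x)" "card (clu S v) <= card (clu (S - ?C) v)"
    using C D S by (auto intro!: card_mono finite_clu')
   then have "csz S x ^ i * csz S v ^ j <= W ?C (S - ?C)"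
    using C True unfolding W_def by (simp add: mult_mono power_mono)
   then show ?thesis using True by (intro exI[of _ ?C]) auto
  qed (auto simp: W_def)
 qed
 also have "... = avw E (%A. of_bool (conn A x u) * csz A x ^ i) * avw E (%A. csz A v ^ j)"
  by (simp only: W_def avg_cmult avg_cmult_right)
 finally show ?thesis .
qed

lemma harris_clusters:
 assumes V: "finite V" and E: "E \<subseteq> Ed V"
 shows "avw E (%A. of_bool (conn A x u) * csz A x ^ i) * avw E (%A. csz A v ^ j)
  <= avw E (%A. (of_bool (conn A x u) * csz A x ^ i) * csz A v ^ j)"
proof -
 interpret finite_perc V E "pk w" by (rule fp_sub[OF V E])
 have cm: "csz A y <= csz B y" if "A \<subseteq> B" "B \<subseteq> E" for A B y
  using card_mono[OF finite_clu'[OF that(2)] clu_mono[OF that(1)]] by simp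
 show ?thesis
 proof (rule harris[OF pE])
  fix A B assume s: "A \<subseteq> B" "B \<subseteq> E"
  then have "of_bool (conn A x u) <= (of_bool (conn B x u) :: real)" using conn_mono[of A x u B] by auto
  then show "of_bool (conn A x u) * csz A x ^ i <= of_bool (conn B x u) * csz B x ^ i"
   by (intro mult_mono power_mono cm s) auto
  show "csz A v ^ j <= csz B v ^ j"
   by (intro power_mono cm s) auto
 qed
qed

text \<open>
 Sprinkling the edges \<open>N\<close> onto \<open>A\<close>: only clusters joined to the cluster of \<open>x\<close> by a single new
 edge are counted.
\<close>

lemma sprinkle_second_moment:
 fixes E N :: "'v set set" and h :: "'v => 'v => real"
 assumes V: "finite V" and E: "E \<subseteq> Ed V" and N: "N \<subseteq> Ed V" "E Int N = {}" and x: "x : V"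
  and h: "h = (%u v. of_bool ({u, v} : N) * w u v)" and b: "\<And>u v. h u v <= b"
 shows "avw E (%A. csz A x ^ 2)
  + (SUM u:V. SUM v:V. h u v * (2 * (avw E (%A. of_bool (conn A x u) * csz A x ^ 1) * avw E (%A. csz A v ^ 1))
     + avw E (%A. of_bool (conn A x u) * csz A x ^ 0) * avw E (%A. csz A v ^ 2)))
  - 3 * b * avw E (%A. csz A x ^ 4)
  - (SUM u:V. SUM v:V. h u v * (b / 2 * (2 * (avw E (%A. of_bool (conn A x u) * csz A x ^ 2) * avw E (%A. csz A v ^ 2))
     + avw E (%A. of_bool (conn A x u) * csz A x ^ 1) * avw E (%A. csz A v ^ 3))))
  <= avw (E Un N) (%A. csz A x ^ 2)"
proof -
 interpret finite_perc V E "pk w" by (rule fp_sub[OF V E])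
 have fE: "finite E" and fN: "finite N"
  using finite_subset[OF E finite_Ed[OF V]] finite_subset[OF N(1) finite_Ed[OF V]] .
 have h0: "0 <= h u v" for u v using w_nonneg by (simp add: h)
 have b0: "0 <= b" using h0 b order_trans by blast
 define K where "K = (%A :: 'v set set. csz A x)"
 define Kv where "Kv = (%v (A :: 'v set set). csz A v)"
 have K0: "0 <= K A" "0 <= Kv v A" for v A by (simp_all add: K_def Kv_def)
 define F where "F = (%A. K A ^ 2 + (SUM u:V. SUM v:V. h u v * (of_bool (conn A x u & ~ conn A x v)
   * (Kv v A * (2 * K A + Kv v A) * (1 - b / 2 * (K A * Kv v A))))))"
 have FA: "F A <= avw N (%B. csz (A Un B) x ^ 2)" if A: "A \<subseteq> E" for A
 proof -
  have AV: "A \<subseteq> Pow V" using A E Ed_Pow by blast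
  let ?K = "clu A x"
  have KV: "?K \<subseteq> V" by (rule clu_subset[OF AV x])
  have fK: "finite ?K" using KV V finite_subset by blast
  have yV: "clu A y \<subseteq> V" if "y : V" for y by (rule clu_subset[OF AV that])
  define U where "U = V - ?K"
  have fU: "finite U" using V by (simp add: U_def)
  define J where "J = (%B y. EX (u, v):{(u, v). u : ?K & v : clu A y & {u, v} : N}. {u, v} : B)"
  have UK: "clu A y Int ?K = {}" if "y : U" for y
  proof (rule ccontr)
   assume "clu A y Int ?K ~= {}"
   then obtain z where "conn A y z" "conn A x z" by auto
   then have "conn A x y" using conn_trans conn_sym by metis
   then show False using that by (auto simp: U_def)
  qed
  have UU: "clu A y \<subseteq> U" if "y : U" for y
   using UK[OF that] yV[of y] that by (auto simp: U_def)
  \<comment> \<open>\<open>Z\<close> is the part outside the old cluster that is now attached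
    through one new edge. It is a union of old clusters, so \<open>Kv y A\<close> is at most
    \<open>card Z\<close> for \<open>y\<close> in \<open>Z\<close>; this gives the lower bound on
    the square of the enlarged size.\<close>
  have pt: "K A ^ 2 + (SUM y:U. of_bool (J B y) * (2 * K A + Kv y A)) <= csz (A Un B) x ^ 2"
   if B: "B \<subseteq> N" for B
  proof -
   define Z where "Z = {y : U. J B y}"
   have fZ: "finite Z" using fU by (simp add: Z_def)
   have AB: "A Un B \<subseteq> Pow V" using AV B N(1) Ed_Pow by blast
   have sub: "?K Un Z \<subseteq> clu (A Un B) x"
   proof
    fix y assume "y : ?K Un Z"
    then show "y : clu (A Un B) x"
    proof
     assume "y : ?K" then show ?thesis by (auto elim: conn_mono)
    next
     assume "y : Z"
     then obtain u v where "conn A x u" "conn A y v" "{u, v} : B" by (auto simp: Z_def J_def)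
     then have "conn (A Un B) x u" "conn (A Un B) u v" "conn (A Un B) v y"
      using conn_sym[of A y v] by (auto intro: conn_edge elim: conn_mono)
     then have "conn (A Un B) x y" by (meson conn_trans)
     then show ?thesis by simp
    qed
   qed
   have "card (?K Un Z) = card ?K + card Z" using fK fZ by (intro card_Un_disjoint) (auto simp: Z_def U_def)
   then have "K A + real (card Z) <= csz (A Un B) x"
    using card_mono[OF finite_clu[OF AB V] sub] by (simp add: K_def)
   then have "(K A + real (card Z)) ^ 2 <= csz (A Un B) x ^ 2"
    using K0 by (intro power_mono) auto
   moreover have "K A ^ 2 + (SUM y:U. of_bool (J B y) * (2 * K A + Kv y A)) <= (K A + real (card Z)) ^ 2"
   proof -
    have "(SUM y:U. of_bool (J B y) * (2 * K A + Kv y A)) = (SUM y:Z. 2 * K A + Kv y A)"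
     using fU by (intro sum.mono_neutral_cong_right) (auto simp: Z_def)
    also have "... <= (SUM y:Z. 2 * K A + real (card Z))"
    proof (intro sum_mono add_left_mono)
     fix y assume y: "y : Z"
     have "clu A y \<subseteq> Z"
     proof
      fix z assume z: "z : clu A y"
      then have "clu A z = clu A y" using clu_eq[of A y z] by simp
      then have "J B z = J B y" by (simp only: J_def)
      then show "z : Z" using UU[of y] y z by (auto simp: Z_def)
     qed
     then show "Kv y A <= real (card Z)" using fZ by (simp add: Kv_def card_mono)
    qed
    also have "... = 2 * K A * real (card Z) + real (card Z) ^ 2" by (simp add: power2_eq_square algebra_simps)
    finally show ?thesis by (simp add: power2_eq_square algebra_simps)
   qed
   ultimately show ?thesis by linarith
  qed
  have pJ: "(SUM u:?K. SUM v:clu A y. h u v) * (1 - b / 2 * (K A * Kv y A)) <= prw N (%B. J B y)" if y: "y : U" for y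
  proof -
   let ?P = "{(u, v). u : ?K & v : clu A y & {u, v} : N}"
   have fy: "finite (clu A y)" using UU[OF y] fU finite_subset by blast
   have PS: "?P \<subseteq> ?K \<times> clu A y" by auto
   have fP: "finite ?P" using finite_subset[OF PS] fK fy by simp
   let ?x = "SUM u:?K. SUM v:clu A y. h u v"
   have "(SUM (u, v):?P. w u v) = (SUM (u, v):?K \<times> clu A y. h u v)"
    using fK fy by (intro sum.mono_neutral_cong_left) (auto simp: h)
   then have xe: "(SUM (u, v):?P. w u v) = ?x" by (simp add: sum.cartesian_product)
   have x0: "0 <= ?x" by (intro sum_nonneg h0)
   have xb: "?x <= b * (K A * Kv y A)"
   proof -
    have "?x <= (SUM u:?K. SUM v:clu A y. b)" by (intro sum_mono b)
    then show ?thesis by (simp add: K_def Kv_def mult_ac)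
   qed
   have "?x * (1 - b / 2 * (K A * Kv y A)) <= ?x - ?x^2 / 2"
    using mult_left_mono[OF xb x0] by (simp add: power2_eq_square algebra_simps)
   also have "... <= 1 - exp (- ?x)" by (rule exp_lower[OF x0])
   also have "... = prw N (%B. J B y)"
    unfolding J_def xe[symmetric]
    using UK[OF y] by (intro prb_pairs_open[symmetric, OF fN fP PS]) auto
   finally show ?thesis .
  qed
  \<comment> \<open>All vertices \<open>y\<close> of one cluster give the same summand, so
    exchanging \<open>y\<close> with the endpoint \<open>v\<close> of a new edge produces the factor
    \<open>Kv v A\<close>.\<close>
  have "F A = K A ^ 2 + (SUM y:U. (2 * K A + Kv y A) * ((SUM u:?K. SUM v:clu A y. h u v) * (1 - b / 2 * (K A * Kv y A))))"
  proof -
   define g where "g = (%y. (2 * K A + Kv y A) * (1 - b / 2 * (K A * Kv y A)))"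
   have gv: "g v = g y" "Kv v A = Kv y A" if "conn A y v" for y v
    using clu_eq[OF that] by (simp_all add: g_def Kv_def)
   have "(SUM y:U. (2 * K A + Kv y A) * ((SUM u:?K. SUM v:clu A y. h u v) * (1 - b / 2 * (K A * Kv y A))))
    = (SUM y:U. SUM u:?K. SUM v:U. of_bool (conn A y v) * (h u v * g y))"
   proof (rule sum.cong[OF refl])
    fix y assume y: "y : U"
    have "(SUM v:clu A y. h u v * g y) = (SUM v:U. of_bool (conn A y v) * (h u v * g y))" for u
     using UU[OF y] fU by (intro sum.mono_neutral_cong_left) auto
    then show "(2 * K A + Kv y A) * ((SUM u:?K. SUM v:clu A y. h u v) * (1 - b / 2 * (K A * Kv y A)))
      = (SUM u:?K. SUM v:U. of_bool (conn A y v) * (h u v * g y))"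
     by (simp add: g_def sum_distrib_left sum_distrib_right mult_ac)
   qed
   also have "... = (SUM u:?K. SUM v:U. SUM y:U. of_bool (conn A y v) * (h u v * g y))"
    by (subst sum.swap, rule sum.cong[OF refl], rule sum.swap)
   also have "... = (SUM u:?K. SUM v:U. h u v * (Kv v A * g v))"
   proof (intro sum.cong refl)
    fix u v assume v: "v : U"
    have "(SUM y:U. of_bool (conn A y v) * (h u v * g y)) = (SUM y:clu A v. h u v * g v)"
     using UU[OF v] fU gv(1) conn_commute[of A v]
     by (intro sum.mono_neutral_cong_right) auto
    then show "(SUM y:U. of_bool (conn A y v) * (h u v * g y)) = h u v * (Kv v A * g v)"
     by (simp add: Kv_def)
   qed
   also have "... = (SUM u:V. SUM v:V. h u v * (of_bool (conn A x u & ~ conn A x v) * (Kv v A * g v)))"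
   proof -
    have "(SUM v:U. h u v * (Kv v A * g v)) = (SUM v:V. h u v * (of_bool (conn A x u & ~ conn A x v) * (Kv v A * g v)))" if "u : ?K" for u
     using that V by (intro sum.mono_neutral_cong_left) (auto simp: U_def)
    then have "(SUM u:?K. SUM v:U. h u v * (Kv v A * g v)) = (SUM u:?K. SUM v:V. h u v * (of_bool (conn A x u & ~ conn A x v) * (Kv v A * g v)))"
     by (rule sum.cong[OF refl])
    also have "... = (SUM u:V. SUM v:V. h u v * (of_bool (conn A x u & ~ conn A x v) * (Kv v A * g v)))"
     using V KV by (intro sum.mono_neutral_left) auto
    finally show ?thesis .
   qed
   finally show ?thesis by (simp add: F_def g_def mult.assoc)
  qed
  also have "... <= K A ^ 2 + (SUM y:U. (2 * K A + Kv y A) * prw N (%B. J B y))"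
   using K0 by (intro add_left_mono sum_mono mult_left_mono pJ) auto
  also have "... = avw N (%B. K A ^ 2 + (SUM y:U. of_bool (J B y) * (2 * K A + Kv y A)))"
   using fN by (simp add: avg_add avg_sum avg_cmult_right mult.commute)
  also have "... <= avw N (%B. csz (A Un B) x ^ 2)"
   using fN by (intro avg_mono pE pt) (auto simp: probs_def p01)
  finally show ?thesis .
 qed
 define a1 where "a1 = (%u v A. (of_bool (conn A x u) * K A ^ 1) * Kv v A ^ 1)"
 define a2 where "a2 = (%u v A. (of_bool (conn A x u) * K A ^ 0) * Kv v A ^ 2)"
 define a3 where "a3 = (%u v A. of_bool (conn A x u & conn A x v) * K A ^ 2)"
 define a4 where "a4 = (%u v A. of_bool (conn A x u & ~ conn A x v) * K A ^ 2 * Kv v A ^ 2)"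
 define a5 where "a5 = (%u v A. of_bool (conn A x u & ~ conn A x v) * K A ^ 1 * Kv v A ^ 3)"
 \<comment> \<open>The indicator that \<open>v\<close> is outside the cluster of \<open>x\<close> is
   removed from the main terms, to which Harris then applies. If \<open>v\<close> is inside,
   \<open>Kv v A = K A\<close> and the overcount is 2 + 1 = 3 times \<open>K A ^ 2\<close>. The
   second-order terms keep the indicator because BK needs distinct clusters.\<close>
 have tm: "of_bool (conn A x u & ~ conn A x v) * (Kv v A * (2 * K A + Kv v A) * (1 - b / 2 * (K A * Kv v A)))
  = 2 * a1 u v A + a2 u v A - 3 * a3 u v A - b / 2 * (2 * a4 u v A + a5 u v A)" for u v A
 proof (cases "conn A x u")
  case True
  show ?thesis
  proof (cases "conn A x v")
   case t: True
   then have "Kv v A = K A" using clu_eq[of A x v] by (simp add: Kv_def K_def)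
   then show ?thesis using True t by (simp add: a1_def a2_def a3_def a4_def a5_def power2_eq_square)
  next
   case False
   then show ?thesis using True
    by (simp add: a1_def a2_def a3_def a4_def a5_def power2_eq_square power3_eq_cube algebra_simps)
  qed
 qed (simp add: a1_def a2_def a3_def a4_def a5_def)
 let ?av = "avw E"
 have "avw (E Un N) (%A. csz A x ^ 2)
  = ?av (%A. avw N (%B. csz (A Un B) x ^ 2))"
  using fE fN N by (intro avg_union)
 also have "... >= ?av F" by (intro avg_mono pE FA)
 also have "?av F = ?av (%A. K A ^ 2) + (SUM u:V. SUM v:V. h u v * (2 * ?av (a1 u v) + ?av (a2 u v) - 3 * ?av (a3 u v) - b / 2 * (2 * ?av (a4 u v) + ?av (a5 u v))))"
  unfolding F_def tm by (simp only: avg_add avg_sum avg_cmult avg_diff)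
 also have "... = ?av (%A. K A ^ 2) + (SUM u:V. SUM v:V. h u v * (2 * ?av (a1 u v) + ?av (a2 u v)))
   - 3 * (SUM u:V. SUM v:V. h u v * ?av (a3 u v)) - (SUM u:V. SUM v:V. h u v * (b / 2 * (2 * ?av (a4 u v) + ?av (a5 u v))))"
  by (simp add: right_diff_distrib sum_subtractf sum_distrib_left mult_ac)
 finally have main: "?av (%A. K A ^ 2) + (SUM u:V. SUM v:V. h u v * (2 * ?av (a1 u v) + ?av (a2 u v)))
   - 3 * (SUM u:V. SUM v:V. h u v * ?av (a3 u v)) - (SUM u:V. SUM v:V. h u v * (b / 2 * (2 * ?av (a4 u v) + ?av (a5 u v))))
  <= avw (E Un N) (%A. csz A x ^ 2)" .
 have h1: "(SUM u:V. SUM v:V. h u v * (2 * (?av (%A. of_bool (conn A x u) * K A ^ 1) * ?av (%A. Kv v A ^ 1))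
     + ?av (%A. of_bool (conn A x u) * K A ^ 0) * ?av (%A. Kv v A ^ 2)))
  <= (SUM u:V. SUM v:V. h u v * (2 * ?av (a1 u v) + ?av (a2 u v)))"
  unfolding a1_def a2_def K_def Kv_def
  by (intro sum_mono mult_left_mono add_mono harris_clusters[OF V E] h0) auto
 have h3: "(SUM u:V. SUM v:V. h u v * ?av (a3 u v)) <= b * ?av (%A. K A ^ 4)"
 proof -
  have "(SUM u:V. SUM v:V. h u v * ?av (a3 u v)) <= (SUM u:V. SUM v:V. b * ?av (a3 u v))"
   by (intro sum_mono mult_right_mono b avg_nonneg pE) (auto simp: a3_def)
  also have "... = b * ?av (%A. SUM u:V. SUM v:V. a3 u v A)"
   by (simp add: avg_sum sum_distrib_left)
  also have "?av (%A. SUM u:V. SUM v:V. a3 u v A) = ?av (%A. K A ^ 4)"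
  proof (rule avg_cong)
   fix A assume "A \<subseteq> E"
   then have "clu A x \<subseteq> V" using E Ed_Pow[of V] by (intro clu_subset x) blast
   then have "(SUM u:V. of_bool (conn A x u)) = K A"
    using card_Int_sum[OF V, of "clu A x"] by (simp add: K_def Int_absorb2)
   moreover have "(SUM u:V. SUM v:V. a3 u v A) = (SUM u:V. of_bool (conn A x u)) * (SUM u:V. of_bool (conn A x u)) * K A ^ 2"
    by (subst sum_product) (simp add: a3_def of_bool_conj sum_distrib_right)
   ultimately show "(SUM u:V. SUM v:V. a3 u v A) = K A ^ 4" by (simp add: power2_eq_square power4_eq_xxxx)
  qed
  finally show ?thesis .
 qed
 have h4: "(SUM u:V. SUM v:V. h u v * (b / 2 * (2 * ?av (a4 u v) + ?av (a5 u v))))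
  <= (SUM u:V. SUM v:V. h u v * (b / 2 * (2 * (?av (%A. of_bool (conn A x u) * K A ^ 2) * ?av (%A. Kv v A ^ 2))
     + ?av (%A. of_bool (conn A x u) * K A ^ 1) * ?av (%A. Kv v A ^ 3))))"
  unfolding a4_def a5_def K_def Kv_def using b0
  by (intro sum_mono mult_left_mono add_mono bk_clusters[OF V E] h0) auto
 show ?thesis using main h1 h3 h4 unfolding K_def Kv_def by linarith
qed

end

section \<open>Growth of the truncated moments with the range\<close>

context crit_low
begin

definition mu :: "nat => nat => nat => real" where
 "mu k R n = avw (EdR (lbox 0 n) R) (%A. csz A 0 ^ k)"

text \<open>The supremum is also the limit over boxes (\<open>mu_lim\<close>) and dominates every
  finite volume by translation (\<open>le_mk\<close>), so \<open>mk k R\<close> is the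
  infinite-volume moment.\<close>

definition mk :: "nat => nat => real" where
 "mk k R = (SUP n. mu k R n)"

lemma card_clu_mono:
 "finite V ==> A' \<subseteq> Ed V ==> A \<subseteq> A' ==> csz A x ^ k <= csz A' x ^ k"
 using Ed_Pow[of V] by (intro power_mono of_nat_mono card_mono finite_clu[of A' V] clu_mono) auto

lemma mu_mono: "n <= n' ==> mu k R n <= mu k R n'"
 unfolding mu_def using EdR_subset_Ed
 by (intro avg_mono_set pER EdR_mono lbox_mono card_clu_mono[of "lbox 0 n'"] finite_lbox) blast+

lemma mu_dominates:
 assumes V: "finite V"
 shows "EX n. avw (EdR V R) (%A. csz A x ^ k) <= mu k R n"
proof -
 let ?V = "(%y. y + - x) ` V"
 define n where "n = Max (insert 0 (sd 0 ` ?V))"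
 have "sd 0 v <= n" if "v : ?V" for v unfolding n_def using V that by (intro Max_ge) auto
 then have sub: "?V \<subseteq> lbox 0 n" by auto
 have "avw (EdR V R) (%A. csz A x ^ k) = avw (EdR ?V R) (%A. csz A 0 ^ k)"
  unfolding EdR_shift
 proof (rule avg_shift[symmetric])
  fix A assume "A \<subseteq> EdR V R"
  then have "e ~= {}" if "e : A" for e using ne_Ed[of A V] EdR_subset_Ed[of V R] that by blast
  then have "clu ((`) ((`) (%y. y + - x)) A) (x + - x) = (%y. y + - x) ` clu A x"
   by (intro clu_image inj_shift)
  then show "real (card (clu ((`) ((`) (%y. y + - x)) A) 0)) ^ k = csz A x ^ k"
   by (simp add: card_image)
 qed
 also have "... <= mu k R n"
  unfolding mu_def using EdR_subset_Ed
  by (intro avg_mono_set pER EdR_mono sub card_clu_mono[of "lbox 0 n"] finite_lbox) blast+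
 finally show ?thesis by blast
qed

lemma mu_bounded:
 assumes R: "R >= 1" and k: "k <= 4"
 shows "bdd_above (range (mu k R))"
proof -
 obtain C where C: "C > 0" and H: "moments_abs_with C"
  using moments_abs by blast
 define m where "m = max 1 (C * R ^r ((D + 3 * a) / 2))"
 have "avw (EdR V R) (%A. csz A x ^ 2) <= m" if "finite V" for V x
  using H[rule_format, OF R that, of x] unfolding m_def by linarith
 then have 4: "mu 4 R n <= C * (R ^r D * m) powr (2 / 3) * sqrt (m * R ^r ((D + 3 * a) / 2))" for n
  unfolding mu_def using H[rule_format, OF R finite_lbox[of 0 n], of 0] by (simp add: m_def)
 have "mu k R n <= 1 + mu 4 R n" for n
 proof -
  have p: "x ^ k <= 1 + x ^ 4" if "x >= 0" for x :: real
  proof (cases "x <= 1")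
   case True
   then show ?thesis using power_le_one[OF that True, of k] zero_le_power[OF that, of 4] by linarith
  next
   case False
   then have "x ^ k <= x ^ 4" by (intro power_increasing k) simp
   then show ?thesis by simp
  qed
  have "mu k R n <= avw (EdR (lbox 0 n) R) (%A. 1 + csz A 0 ^ 4)"
   unfolding mu_def by (intro avg_mono pER finite_lbox p) simp
  then show ?thesis by (simp add: mu_def avg_add finite_EdR)
 qed
 then have "mu k R n <= 1 + C * (R ^r D * m) powr (2 / 3) * sqrt (m * R ^r ((D + 3 * a) / 2))" for n
  using 4[of n] order_trans[of "mu k R n" "1 + mu 4 R n"] by fastforce
 then show ?thesis by (intro bdd_aboveI2) blast
qed

lemma mu_le_mk: "R >= 1 ==> k <= 4 ==> mu k R n <= mk k R"
 unfolding mk_def by (intro cSUP_upper mu_bounded) auto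

lemma mu_lim: "R >= 1 ==> k <= 4 ==> (%n. mu k R n) \<longlonglongrightarrow> mk k R"
 unfolding mk_def by (intro LIMSEQ_incseq_SUP mu_bounded incseq_def[THEN iffD2] allI impI mu_mono)

lemma le_mk: "finite V ==> R >= 1 ==> k <= 4 ==> avw (EdR V R) (%A. csz A x ^ k) <= mk k R"
 using mu_dominates[of V R x k] mu_le_mk[of R k] order_trans by blast

lemma mk_leI: "(\<And>n. mu k R n <= c) ==> mk k R <= c"
 unfolding mk_def by (intro cSUP_least) auto

lemma card_clu_ge_1: "finite V ==> A \<subseteq> Ed V ==> 1 <= card (clu A x)"
proof -
 assume V: "finite V" "A \<subseteq> Ed V"
 have "finite (clu A x)" by (rule finite_clu[of A V]) (use V Ed_Pow[of V] in auto)
 moreover have "x : clu A x" by simp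
 ultimately have "0 < card (clu A x)" unfolding card_gt_0_iff by blast
 then show ?thesis by simp
qed

lemma mk_ge_1: "R >= 1 ==> k <= 4 ==> 1 <= mk k R"
proof -
 assume R: "R >= 1" "k <= 4"
 have "1 = avw (EdR (lbox 0 0) R) (%A. 1)" by (simp add: finite_EdR)
 also have "... <= mu k R 0" unfolding mu_def
 proof (intro avg_mono pER finite_lbox one_le_power)
  fix A :: "(int ^ 'd) set set" assume "A \<subseteq> EdR (lbox 0 0) R"
  then show "1 <= csz A 0"
   using card_clu_ge_1[of "lbox 0 0" A 0] subset_trans[OF \<open>A \<subseteq> _\<close> EdR_subset_Ed] by simp
 qed
 also have "... <= mk k R" by (rule mu_le_mk[OF R])
 finally show ?thesis .
qed

lemma mu_1_eq: "mu 1 R n = (SUM y:lbox 0 n. pr (EdR (lbox 0 n) R) 0 y)"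
proof -
 have "mu 1 R n = avw (EdR (lbox 0 n) R) (%A. real (card (clu A 0 Int lbox 0 n)))"
  unfolding mu_def
 proof (rule avg_cong)
  fix A assume "A \<subseteq> EdR (lbox 0 n) R"
  then have "clu A 0 \<subseteq> lbox 0 n" using EdR_Pow[of "lbox 0 n" R] by (intro clu_subset) auto
  then show "csz A 0 ^ 1 = real (card (clu A 0 Int lbox 0 n))" by (simp add: Int_absorb2)
 qed
 then show ?thesis by (simp only: avg_card finite_lbox)
qed

abbreviation "mk_1_bounds_with c C \<equiv>
 ALL R>=1. c * R ^r a <= mk 1 R & mk 1 R <= C * R ^r a"

text \<open>For the lower bound, a box of radius \<open>R div 2\<close> has only edges of length at
  most \<open>R\<close>, so there the truncated model agrees with the full one and
  \<open>en_lower\<close> applies.\<close>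

lemma mk_1_bounds: "EX c>0. EX C>0. mk_1_bounds_with c C"
proof -
 obtain C where C: "C > 0" and HC: "chi_upper_with C"
  using chi_upper by blast
 obtain c where c: "c > 0" and Hc: "ALL n>=1. c * n ^r a <= en n" using en_lower by blast
 define c' where "c' = min (c * 4 powr - a) (4 powr - a)"
 have c': "c' > 0" using c by (simp add: c'_def)
 have "c' * R ^r a <= mk 1 R" if R: "R >= 1" for R
 proof (cases "R >= 2")
  case True
  define n where "n = R div 2"
  have n: "n >= 1" "2 * n <= R" "R <= 4 * n" using True unfolding n_def by linarith+
  have e: "EdR (lbox 0 n) R = Ed (lbox (0 :: int ^ 'd) n)"
  proof (rule Ed_EdR[symmetric])
   fix x y :: "int ^ 'd" assume "x : lbox 0 n" "y : lbox 0 n"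
   then show "sd x y <= R" using sd_triangle[of x y 0] sd_commute[of x 0] n by simp
  qed
  have "c' * R ^r a <= c * 4 powr - a * (4 * real n) powr a"
   using n c a0 by (intro mult_mono powr_mono2) (auto simp: c'_def)
  also have "... = c * n ^r a" by (simp add: powr_mult powr_minus)
  also have "... <= en n" using Hc n by simp
  also have "... = mu 1 R n" unfolding mu_def e using avg_lbox[of 0 n] by simp
  also have "... <= mk 1 R" using R by (intro mu_le_mk) auto
  finally show ?thesis .
 next
  case False
  then have "R = 1" using R by simp
  moreover have "c' <= 4 powr - a" "4 powr - a <= (1 :: real)" using a0 powr_mono[of "- a" 0 "4 :: real"] by (simp_all add: c'_def)
  ultimately show ?thesis using mk_ge_1[of R 1] by simp
 qed
 moreover have "mk 1 R <= C * R ^r a" if R: "R >= 1" for R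
  unfolding One_nat_def[symmetric]
  by (rule mk_leI) (simp only: mu_1_eq HC[rule_format, OF R] finite_lbox)
 ultimately show ?thesis using c' C by blast
qed

definition rate :: "nat => nat => real" where
 "rate R R' = (SUM v:lbox 0 R' - lbox 0 R. w 0 v)"

lemma rate_shift: "(SUM v:lbox u R' - lbox u R. w u v) = rate R R'"
proof -
 have e: "sd 0 (v - u) = sd u v" "w 0 (v - u) = w u v" for v
  using sd_shift[of u "- u" v] w_shift[of u "- u" v] by (simp_all del: sd_shift)
 then show ?thesis
  unfolding rate_def
  by (intro sum.reindex_bij_witness[of _ "%v. v + u" "%v. v - u"]) (auto simp: e simp del: sd_shift simp flip: e(1)[of "_ + u"])
qed

lemma rate_nonneg: "0 <= rate R R'"
 unfolding rate_def by (intro sum_nonneg w_nonneg)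

text \<open>A vertex newly reached lies beyond an edge longer than \<open>R\<close> that leaves the
  \<open>R\<close>-cluster; after this edge the full range \<open>R'\<close> is allowed.\<close>

lemma mk_1_growth:
 assumes R: "1 <= R" "R <= R'"
 shows "mk 1 R' <= mk 1 R + rate R R' * mk 1 R * mk 1 R'"
proof (rule mk_leI)
 fix n
 let ?V = "lbox (0 :: int ^ 'd) n" let ?E' = "EdR ?V R'" let ?E = "EdR ?V R"
 have sub: "?E' \<subseteq> Ed ?V" "?E \<subseteq> ?E'" using EdR_subset_Ed EdR_mono[OF subset_refl R(2)] by blast+
 have sum_pr: "(SUM y:?V. pr ?E' v y) <= mk 1 R'" for v
 proof -
  have "(SUM y:?V. pr ?E' v y) = avw ?E' (%A. real (card (clu A v Int ?V)))"
   by (rule avg_card[symmetric]) simp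
  also have "... <= avw ?E' (%A. csz A v ^ 1)"
  proof (intro avg_mono pER finite_lbox)
   fix A assume "A \<subseteq> ?E'"
   then have "finite (clu A v)" using EdR_Pow[of ?V R'] by (intro finite_clu[of A ?V]) auto
   then show "real (card (clu A v Int ?V)) <= csz A v ^ 1" by (simp add: card_mono)
  qed
  also have "... <= mk 1 R'" using R by (intro le_mk) auto
  finally show ?thesis .
 qed
 have p0: "0 <= pr ?E x y" for x y using pr_bounds[of ?E x y] by (simp add: finite_EdR)
 have "mu 1 R' n <= (SUM y:?V. pr ?E 0 y + (SUM u:?V. SUM v:?V. of_bool ({u, v} : ?E' - ?E) * (pr ?E 0 u * w u v * pr ?E' v y)))"
  unfolding mu_1_eq by (intro sum_mono decompose sub finite_lbox)
 also have "... = mu 1 R n + (SUM u:?V. SUM v:?V. of_bool ({u, v} : ?E' - ?E) * (pr ?E 0 u * w u v * (SUM y:?V. pr ?E' v y)))"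
 proof -
  have "(SUM y:?V. SUM u:?V. SUM v:?V. of_bool ({u, v} : ?E' - ?E) * (pr ?E 0 u * w u v * pr ?E' v y))
   = (SUM u:?V. SUM v:?V. of_bool ({u, v} : ?E' - ?E) * (pr ?E 0 u * w u v * (SUM y:?V. pr ?E' v y)))"
   unfolding sum_distrib_left by (subst sum.swap, rule sum.cong[OF refl], rule sum.swap)
  then show ?thesis by (simp only: sum.distrib mu_1_eq)
 qed
 also have "... <= mu 1 R n + (SUM u:?V. pr ?E 0 u * (rate R R' * mk 1 R'))"
 proof (intro add_left_mono sum_mono)
  fix u
  have "(SUM v:?V. of_bool ({u, v} : ?E' - ?E) * (pr ?E 0 u * w u v * (SUM y:?V. pr ?E' v y)))
   <= (SUM v:?V. of_bool ({u, v} : ?E' - ?E) * (pr ?E 0 u * w u v * mk 1 R'))"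
   by (intro sum_mono mult_left_mono sum_pr mult_nonneg_nonneg p0 w_nonneg) simp
  also have "... <= (SUM v:lbox u R' - lbox u R. pr ?E 0 u * w u v * mk 1 R')"
  proof -
   let ?T = "{v : ?V. {u, v} : ?E' - ?E}"
   have "(SUM v:?V. of_bool ({u, v} : ?E' - ?E) * (pr ?E 0 u * w u v * mk 1 R')) = (SUM v:?T. pr ?E 0 u * w u v * mk 1 R')"
    by (intro sum.mono_neutral_cong_right) auto
   also have "... <= (SUM v:lbox u R' - lbox u R. pr ?E 0 u * w u v * mk 1 R')"
    using mk_ge_1[of R' 1] R
    by (intro sum_mono2 mult_nonneg_nonneg p0 w_nonneg) auto
   finally show ?thesis .
  qed
  also have "... = pr ?E 0 u * (rate R R' * mk 1 R')"
   by (simp add: rate_shift[symmetric, of _ _ u] sum_distrib_left sum_distrib_right mult_ac)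
  finally show "(SUM v:?V. of_bool ({u, v} : ?E' - ?E) * (pr ?E 0 u * w u v * (SUM y:?V. pr ?E' v y))) <= pr ?E 0 u * (rate R R' * mk 1 R')" .
 qed
 also have "... = mu 1 R n + rate R R' * mu 1 R n * mk 1 R'"
  unfolding mu_1_eq by (simp add: sum_distrib_left sum_distrib_right mult_ac)
 also have "... <= mk 1 R + rate R R' * mk 1 R * mk 1 R'"
  using R mk_ge_1[of R' 1] rate_nonneg by (intro add_mono mult_right_mono mult_left_mono mu_le_mk) auto
 finally show "mu 1 R' n <= mk 1 R + rate R R' * mk 1 R * mk 1 R'" .
qed

lemma mu_2_eq: "mu 2 R n = (SUM u:lbox 0 n. avw (EdR (lbox 0 n) R) (%A. of_bool (conn A 0 u) * csz A 0 ^ 1))"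
proof -
 have "mu 2 R n = avw (EdR (lbox 0 n) R) (%A. SUM u:lbox 0 n. of_bool (conn A 0 u) * csz A 0 ^ 1)"
  unfolding mu_def
 proof (rule avg_cong)
  fix A assume "A \<subseteq> EdR (lbox 0 n) R"
  then have "clu A 0 \<subseteq> lbox 0 n" using EdR_Pow[of "lbox 0 n" R] by (intro clu_subset) auto
  then have "(SUM u:lbox 0 n. of_bool (conn A 0 u)) = csz A 0"
   using card_Int_sum[of "lbox 0 n" "clu A 0"] by (simp add: Int_absorb2)
  then show "csz A 0 ^ 2 = (SUM u:lbox 0 n. of_bool (conn A 0 u) * csz A 0 ^ 1)"
   by (simp add: power2_eq_square flip: sum_distrib_right)
 qed
 then show ?thesis by (simp only: avg_sum)
qed

lemma conn_moment_sum:
 assumes "finite V" "0 : V" "R >= 1" "i + 1 <= 4"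
 shows "(SUM u:V. avw (EdR V R) (%A. of_bool (conn A 0 u) * csz A 0 ^ i)) <= mk (i + 1) R"
proof -
 have "(SUM u:V. avw (EdR V R) (%A. of_bool (conn A 0 u) * csz A 0 ^ i))
  = avw (EdR V R) (%A. SUM u:V. of_bool (conn A 0 u) * csz A 0 ^ i)"
  by (simp only: avg_sum)
 also have "... = avw (EdR V R) (%A. csz A 0 ^ (i + 1))"
 proof (rule avg_cong)
  fix A assume "A \<subseteq> EdR V R"
  then have "clu A 0 \<subseteq> V" using EdR_Pow[of V R] assms by (intro clu_subset) auto
  then have "(SUM u:V. of_bool (conn A 0 u)) = csz A 0"
   using card_Int_sum[of V "clu A 0"] assms by (simp add: Int_absorb2)
  then show "(SUM u:V. of_bool (conn A 0 u) * csz A 0 ^ i) = csz A 0 ^ (i + 1)"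
   by (simp flip: sum_distrib_right)
 qed
 also have "... <= mk (i + 1) R" using assms by (intro le_mk) auto
 finally show ?thesis .
qed

text \<open>The linear term of \<open>sprinkle_second_moment\<close> sums to
  \<open>2 * mk 2 R * mk 1 R + mk 1 R * mk 2 R\<close> times the rate, which is the coefficient 3.
  \<open>b\<close> bounds the weight of a single new edge.\<close>

lemma mk_2_growth:
 assumes R: "1 <= R" "R <= R'" and b: "b = C0 * R ^r (- (D + a))"
 shows "mk 2 R + 3 * rate R R' * mk 1 R * mk 2 R - 3 * b * mk 4 R - 3 / 2 * b * rate R R' * mk 2 R * mk 3 R <= mk 2 R'"
proof -
 let ?S = "rate R R'"
 note kk = mk_ge_1[OF R(1)] rate_nonneg[of R R']
 have b0: "0 <= b" using C0 by (simp add: b)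
 have "mu 2 R n + ?S * (2 * mu 2 R n * mu 1 R n + mu 1 R n * mu 2 R n) - 3 * b * mk 4 R - 3 / 2 * b * ?S * mk 2 R * mk 3 R <= mk 2 R'" for n
 proof -
  \<comment> \<open>Large enough that every edge of length at most \<open>R'\<close> from a vertex
    of \<open>lbox 0 n\<close> ends at a point whose own box of radius \<open>n\<close> lies in
    \<open>V\<close>.\<close>
  define V where "V = lbox (0 :: int ^ 'd) (2 * n + R')"
  define E where "E = EdR V R"
  define N where "N = EdR V R' - EdR V R"
  define h where "h = (%u v. of_bool ({u, v} : N) * w u v)"
  have V: "finite V" "0 : V" by (simp_all add: V_def)
  have EN: "E \<subseteq> Ed V" "N \<subseteq> Ed V" "E Int N = {}" "E Un N = EdR V R'"
   using EdR_subset_Ed EdR_mono[OF subset_refl R(2), of V] by (auto simp: E_def N_def)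
  have h0: "0 <= h u v" for u v using w_nonneg by (simp add: h_def)
  have hb: "h u v <= b" for u v
  proof (cases "{u, v} : N")
   case True
   then have uv: "u ~= v" "R < sd u v" by (auto simp: N_def)
   have "w u v <= C0 * real (sd u v) powr (- (D + a))" by (rule wu[OF uv(1)])
   also have "... <= b" unfolding b using uv R C0 D1 a0 by (intro mult_left_mono powr_mono2') auto
   finally show ?thesis using True by (simp add: h_def)
  qed (use b0 in \<open>simp add: h_def\<close>)
  have hS: "(SUM v:V. h u v) <= ?S" for u
  proof -
   have "(SUM v:V. h u v) = (SUM v:{v : V. {u, v} : N}. w u v)"
    unfolding h_def using V by (intro sum.mono_neutral_cong_right) auto
   also have "... <= (SUM v:lbox u R' - lbox u R. w u v)"
    by (intro sum_mono2 w_nonneg) (auto simp: N_def)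
   finally show ?thesis by (simp only: rate_shift)
  qed
  have hS': "?S <= (SUM v:lbox u R'. h u v)" if u: "u : lbox 0 n" for u
  proof -
   have "?S = (SUM v:lbox u R' - lbox u R. h u v)"
    unfolding rate_shift[symmetric, of R R' u]
   proof (rule sum.cong[OF refl])
    fix v assume v: "v : lbox u R' - lbox u R"
    then have "u ~= v" by auto
    then have "{u, v} : N" using v u sd_triangle[of 0 v u] by (auto simp: N_def V_def)
    then show "w u v = h u v" by (simp add: h_def)
   qed
   also have "... <= (SUM v:lbox u R'. h u v)" by (intro sum_mono2 h0) auto
   finally show ?thesis .
  qed
  let ?av = "avw E"
  have pE': "probs E (pk w)" unfolding E_def by (rule pER[OF V(1)])
  define f where "f = (%i u. ?av (%A. of_bool (conn A 0 u) * csz A 0 ^ i))"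
  define g where "g = (%i v. ?av (%A. csz A v ^ i))"
  have f0: "0 <= f i u" and g0: "0 <= g i v" for i u v
   unfolding f_def g_def by (intro avg_nonneg pE' mult_nonneg_nonneg zero_le_power; simp)+
  have gk: "g i v <= mk i R" if "i <= 4" for i v
   unfolding g_def E_def using le_mk[OF V(1) R(1) that] .
  have gm: "mu i R n <= g i v" if v: "v : lbox u R'" and u: "u : lbox 0 n" for u v i
  proof -
   have sub: "(%y. y + v) ` lbox 0 n \<subseteq> V"
   proof
    fix y assume "y : (%y. y + v) ` lbox 0 n"
    then have "sd v y <= n" by (simp add: lbox_shift)
    then show "y : V" using v u sd_triangle[of 0 v u] sd_triangle[of 0 y v] by (simp add: V_def)
   qed
   have "mu i R n = avw (EdR ((%y. y + v) ` lbox 0 n) R) (%A. csz A v ^ i)"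
    unfolding EdR_shift mu_def
   proof (rule avg_shift[symmetric])
    fix A assume "A \<subseteq> EdR (lbox (0 :: int ^ 'd) n) R"
    then have "e ~= {}" if "e : A" for e using ne_Ed[of A "lbox 0 n"] EdR_subset_Ed[of "lbox 0 n" R] that by blast
    then have "clu ((`) ((`) (%y. y + v)) A) (0 + v) = (%y. y + v) ` clu A 0"
     by (intro clu_image inj_shift)
    then show "real (card (clu ((`) ((`) (%y. y + v)) A) v)) ^ i = csz A 0 ^ i"
     by (simp add: card_image)
   qed
   also have "... <= g i v" unfolding g_def E_def using EdR_subset_Ed
    by (intro avg_mono_set pER EdR_mono sub card_clu_mono[OF V(1)] V) blast+
   finally show ?thesis .
  qed
  have sub0: "lbox 0 n \<subseteq> V" by (auto simp: V_def)
  have mono0: "(SUM u:lbox 0 n. avw (EdR (lbox 0 n) R) (%A. of_bool (conn A 0 u) * csz A 0 ^ i)) <= (SUM u:lbox 0 n. f i u)" for i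
   unfolding f_def E_def
  proof (intro sum_mono avg_mono_set pER V EdR_mono sub0)
   fix u and A A' :: "(int ^ 'd) set set" assume s: "A \<subseteq> A'" "A' \<subseteq> EdR V R"
   have "of_bool (conn A 0 u) <= (of_bool (conn A' 0 u) :: real)" using conn_mono[OF _ s(1)] by auto
   then show "of_bool (conn A 0 u) * csz A 0 ^ i <= of_bool (conn A' 0 u) * csz A' 0 ^ i"
    using card_clu_mono[OF V(1) _ s(1)] s(2) EdR_subset_Ed[of V R] by (intro mult_mono) auto
  qed simp
  have m0: "0 <= mu i R n" for i unfolding mu_def by (intro avg_nonneg pER) auto
  have pos: "?S * (2 * mu 2 R n * mu 1 R n + mu 1 R n * mu 2 R n)
   <= (SUM u:V. SUM v:V. h u v * (2 * (f 1 u * g 1 v) + f 0 u * g 2 v))"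
  proof -
   have "mu 2 R n <= (SUM u:lbox 0 n. f 1 u)" unfolding mu_2_eq by (rule mono0)
   moreover have "mu 1 R n <= (SUM u:lbox 0 n. f 0 u)" unfolding mu_1_eq using mono0[of 0] by simp
   ultimately have "?S * (2 * mu 2 R n * mu 1 R n + mu 1 R n * mu 2 R n)
    <= ?S * (2 * (SUM u:lbox 0 n. f 1 u) * mu 1 R n + (SUM u:lbox 0 n. f 0 u) * mu 2 R n)"
    using kk m0 by (intro mult_left_mono add_mono mult_right_mono) auto
   also have "... = (SUM u:lbox 0 n. ?S * (2 * (f 1 u * mu 1 R n) + f 0 u * mu 2 R n))"
    by (simp add: sum.distrib sum_distrib_left sum_distrib_right algebra_simps)
   also have "... <= (SUM u:lbox 0 n. (SUM v:lbox u R'. h u v) * (2 * (f 1 u * mu 1 R n) + f 0 u * mu 2 R n))"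
    using f0 m0 by (intro sum_mono mult_right_mono hS' add_nonneg_nonneg mult_nonneg_nonneg) auto
   also have "... <= (SUM u:lbox 0 n. SUM v:lbox u R'. h u v * (2 * (f 1 u * g 1 v) + f 0 u * g 2 v))"
    unfolding sum_distrib_right
    by (intro sum_mono mult_left_mono add_mono gm f0 h0) auto
   also have "... <= (SUM u:lbox 0 n. SUM v:V. h u v * (2 * (f 1 u * g 1 v) + f 0 u * g 2 v))"
   proof (intro sum_mono sum_mono2 V)
    fix u assume u: "u : lbox (0 :: int ^ 'd) n"
    show "lbox u R' \<subseteq> V"
    proof
     fix y assume "y : lbox u R'"
     then show "y : V" using u sd_triangle[of 0 y u] by (simp add: V_def)
    qed
   qed (use h0 f0 g0 in auto)
   also have "... <= (SUM u:V. SUM v:V. h u v * (2 * (f 1 u * g 1 v) + f 0 u * g 2 v))"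
    using h0 f0 g0 by (intro sum_mono2 V sub0 sum_nonneg) auto
   finally show ?thesis .
  qed
  have fk: "(SUM u:V. f i u) <= mk (i + 1) R" if "i + 1 <= 4" for i
   unfolding f_def E_def by (rule conn_moment_sum[OF V R(1) that])
  have neg: "(SUM u:V. SUM v:V. h u v * (b / 2 * (2 * (f 2 u * g 2 v) + f 1 u * g 3 v))) <= 3 / 2 * b * ?S * mk 2 R * mk 3 R"
  proof -
   have "(SUM u:V. SUM v:V. h u v * (b / 2 * (2 * (f 2 u * g 2 v) + f 1 u * g 3 v)))
    <= (SUM u:V. SUM v:V. h u v * (b / 2 * (2 * (f 2 u * mk 2 R) + f 1 u * mk 3 R)))"
    using b0 by (intro sum_mono mult_left_mono add_mono gk f0 h0) auto
   also have "... <= (SUM u:V. ?S * (b / 2 * (2 * (f 2 u * mk 2 R) + f 1 u * mk 3 R)))"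
    unfolding sum_distrib_right[symmetric]
    using b0 f0 kk(1)[of 2] kk(1)[of 3] by (intro sum_mono mult_right_mono hS mult_nonneg_nonneg add_nonneg_nonneg) auto
   also have "... = ?S * (b / 2 * (2 * ((SUM u:V. f 2 u) * mk 2 R) + (SUM u:V. f 1 u) * mk 3 R))"
    by (simp add: sum.distrib sum_distrib_left sum_distrib_right algebra_simps)
   also have "... <= ?S * (b / 2 * (2 * (mk 3 R * mk 2 R) + mk 2 R * mk 3 R))"
    using b0 kk(1)[of 2] kk(1)[of 3] kk(2) fk[of 2] fk[of 1]
    by (intro mult_left_mono add_mono mult_right_mono) (auto simp: numeral_eq_Suc)
   also have "... = 3 / 2 * b * ?S * mk 2 R * mk 3 R" by (simp add: algebra_simps)
   finally show ?thesis .
  qed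
  have "g 2 0 + (SUM u:V. SUM v:V. h u v * (2 * (f 1 u * g 1 v) + f 0 u * g 2 v)) - 3 * b * g 4 0
    - (SUM u:V. SUM v:V. h u v * (b / 2 * (2 * (f 2 u * g 2 v) + f 1 u * g 3 v)))
    <= avw (E Un N) (%A. csz A 0 ^ 2)"
   unfolding f_def g_def by (rule sprinkle_second_moment[OF V(1) EN(1-3) V(2) h_def hb])
  also have "... <= mk 2 R'" unfolding EN(4) using R by (intro le_mk V) auto
  finally have "g 2 0 + (SUM u:V. SUM v:V. h u v * (2 * (f 1 u * g 1 v) + f 0 u * g 2 v)) - 3 * b * g 4 0
    - (SUM u:V. SUM v:V. h u v * (b / 2 * (2 * (f 2 u * g 2 v) + f 1 u * g 3 v))) <= mk 2 R'" .
  moreover have "mu 2 R n <= g 2 0" by (rule gm[of 0 0]) auto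
  moreover have "3 * b * g 4 0 <= 3 * b * mk 4 R" using b0 by (intro mult_left_mono gk) auto
  ultimately show ?thesis using pos neg by linarith
 qed
 moreover have "(%n. mu 2 R n + ?S * (2 * mu 2 R n * mu 1 R n + mu 1 R n * mu 2 R n) - 3 * b * mk 4 R - 3 / 2 * b * ?S * mk 2 R * mk 3 R)
  \<longlonglongrightarrow> mk 2 R + ?S * (2 * mk 2 R * mk 1 R + mk 1 R * mk 2 R) - 3 * b * mk 4 R - 3 / 2 * b * ?S * mk 2 R * mk 3 R"
  using R by (intro tendsto_intros mu_lim) auto
 ultimately have "mk 2 R + ?S * (2 * mk 2 R * mk 1 R + mk 1 R * mk 2 R) - 3 * b * mk 4 R - 3 / 2 * b * ?S * mk 2 R * mk 3 R <= mk 2 R'"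
  using LIMSEQ_le_const2 by blast
 then show ?thesis by (simp add: algebra_simps)
qed

end

text \<open>Both sides have logarithms linear in \<open>t\<close> to first order, with slopes
  \<open>q < r\<close>. For small \<open>t\<close> the growth of the first moment to the power
  \<open>q\<close> is beaten by that of the second moment.\<close>

lemma one_minus_powr_le:
 fixes t q r :: real
 assumes "0 <= t" "t < 1" "0 < q" "0 < r" "t * (r * (1 + q)) <= r - q"
 shows "(1 - t) powr (- q) <= 1 + r * t"
proof -
 have 1: "- ln (1 - t) <= t / (1 - t)"
  using ln_le_minus_one[of "1 / (1 - t)"] assms by (simp add: ln_div field_simps)
 have 2: "r * t / (1 + r * t) <= ln (1 + r * t)"
 proof -
  have p: "0 < 1 + r * t" using assms by (intro add_pos_nonneg) auto
  then have "- ln (1 + r * t) <= 1 / (1 + r * t) - 1"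
   using ln_le_minus_one[of "1 / (1 + r * t)"] by (simp add: ln_div)
  moreover have "1 / (1 + r * t) - 1 = - (r * t / (1 + r * t))" using p by (simp add: field_simps)
  ultimately show ?thesis by linarith
 qed
 have 3: "q * (t / (1 - t)) <= r * t / (1 + r * t)"
 proof -
  have "(q * (1 + r * t)) * t <= (r * (1 - t)) * t"
   using assms by (intro mult_right_mono) (auto simp: algebra_simps)
  then show ?thesis using assms by (simp add: divide_simps add_pos_nonneg) (simp add: algebra_simps)
 qed
 have "- q * ln (1 - t) <= q * (t / (1 - t))" using mult_left_mono[OF 1, of q] assms by simp
 also have "... <= ln (1 + r * t)" using 3 2 by linarith
 finally have "exp (- q * ln (1 - t)) <= exp (ln (1 + r * t))" by simp
 then show ?thesis using assms by (simp add: powr_def add_pos_nonneg)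
qed

context crit_low
begin

text \<open>Exponent of the maximal order of the second moment: the first moment R^a times the
  largest typical size R^((d+a)/2).\<close>

definition h2 :: real where "h2 = (D + 3 * a) / 2"

lemma mk_mono_R: "1 <= R ==> R <= R' ==> k <= 4 ==> mk k R <= mk k R'"
proof (rule mk_leI)
 fix n assume R: "1 <= R" "R <= R'" "k <= 4"
 have "mu k R n <= mu k R' n"
  unfolding mu_def using R EdR_subset_Ed
  by (intro avg_mono_set pER EdR_mono card_clu_mono[of "lbox 0 n"] finite_lbox) blast+
 also have "... <= mk k R'" using R by (intro mu_le_mk) auto
 finally show "mu k R n <= mk k R'" .
qed

lemma mk_3_le: "R >= 1 ==> mk 3 R <= sqrt (mk 2 R * mk 4 R)"
proof (rule mk_leI, rule real_le_rsqrt)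
 fix n assume R: "R >= 1"
 have "(mu 3 R n)^2 <= mu 2 R n * mu 4 R n"
  unfolding mu_def
  using avg_CS[OF pER[of "lbox 0 n" R], of "%A. csz A 0" "%A. csz A 0 ^ 2"]
  by (simp add: power3_eq_cube power2_eq_square power4_eq_xxxx mult_ac)
 also have "... <= mk 2 R * mk 4 R"
  using R mk_ge_1[of R] mu_def by (intro mult_mono mu_le_mk) (auto simp: mu_def intro!: avg_nonneg pER order_trans[OF zero_le_one mk_ge_1])
 finally show "(mu 3 R n)^2 <= mk 2 R * mk 4 R" .
qed

abbreviation "mk_24_le_with C \<equiv>
 ALL R>=1. mk 2 R <= C * R ^r h2 &
   (ALL e>=0. mk 2 R <= e ^ 6 * R ^r h2 --> mk 4 R <= C * e * R ^r (D + a) * mk 2 R)"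

text \<open>After one factor \<open>mk 2 R\<close> is split off, the fourth-moment bound of
  \<open>moments_abs\<close> contains the power 1/6 of \<open>mk 2 R\<close>. A deficit
  \<open>e ^ 6\<close> in the second moment thus becomes a factor \<open>e\<close>.\<close>

lemma mk_24_le: "EX C>0. mk_24_le_with C"
proof -
 obtain C where C: "C > 0" and H: "moments_abs_with C"
  using moments_abs by blast
 show ?thesis
 proof (intro exI[of _ C] conjI C allI impI)
  fix R :: nat assume R: "R >= 1"
  show "mk 2 R <= C * R ^r h2"
   unfolding h2_def by (rule mk_leI) (use H R in \<open>simp add: mu_def\<close>)
  fix e :: real assume e: "e >= 0" and le: "mk 2 R <= e ^ 6 * R ^r h2"
  let ?m = "mk 2 R"
  have m1: "1 <= ?m" using R by (intro mk_ge_1) auto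
  then have e0: "e > 0" using e le by (cases "e = 0") auto
  have "mk 4 R <= C * (R ^r D * ?m) powr (2 / 3) * sqrt (?m * R ^r h2)"
  proof (rule mk_leI)
   fix n
   have "avw (EdR (lbox 0 n) R) (%A. csz A v ^ 2) <= ?m" for v
    using R by (intro le_mk) auto
   then show "mu 4 R n <= C * (R ^r D * ?m) powr (2 / 3) * sqrt (?m * R ^r h2)"
    using H[THEN spec[of _ R], THEN mp[OF _ R], THEN spec[of _ "lbox 0 n"], THEN spec[of _ 0]] m1
    by (simp add: mu_def h2_def)
  qed
  also have "... = C * (R ^r (2 * D / 3) * ?m powr (1 / 6) * R ^r (h2 / 2)) * ?m"
  proof -
   have "?m powr (2 / 3) * ?m powr (1 / 2) = ?m powr (1 / 6) * ?m powr 1"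
    unfolding powr_add[symmetric] by simp
   then show ?thesis using m1 by (simp add: powr_mult powr_powr real_sqrt_mult powr_half_sqrt[symmetric] mult_ac)
  qed
  also have "... <= C * (R ^r (2 * D / 3) * (e * R ^r (h2 / 6)) * R ^r (h2 / 2)) * ?m"
  proof -
   have "?m powr (1 / 6) <= (e ^ 6 * R ^r h2) powr (1 / 6)"
    using m1 le by (intro powr_mono2) auto
   also have "... = (e ^ 6) powr (1 / 6) * R ^r (h2 / 6)" by (simp add: powr_mult powr_powr)
   also have "(e ^ 6) powr (1 / 6) = e"
    unfolding powr_numeral[OF e, symmetric] powr_powr using e0 by simp
   finally show ?thesis using C m1 by (intro mult_right_mono mult_left_mono) auto
  qed
  also have "... = C * e * (R ^r (2 * D / 3) * R ^r (h2 / 6) * R ^r (h2 / 2)) * ?m"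
   by simp
  also have "R ^r (2 * D / 3) * R ^r (h2 / 6) * R ^r (h2 / 2) = R ^r (D + a)"
   unfolding powr_add[symmetric] by (rule arg_cong[of _ _ "(powr) (real R)"]) (simp add: h2_def field_simps)
  finally show "mk 4 R <= C * e * R ^r (D + a) * ?m" .
 qed
qed

abbreviation "rate_bounds_with c C \<equiv>
 ALL M>=1. ALL R>=M. c / real M * R ^r (- a) <= rate R (R + R div M)
   & rate R (R + R div M) <= C / real M * R ^r (- a)"

lemma rate_bounds: "EX c>0. EX C>0. rate_bounds_with c C"
proof -
 define c where "c = c0 * 2 powr (- (D + a))"
 define C where "C = C0 * (D * 2 * 5 ^ (CARD('d) - 1))"
 have d: "CARD('d) > 0" by simp
 have "c / real M * R ^r (- a) <= rate R (R + R div M) & rate R (R + R div M) <= C / real M * R ^r (- a)"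
  if M: "M >= 1" and R: "R >= M" for M R :: nat
 proof -
  define j where "j = R div M"
  let ?T = "lbox (0 :: int ^ 'd) (R + j) - lbox 0 R"
  have R1: "R >= 1" using M R by simp
  have j: "j <= R" "real j <= real R / real M" "real R / (2 * real M) <= real j"
  proof -
   show "j <= R" by (simp add: j_def)
   show "real j <= real R / real M" unfolding j_def by (rule of_nat_div_le_of_nat)
   have "j >= 1" using M R div_le_mono[OF R, of M] by (simp add: j_def)
   moreover have "R < M * (j + 1)" unfolding j_def using M by (simp add: dividend_less_times_div)
   moreover have "M * (j + 1) <= M * (2 * j)" using \<open>j >= 1\<close> by (intro mult_le_mono) auto
   ultimately have "R <= 2 * M * j" by (simp only: mult.assoc mult.left_commute[of M 2])
   then have "real R <= 2 * real M * real j" using of_nat_mono[of R "2 * M * j"] by simp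
   then show "real R / (2 * real M) <= real j" using M by (simp add: divide_simps mult_ac)
  qed
  have pD: "real R ^ (CARD('d) - 1) * real R * R ^r (- (D + a)) = R ^r (- a)"
  proof -
   have "real R ^ (CARD('d) - 1) * real R = R ^r D"
    using R1 powr_Dn[of "real R"] d power_minus_mult[OF d, of "real R"] by simp
   then show ?thesis by (simp flip: powr_add)
  qed
  have card: "real (card ?T) = real (2 * (R + j) + 1) ^ CARD('d) - real (2 * R + 1) ^ CARD('d)"
   by (rule card_annulus) simp
  have sdT: "0 ~= v & real R <= real (sd 0 v) & real (sd 0 v) <= 2 * real R" if "v : ?T" for v
   using that j(1) R1 by force
  have "rate R (R + j) <= (SUM v:?T. C0 * R ^r (- (D + a)))"
   unfolding rate_def
  proof (rule sum_mono)
   fix v assume "v : ?T"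
   note v = sdT[OF this]
   have "w 0 v <= C0 * real (sd 0 v) powr (- (D + a))" using v by (intro wu) auto
   also have "... <= C0 * R ^r (- (D + a))"
    using v R1 C0 D1 a0 by (intro mult_left_mono powr_mono2') auto
   finally show "w 0 v <= C0 * R ^r (- (D + a))" .
  qed
  also have "... = real (card ?T) * (C0 * R ^r (- (D + a)))" by simp
  also have "... <= (D * (2 * (real R / real M)) * (5 * real R) ^ (CARD('d) - 1)) * (C0 * R ^r (- (D + a)))"
  proof (intro mult_right_mono)
   have "real (card ?T) <= real CARD('d) * (real (2 * (R + j) + 1) - real (2 * R + 1)) * real (2 * (R + j) + 1) ^ (CARD('d) - 1)"
    unfolding card by (rule power_diff_le) auto
   also have "... <= D * (2 * (real R / real M)) * (5 * real R) ^ (CARD('d) - 1)"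
    unfolding D_def using j R1 by (intro mult_mono power_mono) auto
   finally show "real (card ?T) <= D * (2 * (real R / real M)) * (5 * real R) ^ (CARD('d) - 1)" .
  qed (use C0 in simp)
  also have "... = C / real M * (real R ^ (CARD('d) - 1) * real R * R ^r (- (D + a)))"
   by (simp add: C_def power_mult_distrib mult_ac)
  finally have up: "rate R (R + j) <= C / real M * R ^r (- a)" unfolding pD .
  have "c / real M * R ^r (- a) = (2 * (real R / (2 * real M)) * real R ^ (CARD('d) - 1)) * (c0 * (2 * real R) powr (- (D + a)))"
   unfolding pD[symmetric] using M by (simp add: c_def powr_mult field_simps)
  also have "... <= real (card ?T) * (c0 * (2 * real R) powr (- (D + a)))"
  proof (intro mult_right_mono)
   have "2 * (real R / (2 * real M)) * real R ^ (CARD('d) - 1) <= (real (2 * (R + j) + 1) - real (2 * R + 1)) * real (2 * R + 1) ^ (CARD('d) - 1)"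
    using j(3) by (intro mult_mono power_mono) auto
   also have "... <= real (card ?T)" unfolding card by (rule power_diff_ge) auto
   finally show "2 * (real R / (2 * real M)) * real R ^ (CARD('d) - 1) <= real (card ?T)" .
  qed (use c0 in simp)
  also have "... = (SUM v:?T. c0 * (2 * real R) powr (- (D + a)))" by simp
  also have "... <= rate R (R + j)"
   unfolding rate_def
  proof (rule sum_mono)
   fix v assume "v : ?T"
   note v = sdT[OF this]
   have "c0 * (2 * real R) powr (- (D + a)) <= c0 * real (sd 0 v) powr (- (D + a))"
    using v R1 c0 D1 a0 by (intro mult_left_mono powr_mono2') auto
   also have "... <= w 0 v" using v by (intro wl) auto
   finally show "c0 * (2 * real R) powr (- (D + a)) <= w 0 v" .
  qed
  finally show ?thesis using up by (simp add: j_def)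
 qed
 moreover have "c > 0" "C > 0" using c0 C0 D1 by (simp_all add: c_def C_def)
 ultimately show ?thesis by blast
qed

text \<open>Keep \<open>c * mk 1 R powr q * R ^r (- \<kappa>) <= mk 2 R\<close> along a sequence of
  ranges. Since \<open>mk 1 R\<close> is of order R^a, this is the claimed order, but unlike the
  claim it propagates under the growth inequalities.\<close>

lemma hyperscaling: "EX c>0. ALL R>=1. c * R ^r h2 <= mk 2 R"
proof -
 obtain c1 C1 where c1: "c1 > 0" and C1: "C1 > 0"
  and chi: "mk_1_bounds_with c1 C1" using mk_1_bounds by blast
 obtain cS CS where cS: "cS > 0" and CS: "CS > 0"
  and rate: "rate_bounds_with cS CS" using rate_bounds by blast
 obtain C4 where C4: "C4 > 0" and m4: "mk_24_le_with C4" using mk_24_le by blast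
 \<comment> \<open>\<open>\<rho>\<close> lies between 2 and 3 because a < d < 3a. Then
   \<open>q\<close> is the midpoint of \<open>\<rho>\<close> and 3, \<open>r\<close> that of
   \<open>q\<close> and 3: \<open>r\<close> is the growth rate of the second moment that survives
   the errors.\<close>
 define \<rho> where "\<rho> = h2 / a"
 define q where "q = (\<rho> + 3) / 2"
 define r where "r = (3 + q) / 2"
 define \<kappa> where "\<kappa> = q * a - h2"
 have qr: "0 < q" "q < r" "r < 3" "0 < \<kappa>" "2 < q"
 proof -
  have "\<rho> < 3" "2 < \<rho>" using low aD a0 by (simp_all add: \<rho>_def h2_def D_def field_simps)
  then have "2 < q" "q < 3" "\<rho> < q" by (simp_all add: q_def)
  then show "0 < q" "q < r" "r < 3" "2 < q" by (simp_all add: r_def)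
  show "0 < \<kappa>" using \<open>\<rho> < q\<close> a0 by (simp add: \<kappa>_def \<rho>_def field_simps)
 qed
 \<comment> \<open>The threshold of \<open>one_minus_powr_le\<close>. Increasing the range by
   \<open>R div M\<close> with \<open>M\<close> large keeps the product of rate and first moment
   below it.\<close>
 define t0 where "t0 = (r - q) / (r * (1 + q))"
 have t0: "0 < t0" "t0 < 1"
 proof -
  have "r * (1 + q) > 2 * 3" using qr by (intro mult_strict_mono) auto
  then show "0 < t0" "t0 < 1" using qr by (simp_all add: t0_def)
 qed
 obtain M :: nat where M: "M >= 1" "CS * C1 / real M <= t0"
 proof -
  obtain M :: nat where "real M >= max 1 (CS * C1 / t0)" using real_arch_simple by blast
  then show ?thesis using t0 by (intro that[of M]) (auto simp: field_simps)
 qed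
 \<comment> \<open>The slack \<open>3 - r\<close> times a lower bound for rate times first moment.
   \<open>e\<close> is then small enough that all error terms, at most
   \<open>Ks * e * mk 2 R\<close>, fit into it.\<close>
 define \<tau> where "\<tau> = (3 - r) * (cS * c1 / real M)"
 have \<tau>: "\<tau> > 0" using qr cS c1 M by (simp add: \<tau>_def)
 define Ks where "Ks = 3 * C0 * C4 + 3 / 2 * C0 * CS * sqrt C4"
 have Ks: "Ks > 0" using C0 C4 CS by (simp add: Ks_def add_pos_pos)
 define e where "e = min 1 (\<tau> / Ks)"
 have e: "0 < e" "e <= 1" "Ks * e <= \<tau>" using \<tau> Ks by (auto simp: e_def min_def field_simps)
 have h0: "h2 > 0" using D1 a0 by (simp add: h2_def)
 define nx where "nx = (%R. R + R div M)"
 have nx: "R < nx R" "nx R <= 2 * R" if "R >= M" for R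
  using that M div_le_mono[OF that, of M] by (auto simp: nx_def)
 \<comment> \<open>The first bound starts the induction at \<open>M\<close>; the second covers a
   step at which the second moment already exceeds \<open>e ^ 6 * R ^r h2\<close>.\<close>
 define c where "c = min (1 / (mk 1 M powr q * M ^r (- \<kappa>))) (e ^ 6 / (C1 powr q * 2 powr h2))"
 have mkM: "mk 1 M > 0" using mk_ge_1[of M 1] M by simp
 have c: "c > 0" using mkM M e C1 by (simp add: c_def)
 define Inv where "Inv = (%R. c * mk 1 R powr q * R ^r (- \<kappa>) <= mk 2 R)"
 have step: "Inv (nx R)" if R: "R >= M" and IH: "Inv R" for R
 proof -
  have R1: "R >= 1" "1 <= nx R" "R <= nx R" using R M nx[OF R] by auto
  have mono2: "mk 2 R <= mk 2 (nx R)" using R1 by (intro mk_mono_R) auto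
  note g1 = mk_ge_1[OF R1(1)] mk_ge_1[OF R1(2)]
  show ?thesis
  \<comment> \<open>Above this level monotonicity in the range gives the next step at once. Below it
    the fourth moment is negligible and the growth inequalities apply.\<close>
  proof (cases "mk 2 R <= e ^ 6 * R ^r h2")
   case False
   have "c * mk 1 (nx R) powr q * real (nx R) powr (- \<kappa>)
    <= (e ^ 6 / (C1 powr q * 2 powr h2)) * (C1 * real (nx R) powr a) powr q * real (nx R) powr (- \<kappa>)"
    using chi R1 c qr g1(2)[of 1] e C1 by (intro mult_right_mono mult_mono powr_mono2) (auto simp: c_def)
   also have "... = e ^ 6 / 2 powr h2 * real (nx R) powr h2"
   proof -
    have "real (nx R) powr (a * q) * real (nx R) powr (- \<kappa>) = real (nx R) powr h2"
     unfolding powr_add[symmetric] by (simp add: \<kappa>_def mult_ac)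
    then show ?thesis using C1 by (simp add: powr_mult powr_powr)
   qed
   also have "... <= e ^ 6 / 2 powr h2 * (2 * real R) powr h2"
    using nx[OF R] h0 e by (intro mult_left_mono powr_mono2) auto
   also have "... = e ^ 6 * R ^r h2" by (simp add: powr_mult)
   also have "... <= mk 2 (nx R)" using False mono2 by simp
   finally show ?thesis by (simp add: Inv_def)
  next
   case True
   define t where "t = rate R (nx R) * mk 1 R"
   have S: "cS / real M * R ^r (- a) <= rate R (nx R)" "rate R (nx R) <= CS / real M * R ^r (- a)"
    using rate M R by (auto simp: nx_def)
   have pa: "R ^r (- a) * R ^r a = 1" using R1 by (simp flip: powr_add)
   have tl: "cS * c1 / real M <= t"
   proof -
    have "cS * c1 / real M = (cS / real M * R ^r (- a)) * (c1 * R ^r a)"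
     using pa by (simp add: field_simps)
    also have "... <= t" unfolding t_def using chi R1 cS c1 S rate_nonneg by (intro mult_mono) auto
    finally show ?thesis .
   qed
   have tu: "t <= t0"
   proof -
    have "t <= (CS / real M * R ^r (- a)) * (C1 * R ^r a)"
     unfolding t_def using chi R1 S rate_nonneg g1(1)[of 1] CS by (intro mult_mono) auto
    also have "... = CS * C1 / real M" using pa by (simp add: field_simps)
    finally show ?thesis using M by linarith
   qed
   have t: "0 < t" "t < 1" using tl tu t0 cS c1 M order.strict_trans2[of 0 "cS * c1 / real M" t] by auto
   define b where "b = C0 * R ^r (- (D + a))"
   have b: "b > 0" using C0 R1 by (simp add: b_def)
   have m4R: "mk 4 R <= C4 * e * R ^r (D + a) * mk 2 R" using m4 R1 e True by auto
   have pDa: "R ^r (- (D + a)) * R ^r (D + a) = 1" using R1 by (simp flip: powr_add)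
   have e4: "b * mk 4 R <= C0 * C4 * e * mk 2 R"
   proof -
    have "b * mk 4 R <= b * (C4 * e * R ^r (D + a) * mk 2 R)" using b m4R by (intro mult_left_mono) auto
    also have "... = C0 * C4 * e * mk 2 R * (R ^r (- (D + a)) * R ^r (D + a))" by (simp add: b_def)
    finally show ?thesis unfolding pDa by simp
   qed
   have m3R: "mk 3 R <= sqrt C4 * e * R ^r (D + 2 * a)"
   proof -
    have "mk 3 R <= sqrt (mk 2 R * mk 4 R)" by (rule mk_3_le[OF R1(1)])
    also have "... <= sqrt ((e ^ 6 * R ^r h2) * (C4 * e * R ^r (D + a) * (e ^ 6 * R ^r h2)))"
     using True m4R g1(1)[of 2] g1(1)[of 4] C4 e
     by (intro real_sqrt_le_mono mult_mono order_trans[OF m4R] mult_left_mono) auto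
    also have "... = sqrt (C4 * e ^ 13 * R ^r (2 * (D + 2 * a)))"
    proof -
     have "R ^r h2 * (R ^r (D + a) * R ^r h2) = R ^r (2 * (D + 2 * a))"
      unfolding powr_add[symmetric] by (rule arg_cong[of _ _ "(powr) (real R)"]) (simp add: h2_def field_simps)
     then show ?thesis by (simp add: mult_ac flip: power_add power_Suc)
    qed
    also have "... <= sqrt (C4 * e ^ 2 * R ^r (2 * (D + 2 * a)))"
     using e C4 by (intro real_sqrt_le_mono mult_right_mono mult_left_mono power_decreasing) auto
    also have "... = sqrt C4 * e * R ^r (D + 2 * a)"
    proof -
     have "R ^r (2 * (D + 2 * a)) = (R ^r (D + 2 * a)) ^ 2"
      by (simp add: power2_eq_square flip: powr_add)
     then show ?thesis using e by (simp add: real_sqrt_mult)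
    qed
    finally show ?thesis .
   qed
   have e3: "b * rate R (nx R) * mk 2 R * mk 3 R <= C0 * CS * sqrt C4 * e * mk 2 R"
   proof -
    have "rate R (nx R) <= CS * R ^r (- a)"
    proof -
     have "CS / real M <= CS / 1" using M CS by (intro divide_left_mono) auto
     then show ?thesis using S(2) by (smt (verit) mult_right_mono powr_ge_zero div_by_1)
    qed
    then have "b * rate R (nx R) * mk 2 R * mk 3 R <= b * (CS * R ^r (- a)) * mk 2 R * (sqrt C4 * e * R ^r (D + 2 * a))"
     using b rate_nonneg g1(1)[of 2] g1(1)[of 3] m3R CS by (intro mult_mono mult_nonneg_nonneg) auto
    also have "... = C0 * CS * sqrt C4 * e * mk 2 R * (R ^r (- (D + a)) * R ^r (- a) * R ^r (D + 2 * a))"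
     by (simp add: b_def)
    also have "R ^r (- (D + a)) * R ^r (- a) * R ^r (D + 2 * a) = 1"
     unfolding powr_add[symmetric] using R1 by simp
    finally show ?thesis by simp
   qed
   have "3 * b * mk 4 R + 3 / 2 * b * rate R (nx R) * mk 2 R * mk 3 R <= Ks * e * mk 2 R"
    using e4 e3 by (simp add: Ks_def algebra_simps)
   also have "... <= (3 - r) * t * mk 2 R"
   proof (rule mult_right_mono)
    have "\<tau> <= (3 - r) * t" unfolding \<tau>_def using tl qr by (intro mult_left_mono) auto
    then show "Ks * e <= (3 - r) * t" using e by linarith
   qed (use g1(1)[of 2] in simp)
   finally have err: "3 * b * mk 4 R + 3 / 2 * b * rate R (nx R) * mk 2 R * mk 3 R <= (3 - r) * t * mk 2 R" .
   have m2: "(1 + r * t) * mk 2 R <= mk 2 (nx R)"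
    using mk_2_growth[OF R1(1,3) b_def] err by (simp add: t_def algebra_simps)
   have m1: "mk 1 (nx R) <= mk 1 R / (1 - t)"
    using mk_1_growth[OF R1(1,3)] t by (simp add: t_def field_simps)
   have "c * mk 1 (nx R) powr q * real (nx R) powr (- \<kappa>) <= c * (mk 1 R / (1 - t)) powr q * R ^r (- \<kappa>)"
    using c m1 qr g1(2)[of 1] R1 by (intro mult_mono mult_left_mono powr_mono2 powr_mono2') auto
   also have "... = (1 - t) powr (- q) * (c * mk 1 R powr q * R ^r (- \<kappa>))"
    using t g1(1)[of 1] by (simp add: powr_divide powr_minus_divide)
   also have "... <= (1 + r * t) * mk 2 R"
   proof (intro mult_mono one_minus_powr_le)
    show "t * (r * (1 + q)) <= r - q" using tu qr by (subst pos_le_divide_eq[symmetric]) (simp_all add: t0_def)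
    show "c * mk 1 R powr q * R ^r (- \<kappa>) <= mk 2 R" using IH by (simp add: Inv_def)
   qed (use t qr c in auto)
   finally show ?thesis using m2 by (simp add: Inv_def)
  qed
 qed
 \<comment> \<open>The invariant is known only along iterates of \<open>nx\<close>. These leave gaps
   of ratio at most 2, to be filled by monotonicity.\<close>
 have ex: "EX R>=M. R <= X & X < nx R & Inv R" if "X >= M" for X
  using that
 proof (induction X rule: dec_induct)
  case base
  have "c * (mk 1 M powr q * M ^r (- \<kappa>)) <= 1"
   using mkM M by (simp add: c_def min_def field_simps split: if_splits)
  then have "Inv M" using mk_ge_1[of M 2] M by (simp add: Inv_def mult.assoc)
  then show ?case using nx[of M] by auto
 next
  case (step X)
  then obtain R where R: "R >= M" "R <= X" "X < nx R" "Inv R" by blast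
  show ?case
  proof (cases "Suc X < nx R")
   case True then show ?thesis using R by (intro exI[of _ R]) auto
  next
   case False
   then have "Suc X = nx R" using R by simp
   then show ?thesis using \<open>\<And>R. M <= R ==> Inv R ==> Inv (nx R)\<close>[OF R(1,4)] R nx[OF R(1)] nx(1)[of "nx R"]
    by (intro exI[of _ "nx R"]) auto
  qed
 qed
 define cf where "cf = min (c * c1 powr q * 2 powr (- h2)) (M ^r (- h2))"
 have "cf * X ^r h2 <= mk 2 X" if X: "X >= 1" for X
 proof (cases "X >= M")
  case True
  then obtain R where R: "R >= M" "R <= X" "X < nx R" "Inv R" using ex by blast
  have R1: "R >= 1" using R M by simp
  have "cf * X ^r h2 <= c * c1 powr q * 2 powr (- h2) * (2 * real R) powr h2"
   using R nx[OF R(1)] h0 c c1 by (intro mult_mono powr_mono2) (auto simp: cf_def)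
  also have "... = c * c1 powr q * R ^r h2" by (simp add: powr_mult powr_minus)
  also have "... = c * (c1 * R ^r a) powr q * R ^r (- \<kappa>)"
  proof -
   have "R ^r (a * q) * R ^r (- \<kappa>) = R ^r h2"
    unfolding powr_add[symmetric] by (simp add: \<kappa>_def mult_ac)
   then show ?thesis using c1 by (simp add: powr_mult powr_powr)
  qed
  also have "... <= c * mk 1 R powr q * R ^r (- \<kappa>)"
   using c qr c1 chi R1 by (intro mult_right_mono mult_left_mono powr_mono2) auto
  also have "... <= mk 2 R" using R by (simp add: Inv_def)
  also have "... <= mk 2 X" using R R1 by (intro mk_mono_R) auto
  finally show ?thesis .
 next
  case False
  have "cf * X ^r h2 <= M ^r (- h2) * M ^r h2"
   using False h0 M by (intro mult_mono powr_mono2) (auto simp: cf_def)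
  also have "... = 1" using M by (simp flip: powr_add)
  also have "... <= mk 2 X" using X by (intro mk_ge_1) auto
  finally show ?thesis .
 qed
 moreover have "cf > 0" using c c1 M by (simp add: cf_def)
 ultimately show ?thesis by blast
qed

end

context crit_low
begin

lemma mk_3_upper: "EX C>0. ALL R>=1. mk 3 R <= C * R ^r (D + 2 * a)"
proof -
 obtain C where C: "C > 0" and H: "mk_24_le_with C"
  using mk_24_le by blast
 define e where "e = max 1 C"
 have e: "1 <= e" "C <= e ^ 6"
 proof -
  show "1 <= e" by (simp add: e_def)
  then have "e ^ 1 <= e ^ 6" by (intro power_increasing) auto
  then show "C <= e ^ 6" by (simp add: e_def)
 qed
 have "mk 3 R <= sqrt (C ^ 3 * e) * R ^r (D + 2 * a)" if R: "R >= 1" for R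
 proof -
  have 2: "mk 2 R <= C * R ^r h2" using H R by blast
  also have "... <= e ^ 6 * R ^r h2" using e by (intro mult_right_mono) auto
  finally have 4: "mk 4 R <= C * e * R ^r (D + a) * mk 2 R" using H R e by auto
  have "mk 3 R <= sqrt (mk 2 R * mk 4 R)" by (rule mk_3_le[OF R])
  also have "... <= sqrt (mk 2 R * (C * e * R ^r (D + a) * mk 2 R))"
   using 4 mk_ge_1[OF R, of 2] by (intro real_sqrt_le_mono mult_left_mono) auto
  also have "... <= sqrt ((C * R ^r h2) * (C * e * R ^r (D + a) * (C * R ^r h2)))"
   using 2 mk_ge_1[OF R, of 2] C e by (intro real_sqrt_le_mono mult_mono mult_left_mono) auto
  also have "... = sqrt (C ^ 3 * e * (R ^r h2 * (R ^r (D + a) * R ^r h2)))"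
   by (simp add: power3_eq_cube mult_ac)
  also have "R ^r h2 * (R ^r (D + a) * R ^r h2) = (R ^r (D + 2 * a))^2"
   unfolding powr_add[symmetric] power2_eq_square
   by (rule arg_cong[of _ _ "(powr) (real R)"]) (simp add: h2_def field_simps)
  finally show ?thesis using R by (simp add: real_sqrt_mult)
 qed
 moreover have "sqrt (C ^ 3 * e) > 0" using C e by simp
 ultimately show ?thesis by blast
qed

abbreviation "second_moment_box_with c \<equiv>
 ALL n>=1. c * n ^r h2 <= avw (Ed (lbox 0 n)) (%A. csz A 0 ^ 2)"

text \<open>Passage from range \<open>R\<close> in a large volume to a box of radius of order
  \<open>R\<close>. Let \<open>X\<close> be the cluster size and \<open>Y\<close> the part found
  without leaving the box; then \<open>E (X - Y)\<close> is small because \<open>phi\<close> is.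
  Cauchy-Schwarz with the third moment makes \<open>E (X * (X - Y))\<close> small, and
  \<open>Y ^ 2 >= X ^ 2 - 2 * X * (X - Y)\<close>.\<close>

lemma second_moment_box: "EX c>0. second_moment_box_with c"
proof -
 obtain c where c: "c > 0" and m2: "ALL R>=1. c * R ^r h2 <= mk 2 R" using hyperscaling by blast
 obtain C1 where C1: "C1 > 0" and chi: "chi_upper_with C1"
  using chi_upper by blast
 obtain C3 where C3: "C3 > 0" and m3: "ALL R>=1. mk 3 R <= C3 * R ^r (D + 2 * a)" using mk_3_upper by blast
 \<comment> \<open>Chosen so that the Cauchy-Schwarz bound on \<open>E (X * (X - Y))\<close> is
   exactly c/8 R^h2; twice this leaves c/4 of the initial c/2.\<close>
 define \<delta> where "\<delta> = (c / 8)^2 / (C3 * C1)"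
 have \<delta>: "\<delta> > 0" using c C1 C3 by (simp add: \<delta>_def)
 obtain K :: nat where K: "K >= 1" and phi: "ALL R>=1. EX s. 1 <= s & s <= K * R & phi R s <= \<delta>"
  using phi_small[OF \<delta>] by blast
 have h0: "h2 > 0" using D1 a0 by (simp add: h2_def)
 have main: "c / 4 * R ^r h2 <= avw (Ed (lbox 0 (K * R))) (%A. csz A 0 ^ 2)" if R: "R >= 1" for R
 proof -
  obtain s where s: "1 <= s" "s <= K * R" "phi R s <= \<delta>" using phi R by blast
  have "c / 2 * R ^r h2 < mk 2 R"
  proof -
   have "c / 2 * R ^r h2 < c * R ^r h2" using c R by simp
   then show ?thesis using m2 R by (smt (verit))
  qed
  then obtain n where n: "c / 2 * R ^r h2 < mu 2 R n"
   using mk_leI[of 2 R "c / 2 * R ^r h2"] by (meson not_le)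
  define V where "V = lbox (0 :: int ^ 'd) n"
  have V: "finite V" "0 : V" by (simp_all add: V_def)
  let ?E = "EdR V R" and ?E1 = "EdR (V Int lbox 0 s) R"
  have E: "?E \<subseteq> Ed V" "?E1 \<subseteq> ?E" "?E1 \<subseteq> Ed V"
   using EdR_subset_Ed EdR_mono[of "V Int lbox 0 s" V R R] by blast+
  note fE = finite_EdR[OF V(1), of R] and pE = pER[OF V(1), of R]
  let ?av = "avw ?E"
  define X where "X = (%A :: (int ^ 'd) set set. csz A 0)"
  define Y where "Y = (%A. X (A Int ?E1))"
  have Y: "0 <= Y A" "Y A <= X A" if "A \<subseteq> ?E" for A
   using card_clu_mono[OF V(1) subset_trans[OF that E(1)], of "A Int ?E1" 0 1] by (simp_all add: X_def Y_def)
  have "?av Y = avw ?E1 X" unfolding Y_def by (rule avg_restrict_Int[OF fE E(2)])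
  then have "?av (%A. X A - Y A) = (SUM y:V. pr ?E 0 y - pr ?E1 0 y)"
   unfolding avg_diff X_def avg_card_V[OF V E(1)] avg_card_V[OF V E(3)] by (simp add: sum_subtractf)
  also have "... <= (SUM y:V. SUM u:lbox 0 s. SUM v:lbox u R - lbox 0 s. pb s u * w u v * pr ?E v y)"
  proof (rule sum_mono)
   fix y
   show "pr ?E 0 y - pr ?E1 0 y <= (SUM u:lbox 0 s. SUM v:lbox u R - lbox 0 s. pb s u * w u v * pr ?E v y)"
    using exit_bound'(2)[OF V(1), of R 0 y s] unfolding add_0 by linarith
  qed
  also have "... = (SUM u:lbox 0 s. SUM v:lbox u R - lbox 0 s. pb s u * w u v * (SUM y:V. pr ?E v y))"
   unfolding sum_distrib_left by (subst sum.swap, rule sum.cong[OF refl], rule sum.swap)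
  also have "... <= (SUM u:lbox 0 s. SUM v:lbox u R - lbox 0 s. pb s u * w u v * (C1 * R ^r a))"
   by (intro sum_mono mult_left_mono mult_nonneg_nonneg pb_nonneg w_nonneg chi[rule_format] R V)
  also have "... = phi R s * (C1 * R ^r a)" by (simp only: phi_def sum_distrib_right)
  also have "... <= \<delta> * (C1 * R ^r a)" using s C1 by (intro mult_right_mono) auto
  finally have ED: "?av (%A. X A - Y A) <= \<delta> * (C1 * R ^r a)" .
  have "(?av (%A. X A * (X A - Y A)))^2 = (?av (%A. (X A * sqrt (X A - Y A)) * sqrt (X A - Y A)))^2"
   using Y by (intro arg_cong[of _ _ "%x. x^2"] avg_cong) simp
  also have "... <= ?av (%A. (X A * sqrt (X A - Y A))^2) * ?av (%A. (sqrt (X A - Y A))^2)"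
   by (rule avg_CS[OF pE])
  also have "... <= mk 3 R * (\<delta> * (C1 * R ^r a))"
  proof (intro mult_mono)
   have "?av (%A. (X A * sqrt (X A - Y A))^2) <= ?av (%A. X A ^ 3)"
   proof (intro avg_mono pE)
    fix A assume A: "A \<subseteq> ?E"
    have "(X A * sqrt (X A - Y A))^2 = X A ^ 2 * (X A - Y A)" using Y[OF A] by (simp add: power_mult_distrib)
    also have "... <= X A ^ 2 * X A" using Y[OF A] by (intro mult_left_mono) auto
    finally show "(X A * sqrt (X A - Y A))^2 <= X A ^ 3" by (simp add: power3_eq_cube power2_eq_square)
   qed
   also have "... <= mk 3 R" unfolding X_def using R by (intro le_mk V) auto
   finally show "?av (%A. (X A * sqrt (X A - Y A))^2) <= mk 3 R" .
   have "?av (%A. (sqrt (X A - Y A))^2) = ?av (%A. X A - Y A)" using Y by (intro avg_cong) simp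
   then show "?av (%A. (sqrt (X A - Y A))^2) <= \<delta> * (C1 * R ^r a)" using ED by simp
  qed (use mk_ge_1[OF R, of 3] in \<open>auto intro!: avg_nonneg pE\<close>)
  also have "... <= C3 * R ^r (D + 2 * a) * (\<delta> * (C1 * R ^r a))"
   using m3 R \<delta> C1 by (intro mult_right_mono) auto
  also have "... = (c / 8)^2 * (R ^r (D + 2 * a) * R ^r a)"
   using C1 C3 by (simp add: \<delta>_def)
  also have "R ^r (D + 2 * a) * R ^r a = (R ^r h2)^2"
   unfolding power2_eq_square powr_add[symmetric]
   by (rule arg_cong[of _ _ "(powr) (real R)"]) (simp add: h2_def field_simps)
  finally have "(?av (%A. X A * (X A - Y A)))^2 <= (c / 8 * R ^r h2)^2" by (simp only: power_mult_distrib)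
  then have cross: "?av (%A. X A * (X A - Y A)) <= c / 8 * R ^r h2"
   by (rule power2_le_imp_le) (use c in simp)
  have "c / 4 * R ^r h2 <= mu 2 R n - 2 * ?av (%A. X A * (X A - Y A))"
   using n cross by linarith
  also have "... = ?av (%A. X A ^ 2 - 2 * (X A * (X A - Y A)))"
   unfolding avg_diff avg_cmult by (simp add: mu_def V_def X_def)
  also have "... <= ?av (%A. Y A ^ 2)"
  proof (intro avg_mono pE)
   fix A
   have "0 <= (X A - Y A)^2" by simp
   then show "X A ^ 2 - 2 * (X A * (X A - Y A)) <= Y A ^ 2" by (simp add: power2_eq_square algebra_simps)
  qed
  also have "... = avw ?E1 (%A. X A ^ 2)" unfolding Y_def by (rule avg_restrict_Int[OF fE E(2)])
  also have "... <= avw (Ed (lbox 0 (K * R))) (%A. csz A 0 ^ 2)"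
  proof -
   have "V Int lbox 0 s \<subseteq> lbox 0 (K * R)" using s by auto
   then have "?E1 \<subseteq> Ed (lbox 0 (K * R))" using EdR_subset_Ed Ed_mono by blast
   then show ?thesis
    unfolding X_def by (intro avg_mono_set pEd card_clu_mono[of "lbox 0 (K * R)"] finite_lbox)
  qed
  finally show ?thesis .
 qed
 define cf where "cf = min (c / 4 * (2 * real K) powr (- h2)) (K ^r (- h2))"
 have "cf * n ^r h2 <= avw (Ed (lbox 0 n)) (%A. csz A 0 ^ 2)" if n: "n >= 1" for n
 proof (cases "n >= K")
  case True
  define R where "R = n div K"
  have R: "R >= 1" "K * R <= n" "n <= K * (2 * R)"
  proof -
   show "R >= 1" using True K div_le_mono[OF True, of K] by (simp add: R_def)
   then have "K * (R + 1) <= K * (2 * R)" by (intro mult_le_mono) auto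
   moreover have "n < K * (R + 1)" unfolding R_def using K by (simp add: dividend_less_times_div)
   ultimately show "n <= K * (2 * R)" by linarith
  qed (simp add: R_def)
  have "cf * n ^r h2 <= c / 4 * (2 * real K) powr (- h2) * (2 * real K * real R) powr h2"
   using of_nat_mono[OF R(3), where 'a = real] h0 c by (intro mult_mono powr_mono2) (auto simp: cf_def mult_ac)
  also have "... = c / 4 * R ^r h2" using K by (simp add: powr_mult powr_minus field_simps)
  also have "... <= avw (Ed (lbox 0 (K * R))) (%A. csz A 0 ^ 2)" by (rule main[OF R(1)])
  also have "... <= avw (Ed (lbox 0 n)) (%A. csz A 0 ^ 2)"
   using R by (intro avg_mono_set pEd card_clu_mono[of "lbox 0 n"] Ed_mono lbox_mono finite_lbox)
  finally show ?thesis .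
 next
  case False
  have "cf * n ^r h2 <= K ^r (- h2) * K ^r h2"
   using False h0 K by (intro mult_mono powr_mono2) (auto simp: cf_def)
  also have "... = avw (Ed (lbox (0 :: int ^ 'd) n)) (%A. 1)" using K by (simp add: finite_Ed flip: powr_add)
  also have "... <= avw (Ed (lbox 0 n)) (%A. csz A 0 ^ 2)"
  proof (intro avg_mono pEd finite_lbox one_le_power)
   fix A :: "(int ^ 'd) set set" assume "A \<subseteq> Ed (lbox 0 n)"
   then show "1 <= csz A 0" using card_clu_ge_1[of "lbox 0 n" A 0] by simp
  qed
  finally show ?thesis .
 qed
 moreover have "cf > 0" using c K by (simp add: cf_def)
 ultimately show ?thesis by blast
qed

abbreviation "big_cluster_0_with c \<equiv>
 ALL n>=1. c * n ^r (- ((D - a) / 2))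
  <= prw (Ed (lbox 0 n)) (%A. c * n ^r ((D + a) / 2) <= csz A 0)"

text \<open>A second-moment argument for X^2: clusters below the threshold carry at most half of the
  second moment, so Cauchy-Schwarz bounds the probability of the others below by the squared second
  moment over the fourth.\<close>

lemma big_cluster_0: "EX c>0. big_cluster_0_with c"
proof -
 obtain c where c: "c > 0" and m2: "second_moment_box_with c"
  using second_moment_box by blast
 obtain C1 where C1: "C1 > 0" and en: "ALL n>=1. en n <= C1 * n ^r a" using en_upper by blast
 obtain C where C: "C >= 1" and bm: "box_moments_with 4 C"
  using box_moments[of 4] by blast
 \<comment> \<open>With this threshold, sizes below \<open>l * n ^r ((D + a) / 2)\<close> contribute
   at most c/2 n^h2, as the first moment is at most \<open>C1 * n ^r a\<close>.\<close>
 define l where "l = c / (2 * C1)"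
 define p where "p = (c / 2)^2 / (C * C1)"
 have lp: "l > 0" "p > 0" using c C1 C by (simp_all add: l_def p_def)
 have "min l p * n ^r (- ((D - a) / 2))
  <= prw (Ed (lbox 0 n)) (%A. min l p * n ^r ((D + a) / 2) <= csz A 0)" if n: "n >= 1" for n
 proof -
  let ?s = "n ^r ((D + a) / 2)"
  let ?E = "Ed (lbox (0 :: int ^ 'd) n)"
  let ?av = "avw ?E"
  have pE: "probs ?E (pk w)" by (intro pEd) simp
  define X where "X = (%A :: (int ^ 'd) set set. csz A 0)"
  have X0: "0 <= X A" for A by (simp add: X_def)
  define Pr where "Pr = prw ?E (%A. l * ?s <= X A)"
  have P0: "0 <= Pr" unfolding Pr_def by (rule prb_nonneg[OF pE])
  have s0: "?s > 0" using n by simp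
  have e1: "?av X <= C1 * n ^r a" unfolding X_def avg_lbox using en n by blast
  have "c * n ^r h2 <= ?av (%A. X A ^ 2)" using m2 n by (simp add: X_def)
  also have "... <= ?av (%A. l * ?s * X A + X A ^ 2 * of_bool (l * ?s <= X A))"
  proof (intro avg_mono pE)
   fix A
   show "X A ^ 2 <= l * ?s * X A + X A ^ 2 * of_bool (l * ?s <= X A)"
    using X0[of A] lp s0 mult_right_mono[of "X A" "l * ?s" "X A"]
    by (cases "l * ?s <= X A") (auto simp: power2_eq_square)
  qed
  also have "... = l * ?s * ?av X + ?av (%A. X A ^ 2 * of_bool (l * ?s <= X A))"
   by (simp only: avg_add avg_cmult)
  also have "l * ?s * ?av X <= l * ?s * (C1 * n ^r a)"
   using e1 lp s0 by (intro mult_left_mono) auto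
  also have "... = c / 2 * (?s * n ^r a)" using C1 by (simp add: l_def)
  also have sn: "?s * n ^r a = n ^r h2"
   unfolding powr_add[symmetric] by (rule arg_cong[of _ _ "(powr) (real n)"]) (simp add: h2_def field_simps)
  finally have lo: "c / 2 * n ^r h2 <= ?av (%A. X A ^ 2 * of_bool (l * ?s <= X A))" by simp
  have "(c / 2 * n ^r h2)^2 <= (?av (%A. X A ^ 2 * of_bool (l * ?s <= X A)))^2"
   using c by (intro power_mono lo) auto
  also have "... <= ?av (%A. (X A ^ 2)^2) * ?av (%A. (of_bool (l * ?s <= X A))^2)"
   by (rule avg_CS[OF pE])
  also have "?av (%A. (of_bool (l * ?s <= X A))^2) = Pr" unfolding Pr_def by (intro avg_cong) simp
  also have "?av (%A. (X A ^ 2)^2) = ?av (%A. X A ^ 4)" by (intro avg_cong) simp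
  also have "?av (%A. X A ^ 4) * Pr <= (C * ?s ^ 3 * (C1 * n ^r a)) * Pr"
  proof (intro mult_right_mono P0)
   have "?av (%A. X A ^ 4) <= C * ?s ^ 3 * ?av X"
    using bm[rule_format, of n 1 0] n by (simp add: X_def)
   also have "... <= C * ?s ^ 3 * (C1 * n ^r a)" using e1 C by (intro mult_left_mono) auto
   finally show "?av (%A. X A ^ 4) <= C * ?s ^ 3 * (C1 * n ^r a)" .
  qed
  finally have "(c / 2)^2 * (n ^r h2)^2 <= (C * C1) * (Pr * (?s ^ 3 * n ^r a))"
   unfolding power_mult_distrib by (simp only: mult_ac)
  moreover have "(n ^r h2)^2 = n ^r (- ((D - a) / 2)) * (?s ^ 3 * n ^r a)"
   unfolding power2_eq_square power3_eq_cube powr_add[symmetric]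
   by (rule arg_cong[of _ _ "(powr) (real n)"]) (simp add: h2_def field_simps)
  moreover have "?s ^ 3 * n ^r a > 0" using n by simp
  ultimately have "(c / 2)^2 * n ^r (- ((D - a) / 2)) <= (C * C1) * Pr"
   by (metis (no_types, lifting) mult.assoc mult_le_cancel_right_pos)
  then have "p * n ^r (- ((D - a) / 2)) <= Pr"
   using C C1 by (simp add: p_def pos_divide_le_eq mult.commute)
  moreover have "min l p * n ^r (- ((D - a) / 2)) <= p * n ^r (- ((D - a) / 2))"
   by (intro mult_right_mono) auto
  moreover have "Pr <= prw ?E (%A. min l p * ?s <= X A)"
   unfolding Pr_def
  proof (intro prb_mono[OF pE])
   fix A assume "l * ?s <= X A"
   moreover have "min l p * ?s <= l * ?s" using s0 by (intro mult_right_mono) auto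
   ultimately show "min l p * ?s <= X A" by linarith
  qed
  ultimately show ?thesis by (simp add: X_def)
 qed
 then show ?thesis using lp by (intro exI[of _ "min l p"]) auto
qed

abbreviation "big_cluster_with c \<equiv>
 ALL n>=1. ALL x. c * n ^r (- ((D - a) / 2))
  <= prw (Ed (lbox x n)) (%A. c * n ^r ((D + a) / 2) <= csz A x)"

lemma big_cluster: "EX c>0. big_cluster_with c"
proof -
 have "prw (Ed (lbox x n)) (%A. c <= csz A x) = prw (Ed (lbox 0 n)) (%A. c <= csz A 0)"
  for x :: "int ^ 'd" and n c
 proof -
  have "lbox x n = (%y. y + x) ` lbox 0 n" by (simp add: lbox_shift)
  then show ?thesis
  proof (simp only: Ed_shift, intro avg_shift)
   fix A :: "(int ^ 'd) set set" assume "A \<subseteq> Ed (lbox 0 n)"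
   then have "clu ((`) ((`) (%y. y + x)) A) (0 + x) = (%y. y + x) ` clu A 0"
    by (intro clu_image inj_shift) (use ne_Ed[of A "lbox 0 n"] in blast)
   then show "of_bool (c <= real (card (clu ((`) ((`) (%y. y + x)) A) x))) = (of_bool (c <= csz A 0) :: real)"
    by (simp add: card_image)
  qed
 qed
 note eq = this
 obtain c where "c > 0" "big_cluster_0_with c"
  using big_cluster_0 by blast
 then show ?thesis by (intro exI[of _ c]) (metis eq)
qed

end

section \<open>The three-point function in finite volume\<close>

context sym_kernel
begin

text \<open>Five independent families of edges: inside each of the three sets, from
  \<open>S1\<close> to \<open>S2\<close>, and from \<open>S1\<close> to \<open>T\<close>. A single
  edge of each of the last two kinds links the clusters.\<close>

lemma glue3:
 assumes fin: "finite S1" "finite S2" "finite T" and disj: "S1 Int S2 = {}" "S1 Int T = {}" "S2 Int T = {}"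
  and L: "L \<subseteq> T" and xy: "x : S1" "y : S2"
  and k: "\<And>u v. u : S1 ==> v : S2 Un L ==> k <= w u v" and k0: "0 <= k" and s0: "0 <= s"
 shows "prw (Ed S1) (%A. s <= csz A x) * (prw (Ed S2) (%A. s <= csz A y) *
   ((1 - exp (- (k * s^2))) * avw (Ed T) (%A. 1 - exp (- (k * s * real (card (clu A z Int L)))))))
  <= prw (Ed (S1 Un S2 Un T)) (%A. conn A x y & conn A x z)"
proof -
 let ?E1 = "Ed S1" and ?E2 = "Ed S2" and ?E3 = "Ed T" and ?F1 = "crs S1 S2" and ?F2 = "crs S1 T"
 let ?Q = "%A. conn A x y & conn A x z"
 have fE: "finite ?E1" "finite ?E2" "finite ?E3" "finite ?F1" "finite ?F2"
  using fin by (simp_all add: finite_Ed finite_crs)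
 have dj: "?E1 Int (?E2 Un (?E3 Un (?F1 Un ?F2))) = {}" "?E2 Int (?E3 Un (?F1 Un ?F2)) = {}"
  "?E3 Int (?F1 Un ?F2) = {}" "?F1 Int ?F2 = {}"
  using disj by (auto simp: Ed_def crs_def doubleton_eq_iff)
 have sub: "?E1 Un (?E2 Un (?E3 Un (?F1 Un ?F2))) \<subseteq> Ed (S1 Un S2 Un T)"
 proof -
  have "?F1 Un ?F2 \<subseteq> Ed (S1 Un S2 Un T)" using disj by (auto simp: crs_def)
  then show ?thesis
   using Ed_mono[of S1 "S1 Un S2 Un T"] Ed_mono[of S2 "S1 Un S2 Un T"] Ed_mono[of T "S1 Un S2 Un T"] by blast
 qed
 have "prw ?E1 (%A. s <= csz A x) * (prw ?E2 (%A. s <= csz A y) *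
   ((1 - exp (- (k * s^2))) * avw ?E3 (%A. 1 - exp (- (k * s * real (card (clu A z Int L)))))))
  = avw ?E1 (%A. avw ?E2 (%B. avw ?E3 (%G. of_bool (s <= csz A x) * (of_bool (s <= csz B y) *
    ((1 - exp (- (k * s^2))) * (1 - exp (- (k * s * real (card (clu G z Int L))))))))))"
  by (simp only: avg_cmult avg_cmult_right)
 also have "... <= avw ?E1 (%A. avw ?E2 (%B. avw ?E3 (%G. avw ?F1 (%H. avw ?F2 (%H'.
   of_bool (?Q (A Un (B Un (G Un (H Un H'))))))))))"
 proof (intro avg_mono pE fE)
  fix A B G assume s: "A \<subseteq> ?E1" "B \<subseteq> ?E2" "G \<subseteq> ?E3"
  let ?X = "clu A x" and ?Y = "clu B y" and ?Z = "clu G z Int L"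
  have X: "?X \<subseteq> S1" using s xy Ed_Pow by (intro clu_subset) blast+
  have Y: "?Y \<subseteq> S2" using s xy Ed_Pow by (intro clu_subset) blast+
  have fX: "finite ?X" "finite ?Y" "finite ?Z" using X Y L fin finite_subset by (meson finite_Int)+
  let ?J = "%H. EX u:?X. EX v:?Y. {u, v} : H" and ?J' = "%H. EX u:?X. EX v:?Z. {u, v} : H"
  show "of_bool (s <= real (card ?X)) * (of_bool (s <= real (card ?Y)) *
    ((1 - exp (- (k * s^2))) * (1 - exp (- (k * s * real (card ?Z))))))
   <= avw ?F1 (%H. avw ?F2 (%H'. of_bool (?Q (A Un (B Un (G Un (H Un H')))))))"
  proof (cases "s <= real (card ?X) & s <= real (card ?Y)")
   case True
   have exY: "1 - exp (- (k * s * t)) <= prw F (%H. EX u:?X. EX v:W. {u, v} : H)"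
    if W: "finite W" "W \<subseteq> S2 Un L" "S1 Int W = {}" "0 <= t" "t <= real (card W)" and F: "finite F" "crs ?X W \<subseteq> F" for F W t
   proof -
    have "k * s * t <= k * real (card ?X) * real (card W)"
     using True k0 s0 W by (intro mult_mono mult_left_mono) auto
    also have "... = (SUM u:?X. SUM v:W. k)" by simp
    also have "... <= (SUM u:?X. SUM v:W. w u v)" using X W by (intro sum_mono k) auto
    finally show ?thesis
     using prb_crs_open[OF F fX(1) W(1) _ w_sym] X W by (simp add: disjoint_iff subset_iff)
   qed
   have "(1 - exp (- (k * s^2))) * (1 - exp (- (k * s * real (card ?Z)))) <= prw ?F1 ?J * prw ?F2 ?J'"
   proof (intro mult_mono)
    show "1 - exp (- (k * s^2)) <= prw ?F1 ?J"
     using exY[of ?Y s ?F1, OF fX(2) le_supI1[OF Y] _ s0 _ fE(4) crs_mono[OF X Y]] True Y disj(1)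
     by (simp add: power2_eq_square mult.assoc) blast
    show "1 - exp (- (k * s * real (card ?Z))) <= prw ?F2 ?J'"
     by (rule exY[OF fX(3) _ _ _ _ fE(5) crs_mono[OF X]]) (use L disj(2) in auto)
   qed (use k0 s0 in \<open>auto intro!: prb_nonneg pE fE mult_nonneg_nonneg\<close>)
   also have "... = avw ?F1 (%H. avw ?F2 (%H'. of_bool (?J H) * of_bool (?J' H')))"
    by (simp only: avg_cmult avg_cmult_right)
   also have "... <= avw ?F1 (%H. avw ?F2 (%H'. of_bool (?Q (A Un (B Un (G Un (H Un H')))))))"
   proof (intro avg_mono pE fE, unfold of_bool_conj[symmetric], rule of_bool_le_if)
    fix H H' let ?U = "A Un (B Un (G Un (H Un H')))"
    assume "?J H & ?J' H'"
    then obtain u v u' v' where c: "conn A x u" "conn B y v" "{u, v} : H" "conn A x u'" "conn G z v'" "{u', v'} : H'"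
     by auto
    have "conn ?U x u" "conn ?U u v" "conn ?U v y" "conn ?U x u'" "conn ?U u' v'" "conn ?U v' z"
     using c conn_sym[OF c(2)] conn_sym[OF c(5)] by (auto intro: conn_edge elim: conn_mono)
    then show "?Q ?U" using conn_trans[of ?U x u v] conn_trans[of ?U x v y] conn_trans[of ?U x u' v'] conn_trans[of ?U x v' z] by blast
   qed
   finally show ?thesis using True by simp
  qed (auto intro!: avg_nonneg pE fE)
 qed
 also have "... = prb (?E1 Un (?E2 Un (?E3 Un (?F1 Un ?F2)))) (pk w) ?Q"
  using fE dj by (simp add: avg_union)
 also have "... <= prw (Ed (S1 Un S2 Un T)) ?Q"
 proof (rule avg_mono_set[OF pEd sub])
  fix A B :: "'v set set" assume "A \<subseteq> B"
  then show "of_bool (?Q A) <= (of_bool (?Q B) :: real)"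
   using conn_mono[of A x y B] conn_mono[of A x z B] by auto
 qed (use fin in simp)
 finally show ?thesis .
qed

end

context crit
begin

abbreviation "boundary_sum_with C \<equiv>
 ALL n>=1. ALL p T. finite T --> T Int lbox p n = {} -->
  (SUM b:lbox p n. SUM u:T. w b u) <= C * n ^r (D - a)"

text \<open>A vertex at distance k from the centre is at distance at least n - k + 1 from the
  complement, hence has outgoing weight of order (n-k+1)^(-a). Summing over at most n^(d-1) points
  per layer gives n^(d-a), as a < 1.\<close>

lemma boundary_sum: "EX C>0. boundary_sum_with C"
proof -
 let ?C = "K2 * (1 + Kd * (2 powr (1 - a) / (1 - a)))"
 have "(SUM b:lbox p n. SUM u:T. w b u) <= ?C * n ^r (D - a)"
  if n: "n >= 1" and T: "finite T" "T Int lbox p n = {}" for n T and p :: "int ^ 'd"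
 proof -
  let ?f = "%k. real (n - k + 1) powr (- a)"
  have far: "(SUM u:T. w b u) <= K2 * ?f (sd p b)" if "b : lbox p n" for b
  proof (rule sum_w_far[OF T(1)])
   fix u assume "u : T"
   then have "n < sd p u" using T(2) by fastforce
   then show "n - sd p b < sd b u" using sd_triangle[of p u b] that by simp
  qed
  have "(SUM b:lbox p n. ?f (sd p b)) = ?f 0 + (SUM b:lbox p n - {p}. ?f (sd p b))"
   by (subst sum.remove[of _ p]) auto
  also have "?f 0 <= n ^r (D - a)"
  proof -
   have "?f 0 <= 1 powr (- a)" using a0 by (intro powr_mono2') auto
   also have "... <= n ^r (D - a)" using n aD by (simp add: ge_one_powr_ge_zero)
   finally show ?thesis .
  qed
  also have "(SUM b:lbox p n - {p}. ?f (sd p b)) <= Kd * (SUM k:{0<..n}. real k ^ (CARD('d) - 1) * ?f k)"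
   unfolding Kd_def D_def by (rule sum_radial_le) (use sd_pos[of p] in force)+
  also have "(SUM k:{0<..n}. real k ^ (CARD('d) - 1) * ?f k) <= (SUM k:{0<..n}. real n ^ (CARD('d) - 1) * ?f k)"
   by (intro sum_mono mult_right_mono power_mono) auto
  also have "... = n ^r (D - 1) * (SUM k:{0<..n}. k ^r (- a))"
   using n unfolding sum_distrib_left[symmetric]
   by (subst powr_D, simp, intro arg_cong2[of _ _ _ _ "(*)"] refl sum.reindex_bij_witness[of _ "%k. n + 1 - k" "%k. n + 1 - k"]) (auto simp: of_nat_diff algebra_simps)
  also have "... <= n ^r (D - 1) * (n ^r (1 - a) / (1 - a))"
   using a0 a1 by (intro mult_left_mono sum_powr_upper) auto
  also have "... = n ^r (D - a) / (1 - a)" by (simp flip: powr_add)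
  also have "... <= 2 powr (1 - a) / (1 - a) * n ^r (D - a)"
   using a1 mult_right_mono[of 1 "2 powr (1 - a)" "n ^r (D - a)"] ge_one_powr_ge_zero[of 2 "1 - a"]
   by (simp add: divide_right_mono)
  finally have "(SUM b:lbox p n. ?f (sd p b)) <= (1 + Kd * (2 powr (1 - a) / (1 - a))) * n ^r (D - a)"
   using Kd_pos by (simp add: algebra_simps)
  then have "K2 * (SUM b:lbox p n. ?f (sd p b)) <= ?C * n ^r (D - a)"
   using K2_pos by (simp add: mult.assoc)
  moreover have "(SUM b:lbox p n. SUM u:T. w b u) <= K2 * (SUM b:lbox p n. ?f (sd p b))"
   unfolding sum_distrib_left by (intro sum_mono far)
  ultimately show ?thesis by linarith
 qed
 moreover have "?C > 0" using K2_pos Kd_pos a1 by (intro mult_pos_pos add_pos_pos) auto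
 ultimately show ?thesis by blast
qed

abbreviation "detour_bound_with C \<equiv>
 ALL V W p n v z. finite V --> W \<subseteq> V --> W Int lbox p n = {} --> 1 <= n --> 4 * n <= sd p z --> 2 * n <= sd p v -->
  (SUM b:lbox p n. SUM u:W. pr (Ed W) z u * w u b * pr (Ed V) b v)
   <= C * real (sd p z) powr (a - D) * real (sd p v) powr (a - D) * n ^r (D - a)"

text \<open>Bounds the connections from \<open>z\<close> to \<open>v\<close> that enter the box at
  some \<open>b\<close>. With \<open>n\<close> a small fraction of both distances this is a small
  fraction of either two-point function, so the box can be removed at little cost.\<close>

lemma detour_bound: "EX C>0. detour_bound_with C"
proof -
 obtain C1 where C1: "C1 > 0" and up: "point_upper_with C1"
  using point_upper by blast
 obtain G where G: "G > 0" and box: "box_upper_with G"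
  using box_upper by blast
 obtain C2 where C2: "C2 > 0" and bd: "boundary_sum_with C2"
  using boundary_sum by blast
 let ?far = "3 ^ CARD('d) * (Cf * G * 8 powr D)" and ?near = "C1 * 4 powr (D - a) * C2"
 let ?C = "(?far + ?near) * (C1 * 2 powr (D - a))"
 have "(SUM b:lbox p n. SUM u:W. pr (Ed W) z u * w u b * pr (Ed V) b v)
   <= ?C * real (sd p z) powr (a - D) * real (sd p v) powr (a - D) * n ^r (D - a)"
  if V: "finite V" and W: "W \<subseteq> V" "W Int lbox p n = {}" and n: "1 <= n" "4 * n <= sd p z" "2 * n <= sd p v"
  for V W p n and v z :: "int ^ 'd"
 proof -
  define r where "r = sd p z"
  define q where "q = sd p v"
  define m where "m = r div 4"
  have m: "1 <= m" "4 * m <= r" "r <= 8 * m" "n <= m" using n unfolding m_def r_def by presburger+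
  have fW: "finite W" using V W finite_subset by blast
  note p0 = pr_bounds[OF finite_Ed[OF fW]] pr_bounds[OF finite_Ed[OF V]]
  \<comment> \<open>Points \<open>u\<close> far from \<open>b\<close> are summed by
    \<open>far_sum\<close>. Points near \<open>b\<close> are far from \<open>z\<close>, and there
    the pointwise upper bound applies.\<close>
  have one: "(SUM u:W. pr (Ed W) z u * w u b) <= Cf * G * m ^r (- D) + C1 * 4 powr (D - a) * r ^r (a - D) * (SUM u:W. w b u)"
   if b: "b : lbox p n" for b
  proof -
   let ?N = "{u : W. sd b u <= m}" and ?F = "{u : W. m < sd b u}"
   have "(SUM u:W. pr (Ed W) z u * w u b) = (SUM u:?F Un ?N. w b u * pr (Ed W) z u)"
    using w_sym by (intro sum.cong) (auto simp: mult.commute)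
   also have "... = (SUM u:?F. w b u * pr (Ed W) z u) + (SUM u:?N. w b u * pr (Ed W) z u)"
    using fW by (intro sum.union_disjoint) auto
   also have "(SUM u:?F. w b u * pr (Ed W) z u) <= Cf * G * m ^r (- D)"
    using G p0 box fW m by (intro far_sum) auto
   also have "(SUM u:?N. w b u * pr (Ed W) z u) <= (SUM u:?N. w b u * (C1 * 4 powr (D - a) * r ^r (a - D)))"
   proof (intro sum_mono mult_left_mono w_nonneg)
    fix u assume u: "u : ?N"
    have "r <= sd p b + (sd b u + sd u z)"
     using sd_triangle[of p z b] sd_triangle[of b z u] by (simp add: r_def)
    then have zu: "r <= 4 * sd z u" using u b m sd_commute[of u z] by simp
    then have zu': "z ~= u" "real r / 4 <= real (sd z u)" using m by auto
    have "pr (Ed W) z u <= C1 * real (sd z u) powr (a - D)" using up fW zu' by blast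
    also have "... <= C1 * (real r / 4) powr (a - D)"
     using C1 zu' m aD by (intro mult_left_mono powr_mono2') auto
    also have "... = C1 * 4 powr (D - a) * r ^r (a - D)"
     by (simp add: powr_divide powr_diff field_simps)
    finally show "pr (Ed W) z u <= C1 * 4 powr (D - a) * r ^r (a - D)" .
   qed
   also have "... <= (SUM u:W. w b u * (C1 * 4 powr (D - a) * r ^r (a - D)))"
    using fW w_nonneg C1 by (intro sum_mono2) auto
   finally show ?thesis by (simp add: sum_distrib_left sum_distrib_right mult_ac)
  qed
  have "(SUM b:lbox p n. SUM u:W. pr (Ed W) z u * w u b * pr (Ed V) b v)
   <= (SUM b:lbox p n. SUM u:W. pr (Ed W) z u * w u b * (C1 * 2 powr (D - a) * q ^r (a - D)))"
  proof (intro sum_mono mult_left_mono mult_nonneg_nonneg w_nonneg)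
   fix b assume b: "b : lbox p n"
   have "q <= 2 * sd b v" using sd_triangle[of p v b] b n by (simp add: q_def)
   then have bv: "b ~= v" "real q / 2 <= real (sd b v)" using n by (auto simp: q_def)
   have "pr (Ed V) b v <= C1 * real (sd b v) powr (a - D)" using up V bv by blast
   also have "... <= C1 * (real q / 2) powr (a - D)"
    using C1 bv n aD by (intro mult_left_mono powr_mono2') (auto simp: q_def)
   also have "... = C1 * 2 powr (D - a) * q ^r (a - D)"
    by (simp add: powr_divide powr_diff field_simps)
   finally show "pr (Ed V) b v <= C1 * 2 powr (D - a) * q ^r (a - D)" .
  qed (use p0 in auto)
  also have "... = (SUM b:lbox p n. SUM u:W. pr (Ed W) z u * w u b) * (C1 * 2 powr (D - a) * q ^r (a - D))"
   by (simp only: sum_distrib_right)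
  also have "... <= ((?far + ?near) * (r ^r (a - D) * n ^r (D - a))) * (C1 * 2 powr (D - a) * q ^r (a - D))"
  proof (rule mult_right_mono)
   have "(SUM b:lbox p n. SUM u:W. pr (Ed W) z u * w u b)
    <= (SUM b:lbox p n. Cf * G * m ^r (- D) + C1 * 4 powr (D - a) * r ^r (a - D) * (SUM u:W. w b u))"
    by (intro sum_mono one)
   also have "... = real (card (lbox p n)) * (Cf * G * m ^r (- D)) + C1 * 4 powr (D - a) * r ^r (a - D) * (SUM b:lbox p n. SUM u:W. w b u)"
    by (simp add: sum.distrib sum_distrib_left)
   also have "... <= ?far * (r ^r (a - D) * n ^r (D - a)) + ?near * (r ^r (a - D) * n ^r (D - a))"
   proof (rule add_mono)
    have "real (card (lbox p n)) <= 3 ^ CARD('d) * n ^r D"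
    proof -
     have "real (card (lbox p n)) = real (2 * n + 1) ^ CARD('d)" by (simp only: card_lbox of_nat_power)
     also have "... <= (3 * real n) ^ CARD('d)" using n by (intro power_mono) auto
     finally show ?thesis using n powr_Dn[of "real n"] by (simp add: power_mult_distrib)
    qed
    moreover have "m ^r (- D) <= (real r / 8) powr (- D)" using m D1 by (intro powr_mono2') auto
    moreover have "(real r / 8) powr (- D) = 8 powr D * r ^r (- D)" by (simp add: powr_divide powr_minus field_simps)
    ultimately have "real (card (lbox p n)) * (Cf * G * m ^r (- D))
     <= 3 ^ CARD('d) * n ^r D * (Cf * G * (8 powr D * r ^r (- D)))"
     using Cf_pos G by (intro mult_mono mult_left_mono) auto
    also have "... = ?far * (r ^r (- D) * (n ^r D))" by simp
    also have "... <= ?far * (r ^r (a - D) * n ^r (D - a))"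
    proof (rule mult_left_mono)
     have "n ^r D = n ^r (D - a) * n ^r a" by (simp flip: powr_add)
     also have "... <= n ^r (D - a) * r ^r a" using m a0 by (intro mult_left_mono powr_mono2) auto
     finally have "r ^r (- D) * n ^r D <= r ^r (- D) * (n ^r (D - a) * r ^r a)"
      by (intro mult_left_mono) auto
     also have "... = (r ^r (- D) * r ^r a) * n ^r (D - a)" by simp
     finally show "r ^r (- D) * n ^r D <= r ^r (a - D) * n ^r (D - a)"
      by (simp flip: powr_add)
    qed (use Cf_pos G in simp)
    finally show "real (card (lbox p n)) * (Cf * G * m ^r (- D)) <= ?far * (r ^r (a - D) * n ^r (D - a))" .
    have "C1 * 4 powr (D - a) * r ^r (a - D) * (SUM b:lbox p n. SUM u:W. w b u)
     <= C1 * 4 powr (D - a) * r ^r (a - D) * (C2 * n ^r (D - a))"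
     using bd n W fW C1 by (intro mult_left_mono) auto
    then show "C1 * 4 powr (D - a) * r ^r (a - D) * (SUM b:lbox p n. SUM u:W. w b u) <= ?near * (r ^r (a - D) * n ^r (D - a))"
     by (simp only: mult_ac)
   qed
   finally show "(SUM b:lbox p n. SUM u:W. pr (Ed W) z u * w u b) <= (?far + ?near) * (r ^r (a - D) * n ^r (D - a))"
    by (simp only: distrib_right)
  qed (use C1 in simp)
  finally show ?thesis by (simp only: r_def q_def mult_ac)
 qed
 moreover have "?C > 0" using Cf_pos G C1 C2 by (intro mult_pos_pos add_pos_pos) auto
 ultimately show ?thesis by blast
qed

end

context kern
begin

text \<open>A connection destroyed by deleting \<open>S\<close> uses an edge from the surviving
  cluster of \<open>z\<close> into \<open>S\<close>.\<close>

lemma removal: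
 assumes V: "finite V" and S: "S \<subseteq> V" and z: "z : V - S"
 shows "pr (Ed V) z v <= pr (Ed (V - S)) z v + (SUM b:S. SUM u:V - S. pr (Ed (V - S)) z u * w u b * pr (Ed V) b v)"
proof -
 let ?U = "V - S"
 let ?F = "%u b. pr (Ed ?U) z u * w u b * pr (Ed V) b v"
 have fin: "finite ?U" "finite S" "finite (Ed V)" "finite (Ed ?U)" using V S finite_subset by (auto intro: finite_Ed)
 have "pr (Ed V) z v <= pr (Ed ?U) z v + (SUM u:V. SUM b:V. of_bool ({u, b} : Ed V - Ed ?U) * ?F u b)"
  by (intro decompose V Ed_mono) auto
 also have "(SUM u:V. SUM b:V. of_bool ({u, b} : Ed V - Ed ?U) * ?F u b) = (SUM u:?U. SUM b:V. of_bool ({u, b} : Ed V - Ed ?U) * ?F u b)"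
  using V z pr_outside[of "Ed ?U" ?U z] by (intro sum.mono_neutral_right) auto
 also have "... <= (SUM u:?U. SUM b:S. ?F u b)"
 proof (rule sum_mono)
  fix u assume u: "u : ?U"
  have "(SUM b:V. of_bool ({u, b} : Ed V - Ed ?U) * ?F u b) = (SUM b:S. of_bool ({u, b} : Ed V - Ed ?U) * ?F u b)"
   using V S u by (intro sum.mono_neutral_right) auto
  also have "... <= (SUM b:S. ?F u b)"
   using w_nonneg pr_bounds[OF fin(3)] pr_bounds[OF fin(4)]
   by (intro sum_mono mult_left_le_one_le mult_nonneg_nonneg) auto
  finally show "(SUM b:V. of_bool ({u, b} : Ed V - Ed ?U) * ?F u b) <= (SUM b:S. ?F u b)" .
 qed
 also have "... = (SUM b:S. SUM u:?U. ?F u b)" by (rule sum.swap)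
 finally show ?thesis by simp
qed

end

context crit_low
begin

abbreviation "three_upper_with C \<equiv>
 ALL V x y z. finite V --> x ~= y --> y ~= z --> z ~= x --> prw (Ed V) (%A. conn A x y & conn A x z)
  <= C * sqrt (real (sd x y) powr (a - D) * real (sd y z) powr (a - D) * real (sd z x) powr (a - D))"

lemma three_upper: "EX C>0. three_upper_with C"
proof -
 obtain C where C: "C > 0" and up: "point_upper_with C"
  using point_upper by blast
 have "prw (Ed V) (%A. conn A x y & conn A x z)
  <= sqrt (8 * C ^ 3) * sqrt (real (sd x y) powr (a - D) * real (sd y z) powr (a - D) * real (sd z x) powr (a - D))"
  if V: "finite V" and ne: "x ~= y" "y ~= z" "z ~= x" for V and x y z :: "int ^ 'd"
 proof -
  interpret finite_perc V "Ed V" "pk w" by (rule fp[OF V])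
  let ?d = "%x y :: int ^ 'd. real (sd x y) powr (a - D)"
  have "(prw (Ed V) (%A. conn A x y & conn A x z))^2 <= 8 * (pr (Ed V) x y * pr (Ed V) y z * pr (Ed V) x z)"
   by (rule gladkov)
  also have "pr (Ed V) x z = pr (Ed V) z x" by (rule prb_conn_commute)
  also have "8 * (pr (Ed V) x y * pr (Ed V) y z * pr (Ed V) z x) <= 8 * ((C * ?d x y) * (C * ?d y z) * (C * ?d z x))"
   using up V ne C pr_bounds[OF finite_Ed[OF V]] by (intro mult_left_mono mult_mono mult_nonneg_nonneg) auto
  also have "... = (8 * C ^ 3) * (?d x y * ?d y z * ?d z x)" by (simp add: power3_eq_cube)
  finally show ?thesis by (subst real_sqrt_mult[symmetric]) (rule real_le_rsqrt)
 qed
 moreover have "sqrt (8 * C ^ 3) > 0" using C by simp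
 ultimately show ?thesis by blast
qed

abbreviation "three_lower_min_with c \<equiv>
 ALL V x y z. finite V --> x ~= y --> sd x y <= sd x z --> sd x y <= sd y z --> lbox x (8 * sd x z) \<subseteq> V -->
  c * real (sd x y) powr ((a - D) / 2) * real (sd x z) powr (a - D) <= prw (Ed V) (%A. conn A x y & conn A x z)"

text \<open>Let r = |x-y| be the smallest distance and R = |x-z|. Large clusters at \<open>x\<close>
  and \<open>y\<close> in boxes of radius of order r each have probability of order r^((a-d)/2) and
  are joined with probability of order 1. Outside the boxes the cluster of \<open>z\<close> meets a
  cell \<open>Q\<close> of side of order r near them in r^d R^(a-d) points on average. An edge from
  the cluster of \<open>x\<close> to these points has probability of order r^((d-a)/2)
  R^(a-d).\<close>

lemma three_lower_min: "EX c>0. three_lower_min_with c"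
proof -
 obtain cl where cl: "cl > 0" and low: "point_lower_with cl"
  using point_lower by blast
 obtain Cd where Cd: "Cd > 0" and det: "detour_bound_with Cd"
  using detour_bound by blast
 obtain Cc where Cc: "Cc > 0" and cm: "cell_moment2_with Cc"
  using cell_moment2 by blast
 obtain cb where cb: "cb > 0" and big: "big_cluster_with cb"
  using big_cluster by blast
 define c2 where "c2 = min 1 (cl * 3 powr (a - D))"
 \<comment> \<open>By \<open>detour_bound\<close> each box of radius at most
   \<open>\<epsilon> * r\<close> then destroys at most a quarter of the lower bound
   \<open>c2 * R ^r (a - D)\<close>, so half of it survives both removals.\<close>
 define \<epsilon> where "\<epsilon> = min (1 / 8) ((c2 / (4 * Cd * 4 powr (D - a))) powr (1 / (D - a)))"
 have c2: "c2 > 0" using cl by (simp add: c2_def)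
 have \<epsilon>: "0 < \<epsilon>" "\<epsilon> <= 1 / 8" "2 * Cd * 4 powr (D - a) * \<epsilon> powr (D - a) <= c2 / 2"
 proof -
  show e: "0 < \<epsilon>" "\<epsilon> <= 1 / 8" using c2 Cd by (simp_all add: \<epsilon>_def)
  have "\<epsilon> powr (D - a) <= ((c2 / (4 * Cd * 4 powr (D - a))) powr (1 / (D - a))) powr (D - a)"
   using e aD by (intro powr_mono2) (auto simp: \<epsilon>_def)
  also have "... = c2 / (4 * Cd * 4 powr (D - a))" using aD c2 Cd by (simp add: powr_powr)
  finally show "2 * Cd * 4 powr (D - a) * \<epsilon> powr (D - a) <= c2 / 2" using Cd by (simp add: field_simps)
 qed
 define h where "h = (D + a) / 2"
 have h: "h > 0" using D1 a0 by (simp add: h_def)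
 define e where "e = cb * (\<epsilon> / 2) powr h"
 \<comment> \<open>The first bound keeps the gluing constant below the kernel at distance
   \<open>2 * r\<close>. The second keeps the quadratic term of the expansion below half the linear
   one, using \<open>cell_moment2\<close>.\<close>
 define k1 where "k1 = min (c0 * 2 powr (- (D + a))) (1 / (Cc * e))"
 have ek: "e > 0" "k1 > 0" "k1 * e * Cc <= 1"
 proof -
  show e: "e > 0" using cb \<epsilon> by (simp add: e_def)
  then show "k1 > 0" using Cc c0 by (simp add: k1_def)
  have "k1 * (Cc * e) <= 1 / (Cc * e) * (Cc * e)" using e Cc by (intro mult_right_mono) (auto simp: k1_def)
  then show "k1 * e * Cc <= 1" using e Cc by (simp add: mult_ac)
 qed
 define q1 where "q1 = 1 - exp (- (k1 * e^2))"
 have q1: "q1 > 0" using ek by (simp add: q1_def)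
 define cf where "cf = cb * (cb * (q1 * (k1 * e / 2 * (8 powr (- D) * (c2 / 2)))))"
 define cs where "cs = cl * cl * \<epsilon> powr ((D - a) / 2)"
 have cfs: "cf > 0" "cs > 0" using cb q1 ek c2 cl \<epsilon> by (simp_all add: cf_def cs_def)
 have "min cf cs * real (sd x y) powr ((a - D) / 2) * real (sd x z) powr (a - D) <= prw (Ed V) (%A. conn A x y & conn A x z)"
  if V: "finite V" and xy: "x ~= y" and mn: "sd x y <= sd x z" "sd x y <= sd y z" and sub: "lbox x (8 * sd x z) \<subseteq> V"
  for V and x y z :: "int ^ 'd"
 proof -
  define r where "r = sd x y"
  define R where "R = sd x z"
  have r1: "1 <= r" "r <= R" using sd_pos[OF xy] mn by (simp_all add: r_def R_def)
  have yz: "R <= 2 * sd y z" using sd_triangle[of x z y] mn by (simp add: R_def)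
  show ?thesis
  proof (cases "\<epsilon> * real r < 1")
   \<comment> \<open>The boxes would have radius 0. As r is bounded by
     \<open>1 / \<epsilon>\<close>, Harris and the two-point lower bounds suffice up to
     constants.\<close>
   case True
   have csr: "cs * r ^r ((a - D) / 2) <= cl * cl * r ^r (a - D)"
   proof -
    have "\<epsilon> powr ((D - a) / 2) <= r ^r ((a - D) / 2)"
    proof -
     have "r ^r ((a - D) / 2) = inverse (real r) powr ((D - a) / 2)"
      using powr_divide[of 1 "real r" "(D - a) / 2"] powr_minus_divide[of "real r" "(D - a) / 2"]
      by (simp add: inverse_eq_divide minus_divide_left)
     moreover have "\<epsilon> <= inverse (real r)" using True r1 by (simp add: field_simps)
     ultimately show ?thesis using \<epsilon> aD by (simp add: powr_mono2)
    qed
    then have "cs * r ^r ((a - D) / 2) <= cl * cl * (r ^r ((a - D) / 2) * r ^r ((a - D) / 2))"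
     using cl by (simp add: cs_def mult_ac mult_left_mono mult_right_mono)
    then show ?thesis by (simp flip: powr_add)
   qed
   have "min cf cs * r ^r ((a - D) / 2) * R ^r (a - D) <= (cl * cl * r ^r (a - D)) * R ^r (a - D)"
   proof (rule mult_right_mono)
    have "min cf cs * r ^r ((a - D) / 2) <= cs * r ^r ((a - D) / 2)" by (intro mult_right_mono) auto
    then show "min cf cs * r ^r ((a - D) / 2) <= cl * cl * r ^r (a - D)" using csr by linarith
   qed simp
   also have "... = (cl * r ^r (a - D)) * (cl * R ^r (a - D))" by simp
   also have "... <= pr (Ed V) x y * pr (Ed V) x z"
   proof (intro mult_mono)
    have "lbox x (2 * sd x y) \<subseteq> V" "lbox x (2 * sd x z) \<subseteq> V" "x ~= z"
     using sub lbox_mono[of "2 * sd x y" "8 * sd x z" x] lbox_mono[of "2 * sd x z" "8 * sd x z" x] mn r1 by (auto simp: r_def)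
    then show "cl * r ^r (a - D) <= pr (Ed V) x y" "cl * R ^r (a - D) <= pr (Ed V) x z"
     using low V xy by (auto simp: r_def R_def)
   qed (use cl pr_bounds[OF finite_Ed[OF V]] in auto)
   also have "... <= avw (Ed V) (%A. of_bool (conn A x y) * of_bool (conn A x z))"
   proof (rule harris[OF pEd[OF V]])
    fix A B :: "(int ^ 'd) set set" assume "A \<subseteq> B"
    then show "of_bool (conn A x y) <= (of_bool (conn B x y) :: real)" "of_bool (conn A x z) <= (of_bool (conn B x z) :: real)"
     using conn_mono[of A x _ B] by auto
   qed
   finally show ?thesis by (simp add: of_bool_conj r_def R_def)
  next
   case False
   define n where "n = nat \<lfloor>\<epsilon> * real r\<rfloor>"
   have n: "1 <= n" "real n <= \<epsilon> * real r" "\<epsilon> * real r <= 2 * real n"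
   proof -
    show n1: "1 <= n" "real n <= \<epsilon> * real r" using False unfolding n_def by linarith+
    have "\<epsilon> * real r <= real n + 1" unfolding n_def by linarith
    then show "\<epsilon> * real r <= 2 * real n" using n1 by simp
   qed
   have n8: "8 * n <= r"
   proof -
    have "real n <= 1 / 8 * real r" using n(2) mult_right_mono[OF \<epsilon>(2), of "real r"] by linarith
    then show ?thesis by linarith
   qed
   define m where "m = r div 4"
   have m: "1 <= m" "4 * m <= r" "r <= 8 * m" using n n8 unfolding m_def by presburger+
   \<comment> \<open>Reflecting \<open>y\<close> in \<open>x\<close> puts the cell \<open>Q\<close>
     at a distance of order r from both boxes, wherever \<open>z\<close> is; \<open>z\<close> itself
     may lie in \<open>Q\<close>.\<close>
   define q where "q = x + (x - y)"
   define Q where "Q = cube m (ci m q)"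
   have fQ: "finite Q" unfolding Q_def by (rule finite_cube[OF m(1)])
   let ?S1 = "lbox x n" and ?S2 = "lbox y n"
   define U where "U = V - (?S1 Un ?S2)"
   have xq: "sd x q = r"
    using sd_shift_left[of x 0 "x - y"] sd_shift[of 0 y "x - y"] by (simp add: q_def r_def sd_commute[of y])
   have yq: "r <= sd y q"
    unfolding r_def sd_le_iff
   proof
    fix i
    show "\<bar>x $ i - y $ i\<bar> <= int (sd y q)" using abs_le_sd[of y i q] by (simp add: q_def)
   qed
   have vQ: "sd x v <= r + m" "r <= sd x v + m" "r <= sd y v + m" if "v : Q" for v
   proof -
    have "sd q v <= m" using that cube_sd[OF m(1), of q "ci m q" v] in_cube_ci[of q m] by (simp add: Q_def)
    then show "sd x v <= r + m" "r <= sd x v + m" "r <= sd y v + m"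
     using sd_triangle[of x v q] sd_triangle[of x q v] sd_triangle[of y q v] xq yq sd_commute[of v q] by linarith+
   qed
   have inV: "u : V" if "sd x u <= 8 * R" for u using sub that by (auto simp: R_def)
   have SV: "?S1 Un ?S2 \<subseteq> V"
   proof
    fix u assume "u : ?S1 Un ?S2"
    then have "sd x u <= r + n" using sd_triangle[of x u y] by (auto simp: r_def)
    then show "u : V" using n8 r1 by (intro inV) linarith
   qed
   have zU: "z : V - (?S1 Un ?S2)" using inV[of z] mn n n8 r1 by (auto simp: R_def r_def)
   have QU: "Q \<subseteq> U"
   proof
    fix v assume "v : Q"
    note this = vQ[OF this]
    then show "v : U" using inV[of v] n8 m r1 n by (auto simp: U_def)
   qed
   have disj: "?S1 Int ?S2 = {}"
   proof (rule ccontr)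
    assume "?S1 Int ?S2 ~= {}"
    then obtain u where "sd x u <= n" "sd y u <= n" by auto
    then show False using sd_triangle[of x y u] n8 n by (simp add: r_def sd_commute[of u y])
   qed
   have fU: "finite U" using V by (simp add: U_def)
   have zv: "c2 / 2 * R ^r (a - D) <= pr (Ed U) z v" if v: "v : Q" for v
   proof -
    note vv = vQ[OF v]
    have lo: "c2 * R ^r (a - D) <= pr (Ed V) z v"
    proof (cases "v = z")
     case True
     have "c2 * R ^r (a - D) <= 1 * 1"
      using aD r1 powr_mono[of "a - D" 0 "real R"] by (intro mult_mono) (auto simp: c2_def)
     then show ?thesis using True V by (simp add: pr_self finite_Ed)
    next
     case ne: False
     have zvR: "sd z v <= R + (r + m)" using sd_triangle[of z v x] vv sd_commute[of z x] by (simp add: R_def)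
     have zV: "lbox z (2 * sd z v) \<subseteq> V"
     proof
      fix u assume "u : lbox z (2 * sd z v)"
      then have "sd x u <= R + 2 * (R + (r + m))" using sd_triangle[of x u z] zvR by (simp add: R_def)
      moreover have "R + 2 * (R + (r + m)) <= 8 * R" using m(2) r1 by arith
      ultimately show "u : V" by (intro inV) (rule order_trans)
     qed
     have "cl * real (sd z v) powr (a - D) <= pr (Ed V) z v" by (rule low[rule_format, OF V _ zV]) (use ne in simp)
     moreover have "cl * (3 * real R) powr (a - D) <= cl * real (sd z v) powr (a - D)"
      using zvR m r1 sd_pos[of z v] ne aD cl by (intro mult_left_mono powr_mono2') auto
     moreover have "c2 * R ^r (a - D) <= cl * (3 powr (a - D)) * R ^r (a - D)"
      by (intro mult_right_mono) (auto simp: c2_def)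
     ultimately show ?thesis by (simp add: powr_mult mult.assoc)
    qed
    have det1: "(SUM b:lbox p n. SUM u:U. pr (Ed U) z u * w u b * pr (Ed V) b v) <= c2 / 4 * R ^r (a - D)"
     if p: "p = x \<or> p = y" for p
    proof -
     have "(SUM b:lbox p n. SUM u:U. pr (Ed U) z u * w u b * pr (Ed V) b v)
      <= Cd * real (sd p z) powr (a - D) * real (sd p v) powr (a - D) * n ^r (D - a)"
      using p V n n8 mn m vv r1 by (intro det[rule_format]) (auto simp: U_def r_def)
     also have "... <= Cd * (real R / 2) powr (a - D) * (real r / 2) powr (a - D) * (\<epsilon> * real r) powr (D - a)"
      using p mn yz n aD Cd m vv r1
      by (intro mult_mono mult_left_mono powr_mono2 powr_mono2' mult_nonneg_nonneg) (auto simp: R_def)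
     also have "... = (Cd * 4 powr (D - a) * \<epsilon> powr (D - a)) * (r ^r (a - D) * r ^r (D - a)) * R ^r (a - D)"
     proof -
      have "(x / 2) powr (a - D) = x powr (a - D) * 2 powr (D - a)" if "0 <= x" for x :: real
       using that by (simp add: powr_divide powr_diff field_simps)
      moreover have "(4 :: real) powr (D - a) = 2 powr (D - a) * 2 powr (D - a)"
       using powr_mult[of 2 2 "D - a"] by simp
      ultimately show ?thesis using \<epsilon> by (simp add: powr_mult mult_ac)
     qed
     also have "r ^r (a - D) * r ^r (D - a) = 1" using r1 by (simp flip: powr_add)
     also have "(Cd * 4 powr (D - a) * \<epsilon> powr (D - a)) * 1 * R ^r (a - D) <= c2 / 4 * R ^r (a - D)"
      using \<epsilon>(3) by (intro mult_right_mono) auto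
     finally show ?thesis .
    qed
    have "pr (Ed V) z v <= pr (Ed U) z v + (SUM b:?S1 Un ?S2. SUM u:U. pr (Ed U) z u * w u b * pr (Ed V) b v)"
     unfolding U_def by (rule removal[OF V SV zU])
    also have "(SUM b:?S1 Un ?S2. SUM u:U. pr (Ed U) z u * w u b * pr (Ed V) b v)
     = (SUM b:?S1. SUM u:U. pr (Ed U) z u * w u b * pr (Ed V) b v) + (SUM b:?S2. SUM u:U. pr (Ed U) z u * w u b * pr (Ed V) b v)"
     by (rule sum.union_disjoint[OF finite_lbox finite_lbox disj])
    finally show ?thesis using lo det1[of x] det1[of y] by (simp add: field_simps)
   qed
   let ?X = "%A. real (card (clu A z Int Q))"
   let ?av = "avw (Ed U)"
   have EX: "?av ?X = (SUM v:Q. pr (Ed U) z v)" by (rule avg_card[OF fQ])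
   have X1: "8 powr (- D) * (c2 / 2) * (r ^r D * R ^r (a - D)) <= ?av ?X"
   proof -
    have "8 powr (- D) * r ^r D = (real r / 8) powr D" by (simp add: powr_divide powr_minus field_simps)
    also have "... <= m ^r D" using m D1 by (intro powr_mono2) auto
    also have "... = real (card Q)" using m powr_Dn[of "real m"] by (simp add: Q_def card_cube)
    finally have "8 powr (- D) * r ^r D * (c2 / 2 * R ^r (a - D)) <= real (card Q) * (c2 / 2 * R ^r (a - D))"
     using c2 by (intro mult_right_mono) auto
    also have "... <= ?av ?X" unfolding EX using sum_mono[of Q "%_. c2 / 2 * R ^r (a - D)", OF zv] by simp
    finally show ?thesis by (simp add: mult_ac)
   qed
   have X0: "0 <= ?av ?X" by (intro avg_nonneg pEd fU) simp
   have rh: "r ^r h > 0" "r ^r (- h) * r ^r h = 1" using r1 by (simp_all flip: powr_add)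
   have X2: "?av (%A. ?X A ^ 2) <= Cc * r ^r h * ?av ?X"
   proof -
    have "?av (%A. ?X A ^ 2) <= Cc * m ^r h * ?av ?X"
     unfolding EX using cm m fU by (simp add: Q_def h_def)
    also have "... <= Cc * r ^r h * ?av ?X"
     using m h X0 Cc by (intro mult_right_mono mult_left_mono powr_mono2) auto
    finally show ?thesis .
   qed
   let ?k = "k1 * r ^r (- (D + a))" and ?s = "e * r ^r h"
   let ?t = "k1 * e * r ^r (- h)"
   have rr: "r ^r (- (D + a)) = r ^r (- h) * r ^r (- h)"
    unfolding powr_add[symmetric] by (rule arg_cong[of _ _ "(powr) (real r)"]) (simp add: h_def field_simps)
   have ks: "?k * ?s = ?t" "?k * ?s^2 = k1 * e^2"
   proof -
    have "?k * ?s = k1 * e * r ^r (- h) * (r ^r (- h) * r ^r h)" unfolding rr by simp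
    then show "?k * ?s = ?t" unfolding rh by simp
    have "?k * ?s^2 = k1 * e^2 * (r ^r (- h) * r ^r h)^2"
     unfolding rr by (simp add: power2_eq_square)
    then show "?k * ?s^2 = k1 * e^2" unfolding rh by simp
   qed
   have X3: "?t / 2 * ?av ?X <= ?av (%A. 1 - exp (- (?k * ?s * ?X A)))"
   proof -
    have "?t * ?av (%A. ?X A ^ 2) <= ?t * (Cc * r ^r h * ?av ?X)"
     using ek X2 by (intro mult_left_mono) auto
    also have "... = (k1 * e * Cc) * (r ^r (- h) * r ^r h) * ?av ?X" by simp
    also have "... <= 1 * 1 * ?av ?X" unfolding rh using ek X0 by (intro mult_right_mono) auto
    finally have "?t / 2 * (?t * ?av (%A. ?X A ^ 2)) <= ?t / 2 * ?av ?X"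
     using ek by (intro mult_left_mono) auto
    then have "?t / 2 * ?av ?X <= ?t * ?av ?X - ?t / 2 * (?t * ?av (%A. ?X A ^ 2))" by (simp add: field_simps)
    also have "... = ?av (%A. ?t * ?X A - ?t / 2 * (?t * ?X A ^ 2))" by (simp only: avg_diff avg_cmult)
    also have "... <= ?av (%A. 1 - exp (- (?k * ?s * ?X A)))"
    proof (intro avg_mono pEd fU)
     fix A
     have "0 <= ?t * ?X A" using ek by simp
     from exp_lower[OF this] show "?t * ?X A - ?t / 2 * (?t * ?X A ^ 2) <= 1 - exp (- (?k * ?s * ?X A))"
      unfolding ks by (simp add: power2_eq_square mult_ac)
    qed
    finally show ?thesis .
   qed
   have bigs: "cb * r ^r ((a - D) / 2) <= prw (Ed (lbox p n)) (%A. ?s <= csz A p)" for p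
   proof -
    have "cb * r ^r ((a - D) / 2) <= cb * n ^r (- ((D - a) / 2))"
     using n n8 aD cb powr_mono2'[of "(a - D) / 2" "real n" "real r"] by (simp add: minus_divide_left)
    also have "... <= prw (Ed (lbox p n)) (%A. cb * n ^r h <= csz A p)"
     unfolding h_def using big n by blast
    also have "... <= prw (Ed (lbox p n)) (%A. ?s <= csz A p)"
    proof (intro prb_mono pEd finite_lbox)
     fix A :: "(int ^ 'd) set set" assume "cb * n ^r h <= csz A p"
     moreover have "?s = cb * (\<epsilon> * real r / 2) powr h" using \<epsilon> by (simp add: e_def powr_mult powr_divide)
     moreover have "cb * (\<epsilon> * real r / 2) powr h <= cb * n ^r h"
      using n h \<epsilon> cb by (intro mult_left_mono powr_mono2) auto
     ultimately show "?s <= csz A p" by linarith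
    qed
    finally show ?thesis .
   qed
   have "min cf cs * r ^r ((a - D) / 2) * R ^r (a - D) <= cf * (r ^r ((a - D) / 2) * R ^r (a - D))"
    unfolding mult.assoc by (intro mult_right_mono) auto
   \<comment> \<open>Balance of exponents with h = (d+a)/2: the extra factors r^((a-d)/2), r^(-h)
     and r^d cancel, leaving one factor r^((a-d)/2).\<close>
   also have "... = (cb * r ^r ((a - D) / 2)) * ((cb * r ^r ((a - D) / 2)) * (q1 * (?t / 2 * (8 powr (- D) * (c2 / 2) * (r ^r D * R ^r (a - D))))))"
   proof -
    have "r ^r ((a - D) / 2) = r ^r ((a - D) / 2) * (r ^r ((a - D) / 2) * (r ^r (- h) * r ^r D))"
     unfolding powr_add[symmetric] by (rule arg_cong[of _ _ "(powr) (real r)"]) (simp add: h_def field_simps)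
    from arg_cong[OF this, of "%u. cf * (u * R ^r (a - D))"]
    show ?thesis unfolding cf_def by (simp only: mult_ac times_divide_eq_left times_divide_eq_right)
   qed
   also have "... <= prw (Ed ?S1) (%A. ?s <= csz A x) * (prw (Ed ?S2) (%A. ?s <= csz A y) *
     ((1 - exp (- (?k * ?s^2))) * ?av (%A. 1 - exp (- (?k * ?s * ?X A)))))"
   proof (intro mult_mono bigs)
    show "q1 <= 1 - exp (- (?k * ?s^2))" unfolding ks by (simp add: q1_def)
    have "?t / 2 * (8 powr (- D) * (c2 / 2) * (r ^r D * R ^r (a - D))) <= ?t / 2 * ?av ?X"
     using ek X1 by (intro mult_left_mono) auto
    then show "?t / 2 * (8 powr (- D) * (c2 / 2) * (r ^r D * R ^r (a - D))) <= ?av (%A. 1 - exp (- (?k * ?s * ?X A)))"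
     using X3 by linarith
   qed (use q1 ek c2 cb in \<open>auto intro!: mult_nonneg_nonneg prb_nonneg pEd simp: q1_def ks\<close>)
   also have "... <= prw (Ed (?S1 Un ?S2 Un U)) (%A. conn A x y & conn A x z)"
   proof (rule glue3[OF finite_lbox finite_lbox fU disj _ _ QU self_in_lbox self_in_lbox])
    fix u v assume u: "u : ?S1" and v: "v : ?S2 Un Q"
    have uv: "u ~= v" using u v disj QU by (auto simp: U_def)
    have "sd x v <= r + m + n" using v vQ[of v] sd_triangle[of x v y] by (auto simp: r_def)
    then have "sd u v <= 2 * r" using u sd_triangle[of u v x] sd_commute[of u x] n8 m by simp
    then have "(2 * real r) powr (- (D + a)) <= real (sd u v) powr (- (D + a))"
     using sd_pos[OF uv] D1 a0 by (intro powr_mono2') auto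
    then have "c0 * 2 powr (- (D + a)) * r ^r (- (D + a)) <= c0 * real (sd u v) powr (- (D + a))"
     using c0 by (simp add: powr_mult)
    also have "... <= w u v" by (rule wl[OF uv])
    finally show "?k <= w u v"
     using mult_right_mono[of k1 "c0 * 2 powr (- (D + a))" "r ^r (- (D + a))"] by (simp add: k1_def)
   qed (use ek in \<open>auto simp: U_def\<close>)
   also have "?S1 Un ?S2 Un U = V" using SV by (auto simp: U_def)
   finally show ?thesis by (simp only: r_def R_def)
  qed
 qed
 then show ?thesis using cfs by (intro exI[of _ "min cf cs"]) auto
qed

text \<open>The event is symmetric in the three points, so the closest pair may come first. The
  triangle inequality then makes the other two distances comparable, which turns the bound of
  \<open>three_lower_min\<close> into the symmetric expression.\<close>

lemma three_bounds:
 "EX c>0. EX C>0. ALL x y z. x ~= y --> y ~= z --> z ~= x --> (EX V0. finite V0 & (ALL V. finite V --> V0 \<subseteq> V -->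
  (let R = sqrt (real (sd x y) powr (a - D) * real (sd y z) powr (a - D) * real (sd z x) powr (a - D));
     p = prw (Ed V) (%A. conn A x y & conn A x z) in c * R <= p & p <= C * R)))"
proof -
 obtain C where C: "C > 0" and up: "three_upper_with C"
  using three_upper by blast
 obtain c where c: "c > 0" and lo: "three_lower_min_with c"
  using three_lower_min by blast
 let ?d = "%x y :: int ^ 'd. real (sd x y) powr (a - D)"
 define c' where "c' = c * 2 powr ((a - D) / 2)"
 have ex: "c' * sqrt (?d x y * ?d y z * ?d z x) <= prw (Ed V) (%A. conn A x y & conn A x z)"
  if ne: "x ~= y" "y ~= z" "z ~= x" and mn: "sd x y <= sd x z" "sd x y <= sd y z" and V: "finite V" "lbox x (8 * sd x z) \<subseteq> V" for x y z V
 proof -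
  have "real (sd x z) / 2 <= real (sd y z)" using sd_triangle[of x z y] mn by simp
  then have "?d y z <= (real (sd x z) / 2) powr (a - D)" using sd_pos[OF ne(3)] aD sd_commute[of z x] by (intro powr_mono2') auto
  also have "... = 2 powr (D - a) * ?d z x" by (simp add: powr_divide powr_diff field_simps sd_commute[of z x])
  finally have "sqrt (?d x y * ?d y z * ?d z x) <= sqrt (?d x y * (2 powr (D - a) * ?d z x) * ?d z x)"
   by (intro real_sqrt_le_mono mult_right_mono mult_left_mono) auto
  also have "... = 2 powr ((D - a) / 2) * (real (sd x y) powr ((a - D) / 2) * ?d x z)"
   by (simp add: real_sqrt_mult powr_half_sqrt[symmetric] powr_powr sd_commute[of z x])
    (simp add: mult.assoc flip: powr_add)
  finally have "c' * sqrt (?d x y * ?d y z * ?d z x) <= c' * (2 powr ((D - a) / 2) * (real (sd x y) powr ((a - D) / 2) * ?d x z))"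
   using c by (intro mult_left_mono) (auto simp: c'_def)
  also have "... = c * (2 powr ((a - D) / 2) * 2 powr ((D - a) / 2)) * real (sd x y) powr ((a - D) / 2) * ?d x z"
   by (simp add: c'_def)
  also have "2 powr ((a - D) / 2) * 2 powr ((D - a) / 2) = (1 :: real)"
   unfolding powr_add[symmetric] by (simp add: field_simps)
  finally show ?thesis using lo[rule_format, OF V(1) ne(1) mn V(2)] by simp
 qed
 define R where "R = (%x y z. sqrt (?d x y * ?d y z * ?d z x))"
 have Rs: "R y x z = R x y z" "R z x y = R x y z" "R y z x = R x y z" "R z y x = R x y z" "R x z y = R x y z" for x y z
  by (simp_all add: R_def sd_commute[of y x] sd_commute[of z y] sd_commute[of x z] mult_ac)
 have exR: "EX V0. finite V0 & (ALL V. finite V --> V0 \<subseteq> V --> c' * R x y z <= prw (Ed V) (%A. conn A x y & conn A x z))"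
  if "x ~= y" "y ~= z" "z ~= x" "sd x y <= sd x z" "sd x y <= sd y z" for x y z
  using ex[OF that] unfolding R_def by (intro exI[of _ "lbox x (8 * sd x z)"]) simp
 have ev: "prw (Ed V) (%A. conn A u v & conn A u t) = prw (Ed V) (%A. conn A x y & conn A x z)"
  if "{u, v, t} = {x, y, z}" for u v t x y z :: "int ^ 'd" and V
 proof (rule avg_cong, rule arg_cong[of _ _ of_bool])
  fix A :: "(int ^ 'd) set set"
  have 1: "conn A u v & conn A u t \<longleftrightarrow> {u, v, t} \<subseteq> clu A u" for u v t by auto
  have 2: "{u, v, t} \<subseteq> clu A u \<longleftrightarrow> (EX p. {u, v, t} \<subseteq> clu A p)" for u v t
  proof
   assume "EX p. {u, v, t} \<subseteq> clu A p"
   then obtain p where p: "{u, v, t} \<subseteq> clu A p" by blast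
   then have "clu A u = clu A p" using clu_eq[of A p u] by simp
   then show "{u, v, t} \<subseteq> clu A u" using p by simp
  qed blast
  show "(conn A u v & conn A u t) = (conn A x y & conn A x z)" by (simp only: 1 2) (simp only: that)
 qed
 have main: "EX V0. finite V0 & (ALL V. finite V --> V0 \<subseteq> V --> c' * R x y z <= prw (Ed V) (%A. conn A x y & conn A x z))"
  if ne: "x ~= y" "y ~= z" "z ~= x" for x y z :: "int ^ 'd"
 proof -
  consider "sd x y <= sd x z" "sd x y <= sd y z" | "sd x z <= sd x y" "sd x z <= sd z y" | "sd y z <= sd y x" "sd y z <= sd z x"
   using sd_commute[of x y] sd_commute[of y z] sd_commute[of x z] by linarith
  then show ?thesis
  proof cases
   case 1
   then show ?thesis using exR[of x y z] ne by blast
  next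
   case 2
   have "{x, z, y} = {x, y, z}" by auto
   note e = ev[OF this]
   show ?thesis using exR[of x z y] 2 ne unfolding e Rs(5)[of x y z] by simp
  next
   case 3
   have "{y, z, x} = {x, y, z}" by auto
   note e = ev[OF this]
   show ?thesis using exR[of y z x] 3 ne unfolding e Rs(3)[of y z x] by simp
  qed
 qed
 have c': "c' > 0" using c by (simp add: c'_def)
 have "EX V0. finite V0 & (ALL V. finite V --> V0 \<subseteq> V -->
   c' * R x y z <= prw (Ed V) (%A. conn A x y & conn A x z) & prw (Ed V) (%A. conn A x y & conn A x z) <= C * R x y z)"
  if ne: "x ~= y" "y ~= z" "z ~= x" for x y z
 proof -
  obtain V0 where V0: "finite V0" "ALL V. finite V --> V0 \<subseteq> V --> c' * R x y z <= prw (Ed V) (%A. conn A x y & conn A x z)"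
   using main[OF ne] by blast
  have "prw (Ed V) (%A. conn A x y & conn A x z) <= C * R x y z" if "finite V" for V
   using up that ne unfolding R_def by blast
  then show ?thesis using V0 by (intro exI[of _ V0]) simp
 qed
 then show ?thesis
  unfolding R_def Let_def by (intro exI[of _ c'] exI[of _ C] conjI c' C allI impI)
qed

end

section \<open>Norms and admissible kernels\<close>

lemma norm_sd_bounds:
 fixes N :: "real ^ 'd => real"
 assumes N: "is_norm N"
 shows "EX m>0. EX M>0. ALL x y. m * real (sd x y) <= lattice_dist N x y & lattice_dist N x y <= M * real (sd x y)"
proof -
 have N0: "N x = 0 \<longleftrightarrow> x = 0" and Ns: "N (t *\<^sub>R x) = \<bar>t\<bar> * N x" and Nt: "N (x + y) <= N x + N y" for x y t
  using N by (auto simp: is_norm_def)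
 have Nz: "N 0 = 0" using N0 by blast
 have Nm: "N (- x) = N x" for x using Ns[of "- 1" x] by simp
 have Np: "0 <= N x" for x using Nt[of x "- x"] by (simp add: Nm Nz)
 have Nsum: "N (SUM b:F. f b) <= (SUM b:F. N (f b))" if "finite F" for F and f :: "real ^ 'd => real ^ 'd"
  using that
 proof (induction F)
  case (insert b F)
  then show ?case using Nt[of "f b" "SUM b:F. f b"] by simp
 qed (simp add: Nz)
 define K where "K = 1 + (SUM b:Basis. N b)"
 have K: "K > 0" using Np by (simp add: K_def add_pos_nonneg sum_nonneg)
 have up: "N x <= K * norm x" for x
 proof -
  have "N x <= (SUM b:Basis. N ((x \<bullet> b) *\<^sub>R b))"
   using Nsum[OF finite_Basis, of "%b. (x \<bullet> b) *\<^sub>R b"] by (simp add: euclidean_representation)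
  also have "... <= (SUM b:Basis. norm x * N b)"
   by (intro sum_mono) (simp add: Ns Np Basis_le_norm mult_right_mono)
  also have "... = norm x * (SUM b:Basis. N b)" by (simp only: sum_distrib_left)
  also have "... <= K * norm x" by (simp add: K_def mult.commute mult_left_mono)
  finally show ?thesis .
 qed
 have "K-lipschitz_on UNIV N"
 proof (rule lipschitz_onI)
  fix x y
  have "N x <= N y + N (x - y)" "N y <= N x + N (x - y)"
   using Nt[of y "x - y"] Nt[of x "y - x"] Nm[of "x - y"] by simp_all
  then show "dist (N x) (N y) <= K * dist x y" using up[of "x - y"] by (simp add: dist_norm abs_le_iff)
 qed (use K in simp)
 then have "continuous_on (sphere 0 1) N" using lipschitz_on_continuous_on continuous_on_subset by blast
 moreover have "sphere (0 :: real ^ 'd) 1 ~= {}" by (simp add: sphere_eq_empty)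
 ultimately obtain v where v: "v : sphere 0 1" "\<And>u. u : sphere 0 1 ==> N v <= N u"
  using continuous_attains_inf[of "sphere 0 1" N] compact_sphere by blast
 have m: "N v > 0" using v(1) N0[of v] Np[of v] by (cases "v = 0") auto
 have low: "N v * norm x <= N x" for x
 proof (cases "x = 0")
  case False
  then have "N v <= N ((1 / norm x) *\<^sub>R x)" by (intro v(2)) simp
  then show ?thesis using False by (simp add: Ns field_simps)
 qed (simp add: Nz)
 have "N v * real (sd x y) <= lattice_dist N x y & lattice_dist N x y <= (K * real CARD('d)) * real (sd x y)" for x y
 proof
  let ?u = "\<chi> i. real_of_int (x $ i - y $ i)"
  have ui: "\<bar>?u $ i\<bar> = real_of_int \<bar>x $ i - y $ i\<bar>" for i by simp
  have "sd x y <= nat \<lfloor>norm ?u\<rfloor>"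
   unfolding sd_le_iff
  proof
   fix i
   have "real_of_int \<bar>x $ i - y $ i\<bar> <= norm ?u" using component_le_norm_cart[of ?u i] unfolding ui .
   then show "\<bar>x $ i - y $ i\<bar> <= int (nat \<lfloor>norm ?u\<rfloor>)" by (simp add: le_floor_iff)
  qed
  then have "real (sd x y) <= norm ?u" using of_nat_floor[OF norm_ge_zero[of ?u]] by (meson of_nat_mono order_trans)
  then have "N v * real (sd x y) <= N v * norm ?u" using m by simp
  then show "N v * real (sd x y) <= lattice_dist N x y" using low[of ?u] by (simp add: lattice_dist_def)
  have "norm ?u <= (SUM i:UNIV. \<bar>?u $ i\<bar>)" by (rule norm_le_l1_cart)
  also have "... <= (SUM i:(UNIV :: 'd set). real (sd x y))"
  proof (rule sum_mono)
   fix i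
   have "real_of_int \<bar>x $ i - y $ i\<bar> <= real_of_int (int (sd x y))" using abs_le_sd[of x i y] by (simp only: of_int_le_iff)
   then show "\<bar>?u $ i\<bar> <= real (sd x y)" unfolding ui by simp
  qed
  finally have "K * norm ?u <= K * (real CARD('d) * real (sd x y))" using K by simp
  then show "lattice_dist N x y <= (K * real CARD('d)) * real (sd x y)"
   using up[of ?u] by (simp add: lattice_dist_def mult.assoc)
 qed
 moreover have "K * real CARD('d) > 0" using K by simp
 ultimately show ?thesis using m by blast
qed

text \<open>Once |\<delta>| < 1/2, the derivative of \<open>J\<close> lies between two negative
  multiples of r^(-s-1). Subtracting the matching multiple of r^(-s) from \<open>J\<close> gives a
  monotone function that vanishes at infinity, which fixes its sign.\<close>

lemma kernel_decay:
 assumes J: "admissible_kernel d \<alpha> J" and \<alpha>: "\<alpha> > 0" and \<rho>: "\<rho> > 0"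
 shows "EX c>0. EX C>0. ALL r>=\<rho>. c * r powr (- (real d + \<alpha>)) <= J r & J r <= C * r powr (- (real d + \<alpha>))"
proof -
 define s where "s = real d + \<alpha>"
 have s: "s > 0" using \<alpha> by (simp add: s_def)
 obtain C \<delta> where Jp: "\<And>r. r > 0 ==> J r > 0" and anti: "\<And>r t. 0 < r ==> r <= t ==> J t <= J r"
  and Jd: "\<And>r. r > 0 ==> J differentiable (at r)" and J0: "(J \<longlongrightarrow> 0) at_top" and C: "C > 0"
  and J': "\<And>r. r > 0 ==> \<bar>deriv J r\<bar> = C * (1 + \<delta> r) * r powr (- real d - \<alpha> - 1)" and \<delta>: "(\<delta> \<longlongrightarrow> 0) at_top"
  using J unfolding admissible_kernel_def monotone_on_def by auto
 have dJ: "(J has_real_derivative deriv J r) (at r)" if "r > 0" for r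
  using Jd[OF that] by (simp add: DERIV_deriv_iff_real_differentiable)
 have neg: "deriv J r <= 0" if r0: "r > 0" for r
 proof (rule ccontr)
  assume "~ deriv J r <= 0"
  then obtain h where h: "h > 0" "ALL x>0. x < h --> J r < J (r + x)"
   using DERIV_pos_inc_right[OF dJ[OF r0]] by auto
  from h(2)[rule_format, of "h / 2"] have "J r < J (r + h / 2)" using h(1) by simp
  then show False using anti[of r "r + h / 2"] r0 h(1) by simp
 qed
 have "eventually (%r. \<bar>\<delta> r\<bar> < 1 / 2) at_top"
  using \<delta> by (auto dest: tendstoD[of _ _ _ "1 / 2"] simp: dist_real_def)
 then obtain r1 where r1: "r1 >= 1" "\<And>r. r >= r1 ==> \<bar>\<delta> r\<bar> < 1 / 2"
  unfolding eventually_at_top_linorder by (metis max.bounded_iff max.cobounded1)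
 have der: "- (3 / 2 * C) * r powr (- s - 1) <= deriv J r & deriv J r <= - (C / 2) * r powr (- s - 1)" if "r >= r1" for r
 proof -
  have r: "r > 0" using that r1 by simp
  have e: "deriv J r = - ((1 + \<delta> r) * (C * r powr (- s - 1)))"
  proof -
   have "- real d - \<alpha> - 1 = - s - 1" by (simp add: s_def)
   then show ?thesis using J'[OF r] neg[OF r] by (simp only: abs_of_nonpos) (simp add: algebra_simps)
  qed
  have b: "1 / 2 <= 1 + \<delta> r" "1 + \<delta> r <= 3 / 2" using r1(2)[OF that] by linarith+
  have p: "0 <= C * r powr (- s - 1)" using C by simp
  show ?thesis using mult_right_mono[OF b(1) p] mult_right_mono[OF b(2) p] unfolding e by simp
 qed
 have dF: "((%r. J r - t / s * r powr (- s)) has_real_derivative deriv J r + t * r powr (- s - 1)) (at r)" if "r >= r1" for r t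
  using that r1 s by (auto intro!: derivative_eq_intros dJ)
 have lim: "((%r. J r - t / s * r powr (- s)) \<longlongrightarrow> 0) at_top" for t
 proof -
  have "((%r. r powr (- s)) \<longlongrightarrow> 0) at_top" using s by (intro tendsto_neg_powr filterlim_ident) auto
  from tendsto_diff[OF J0 tendsto_mult_left[OF this, of "t / s"]] show ?thesis by simp
 qed
 have large: "C / (2 * s) * r powr (- s) <= J r & J r <= 3 * C / (2 * s) * r powr (- s)" if r: "r >= r1" for r
 proof
  let ?F = "%t r. J r - t / s * r powr (- s)"
  have "eventually (%u. ?F (C / 2) u <= ?F (C / 2) r) at_top"
   using eventually_ge_at_top[of r]
  proof eventually_elim
   case (elim u)
   show ?case
    using der dF[of _ "C / 2"] r by (intro DERIV_nonpos_imp_nonincreasing[OF elim]) (smt (verit) mult_minus_left)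
  qed
  then have "0 <= ?F (C / 2) r" by (rule tendsto_upperbound[OF lim]) simp
  then show "C / (2 * s) * r powr (- s) <= J r" by simp
  have "eventually (%u. ?F (3 / 2 * C) r <= ?F (3 / 2 * C) u) at_top"
   using eventually_ge_at_top[of r]
  proof eventually_elim
   case (elim u)
   show ?case
    using der dF[of _ "3 / 2 * C"] r by (intro DERIV_nonneg_imp_nondecreasing[OF elim]) (smt (verit) mult_minus_left)
  qed
  then have "?F (3 / 2 * C) r <= 0" by (rule tendsto_lowerbound[OF lim]) simp
  then show "J r <= 3 * C / (2 * s) * r powr (- s)" by simp
 qed
 \<comment> \<open>The second entries of the minimum and maximum cover the bounded range from
   \<open>\<rho>\<close> to \<open>r1\<close>, where \<open>J\<close> is only known to be
   decreasing.\<close>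
 define c' where "c' = min (C / (2 * s)) (J r1 * \<rho> powr s)"
 define C' where "C' = max (3 * C / (2 * s)) (J \<rho> * r1 powr s)"
 have "c' * r powr (- s) <= J r & J r <= C' * r powr (- s)" if r: "r >= \<rho>" for r
 proof (cases "r >= r1")
  case True
  have "c' * r powr (- s) <= C / (2 * s) * r powr (- s)" "3 * C / (2 * s) * r powr (- s) <= C' * r powr (- s)"
   by (intro mult_right_mono; simp add: c'_def C'_def)+
  then show ?thesis using large[OF True] by linarith
 next
  case False
  have rr: "r > 0" using r \<rho> by simp
  have "c' * r powr (- s) <= (J r1 * \<rho> powr s) * \<rho> powr (- s)"
   using r s \<rho> Jp[of r1] r1 by (intro mult_mono powr_mono2') (auto simp: c'_def)
  also have "... = J r1" using \<rho> by (simp add: mult.assoc flip: powr_add)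
  also have "... <= J r" using False rr by (intro anti) auto
  finally have 1: "c' * r powr (- s) <= J r" .
  have "J r <= J \<rho>" using r \<rho> by (intro anti)
  also have "... = (J \<rho> * r1 powr s) * r1 powr (- s)" using r1 by (simp add: mult.assoc flip: powr_add)
  also have "... <= C' * r powr (- s)"
   using False rr s C Jp[OF \<rho>] by (intro mult_mono powr_mono2') (auto simp: C'_def le_max_iff_disj)
  finally show ?thesis using 1 by simp
 qed
 moreover have "c' > 0" "C' > 0" using C s Jp[of r1] Jp[OF \<rho>] r1 \<rho> by (auto simp: c'_def C'_def less_max_iff_disj)
 ultimately show ?thesis unfolding s_def by blast
qed

lemma lattice_dist_shift: "lattice_dist N (x + z) (y + z) = lattice_dist N x y"
 by (simp add: lattice_dist_def)

lemma kernel_bounds: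
 fixes N :: "real ^ 'd => real"
 assumes N: "is_norm N" and J: "admissible_kernel CARD('d) \<alpha> J" and \<alpha>: "\<alpha> > 0"
 shows "EX c>0. EX C>0. ALL x y. x ~= y --> c * real (sd x y) powr (- (real CARD('d) + \<alpha>)) <= kernel N J x y &
  kernel N J x y <= C * real (sd x y) powr (- (real CARD('d) + \<alpha>))"
proof -
 let ?s = "real CARD('d) + \<alpha>"
 obtain m M where m: "m > 0" and M: "M > 0" and sd: "ALL x y. m * real (sd x y) <= lattice_dist N x y & lattice_dist N x y <= M * real (sd x y)"
  using norm_sd_bounds[OF N] by blast
 obtain c C where c: "c > 0" and C: "C > 0" and Jb: "ALL r>=m. c * r powr (- ?s) <= J r & J r <= C * r powr (- ?s)"
  using kernel_decay[OF J \<alpha> m] by blast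
 have "(c * M powr (- ?s)) * real (sd x y) powr (- ?s) <= kernel N J x y & kernel N J x y <= (C * m powr (- ?s)) * real (sd x y) powr (- ?s)"
  if "x ~= y" for x y
 proof -
  have d: "real (sd x y) >= 1" using sd_pos[OF that] by simp
  have l: "m <= lattice_dist N x y" using sd mult_left_mono[OF d, of m] m by (metis less_imp_le mult.right_neutral order_trans)
  have k: "kernel N J x y = J (lattice_dist N x y)" using that by (simp add: kernel_def)
  have "c * (M * real (sd x y)) powr (- ?s) <= c * lattice_dist N x y powr (- ?s)"
   using l m sd \<alpha> c by (intro mult_left_mono powr_mono2') auto
  moreover have "C * lattice_dist N x y powr (- ?s) <= C * (m * real (sd x y)) powr (- ?s)"
   using l m sd \<alpha> C d by (intro mult_left_mono powr_mono2') auto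
  ultimately show ?thesis using Jb l unfolding k by (simp add: powr_mult mult.assoc) (meson order_trans)
 qed
 moreover have "c * M powr (- ?s) > 0" "C * m powr (- ?s) > 0" using c C m M by simp_all
 ultimately show ?thesis by blast
qed

section \<open>The infinite-volume model at its critical point\<close>

locale lrp =
 fixes N :: "real ^ 'd => real" and J :: "real => real" and \<alpha> k0 k1 :: real
 assumes N: "is_norm N" and \<alpha>: "0 < \<alpha>" "\<alpha> < 1" and k01: "0 < k0" "0 < k1"
  and kb: "x ~= y ==> k0 * real (sd x y) powr (- (real CARD('d) + \<alpha>)) <= kernel N J x y &
   kernel N J x y <= k1 * real (sd x y) powr (- (real CARD('d) + \<alpha>))"
begin

abbreviation "k \<equiv> kernel N J"
abbreviation "P \<equiv> percolation N J"

definition kw :: "real => int ^ 'd => int ^ 'd => real" where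
 "kw \<beta> x y = \<beta> * k x y"

abbreviation "p \<beta> \<equiv> pk (kw \<beta>)"

lemma k_nonneg: "0 <= k x y"
proof (cases "x = y")
 case False
 have "0 <= k0 * real (sd x y) powr (- (real CARD('d) + \<alpha>))" using k01 by simp
 then show ?thesis using kb[OF False] by linarith
qed (simp add: kernel_def)

lemma sk: "\<beta> >= 0 ==> sym_kernel (kw \<beta>)"
 using lattice_dist_commute[OF N] k_nonneg
 by unfold_locales (auto simp: kw_def kernel_def)

lemma kn: "\<beta> > 0 ==> kern (kw \<beta>) \<alpha> (\<beta> * k0) (\<beta> * k1)"
proof -
 assume b: "\<beta> > 0"
 interpret sym_kernel "kw \<beta>" using b by (intro sk) simp
 show ?thesis
  using \<alpha> k01 b kb by unfold_locales (auto simp: kw_def kernel_def lattice_dist_shift mult.assoc)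
qed

definition gr :: "nat => ((int ^ 'd) set => bool) => (int ^ 'd) set set" where
 "gr n \<omega> = {e : Ed (lbox 0 n). \<omega> e}"

lemma gr_mono: "n <= m ==> gr n \<omega> \<subseteq> gr m \<omega>"
 using Ed_mono[OF lbox_mono] by (auto simp: gr_def)

lemma prob_P: "prob_space (P \<beta>)"
 unfolding percolation_def by (intro prob_space_PiM measure_pmf.prob_space_axioms)

text \<open>An event depending on finitely many edges is a finite disjoint union of cylinders, whose
  product measures are the weights in \<open>avg\<close>.\<close>

lemma prob_finite:
 assumes \<beta>: "\<beta> >= 0" and E: "finite E" "E \<subseteq> edges"
 shows "{\<omega> : space (P \<beta>). Q {e : E. \<omega> e}} : sets (P \<beta>) & measure (P \<beta>) {\<omega> : space (P \<beta>). Q {e : E. \<omega> e}} = prb E (p \<beta>) Q"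
proof -
 interpret sym_kernel "kw \<beta>" by (rule sk[OF \<beta>])
 define M where "M = (%e. measure_pmf (bernoulli_pmf (edge_prob N J \<beta> e)))"
 interpret product_prob_space M edges
  by (intro product_prob_spaceI) (simp add: M_def measure_pmf.prob_space_axioms)
 have P: "P \<beta> = Pi\<^sub>M edges M" by (simp add: percolation_def M_def)
 have pe: "edge_prob N J \<beta> e = p \<beta> e" if "e : edges" for e
  using that w_sym by (auto simp: edges_def edge_prob_eq[OF N] pk_edge kw_def)
 define cyl where "cyl = (%A. emb edges E (\<Pi>\<^sub>E e\<in>E. {e : A}))"
 have cyl: "\<omega> : cyl A \<longleftrightarrow> \<omega> : space (P \<beta>) & {e : E. \<omega> e} = A" if "A \<subseteq> E" for \<omega> A
 proof -
  have "\<omega> : cyl A \<longleftrightarrow> \<omega> : extensional edges & (ALL e:E. \<omega> e = (e : A))"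
   by (auto simp: cyl_def prod_emb_iff M_def PiE_iff)
  moreover have "space (P \<beta>) = extensional edges" by (auto simp: P space_PiM PiE_def M_def)
  moreover have "(ALL e:E. \<omega> e = (e : A)) \<longleftrightarrow> {e : E. \<omega> e} = A" using that by auto
  ultimately show ?thesis by simp
 qed
 have mc: "measure (P \<beta>) (cyl A) = (PROD e:A. p \<beta> e) * (PROD e:E - A. 1 - p \<beta> e)" if A: "A \<subseteq> E" for A
 proof -
  have "measure (P \<beta>) (cyl A) = (PROD e:E. measure (M e) {e : A})"
   unfolding P cyl_def by (intro measure_PiM_emb E) (simp add: M_def)
  also have "... = (PROD e:E. if e : A then p \<beta> e else 1 - p \<beta> e)"
   using E p01 by (intro prod.cong) (auto simp: M_def measure_pmf_single pe subset_iff)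
  also have "... = (PROD e:A. p \<beta> e) * (PROD e:E - A. 1 - p \<beta> e)"
   using E A by (simp add: prod.If_cases Int_absorb1 Diff_eq)
  finally show ?thesis .
 qed
 have sc: "cyl A : sets (P \<beta>)" for A unfolding cyl_def P using E by (intro sets_PiM_I) (auto simp: M_def)
 let ?S = "{A : Pow E. Q A}"
 have eq: "{\<omega> : space (P \<beta>). Q {e : E. \<omega> e}} = (UN A:?S. cyl A)" using cyl by auto
 have "measure (P \<beta>) (UN A:?S. cyl A) = (SUM A:?S. measure (P \<beta>) (cyl A))"
  unfolding P using sc E cyl
  by (intro finite_measure_finite_Union) (auto simp: P[symmetric] disjoint_family_on_def)
 also have "... = (SUM A:?S. (PROD e:A. p \<beta> e) * (PROD e:E - A. 1 - p \<beta> e))" by (intro sum.cong mc) auto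
 also have "... = prb E (p \<beta>) Q"
  unfolding avg_def using E by (intro sum.mono_neutral_cong_left) auto
 finally show ?thesis unfolding eq using sc E by (auto intro!: sets.finite_UN)
qed

lemma Ed_edges: "Ed V \<subseteq> edges"
 by (auto simp: Ed_def edges_def)

lemmas prob_box = prob_finite[OF _ finite_Ed[OF finite_lbox[where x = 0]] Ed_edges, folded gr_def]

text \<open>Continuity from below along increasing boxes. Monotonicity of \<open>Q\<close> is
  required only for finite graphs with two-element edges, where clusters are finite and
  cardinalities behave.\<close>

lemma lim_event:
 assumes \<beta>: "\<beta> >= 0" and Q: "\<And>A B. A \<subseteq> B ==> B \<subseteq> Pow UNIV ==> finite B ==> (ALL e:B. card e = 2) ==> Q A ==> Q B"
 shows "{\<omega> : space (P \<beta>). EX n. Q (gr n \<omega>)} : sets (P \<beta>)"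
  and "(%n. prb (Ed (lbox 0 n)) (p \<beta>) Q) \<longlonglongrightarrow> measure (P \<beta>) {\<omega> : space (P \<beta>). EX n. Q (gr n \<omega>)}"
proof -
 interpret prob_space "P \<beta>" by (rule prob_P)
 let ?A = "%n. {\<omega> : space (P \<beta>). Q (gr n \<omega>)}"
 have U: "{\<omega> : space (P \<beta>). EX n. Q (gr n \<omega>)} = (\<Union>n. ?A n)" by auto
 have s: "range ?A \<subseteq> sets (P \<beta>)" using prob_box[OF \<beta>] by auto
 show "{\<omega> : space (P \<beta>). EX n. Q (gr n \<omega>)} : sets (P \<beta>)" unfolding U using s by blast
 have "incseq ?A"
 proof (rule incseq_SucI, rule subsetI)
  fix n \<omega> assume "\<omega> : ?A n"
  moreover have "Q (gr n \<omega>) ==> Q (gr (Suc n) \<omega>)"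
   by (rule Q[OF gr_mono]) (auto simp: gr_def finite_Ed Ed_card)
  ultimately show "\<omega> : ?A (Suc n)" by simp
 qed
 from finite_Lim_measure_incseq[OF s this]
 show "(%n. prb (Ed (lbox 0 n)) (p \<beta>) Q) \<longlonglongrightarrow> measure (P \<beta>) {\<omega> : space (P \<beta>). EX n. Q (gr n \<omega>)}"
  unfolding U using prob_box[OF \<beta>] by simp
qed

lemma cluster_iff: "y : cluster \<omega> x \<longleftrightarrow> (EX n. conn (gr n \<omega>) x y)"
proof
 assume "y : cluster \<omega> x"
 then have "(x, y) : (open_adj \<omega>)\<^sup>*" by (simp add: cluster_def)
 then show "EX n. conn (gr n \<omega>) x y"
 proof (induction rule: rtrancl_induct)
  case (step y z)
  then obtain n where n: "conn (gr n \<omega>) x y" by blast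
  define m where "m = max n (max (sd 0 y) (sd 0 z))"
  have "{y, z} : gr m \<omega>" using step(2) by (simp add: open_adj_def gr_def m_def le_max_iff_disj)
  moreover have "conn (gr m \<omega>) x y" using conn_mono[OF n gr_mono] by (simp add: m_def)
  ultimately show ?case using conn_trans conn_edge by metis
 qed simp
next
 assume "EX n. conn (gr n \<omega>) x y"
 then obtain n where "conn (gr n \<omega>) x y" ..
 then have "(x, y) : (open_adj \<omega>)\<^sup>*"
 proof (induction rule: conn_induct)
  case (step y z)
  then have "(y, z) : open_adj \<omega>" by (simp add: gr_def open_adj_def)
  then show ?case using step.IH by (rule rtrancl_into_rtrancl[rotated])
 qed simp
 then show "y : cluster \<omega> x" by (simp add: cluster_def)
qed

lemma conn_gr_mono: "conn (gr n \<omega>) x y ==> n <= m ==> conn (gr m \<omega>) x y"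
 using conn_mono gr_mono by metis

lemma tau_lim:
 assumes \<beta>: "\<beta> >= 0"
 shows "(%n. prb (Ed (lbox 0 n)) (p \<beta>) (%A. conn A x y & conn A x z)) \<longlonglongrightarrow> tau N J \<beta> [x, y, z]"
proof -
 have "(EX K:clusters \<omega>. {x, y, z} \<subseteq> K) \<longleftrightarrow> (EX n. conn (gr n \<omega>) x y & conn (gr n \<omega>) x z)" for \<omega>
 proof
  assume "EX K:clusters \<omega>. {x, y, z} \<subseteq> K"
  then obtain q n1 n2 n3 where n: "conn (gr n1 \<omega>) q x" "conn (gr n2 \<omega>) q y" "conn (gr n3 \<omega>) q z"
   by (auto simp: clusters_def cluster_iff)
  define n where "n = max n1 (max n2 n3)"
  have "conn (gr n \<omega>) q x" "conn (gr n \<omega>) q y" "conn (gr n \<omega>) q z"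
   using n[THEN conn_gr_mono, of n] by (simp_all add: n_def)
  then show "EX n. conn (gr n \<omega>) x y & conn (gr n \<omega>) x z"
   using conn_trans[OF conn_sym[of "gr n \<omega>" q x]] by blast
 next
  assume "EX n. conn (gr n \<omega>) x y & conn (gr n \<omega>) x z"
  moreover have "conn (gr 0 \<omega>) x x" by simp
  ultimately have "{x, y, z} \<subseteq> cluster \<omega> x" unfolding subset_iff cluster_iff by (auto intro: exI[of _ 0])
  then show "EX K:clusters \<omega>. {x, y, z} \<subseteq> K" by (auto simp: clusters_def)
 qed
 then have "tau N J \<beta> [x, y, z] = measure (P \<beta>) {\<omega> : space (P \<beta>). EX n. conn (gr n \<omega>) x y & conn (gr n \<omega>) x z}"
  unfolding tau_def by simp
 then show ?thesis
 proof (simp only:, intro lim_event(2)[OF \<beta>])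
  fix A B :: "(int ^ 'd) set set" assume "A \<subseteq> B" "conn A x y & conn A x z"
  then show "conn B x y & conn B x z" using conn_mono[of A x y B] conn_mono[of A x z B] by simp
 qed
qed

definition Einf :: "real => ((int ^ 'd) set => bool) set" where
 "Einf \<beta> = {\<omega> : space (P \<beta>). EX K:clusters \<omega>. infinite K}"

definition Tn :: "real => int ^ 'd => nat => ((int ^ 'd) set => bool) set" where
 "Tn \<beta> x m = {\<omega> : space (P \<beta>). EX n. m <= card (clu (gr n \<omega>) x)}"

lemma finite_clu_gr: "finite (clu (gr n \<omega>) x)"
 using Ed_Pow by (intro finite_clu[of _ "lbox 0 n"]) (auto simp: gr_def)

lemma infinite_cluster: "infinite (cluster \<omega> x) \<longleftrightarrow> (ALL m. EX n. m <= card (clu (gr n \<omega>) x))"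
proof
 assume inf: "infinite (cluster \<omega> x)"
 show "ALL m. EX n. m <= card (clu (gr n \<omega>) x)"
 proof
  fix m
  obtain F where F: "finite F" "card F = m" "F \<subseteq> cluster \<omega> x" using infinite_arbitrarily_large[OF inf] by blast
  then have "ALL y:F. EX n. conn (gr n \<omega>) x y" using cluster_iff by blast
  then obtain f where f: "\<And>y. y : F ==> conn (gr (f y) \<omega>) x y" by metis
  define n where "n = Max (insert 0 (f ` F))"
  have "F \<subseteq> clu (gr n \<omega>) x"
  proof
   fix y assume "y : F"
   then show "y : clu (gr n \<omega>) x" using conn_gr_mono[OF f, of y n] F by (simp add: n_def)
  qed
  then show "EX n. m <= card (clu (gr n \<omega>) x)" using card_mono[OF finite_clu_gr] F by blast
 qed
next
 assume a: "ALL m. EX n. m <= card (clu (gr n \<omega>) x)"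
 show "infinite (cluster \<omega> x)"
 proof
  assume fin: "finite (cluster \<omega> x)"
  obtain n where n: "Suc (card (cluster \<omega> x)) <= card (clu (gr n \<omega>) x)" using a by blast
  have "clu (gr n \<omega>) x \<subseteq> cluster \<omega> x" using cluster_iff by auto
  from card_mono[OF fin this] show False using n by simp
 qed
qed

lemma Tn_facts:
 assumes \<beta>: "\<beta> >= 0"
 shows "Tn \<beta> x m : sets (P \<beta>)"
  and "(%n. prb (Ed (lbox 0 n)) (p \<beta>) (%A. m <= card (clu A x))) \<longlonglongrightarrow> measure (P \<beta>) (Tn \<beta> x m)"
  and "(%m. measure (P \<beta>) (Tn \<beta> x m)) \<longlonglongrightarrow> measure (P \<beta>) (\<Inter>m. Tn \<beta> x m)"
  and "Einf \<beta> = (\<Union>x. \<Inter>m. Tn \<beta> x m)"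
  and "(\<Inter>m. Tn \<beta> x m) : sets (P \<beta>)"
proof -
 interpret prob_space "P \<beta>" by (rule prob_P)
 have Q: "m <= card (clu B x)" if "A \<subseteq> B" "finite B" "ALL e:B. card e = 2" "m <= card (clu A x)" for A B m
 proof -
  have "finite (\<Union>B)" using that(2,3) card.infinite by (intro finite_Union) force+
  then have "finite (clu B x)" by (intro finite_clu[of B "\<Union>B"]) auto
  then show ?thesis using card_mono[OF _ clu_mono[OF that(1)], of x] that(4) by fastforce
 qed
 have 1: "Tn \<beta> x m : sets (P \<beta>)" for m unfolding Tn_def using Q by (intro lim_event(1)[OF \<beta>]) blast
 then show "Tn \<beta> x m : sets (P \<beta>)" .
 show "(%n. prb (Ed (lbox 0 n)) (p \<beta>) (%A. m <= card (clu A x))) \<longlonglongrightarrow> measure (P \<beta>) (Tn \<beta> x m)"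
  unfolding Tn_def using Q by (intro lim_event(2)[OF \<beta>]) blast
 have "decseq (Tn \<beta> x)" unfolding decseq_def Tn_def using order_trans by fastforce
 then show "(%m. measure (P \<beta>) (Tn \<beta> x m)) \<longlonglongrightarrow> measure (P \<beta>) (\<Inter>m. Tn \<beta> x m)"
  using 1 by (intro finite_Lim_measure_decseq) auto
 show "(\<Inter>m. Tn \<beta> x m) : sets (P \<beta>)" using 1 by (intro sets.countable_INT) auto
 show "Einf \<beta> = (\<Union>x. \<Inter>m. Tn \<beta> x m)"
  by (auto simp: Einf_def Tn_def clusters_def infinite_cluster)
qed

text \<open>Translate the vertex to 0, exhaust the lattice by boxes, and let the size tend to
  infinity: the uniform \<open>\<theta>\<close> survives as a lower bound for an infinite cluster at
  0.\<close>

lemma percolates: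
 assumes \<beta>: "\<beta> > 0" and \<theta>: "\<theta> > 0" "\<And>n. EX V x. finite V & \<theta> <= prb (Ed V) (p \<beta>) (%A. n <= card (clu A x))"
 shows "measure (P \<beta>) (Einf \<beta>) > 0"
proof -
 interpret prob_space "P \<beta>" by (rule prob_P)
 interpret kern "kw \<beta>" \<alpha> "\<beta> * k0" "\<beta> * k1" by (rule kn[OF \<beta>])
 have b0: "\<beta> >= 0" using \<beta> by simp
 have "\<theta> <= measure (P \<beta>) (Tn \<beta> 0 n)" for n
 proof -
  obtain V x where V: "finite V" "\<theta> <= prb (Ed V) (p \<beta>) (%A. n <= card (clu A x))" using \<theta> by blast
  let ?V = "(%y. y + - x) ` V"
  have shift: "prb (Ed ?V) (p \<beta>) (%A. n <= card (clu A 0)) = prb (Ed V) (p \<beta>) (%A. n <= card (clu A x))"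
   unfolding Ed_shift
  proof (rule avg_shift)
   fix A assume "A \<subseteq> Ed V"
   then have "clu ((`) ((`) (%y. y + - x)) A) (x + - x) = (%y. y + - x) ` clu A x"
    by (intro clu_image inj_shift) (use ne_Ed[of A V] in blast)
   then show "of_bool (n <= card (clu ((`) ((`) (%y. y + - x)) A) 0)) = (of_bool (n <= card (clu A x)) :: real)"
    by (simp add: card_image)
  qed
  define s where "s = Max (insert 0 (sd 0 ` ?V))"
  have "sd 0 v <= s" if "v : ?V" for v unfolding s_def using V that by (intro Max_ge) auto
  then have sub: "?V \<subseteq> lbox 0 s" by auto
  have "\<theta> <= prb (Ed (lbox 0 m)) (p \<beta>) (%A. n <= card (clu A 0))" if "m >= s" for m
  proof -
   have "?V \<subseteq> lbox 0 m" using sub lbox_mono[OF that, of 0] by blast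
   then have "prb (Ed ?V) (p \<beta>) (%A. n <= card (clu A 0)) <= prb (Ed (lbox 0 m)) (p \<beta>) (%A. n <= card (clu A 0))"
   proof (intro avg_mono_set pEd Ed_mono of_bool_le_if finite_lbox)
    fix A A' :: "(int ^ 'd) set set" assume "A \<subseteq> A'" "A' \<subseteq> Ed (lbox 0 m)" "n <= card (clu A 0)"
    moreover have "finite (clu A' 0)" using \<open>A' \<subseteq> _\<close> Ed_Pow[of "lbox 0 m"] by (intro finite_clu[of A' "lbox 0 m"]) auto
    ultimately show "n <= card (clu A' 0)" using card_mono[OF _ clu_mono[of A A' 0]] by fastforce
   qed
   then show ?thesis using V shift by simp
  qed
  then show ?thesis by (intro LIMSEQ_le_const[OF Tn_facts(2)[OF b0]]) auto
 qed
 then have "\<theta> <= measure (P \<beta>) (\<Inter>m. Tn \<beta> 0 m)" by (intro LIMSEQ_le_const[OF Tn_facts(3)[OF b0]]) auto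
 also have "... <= measure (P \<beta>) (Einf \<beta>)"
  unfolding Tn_facts(4)[OF b0]
  by (intro finite_measure_mono sets.countable_UN'' Tn_facts(5)[OF b0]) auto
 finally show ?thesis using \<theta> by simp
qed

text \<open>Markov: a cluster size with mean at most \<open>M\<close> in every volume exceeds
  \<open>m\<close> with probability at most \<open>M / m\<close>, and there are countably many
  vertices.\<close>

lemma no_percolation:
 assumes \<beta>: "\<beta> >= 0" and M: "\<And>x V. finite V ==> x : V ==> avg (Ed V) (p \<beta>) (%A. csz A x) <= M"
 shows "measure (P \<beta>) (Einf \<beta>) = 0"
proof -
 interpret prob_space "P \<beta>" by (rule prob_P)
 interpret sym_kernel "kw \<beta>" by (rule sk[OF \<beta>])
 have T: "measure (P \<beta>) (Tn \<beta> x m) <= M / real m" if m: "m >= 1" for x m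
 proof (rule LIMSEQ_le_const2[OF Tn_facts(2)[OF \<beta>]], intro exI allI impI)
  fix n assume n: "sd 0 x <= n"
  have "prb (Ed (lbox 0 n)) (p \<beta>) (%A. m <= card (clu A x)) = prb (Ed (lbox 0 n)) (p \<beta>) (%A. real m <= csz A x)"
   by simp
  also have "... <= avg (Ed (lbox 0 n)) (p \<beta>) (%A. csz A x) / real m"
   using m by (intro avg_markov pEd) auto
  also have "... <= M / real m" using M n by (intro divide_right_mono) auto
  finally show "prb (Ed (lbox 0 n)) (p \<beta>) (%A. m <= card (clu A x)) <= M / real m" .
 qed
 have 0: "(%m. M / real m) \<longlonglongrightarrow> 0" by (rule lim_const_over_n)
 have "measure (P \<beta>) (\<Inter>m. Tn \<beta> x m) <= 0" for x
  using T by (intro LIMSEQ_le[OF Tn_facts(3)[OF \<beta>] 0]) auto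
 then have "(\<Inter>m. Tn \<beta> x m) : null_sets (P \<beta>)" for x
  using Tn_facts(5)[OF \<beta>] measure_nonneg[of "P \<beta>"]
  by (intro null_setsI) (auto simp: emeasure_eq_measure intro: antisym)
 then have "Einf \<beta> : null_sets (P \<beta>)"
  unfolding Tn_facts(4)[OF \<beta>] by (rule null_sets_UN)
 then show ?thesis by (simp add: measure_eq_0_null_sets)
qed

section \<open>The critical point and its finite-volume criteria\<close>

definition supercrit :: "real set" where
 "supercrit = {\<beta>. \<beta> >= 0 & measure (P \<beta>) (Einf \<beta>) > 0}"

abbreviation "bc \<equiv> beta_c N J"

lemma bc_Inf: "bc = Inf supercrit"
 by (simp add: beta_c_def supercrit_def Einf_def)

text \<open>Finite-volume expectations are continuous in \<open>\<beta>\<close>; this carries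
  criteria for one parameter to nearby ones.\<close>

lemma isCont_avg: "isCont (%\<beta>. avg E (p \<beta>) f) b"
 unfolding avg_def pk_def kw_def by (intro continuous_intros) auto

abbreviation "renorm_with \<delta> T \<equiv> ALL \<beta> L m. \<beta> > 0 --> L >= 1 --> m >= 1 -->
  T <= \<beta> * ((real m)^2 * L ^r (- (real CARD('d) + \<alpha>))) -->
  1 - \<delta> <= prb (Ed (cube L 0)) (p \<beta>) (%A. EX v. m <= card (clu A v Int cube L 0)) --> \<beta> : supercrit"

text \<open>The renormalization as a finite-size criterion whose threshold scales with
  \<open>\<beta>\<close>. The constants do not depend on \<open>\<beta>\<close>, as needed for
  parameters approaching the critical point.\<close>

lemma renorm: "EX \<delta>>0. \<delta> < 1 & (EX T>0. renorm_with \<delta> T)"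
proof -
 let ?d = "CARD('d)"
 define s where "s = real ?d + \<alpha>"
 define t where "t = real ?d - \<alpha>"
 have "real ?d >= 1" by (simp add: Suc_le_eq)
 then have t: "t > 0" using \<alpha> unfolding t_def by linarith
 obtain K :: nat where K: "real K >= max 4 ((8 * 2 powr s) powr (1 / t))" using real_arch_simple by blast
 have K4: "K >= 4" using K by simp
 have Kt: "8 * 2 powr s <= K ^r t"
 proof -
  have "8 * 2 powr s = ((8 * 2 powr s) powr (1 / t)) powr t" using t by (simp add: powr_powr)
  also have "... <= K ^r t" using K t by (intro powr_mono2) auto
  finally show ?thesis .
 qed
 define \<delta> where "\<delta> = 1 / (2 * (2 * real K) ^ (2 * ?d))"
 have \<delta>: "0 < \<delta>" "\<delta> < 1"
 proof -
  have "1 <= (2 * real K) ^ (2 * ?d)" using K4 by (intro one_le_power) simp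
  then show "0 < \<delta>" "\<delta> < 1" by (simp_all add: \<delta>_def divide_simps)
 qed
 define b where "b = 4 * 16 ^ ?d * real K ^ (4 * ?d)"
 \<comment> \<open>Makes the linking exponent after the factor \<open>k0 * K ^r (- s)\<close> at
   least \<open>ln b\<close>, the requirement of \<open>renorm_iterate\<close>; the 1 ensures
   positivity.\<close>
 define T where "T = max 1 (ln b / (k0 * K ^r (- s)))"
 have "\<beta> : supercrit"
  if \<beta>: "\<beta> > 0" and L: "L >= 1" "m >= 1" and le: "T <= \<beta> * ((real m)^2 * L ^r (- s))"
  and f: "1 - \<delta> <= prb (Ed (cube L 0)) (p \<beta>) (%A. EX v. m <= card (clu A v Int cube L 0))" for \<beta> L m
 proof -
  interpret kern "kw \<beta>" \<alpha> "\<beta> * k0" "\<beta> * k1" by (rule kn[OF \<beta>])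
  have st: "D + \<alpha> = s" "D - \<alpha> = t" by (simp_all add: D_def s_def t_def)
  have kK: "k0 * K ^r (- s) > 0" using k01 K4 by simp
  have "ln b / (k0 * K ^r (- s)) <= \<beta> * ((real m)^2 * L ^r (- s))" using le by (simp add: T_def)
  then have "ln b <= \<beta> * ((real m)^2 * L ^r (- s)) * (k0 * K ^r (- s))"
   using pos_divide_le_eq[OF kK] by blast
  also have "... = \<beta> * k0 * (real m)^2 * real (K * L) powr (- s)" by (simp add: powr_mult mult_ac)
  finally have "exp (ln b) <= exp (\<beta> * k0 * (real m)^2 * real (K * L) powr (- s))"
   by (simp only: exp_le_cancel_iff)
  moreover have "b > 0" using K4 by (simp add: b_def)
  ultimately have "b <= exp (\<beta> * k0 * (real m)^2 * real (K * L) powr (- s))" by simp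
  moreover have "fail L m <= \<delta>"
   using f prb_compl[OF pEd[OF finite_cube[OF L(1)]], of 0 "%A. EX v. m <= card (clu A v Int cube L 0)"]
   by (simp add: fail_def big_def)
  ultimately have "EX \<theta>>0. ALL n. EX V x. finite V & \<theta> <= prb (Ed V) (p \<beta>) (%A. n <= card (clu A x))"
   using K4 Kt L by (intro renorm_percolates[of K L m]) (auto simp: st b_def \<delta>_def)
  then show ?thesis using percolates[OF \<beta>] \<beta> by (auto simp: supercrit_def)
 qed
 then show ?thesis using \<delta> unfolding s_def by (intro exI[of _ \<delta>] conjI exI[of _ T]) (auto simp: T_def)
qed

text \<open>At side 1 and size 1 the criterion holds with certainty, so \<open>\<beta> = T\<close>
  percolates and the infimum defining the critical point is a genuine one.\<close>

lemma supercrit_nonempty: "EX \<beta>. \<beta> : supercrit"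
proof -
 obtain \<delta> T where \<delta>: "\<delta> > 0" and T: "T > 0" and H: "renorm_with \<delta> T"
  using renorm by blast
 have "1 <= card (clu A 0 Int cube 1 0)" for A :: "(int ^ 'd) set set"
 proof -
  have "(0 :: int ^ 'd) : clu A 0 Int cube 1 0" by (simp add: cube_def)
  moreover have "finite (cube 1 0 :: (int ^ 'd) set)" by (intro finite_cube) simp
  ultimately have "0 < card (clu A 0 Int cube 1 0)" unfolding card_gt_0_iff by blast
  then show ?thesis by simp
 qed
 then have "prb (Ed (cube 1 0)) (p T) (%A. EX v. 1 <= card (clu A v Int cube 1 (0 :: int ^ 'd))) = avg (Ed (cube 1 (0 :: int ^ 'd))) (p T) (%A. 1)"
  by (intro avg_cong) auto
 also have "... = 1" by (simp add: finite_Ed finite_cube)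
 finally show ?thesis using H[rule_format, of T 1 1] \<delta> T by auto
qed

lemma not_supercrit_0: "0 \<notin> supercrit"
proof -
 interpret sym_kernel "kw 0" by (rule sk) simp
 have "measure (P 0) (Einf 0) = 0"
 proof (rule no_percolation)
  fix x :: "int ^ 'd" and V assume V: "finite V" "x : V"
  have p0: "p 0 e = 0" for e :: "(int ^ 'd) set" by (simp add: pk_def kw_def)
  have "avg (Ed V) (p 0) f = f {}" for f :: "(int ^ 'd) set set => real"
  proof -
   have "(PROD e:A. p 0 e) = 0" if "A : Pow (Ed V) - {{}}" for A
    using that finite_subset[OF _ finite_Ed[OF V(1)]] by (intro prod_zero) (auto simp: p0)
   then have "avg (Ed V) (p 0) f = (SUM A:{{}}. (PROD e:A. p 0 e) * (PROD e:Ed V - A. 1 - p 0 e) * f A)"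
    unfolding avg_def using finite_Ed[OF V(1)] by (intro sum.mono_neutral_right) auto
   then show ?thesis by (simp add: p0)
  qed
  moreover have "clu {} x = {x}" using conn_in[of "{}" x _ "{x}"] by auto
  ultimately show "avg (Ed V) (p 0) (%A. csz A x) <= 1" by simp
 qed simp
 then show ?thesis by (simp add: supercrit_def)
qed

definition ks :: "(int ^ 'd) set => int ^ 'd => real" where
 "ks S u = (SUP T\<in>{T. finite T & T Int S = {}}. SUM v:T. k u v)"

lemma ks_upper: "u : S ==> finite T ==> T Int S = {} ==> (SUM v:T. k u v) <= ks S u"
proof -
 assume u: "u : S" and T: "finite T" "T Int S = {}"
 interpret kern "kw 1" \<alpha> "1 * k0" "1 * k1" by (rule kn) simp
 have "bdd_above ((%T. SUM v:T. k u v) ` {T. finite T & T Int S = {}})"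
 proof (rule bdd_aboveI2)
  fix T assume "T : {T. finite T & T Int S = {}}"
  then have "(SUM v:T. kw 1 u v) <= K2 * real (0 + 1) powr (- \<alpha>)"
   using u sd_pos[of u] by (intro sum_w_far) (force simp: Suc_le_eq)+
  then show "(SUM v:T. k u v) <= K2" by (simp add: kw_def)
 qed
 then show ?thesis unfolding ks_def using T by (intro cSUP_upper) auto
qed

text \<open>The mean number of edges, counted by weight, that leave \<open>S\<close> from the
  cluster of 0 inside \<open>S\<close>.\<close>

definition ph :: "(int ^ 'd) set => real => real" where
 "ph S \<beta> = (SUM u:S. prb (Ed S) (p \<beta>) (%A. conn A 0 u) * (\<beta> * ks S u))"

text \<open>Explore the cluster inside a translate of \<open>S\<close>; each edge leaving it
  restarts the exploration. The largest mean cluster size \<open>M\<close> in \<open>V\<close>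
  satisfies \<open>M <= card S + ph S \<beta> * M\<close>, a bound free of \<open>V\<close>.\<close>

lemma subcritical:
 assumes \<beta>: "\<beta> > 0" and S: "finite S" "0 : S" and lt: "ph S \<beta> < 1"
 shows "\<beta> \<notin> supercrit"
proof -
 interpret kern "kw \<beta>" \<alpha> "\<beta> * k0" "\<beta> * k1" by (rule kn[OF \<beta>])
 have ks0: "0 <= ks S u" if "u : S" for u using ks_upper[OF that, of "{}"] by simp
 have "measure (P \<beta>) (Einf \<beta>) = 0"
 proof (rule no_percolation)
  fix x :: "int ^ 'd" and V assume V: "finite V" and xV: "x : V"
  define X where "X = (%x. SUM y:V. pr (Ed V) x y)"
  define M where "M = Max (X ` V)"
  have XM: "X x <= M" if "x : V" for x unfolding M_def using V that by (intro Max_ge) auto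
  note fV = finite_Ed[OF V]
  have X0: "0 <= X x" for x unfolding X_def using pr_bounds[OF fV] by (intro sum_nonneg) auto
  have M0: "0 <= M" using XM[OF xV] X0[of x] by simp
  have step: "X x <= real (card S) + ph S \<beta> * M" if x: "x : V" for x
  proof -
   define W where "W = V Int (%y. y + x) ` S"
   have W: "finite W" "x : W" "V - (V - W) = W" using V S x by (auto simp: W_def image_iff intro: bexI[of _ 0])
   have "X x <= (SUM y:V. pr (Ed W) x y + (SUM b:V - W. SUM u:W. pr (Ed W) x u * kw \<beta> u b * pr (Ed V) b y))"
    unfolding X_def using removal[OF V, of "V - W" x] W by (intro sum_mono) auto
   also have "... = (SUM y:V. pr (Ed W) x y) + (SUM b:V - W. SUM u:W. pr (Ed W) x u * kw \<beta> u b * X b)"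
    unfolding X_def sum.distrib sum_distrib_left
    by (subst sum.swap, rule arg_cong2[of _ _ _ _ "(+)"], rule refl, rule sum.cong, rule refl, rule sum.swap)
   also have "(SUM y:V. pr (Ed W) x y) <= real (card S)"
   proof -
    have "(SUM y:V. pr (Ed W) x y) = (SUM y:W. pr (Ed W) x y)"
     using V W pr_outside[of "Ed W" W x] by (intro sum.mono_neutral_right) (auto simp: W_def)
    also have "... <= (SUM y:W. 1)" using pr_bounds[OF finite_Ed[OF W(1)]] by (intro sum_mono) auto
    also have "... <= real (card ((%y. y + x) ` S))" using S by (simp add: W_def card_mono)
    finally show ?thesis using card_image_le[OF S(1), of "%y. y + x"] by linarith
   qed
   also have "(SUM b:V - W. SUM u:W. pr (Ed W) x u * kw \<beta> u b * X b) <= (SUM b:V - W. SUM u:W. pr (Ed W) x u * kw \<beta> u b * M)"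
    using pr_bounds[OF finite_Ed[OF W(1)]] w_nonneg XM by (intro sum_mono mult_left_mono mult_nonneg_nonneg) auto
   also have "... = (SUM u:W. pr (Ed W) x u * (\<beta> * (SUM b:V - W. k u b))) * M"
    by (subst sum.swap) (simp add: sum_distrib_left sum_distrib_right kw_def mult_ac)
   also have "... <= ph S \<beta> * M"
   proof (rule mult_right_mono[OF _ M0])
    have u: "u - x : S" if "u : W" for u using that by (auto simp: W_def)
    have "(SUM u:W. pr (Ed W) x u * (\<beta> * (SUM b:V - W. k u b))) <= (SUM u:W. pr (Ed S) 0 (u - x) * (\<beta> * ks S (u - x)))"
    proof (intro sum_mono mult_mono)
     fix u assume uW: "u : W"
     have "pr (Ed W) x u <= pr (Ed ((%y. y + x) ` S)) (0 + x) (u - x + x)"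
      using S W by (simp, intro pr_mono Ed_mono finite_Ed) (auto simp: W_def)
     then show "pr (Ed W) x u <= pr (Ed S) 0 (u - x)" unfolding pr_shift .
     have "k (u - x) (b - x) = k u b" for b
      using lattice_dist_shift[of N u "- x" b] by (simp add: kernel_def)
     then have "(SUM b:V - W. k u b) = (SUM b:(%b. b - x) ` (V - W). k (u - x) b)"
      by (subst sum.reindex) (auto simp: inj_on_def)
     also have "... <= ks S (u - x)" using V image_eqI[of _ "%y. y + x" "_ - x" S] by (intro ks_upper u uW) (auto simp: W_def)
     finally show "(SUM b:V - W. k u b) <= ks S (u - x)" .
    qed (use \<beta> k_nonneg pr_bounds[OF finite_Ed[OF S(1)]] in \<open>auto intro!: sum_nonneg mult_nonneg_nonneg\<close>)
    also have "... = (SUM v:(%u. u - x) ` W. pr (Ed S) 0 v * (\<beta> * ks S v))"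
     by (subst sum.reindex) (auto simp: inj_on_def)
    also have "... <= ph S \<beta>"
     unfolding ph_def using u S \<beta> ks0 pr_bounds[OF finite_Ed[OF S(1)]] by (intro sum_mono2 mult_nonneg_nonneg) auto
    finally show "(SUM u:W. pr (Ed W) x u * (\<beta> * (SUM b:V - W. k u b))) <= ph S \<beta>" .
   qed
   finally show ?thesis by simp
  qed
  have "M : X ` V" unfolding M_def using V xV by (intro Max_in) auto
  then have "M <= real (card S) + ph S \<beta> * M" using step by auto
  then have "M <= real (card S) / (1 - ph S \<beta>)" using lt by (simp add: field_simps)
  then show "avg (Ed V) (p \<beta>) (%A. csz A x) <= real (card S) / (1 - ph S \<beta>)"
   using XM[OF xV] avg_card_V[OF V xV, of "Ed V"] by (simp add: X_def)
 qed (use \<beta> in simp)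
 then show ?thesis by (simp add: supercrit_def)
qed

text \<open>By continuity \<open>ph S < 1\<close> persists slightly above \<open>b\<close>, where
  \<open>subcritical\<close> then excludes percolation. At 0 this shows that the critical point is
  positive; at the critical point it yields \<open>phi_ge\<close> by contradiction.\<close>

lemma ph_open:
 assumes S: "finite S" "0 : S" and lt: "ph S b < 1" and b: "\<And>\<beta>. \<beta> : supercrit ==> b <= \<beta>" and b0: "0 <= b"
 shows "b < bc"
proof -
 have "isCont (ph S) b" unfolding ph_def by (intro continuous_intros isCont_avg)
 then have "eventually (%\<beta>. ph S \<beta> < 1) (at b)" using lt by (intro order_tendstoD(2)) (auto simp: isCont_def)
 then obtain e where e: "e > 0" "\<And>\<beta>. \<beta> ~= b ==> dist \<beta> b < e ==> ph S \<beta> < 1"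
  unfolding eventually_at by auto
 have "b + e <= \<beta>" if \<beta>: "\<beta> : supercrit" for \<beta>
 proof (rule ccontr)
  assume "~ b + e <= \<beta>"
  then have "ph S \<beta> < 1" using b[OF \<beta>] e lt by (cases "\<beta> = b") (auto simp: dist_real_def)
  moreover have "\<beta> > 0" using b[OF \<beta>] b0 not_supercrit_0 \<beta> by (cases "\<beta> = 0") auto
  ultimately show False using subcritical[OF _ S] \<beta> by blast
 qed
 then have "b + e <= bc" unfolding bc_Inf using supercrit_nonempty by (intro cInf_greatest) auto
 then show ?thesis using e by simp
qed

lemma bc_lower: "\<beta> : supercrit ==> bc <= \<beta>"
 unfolding bc_Inf by (intro cInf_lower bdd_belowI[of _ 0]) (auto simp: supercrit_def)

lemma bc_pos: "0 < bc"
 by (rule ph_open[of "{0}"]) (auto simp: ph_def supercrit_def)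

text \<open>Below \<open>bc\<close> the criterion of \<open>renorm\<close> must fail, which bounds
  the probability of a large cluster; left continuity in \<open>\<beta>\<close> at fixed volume
  carries the bound to \<open>bc\<close>. The bound on outgoing edges is \<open>ph_open\<close> at
  \<open>bc\<close>.\<close>

lemma critical: "EX \<delta> B. crit (kw bc) \<alpha> (bc * k0) (bc * k1) \<delta> B"
proof -
 obtain \<delta> T where \<delta>: "\<delta> > 0" "\<delta> < 1" and T: "T > 0" and H: "renorm_with \<delta> T"
  using renorm by blast
 \<comment> \<open>Guarantees \<open>T <= \<beta> * B^2\<close> for every \<open>\<beta>\<close>
   above \<open>bc / 2\<close>, so one \<open>B\<close> serves all parameters approaching
   \<open>bc\<close> from below.\<close>
 define B where "B = max 1 (sqrt (2 * T / bc))"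
 have TB: "T <= bc / 2 * B^2"
 proof -
  have "2 * T / bc = (sqrt (2 * T / bc))^2" using T bc_pos by simp
  also have "... <= B^2" using T bc_pos by (intro power_mono) (auto simp: B_def)
  finally show ?thesis using bc_pos by (simp add: field_simps)
 qed
 interpret kern "kw bc" \<alpha> "bc * k0" "bc * k1" by (rule kn[OF bc_pos])
 have "crit (kw bc) \<alpha> (bc * k0) (bc * k1) \<delta> B"
 proof unfold_locales
  fix L m :: nat assume L: "L >= 1" "m >= 1" and Bm: "B * L ^r ((real CARD('d) + \<alpha>) / 2) <= real m"
  let ?f = "%\<beta>. prb (Ed (cube L (0 :: int ^ 'd))) (p \<beta>) (%A. EX v. m <= card (clu A v Int cube L 0))"
  have "((?f) \<longlongrightarrow> ?f bc) (at_left bc)"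
   by (rule tendsto_mono[OF at_le[OF subset_UNIV]]) (use isCont_avg in \<open>simp add: isCont_def\<close>)
  moreover have "eventually (%\<beta>. ?f \<beta> <= 1 - \<delta>) (at_left bc)"
   unfolding eventually_at_left_field
  proof (intro exI[of _ "bc / 2"] conjI allI impI)
   fix \<beta> assume \<beta>: "bc / 2 < \<beta>" "\<beta> < bc"
   have "B^2 * L ^r (real CARD('d) + \<alpha>) = (B * L ^r ((real CARD('d) + \<alpha>) / 2))^2"
    by (simp add: power_mult_distrib power2_eq_square[of "_ powr _"] flip: powr_add)
   also have "... <= (real m)^2" using Bm by (intro power_mono) (auto simp: B_def)
   finally have "B^2 * L ^r (real CARD('d) + \<alpha>) * L ^r (- (real CARD('d) + \<alpha>)) <= (real m)^2 * L ^r (- (real CARD('d) + \<alpha>))"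
    by (intro mult_right_mono) auto
   moreover have "L ^r (real CARD('d) + \<alpha>) * L ^r (- (real CARD('d) + \<alpha>)) = 1" using L by (simp flip: powr_add)
   ultimately have "B^2 <= (real m)^2 * L ^r (- (real CARD('d) + \<alpha>))" by (simp add: mult.assoc)
   then have "bc / 2 * B^2 <= \<beta> * ((real m)^2 * L ^r (- (real CARD('d) + \<alpha>)))"
    using \<beta> bc_pos by (intro mult_mono) auto
   then have "T <= \<beta> * ((real m)^2 * L ^r (- (real CARD('d) + \<alpha>)))" using TB by linarith
   moreover have "\<beta> \<notin> supercrit" using bc_lower \<beta> by force
   ultimately show "?f \<beta> <= 1 - \<delta>" using H L \<beta> bc_pos by (meson less_imp_le linorder_le_cases order.strict_trans half_gt_zero)
  qed (use bc_pos in simp)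
  ultimately show "?f bc <= 1 - \<delta>" by (intro tendsto_upperbound) auto
 next
  fix S :: "(int ^ 'd) set" and g assume S: "finite S" "0 : S"
   and g: "\<And>u T. u : S ==> finite T ==> T Int S = {} ==> (SUM v:T. kw bc u v) <= g u"
  have "1 <= ph S bc"
  proof (rule ccontr)
   assume "~ 1 <= ph S bc"
   then have "bc < bc" using bc_pos by (intro ph_open[OF S _ bc_lower]) auto
   then show False by simp
  qed
  also have "... <= (SUM u:S. pr (Ed S) 0 u * g u)"
   unfolding ph_def
  proof (intro sum_mono mult_left_mono)
   fix u assume u: "u : S"
   have "ks S u <= g u / bc"
    unfolding ks_def
   proof (rule cSUP_least)
    fix T assume "T : {T. finite T & T Int S = {}}"
    then have "bc * (SUM v:T. k u v) <= g u" using g[OF u, of T] by (simp add: kw_def sum_distrib_left)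
    then show "(SUM v:T. k u v) <= g u / bc" using bc_pos by (simp add: field_simps)
   qed auto
   then show "bc * ks S u <= g u" using bc_pos by (simp add: field_simps)
  qed (use pr_bounds[OF finite_Ed[OF S(1)]] in auto)
  finally show "1 <= (SUM u:S. pr (Ed S) 0 u * g u)" .
 qed (use \<delta> in \<open>auto simp: B_def\<close>)
 then show ?thesis by blast
qed

abbreviation "tau_with c C \<equiv>
 ALL x y z. x ~= y --> y ~= z --> z ~= x -->
  (let e = \<alpha> - real CARD('d); R = sqrt (real (sd x y) powr e * real (sd y z) powr e * real (sd z x) powr e) in
   c * R <= tau N J bc [x, y, z] & tau N J bc [x, y, z] <= C * R)"

lemma tau_bounds:
 assumes low: "real CARD('d) < 3 * \<alpha>"
 shows "EX c>0. EX C>0. tau_with c C"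
proof -
 obtain \<delta> B where "crit (kw bc) \<alpha> (bc * k0) (bc * k1) \<delta> B" using critical by blast
 then interpret crit_low "kw bc" \<alpha> "bc * k0" "bc * k1" \<delta> B
  using low by (intro crit_low.intro crit_low_axioms.intro) (simp_all add: kern.D_def[OF kn[OF bc_pos]])
 obtain c C where cC: "c > 0" "C > 0" and H: "ALL x y z. x ~= y --> y ~= z --> z ~= x --> (EX V0. finite V0 & (ALL V. finite V --> V0 \<subseteq> V -->
  (let R = sqrt (real (sd x y) powr (\<alpha> - D) * real (sd y z) powr (\<alpha> - D) * real (sd z x) powr (\<alpha> - D));
     p = prb (Ed V) (pk (kw bc)) (%A. conn A x y & conn A x z) in c * R <= p & p <= C * R)))"
  using three_bounds by blast
 show ?thesis
  unfolding Let_def D_def[symmetric]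
 proof (rule exI[of _ c], intro conjI cC, rule exI[of _ C], intro conjI cC allI impI)
  fix x y z :: "int ^ 'd" assume ne: "x ~= y" "y ~= z" "z ~= x"
  let ?R = "sqrt (real (sd x y) powr (\<alpha> - D) * real (sd y z) powr (\<alpha> - D) * real (sd z x) powr (\<alpha> - D))"
  let ?q = "%V. prb (Ed V) (p bc) (%A. conn A x y & conn A x z)"
  obtain V0 where V0: "finite V0" "\<And>V. finite V ==> V0 \<subseteq> V ==> c * ?R <= ?q V & ?q V <= C * ?R"
   using H[rule_format, OF ne] unfolding Let_def by blast
  define s where "s = Max (insert 0 (sd 0 ` V0))"
  have "sd 0 v <= s" if "v : V0" for v unfolding s_def using V0(1) that by (intro Max_ge) auto
  then have "V0 \<subseteq> lbox 0 n" if "n >= s" for n using that order_trans by fastforce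
  then have b: "ALL n>=s. c * ?R <= ?q (lbox 0 n) & ?q (lbox 0 n) <= C * ?R" using V0(2) by simp
  note l = tau_lim[of bc x y z] bc_pos
  show "c * ?R <= tau N J bc [x, y, z]" using b l by (intro LIMSEQ_le_const[OF l(1)]) auto
  show "tau N J bc [x, y, z] <= C * ?R" using b l by (intro LIMSEQ_le_const2[OF l(1)]) auto
 qed
qed

end

theorem mainTheorem2:
  fixes N :: "real ^ 'd \<Rightarrow> real" and J :: "real \<Rightarrow> real" and \<alpha> :: real
  assumes "\<alpha> > 0"
    and "is_norm N"
    and "admissible_kernel CARD('d) \<alpha> J"
    and "\<alpha> < 1"
    and "real CARD('d) < 3 * \<alpha>"
  shows "\<exists>c>0. \<exists>C>0. \<forall>x y z :: int ^ 'd. x \<noteq> y \<and> y \<noteq> z \<and> z \<noteq> x \<longrightarrow>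
    (let D = (\<lambda>u v. lattice_dist N u v powr (- real CARD('d) + \<alpha>));
         R = sqrt (D x y * D y z * D z x)
     in c * R \<le> tau N J (beta_c N J) [x, y, z] \<and>
        tau N J (beta_c N J) [x, y, z] \<le> C * R)"
proof -
 obtain k0 k1 where k: "k0 > 0" "k1 > 0" "ALL x y. x ~= y --> k0 * real (sd x y) powr (- (real CARD('d) + \<alpha>)) <= kernel N J x y &
  kernel N J x y <= k1 * real (sd x y) powr (- (real CARD('d) + \<alpha>))"
  using kernel_bounds[OF assms(2,3,1)] by blast
 interpret lrp N J \<alpha> k0 k1 using assms k by unfold_locales auto
 obtain c C where c: "c > 0" and C: "C > 0" and H: "tau_with c C"
  using tau_bounds[OF assms(5)] by blast
 obtain m M where m: "m > 0" and M: "M > 0" and sd: "ALL x y :: int ^ 'd. m * real (sd x y) <= lattice_dist N x y & lattice_dist N x y <= M * real (sd x y)"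
  using norm_sd_bounds[OF assms(2)] by blast
 define e where "e = \<alpha> - real CARD('d)"
 have "real CARD('d) >= 1" by (simp add: Suc_le_eq)
 then have e: "e < 0" "- real CARD('d) + \<alpha> = e" using assms(4) unfolding e_def by linarith+
 \<comment> \<open>The exponent \<open>e\<close> is negative, so the larger constant
   \<open>M\<close> gives the lower bound.\<close>
 have D: "M powr e * real (sd x y) powr e <= lattice_dist N x y powr e & lattice_dist N x y powr e <= m powr e * real (sd x y) powr e"
  if "x ~= y" for x y :: "int ^ 'd"
 proof -
  have "m * real (sd x y) > 0" using m sd_pos[OF that] by simp
  then have "(M * real (sd x y)) powr e <= lattice_dist N x y powr e & lattice_dist N x y powr e <= (m * real (sd x y)) powr e"
   using sd e by (intro conjI powr_mono2') (auto intro: order.strict_trans2)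
  then show ?thesis by (simp add: powr_mult)
 qed
 let ?L = "%x y. lattice_dist N x y powr e" and ?S = "%x y :: int ^ 'd. real (sd x y) powr e"
 have "c / sqrt ((m powr e) ^ 3) * sqrt (?L x y * ?L y z * ?L z x) <= tau N J bc [x, y, z] &
  tau N J bc [x, y, z] <= C / sqrt ((M powr e) ^ 3) * sqrt (?L x y * ?L y z * ?L z x)"
  if ne: "x ~= y" "y ~= z" "z ~= x" for x y z :: "int ^ 'd"
 proof -
  have t: "(t * ?S x y) * (t * ?S y z) * (t * ?S z x) = t ^ 3 * (?S x y * ?S y z * ?S z x)" for t
   by (simp add: power3_eq_cube)
  have "sqrt (?L x y * ?L y z * ?L z x) <= sqrt ((m powr e) ^ 3) * sqrt (?S x y * ?S y z * ?S z x)"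
   unfolding real_sqrt_mult[symmetric] t[symmetric] using D ne by (intro real_sqrt_le_mono mult_mono) auto
  then have "c / sqrt ((m powr e) ^ 3) * sqrt (?L x y * ?L y z * ?L z x) <= c * sqrt (?S x y * ?S y z * ?S z x)"
   using c m by (simp add: field_simps)
  moreover have "sqrt ((M powr e) ^ 3) * sqrt (?S x y * ?S y z * ?S z x) <= sqrt (?L x y * ?L y z * ?L z x)"
   unfolding real_sqrt_mult[symmetric] t[symmetric] using D ne by (intro real_sqrt_le_mono mult_mono) auto
  then have "C * sqrt (?S x y * ?S y z * ?S z x) <= C / sqrt ((M powr e) ^ 3) * sqrt (?L x y * ?L y z * ?L z x)"
   using C M by (simp add: field_simps)
  ultimately show ?thesis using H[rule_format, OF ne] unfolding Let_def e_def[symmetric] by linarith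
 qed
 moreover have "c / sqrt ((m powr e) ^ 3) > 0" "C / sqrt ((M powr e) ^ 3) > 0" using c C m M by simp_all
 ultimately show ?thesis unfolding Let_def e(2) by blast
qed

end
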